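(* Let $r\in[0,\frac12]$, and let $t=\nu x_{\nu,m}(r)$ ($m=0,\pm1,\pm2,\ldots$) denote the positive zeros of $\Re\{e^{-ir\pi}J_{i\nu}(t)\}$, labelled as described in the context. Then $$x_{\nu,m}(r)\sim\sum_{s=0}^\infty\frac{p_{m,s}(r)}{\nu^{2s}}$$ as $\nu\to\infty$, uniformly for $m=0,\pm1,\pm2,\ldots$. Here $$p_{m,0}(r)=\rho^{-1}(M),\qquad M=\nu^{-1}\left(m+r-\tfrac14\right)\pi,$$ where $\rho^{-1}$ is the inverse of the increasing bijection $\rho:(0,\infty)\to(-\infty,\infty)$, $\rho(x)=(x^2+1)^{1/2}-\ln\{(1+(x^2+1)^{1/2})/x\}$; and $p_{m,s}(r)=q_s(p_{m,0}(r))$ with $q_0(x)=x$ and $q_s$ ($s\ge1$) rational functions, the first four of which are $$q_1(x)=\frac{x(3x^2-2)}{24(x^2+1)^2},$$ $$q_2(x)=-\frac{x(465x^6-4119x^4+1812x^2-4)}{5760(x^2+1)^5},$$ $$q_3(x)=\frac{x}{2903040(x^2+1)^8}\left(714231x^{10}-19038132x^8+46671831x^6-19043730x^4+910164x^2-1912\right),$$ $$q_4(x)=-\frac{x}{1393459200(x^2+1)^{11}}\big(2542280985x^{14}-138922188885x^{12}+846638961795x^{10}-1239519604671x^8+493158930936x^6-45022408056x^4+452367216x^2+742544\big).$$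
   Context: $J_{i\nu}$ is the Bessel function of the first kind of imaginary order $i\nu$, $\nu>0$. Labelling: write $J_{i\nu}(\nu x)=|J_{i\nu}(\nu x)|e^{i\Theta(\nu,x)}$ with $\Theta$ continuous in $x\in(0,\infty)$, on the branch for which $\Theta(\nu,x)=\nu\ln(\frac12x)+\nu-\frac14\pi+\mathcal{O}(\nu x^2)+\mathcal{O}(\nu^{-1})$ as $\nu x\to0^+$, $\nu\to\infty$. The zero $x=x_{\nu,m}(r)$ is the one for which $\Theta(\nu,x)=(m+r-\frac12)\pi$; equivalently it satisfies the asymptotic relation $\nu\rho(x)+\sum_{s=0}^\infty\hat{\mathrm{E}}_{2s+1}(\hat\beta)\nu^{-2s-1}\sim(m+r-\frac14)\pi$ as $\nu\to\infty$, where $\hat\beta=(1+x^2)^{-1/2}$, $\hat{\mathrm{E}}_{2s+1}(\hat\beta)=-i\,\mathrm{E}_{2s+1}(-i\hat\beta)$, and $\mathrm{E}_1(\beta)=\frac1{24}\beta(5\beta^2+3)$, $\mathrm{E}_2(\beta)=\frac1{16}\beta^2(5\beta^2+1)(\beta^2+1)$, and for $s\ge2$ $$\mathrm{E}_{s+1}(\beta)=\tfrac12\beta^2(\beta^2+1)\mathrm{E}_s'(\beta)+\tfrac12\int_0^\beta p^2(p^2+1)\sum_{j=1}^{s-1}\mathrm{E}_j'(p)\mathrm{E}_{s-j}'(p)\,dp.$$ The coefficients $p_{m,s}(r)$ are those obtained recursively by inserting the series for $x_{\nu,m}(r)$ into this relation, expanding in inverse powers of $\nu$ (with $M$ held as a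 parameter), and equating coefficients. As $m\to-\infty$ the zeros tend to $0^+$, and as $m\to\infty$ they tend to $\infty$ (for fixed $\nu$). The symbol $\sim$ means that for each $n\ge1$, $x_{\nu,m}(r)-\sum_{s=0}^{n-1}p_{m,s}(r)\nu^{-2s}=\mathcal{O}(\nu^{-2n})$ as $\nu\to\infty$. *)

theory Defs
  imports "HOL-Analysis.Analysis"
begin

text \<open>
  Bessel function of the first kind of complex order, with the principal branch of the power.
  The junk value of \<open>powr\<close> at \<open>0\<close> makes this meaningful only for \<open>z \<noteq> 0\<close>.
\<close>

definition bessel_J :: "complex \<Rightarrow> complex \<Rightarrow> complex" where
  "bessel_J \<mu> z =
     (z / 2) powr \<mu> * (\<Sum>k. (-1) ^ k * rGamma (\<mu> + of_nat k + 1) / fact k * (z / 2) ^ (2 * k))"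

text \<open>
  \<open>\<Theta> \<nu> x\<close> is a phase of \<open>J\<^sub>i\<^sub>\<nu>(\<nu>x)\<close>, continuous in \<open>x > 0\<close>.  The last clause selects the branch:
  it spells out
  \<open>\<Theta>(\<nu>,x) = \<nu> ln(x/2) + \<nu> - \<pi>/4 + O(\<nu>x\<^sup>2) + O(1/\<nu>)\<close> as \<open>\<nu>x \<rightarrow> 0+\<close>, \<open>\<nu> \<rightarrow> \<infinity>\<close>, and thereby determines
  \<open>\<Theta> \<nu>\<close> for all sufficiently large \<open>\<nu>\<close>.
\<close>

definition bessel_phase :: "(real \<Rightarrow> real \<Rightarrow> real) \<Rightarrow> bool" where
  "bessel_phase \<Theta> \<longleftrightarrow>
     (\<forall>\<nu>>0. continuous_on {0<..} (\<Theta> \<nu>) \<and>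
        (\<forall>x>0. bessel_J (\<i> * of_real \<nu>) (of_real (\<nu> * x)) =
           of_real (cmod (bessel_J (\<i> * of_real \<nu>) (of_real (\<nu> * x)))) * cis (\<Theta> \<nu> x))) \<and>
     (\<exists>C \<delta> N. \<delta> > 0 \<and> N > 0 \<and>
        (\<forall>\<nu>\<ge>N. \<forall>x. 0 < x \<and> \<nu> * x \<le> \<delta> \<longrightarrow>
           \<bar>\<Theta> \<nu> x - (\<nu> * ln (x / 2) + \<nu> - pi / 4)\<bar> \<le> C * (\<nu> * x\<^sup>2 + 1 / \<nu>)))"

definition bessel_zeros :: "real \<Rightarrow> real \<Rightarrow> real set" where
  "bessel_zeros r \<nu> =
     {t. 0 < t \<and> Re (exp (- \<i> * of_real r * of_real pi) * bessel_J (\<i> * of_real \<nu>) (of_real t)) = 0}"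

definition scaled_zero :: "(real \<Rightarrow> real \<Rightarrow> real) \<Rightarrow> real \<Rightarrow> real \<Rightarrow> int \<Rightarrow> real" where
  "scaled_zero \<Theta> r \<nu> m =
     (THE x. 0 < x \<and> \<nu> * x \<in> bessel_zeros r \<nu> \<and> \<Theta> \<nu> x = (of_int m + r - 1 / 2) * pi)"

definition rho :: "real \<Rightarrow> real" where
  "rho x = sqrt (x\<^sup>2 + 1) - ln ((1 + sqrt (x\<^sup>2 + 1)) / x)"

lemma has_real_derivative_rho:
  assumes "x > 0"
  shows "(rho has_real_derivative sqrt (x\<^sup>2 + 1) / x) (at x)"
proof -
  define w where "w = sqrt (x\<^sup>2 + 1)"
  have w: "w > 0" "w * w = x * x + 1"
    by (auto simp: w_def power2_eq_square add_nonneg_pos)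
  have "1 + w > 0" using w by simp
  have pos: "1 + sqrt (y\<^sup>2 + 1) > 0" for y :: real
    by (simp add: add_pos_nonneg)
  then have nz: "1 + sqrt (y\<^sup>2 + 1) \<noteq> 0" for y :: real
    by (metis less_irrefl)
  have ev: "\<forall>\<^sub>F y in nhds x. sqrt (y\<^sup>2 + 1) - (ln (1 + sqrt (y\<^sup>2 + 1)) - ln y) = rho y"
    using eventually_nhds_in_open[of "{0<..}" x] assms
    by (auto elim!: eventually_mono simp: rho_def ln_div pos nz)
  have "((\<lambda>y. sqrt (y\<^sup>2 + 1) - (ln (1 + sqrt (y\<^sup>2 + 1)) - ln y)) has_real_derivative
          x / w - (x / w / (1 + w) - 1 / x)) (at x)"
    unfolding w_def using assms pos[of x] sum_power2_gt_zero_iff[of x 1]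
    by (auto intro!: derivative_eq_intros simp: field_simps)
  also have "x / w - (x / w / (1 + w) - 1 / x) = w / x"
    using w \<open>1 + w > 0\<close> assms
    by (simp add: divide_simps) (use w(2) in algebra)
  finally show ?thesis
    using ev unfolding w_def by (simp cong: DERIV_cong_ev)
qed

lemma strict_mono_on_rho: "strict_mono_on {0<..} rho"
proof (rule strict_mono_onI)
  fix a b :: real
  assume "a \<in> {0<..}" "a < b"
  have "\<exists>y. (rho has_real_derivative y) (at x) \<and> y > 0" if "a \<le> x" for x
  proof -
    have "x > 0" using \<open>a \<in> {0<..}\<close> that by simp
    moreover from this have "sqrt (x\<^sup>2 + 1) / x > 0"
      by (simp add: add_nonneg_pos)
    ultimately show ?thesis
      using has_real_derivative_rho by blast
  qed
  then show "rho a < rho b"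
    using DERIV_pos_imp_increasing[OF \<open>a < b\<close>, of rho] by blast
qed

lemma bij_betw_rho: "bij_betw rho {0<..} UNIV"
proof -
  have "\<exists>x>0. rho x = y" for y
  proof -
    define a b where "a = exp (- \<bar>y\<bar> - 2)" and "b = \<bar>y\<bar> + 2"
    have a: "0 < a" "a \<le> 1" and ab: "a \<le> b" and b: "b \<ge> 1"
      by (auto simp: a_def b_def intro: order_trans[of _ 1])
    have "a\<^sup>2 \<le> 1"
      using a by (simp add: power_le_one)
    then have "sqrt (a\<^sup>2 + 1) \<le> sqrt (2\<^sup>2)"
      by (intro real_sqrt_le_mono) simp
    moreover have "ln (1 / a) \<le> ln ((1 + sqrt (a\<^sup>2 + 1)) / a)"
      using a by (intro ln_mono divide_right_mono divide_pos_pos add_pos_nonneg) auto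
    ultimately have "rho a \<le> y"
      using a by (simp add: rho_def ln_div[of 1]) (simp add: a_def)
    have "sqrt (b\<^sup>2 + 1) \<le> 1 + b"
      using b by (intro real_le_lsqrt) (auto simp: power2_eq_square algebra_simps)
    then have "(1 + sqrt (b\<^sup>2 + 1)) / b \<le> 3"
      using b by (simp add: divide_simps)
    then have "ln ((1 + sqrt (b\<^sup>2 + 1)) / b) \<le> 2"
      using b ln_le_minus_one[of "(1 + sqrt (b\<^sup>2 + 1)) / b"]
      by (simp add: divide_pos_pos add_pos_nonneg)
    moreover have "b \<le> sqrt (b\<^sup>2 + 1)"
      using b by (intro real_le_rsqrt) simp
    ultimately have "y \<le> rho b"
      by (simp add: rho_def b_def)
    have "continuous_on {a..b} rho"
      using a DERIV_isCont[OF has_real_derivative_rho]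
      by (intro continuous_at_imp_continuous_on ballI) auto
    then obtain x where "a \<le> x" "rho x = y"
      using IVT'[of rho a y b] \<open>rho a \<le> y\<close> \<open>y \<le> rho b\<close> ab by blast
    then show ?thesis
      using a by (intro exI[of _ x]) auto
  qed
  then have "rho ` {0<..} = UNIV"
    by (auto simp: image_iff) (metis greaterThan_iff)
  then show ?thesis
    by (simp add: bij_betw_def strict_mono_on_rho strict_mono_on_imp_inj_on)
qed

definition poly_antideriv :: "complex poly \<Rightarrow> complex poly" where
  "poly_antideriv p = (\<Sum>i\<le>degree p. monom (coeff p i / of_nat (Suc i)) (Suc i))"

lemma coeff_poly_antideriv:
  "coeff (poly_antideriv p) n = (case n of 0 \<Rightarrow> 0 | Suc i \<Rightarrow> coeff p i / of_nat (Suc i))"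
proof (cases n)
  case (Suc i)
  have "(\<Sum>j\<le>degree p. if j = i then coeff p j / of_nat (Suc j) else 0) = coeff p i / of_nat (Suc i)"
    by (cases "i \<le> degree p") (simp_all add: coeff_eq_0 del: of_nat_Suc)
  then show ?thesis
    by (simp add: Suc poly_antideriv_def coeff_sum del: of_nat_Suc)
qed (simp add: poly_antideriv_def coeff_sum)

lemma pderiv_poly_antideriv: "pderiv (poly_antideriv p) = p"
  by (rule poly_eqI) (simp add: coeff_pderiv coeff_poly_antideriv del: of_nat_Suc)

lemma poly_poly_antideriv_0: "poly (poly_antideriv p) 0 = 0"
  by (simp add: poly_0_coeff_0 coeff_poly_antideriv)

text \<open>
  The coefficient polynomials \<open>E\<^sub>s(\<beta>)\<close>, \<open>s \<ge> 1\<close>; the value at \<open>s = 0\<close> is a dummy that is never used.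
  By the two preceding lemmas \<open>poly_antideriv p\<close> evaluated at \<open>\<beta>\<close> is the integral of \<open>p\<close> from
  \<open>0\<close> to \<open>\<beta>\<close>.  The last equation is the recursion for \<open>E\<^sub>s\<^sub>+\<^sub>1\<close> in terms of \<open>E\<^sub>1, \<dots>, E\<^sub>s\<close>
  at \<open>s = k + 2\<close>.
\<close>

fun E_poly :: "nat \<Rightarrow> complex poly" where
  "E_poly 0 = 0"
| "E_poly (Suc 0) = smult (1 / 24) ([:0, 1:] * [:3, 0, 5:])"
| "E_poly (Suc (Suc 0)) = smult (1 / 16) ([:0, 0, 1:] * [:1, 0, 5:] * [:1, 0, 1:])"
| "E_poly (Suc (Suc (Suc k))) =
     smult (1 / 2) ([:0, 0, 1:] * [:1, 0, 1:] * pderiv (E_poly (k + 2))) +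
     smult (1 / 2) (poly_antideriv ([:0, 0, 1:] * [:1, 0, 1:] *
       (\<Sum>j\<in>{1..k + 1}. pderiv (E_poly j) * pderiv (E_poly (k + 2 - j)))))"

definition E_hat :: "nat \<Rightarrow> real \<Rightarrow> real" where
  "E_hat s b = Re (- \<i> * poly (E_poly s) (- \<i> * of_real b))"

definition real_graded :: "nat \<Rightarrow> complex poly \<Rightarrow> bool" where
  "real_graded d p \<longleftrightarrow> (\<forall>i. coeff p i \<in> \<real> \<and> (odd (i + d) \<longrightarrow> coeff p i = 0))"

lemma real_graded_mult:
  assumes "real_graded d p" "real_graded e q" "even (d + e + f)"
  shows "real_graded f (p * q)"
  unfolding real_graded_def coeff_mult
proof (intro allI conjI impI)
  fix i
  show "(\<Sum>j\<le>i. coeff p j * coeff q (i - j)) \<in> \<real>"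
    using assms by (intro sum_in_Reals Reals_mult) (auto simp: real_graded_def)
  assume "odd (i + f)"
  then have "odd (j + d) \<or> odd (i - j + e)" if "j \<le> i" for j
    using that assms(3) \<open>odd (i + f)\<close> by presburger
  then show "(\<Sum>j\<le>i. coeff p j * coeff q (i - j)) = 0"
    using assms(1,2) unfolding real_graded_def by (intro sum.neutral ballI) (metis atMost_iff mult_zero_left mult_zero_right)
qed

lemma real_graded_E_poly: "real_graded s (E_poly s)"
proof (induction s rule: E_poly.induct)
  case 1
  show ?case by (simp add: real_graded_def)
next
  case 2
  show ?case
    by (auto simp: real_graded_def coeff_pCons split: nat.splits)
next
  case 3
  show ?case
    by (auto simp: real_graded_def coeff_pCons split: nat.splits)
next
  case (4 k)
  have w: "real_graded 0 [:0, 0, 1:]" "real_graded 0 [:1, 0, 1:]"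
    by (auto simp: real_graded_def coeff_pCons split: nat.splits)
  have der: "real_graded (Suc d) (pderiv p)" if "real_graded d p" for d p
    using that by (auto simp: real_graded_def coeff_pderiv simp del: of_nat_Suc)
  have antider: "real_graded e (poly_antideriv p)" if "real_graded d p" "e = Suc d" for d e p
    using that by (auto simp: real_graded_def coeff_poly_antideriv split: nat.splits simp del: of_nat_Suc)
  have half: "real_graded d (smult (1 / 2) p + smult (1 / 2) q)"
    if "real_graded d p" "real_graded d q" for d p q
    using that by (auto simp: real_graded_def)
  have 1: "real_graded (k + 3) ([:0, 0, 1:] * [:1, 0, 1:] * pderiv (E_poly (k + 2)))"
    using real_graded_mult[OF real_graded_mult[OF w, of 0] der[OF 4(1)], of "k + 3"] by simp
  have "real_graded (k + 2) (pderiv (E_poly j) * pderiv (E_poly (k + 2 - j)))"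
    if "j \<in> {1..k + 1}" for j
    using that real_graded_mult[OF der[OF 4(2)] der[OF 4(3)], of j j "k + 2"] by simp
  then have "real_graded (k + 2) (\<Sum>j\<in>{1..k + 1}. pderiv (E_poly j) * pderiv (E_poly (k + 2 - j)))"
    unfolding real_graded_def coeff_sum by (auto intro!: sum_in_Reals sum.neutral simp del: sum.cl_ivl_Suc)
  then have "real_graded (k + 2) ([:0, 0, 1:] * [:1, 0, 1:] *
      (\<Sum>j\<in>{1..k + 1}. pderiv (E_poly j) * pderiv (E_poly (k + 2 - j))))"
    using real_graded_mult[OF real_graded_mult[OF w, of 0]] by simp
  from half[OF 1 antider[OF this]] show ?case
    by (simp only: E_poly.simps numeral_3_eq_3 numeral_2_eq_2 add_Suc_right add_0_right simp_thms)
qed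

text \<open>Taking the real part in \<open>E_hat\<close> loses nothing at the odd indices that are used.\<close>

lemma of_real_E_hat:
  assumes "odd s"
  shows "of_real (E_hat s b) = - \<i> * poly (E_poly s) (- \<i> * of_real b)"
proof -
  have "coeff (E_poly s) i * (- \<i> * of_real b) ^ i * \<i> \<in> \<real>" for i
  proof (cases "even i")
    case True
    then have "coeff (E_poly s) i = 0"
      using assms real_graded_E_poly[of s] by (auto simp: real_graded_def)
    then show ?thesis by simp
  next
    case False
    then obtain k where i: "i = 2 * k + 1" by (auto elim: oddE)
    have "(- \<i> * of_real b) ^ i * \<i> = ((- \<i> * of_real b)\<^sup>2) ^ k * ((- \<i> * of_real b) * \<i>)"
      by (simp only: i power_add power_mult power_one_right mult.assoc)
    also have "(- \<i> * complex_of_real b)\<^sup>2 = of_real (- (b\<^sup>2))"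
      by (simp add: power_mult_distrib)
    also have "(- \<i> * complex_of_real b) * \<i> = of_real b"
      by (simp add: mult.commute[of _ \<i>])
    finally have "(- \<i> * of_real b) ^ i * \<i> = of_real ((- (b\<^sup>2)) ^ k * b)"
      by simp
    moreover have "coeff (E_poly s) i \<in> \<real>"
      using real_graded_E_poly[of s] by (auto simp: real_graded_def)
    ultimately show ?thesis
      by (metis Reals_mult Reals_of_real mult.assoc)
  qed
  then have "(\<Sum>i\<le>degree (E_poly s). coeff (E_poly s) i * (- \<i> * of_real b) ^ i * \<i>) \<in> \<real>"
    by (rule sum_in_Reals)
  then have "poly (E_poly s) (- \<i> * of_real b) * \<i> \<in> \<real>"
    unfolding poly_altdef sum_distrib_right .
  from Reals_minus[OF this] have "- \<i> * poly (E_poly s) (- \<i> * of_real b) \<in> \<real>"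
    by (simp only: mult_minus_left mult.commute[of \<i>])
  then show ?thesis
    unfolding E_hat_def by (rule of_real_Re)
qed

text \<open>
  The formal substitution of \<open>\<Sum>\<^sub>s c\<^sub>s \<epsilon>\<^sup>s\<close> into a function \<open>f\<close> that is smooth at \<open>c\<^sub>0\<close>, as a power series
  in \<open>\<epsilon>\<close>: the Taylor series of \<open>f\<close> at \<open>c\<^sub>0\<close> composed with \<open>\<Sum>\<^sub>s\<^sub>\<ge>\<^sub>1 c\<^sub>s \<epsilon>\<^sup>s\<close>.
\<close>

definition formal_subst :: "(real \<Rightarrow> real) \<Rightarrow> (nat \<Rightarrow> real) \<Rightarrow> real fps" where
  "formal_subst f c =
     Abs_fps (\<lambda>k. (deriv ^^ k) f (c 0) / fact k) oo (Abs_fps c - fps_const (c 0))"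

text \<open>
  Divided by \<open>\<nu>\<close>, the asymptotic relation for the zeros is
  \<open>\<rho>(x) + \<Sum>\<^sub>s \<nu>\<^sup>-\<^sup>2\<^sup>(\<^sup>s\<^sup>+\<^sup>1\<^sup>) E\<^sub>2\<^sub>s\<^sub>+\<^sub>1(\<beta>) \<sim> M\<close> (hatted \<open>E\<close> and \<open>\<beta>\<close>).  The coefficients are obtained by substituting
  \<open>x = \<Sum>\<^sub>s c\<^sub>s \<epsilon>\<^sup>s\<close>, \<open>\<epsilon> = 1/\<nu>\<^sup>2\<close>, and equating coefficients of \<open>\<epsilon>\<^sup>n\<close> with \<open>M\<close> held fixed.
\<close>

definition solves_formally :: "real \<Rightarrow> (nat \<Rightarrow> real) \<Rightarrow> bool" where
  "solves_formally M c \<longleftrightarrow> 0 < c 0 \<and>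
     (\<forall>n. fps_nth (formal_subst rho c) n +
          (\<Sum>s<n. fps_nth (formal_subst (\<lambda>x. E_hat (2 * s + 1) (1 / sqrt (1 + x\<^sup>2))) c) (n - (s + 1)))
        = fps_nth (fps_const M) n)"

definition zero_param :: "real \<Rightarrow> real \<Rightarrow> int \<Rightarrow> real" where
  "zero_param r \<nu> m = (of_int m + r - 1 / 4) * pi / \<nu>"

definition zero_coeff :: "real \<Rightarrow> real \<Rightarrow> int \<Rightarrow> nat \<Rightarrow> real" where
  "zero_coeff r \<nu> m = (THE c. solves_formally (zero_param r \<nu> m) c)"

end

theory Submission
  imports Defs "HOL-Complex_Analysis.Complex_Analysis" "HOL-Real_Asymp.Real_Asymp"
begin

text \<open>
  Let \<open>E(t) = J\<^sub>i\<^sub>\<nu>(t)\<close>.  The Wronskian of \<open>E\<close> and its conjugate is a nonzero multiple of \<open>1/t\<close>, so \<open>E\<close> never vanishes and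
  its phase is strictly increasing; it maps \<open>(0, \<infinity>)\<close> onto the real line, because \<open>E\<close> is bounded near \<open>0\<close>
  and \<open>\<surd>t E(t)\<close> is bounded near \<open>\<infinity>\<close>.  Hence every integer \<open>m\<close> labels exactly one zero.

  In the variable \<open>\<rho>(x)\<close> the Bessel equation is a perturbed oscillator on the whole real line, and
  the polynomials \<open>E\<^sub>s\<close> give WKB solutions whose residual is integrable with a total of
  \<open>O(\<nu>\<^sup>-\<^sup>N\<^sup>-\<^sup>1)\<close>.  Variation of parameters started at \<open>x = \<infinity>\<close>, where the behaviour of \<open>E\<close> is read off the singularity
  at \<open>p = \<i>\<close> of its Laplace transform, therefore approximates \<open>E(\<nu>x)\<close> with a relative error
  \<open>O(\<nu>\<^sup>-\<^sup>N\<^sup>-\<^sup>1)\<close> uniformly in \<open>x > 0\<close>.  The phase is thus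
  \<open>\<nu>\<rho>(x) + \<Sum>\<^sub>s \<nu>\<^sup>-\<^sup>2\<^sup>s\<^sup>-\<^sup>1 E\<^sub>2\<^sub>s\<^sub>+\<^sub>1(\<beta>) - \<pi>/4 + O(\<nu>\<^sup>-\<^sup>2\<^sup>n\<^sup>-\<^sup>1)\<close> uniformly in \<open>x\<close>.

  With \<open>b = 1/(1 + x\<^sup>2)\<close>, \<open>x = p\<^sub>m\<^sub>,\<^sub>0\<close>, and the zero written as \<open>x (1 + b v)\<close>, the recursion for the coefficients of
  \<open>v\<close> involves only polynomials in \<open>b\<close>.  As \<open>b\<close> ranges over the compact interval \<open>[0, 1]\<close>, this gives both the
  rationality of \<open>q\<^sub>s\<close> and the uniformity of the truncation error in \<open>m\<close>.
\<close>

subsection \<open>The Bessel function of imaginary order\<close>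

text \<open>The obstacle is the constant term of the phase. Near \<open>x = 0\<close> the function
  is a single wave, \<open>exp (\<i> \<nu> ln x)\<close> times an analytic factor, so the second WKB
  amplitude tends to 0 there and both amplitudes can be compared with their limits at
  \<open>0\<close>. But the argument of the first amplitude at \<open>0\<close> contains that of
  \<open>Gamma (1 + \<i> \<nu>)\<close> and all the endpoint values of the \<open>E_s\<close>;
  matching these would amount to the Stirling series to every order. At infinity all
  \<open>E_s\<close> terms vanish and the constant is explicit, at the price of a second wave of
  unknown amplitude. The Laplace transform isolates the wanted wave, and an average over two
  opposite relative phases removes the other one. Since all errors are relative, it then suffices
  that the amplitudes change little over the whole half-line and that the branch condition in
  \<open>bessel_phase\<close> excludes other multiples of \<open>2 \<pi>\<close> at one point near
  \<open>0\<close>. The factor \<open>b\<close> in front of \<open>v\<close> is chosen so that a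
  common factor \<open>b^(1/2)\<close> drops out of the formal equation; this is why no square roots
  survive in the coefficients.\<close>

definition bes_coeff :: "complex \<Rightarrow> nat \<Rightarrow> complex" where
  "bes_coeff \<mu> k = (-1) ^ k * rGamma (\<mu> + of_nat k + 1) / fact k"

lemma bes_coeff_Suc:
  "of_nat (Suc k) * (of_nat (Suc k) + \<mu>) * bes_coeff \<mu> (Suc k) = - bes_coeff \<mu> k"
proof -
  have "(\<mu> + of_nat k + 1) * rGamma (\<mu> + of_nat (Suc k) + 1) = rGamma (\<mu> + of_nat k + 1)"
    using rGamma_plus1[of "\<mu> + of_nat k + 1"] by (simp add: add_ac)
  then have "bes_coeff \<mu> k = (-1) ^ k * ((\<mu> + of_nat k + 1) * rGamma (\<mu> + of_nat (Suc k) + 1)) / fact k"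
    by (simp add: bes_coeff_def)
  moreover have "of_nat (Suc k) / fact (Suc k) = (1 :: complex) / fact k"
    by (simp add: fact_Suc del: of_nat_Suc)
  moreover have "of_nat (Suc k) * (of_nat (Suc k) + \<mu>) * bes_coeff \<mu> (Suc k)
     = (-1) ^ Suc k * ((\<mu> + of_nat k + 1) * rGamma (\<mu> + of_nat (Suc k) + 1)) * (of_nat (Suc k) / fact (Suc k))"
    by (simp add: bes_coeff_def add_ac mult_ac del: of_nat_Suc) (simp add: add_ac)
  ultimately show ?thesis
    by (simp del: of_nat_Suc)
qed

text \<open>For \<open>Re \<mu> \<ge> 0\<close> the factor \<open>k + 1 + \<mu>\<close> of the
  recurrence has modulus at least \<open>k + 1\<close>, which supplies the second factorial. The
  squared factorial later lets the Laplace integral be taken term by term.\<close>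

lemma norm_bes_coeff_le:
  assumes "Re \<mu> \<ge> 0"
  shows "norm (bes_coeff \<mu> k) \<le> norm (bes_coeff \<mu> 0) / fact k ^ 2"
proof (induction k)
  case (Suc k)
  have ge: "real (Suc k) \<le> norm (of_nat (Suc k) + \<mu>)"
    using complex_Re_le_cmod[of "of_nat (Suc k) + \<mu>"] assms by simp
  have "real (Suc k) * real (Suc k) * norm (bes_coeff \<mu> (Suc k))
      \<le> real (Suc k) * norm (of_nat (Suc k) + \<mu>) * norm (bes_coeff \<mu> (Suc k))"
    using ge by (intro mult_right_mono mult_left_mono) auto
  also have "\<dots> = norm (bes_coeff \<mu> k)"
    by (metis bes_coeff_Suc norm_minus_cancel norm_mult norm_of_nat)
  also note Suc
  finally show ?case
    by (simp add: field_simps power2_eq_square del: of_nat_Suc)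
qed simp

text \<open>The entire factor of the Bessel function:
  \<open>J_\<mu>(z) = (z/2)^\<mu> bes_fun \<mu> ((z/2)^2)\<close>. Splitting off the power keeps the
  singular behaviour at \<open>z = 0\<close> in one explicit exponential.\<close>

definition bes_fun :: "complex \<Rightarrow> complex \<Rightarrow> complex" where
  "bes_fun \<mu> s = (\<Sum>k. bes_coeff \<mu> k * s ^ k)"

definition bes_fun' :: "complex \<Rightarrow> complex \<Rightarrow> complex" where
  "bes_fun' \<mu> s = (\<Sum>k. diffs (bes_coeff \<mu>) k * s ^ k)"

lemma summable_bes_coeff:
  assumes "Re \<mu> \<ge> 0"
  shows "summable (\<lambda>k. bes_coeff \<mu> k * s ^ k)"
proof (rule summable_comparison_test')
  show "summable (\<lambda>k. norm (bes_coeff \<mu> 0) * (norm s ^ k / fact k))"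
    using summable_exp_generic[of "norm s"] by (intro summable_mult) (simp add: field_simps)
  fix k :: nat
  have "norm (bes_coeff \<mu> 0) / fact k ^ 2 \<le> norm (bes_coeff \<mu> 0) / fact k"
    by (intro divide_left_mono) (auto simp: power2_eq_square)
  with norm_bes_coeff_le[OF assms, of k]
  have "norm (bes_coeff \<mu> k) \<le> norm (bes_coeff \<mu> 0) / fact k" by linarith
  then have "norm (bes_coeff \<mu> k) * norm s ^ k \<le> norm (bes_coeff \<mu> 0) / fact k * norm s ^ k"
    by (intro mult_right_mono) auto
  then show "norm (bes_coeff \<mu> k * s ^ k) \<le> norm (bes_coeff \<mu> 0) * (norm s ^ k / fact k)"
    by (simp add: norm_mult norm_power)
qed

lemma has_field_derivative_bes_fun:
  assumes "Re \<mu> \<ge> 0"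
  shows "(bes_fun \<mu> has_field_derivative bes_fun' \<mu> s) (at s)"
  unfolding bes_fun_def bes_fun'_def
  by (rule termdiffs_strong_converges_everywhere) (rule summable_bes_coeff[OF assms])

text \<open>Multiplying the recurrence \<open>bes_coeff_Suc\<close> by \<open>s^k\<close> and
  summing gives Bessel's equation in the variable \<open>s = (z/2)^2\<close>.\<close>

lemma has_field_derivative_bes_fun':
  assumes "Re \<mu> \<ge> 0"
  shows "\<exists>g. (bes_fun' \<mu> has_field_derivative g) (at s) \<and> s * g + (\<mu> + 1) * bes_fun' \<mu> s + bes_fun \<mu> s = 0"
proof -
  define c where "c = bes_coeff \<mu>"
  have s0: "summable (\<lambda>k. c k * z ^ k)" for z
    using summable_bes_coeff[OF assms] by (simp add: c_def)
  have s1: "summable (\<lambda>k. diffs c k * z ^ k)" for z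
    by (rule termdiff_converges_all) (rule s0)
  have s2: "summable (\<lambda>k. diffs (diffs c) k * z ^ k)" for z
    by (rule termdiff_converges_all) (rule s1)
  define g where "g = (\<Sum>k. diffs (diffs c) k * s ^ k)"
  have "(bes_fun' \<mu> has_field_derivative g) (at s)"
    unfolding bes_fun'_def g_def c_def[symmetric]
    by (rule termdiffs_strong_converges_everywhere) (rule s1)
  moreover have "s * g + (\<mu> + 1) * bes_fun' \<mu> s + bes_fun \<mu> s = 0"
  proof -
    have "(\<lambda>k. s * (diffs (diffs c) k * s ^ k)) sums (s * g)"
      unfolding g_def by (intro sums_mult summable_sums s2)
    then have "(\<lambda>k. of_nat (Suc k) * diffs c (Suc k) * s ^ Suc k) sums (s * g)"
      by (simp add: diffs_def mult_ac)
    \<comment> \<open>The added term of index 0 carries the factor \<open>of_nat 0\<close>, so the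
      shifted series may start at 0.\<close>
    then have "(\<lambda>k. of_nat k * diffs c k * s ^ k) sums (s * g)"
      by (subst (asm) sums_Suc_iff) simp
    moreover have "(\<lambda>k. (\<mu> + 1) * (diffs c k * s ^ k)) sums ((\<mu> + 1) * bes_fun' \<mu> s)"
      unfolding bes_fun'_def c_def[symmetric] by (intro sums_mult summable_sums s1)
    moreover have "(\<lambda>k. c k * s ^ k) sums bes_fun \<mu> s"
      unfolding bes_fun_def c_def[symmetric] by (intro summable_sums s0)
    ultimately have "(\<lambda>k. of_nat k * diffs c k * s ^ k + (\<mu> + 1) * (diffs c k * s ^ k) + c k * s ^ k)
        sums (s * g + (\<mu> + 1) * bes_fun' \<mu> s + bes_fun \<mu> s)"
      by (intro sums_add)
    moreover have "of_nat k * diffs c k * s ^ k + (\<mu> + 1) * (diffs c k * s ^ k) + c k * s ^ k = 0" for k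
    proof -
      have "of_nat k * diffs c k + (\<mu> + 1) * diffs c k + c k = 0"
        using bes_coeff_Suc[of k \<mu>] by (simp add: diffs_def c_def algebra_simps)
      then show ?thesis by (metis distrib_right mult.assoc mult_zero_left)
    qed
    ultimately show ?thesis
      by (simp add: sums_iff)
  qed
  ultimately show ?thesis by blast
qed

text \<open>\<open>bes_yd \<nu> t = t \<cdot> d/dt J\<^sub>i\<^sub>\<nu>(t)\<close> for \<open>t > 0\<close>.\<close>

definition bes_y :: "real \<Rightarrow> real \<Rightarrow> complex" where
  "bes_y \<nu> t = bessel_J (\<i> * of_real \<nu>) (of_real t)"

definition bes_yd :: "real \<Rightarrow> real \<Rightarrow> complex" where
  "bes_yd \<nu> t = exp (\<i> * of_real \<nu> * of_real (ln (t / 2))) *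
     (\<i> * of_real \<nu> * bes_fun (\<i> * of_real \<nu>) (of_real ((t / 2)\<^sup>2))
      + 2 * of_real ((t / 2)\<^sup>2) * bes_fun' (\<i> * of_real \<nu>) (of_real ((t / 2)\<^sup>2)))"

lemma bes_y_eq:
  assumes "t > 0"
  shows "bes_y \<nu> t = exp (\<i> * of_real \<nu> * of_real (ln (t / 2))) * bes_fun (\<i> * of_real \<nu>) (of_real ((t / 2)\<^sup>2))"
proof -
  have "(complex_of_real t / 2) powr (\<i> * of_real \<nu>) = exp (\<i> * of_real \<nu> * of_real (ln (t / 2)))"
    using assms Ln_of_real[of "t / 2"] by (simp add: powr_def)
  then have "bes_y \<nu> t = exp (\<i> * of_real \<nu> * of_real (ln (t / 2))) *
      (\<Sum>k. (-1) ^ k * rGamma (\<i> * of_real \<nu> + of_nat k + 1) / fact k * ((of_real t / 2)\<^sup>2) ^ k)"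
    by (simp only: bes_y_def bessel_J_def power_mult)
  then show ?thesis
    by (simp only: bes_fun_def bes_coeff_def of_real_power of_real_divide of_real_numeral)
qed

text \<open>Bessel's equation as a first-order system for \<open>y\<close> and \<open>t y'\<close>;
  the sum \<open>\<nu>^2 + t^2\<close> comes from \<open>\<mu>^2 = - \<nu>^2\<close>. The complex
  derivatives are computed first and then restricted to the positive axis, where \<open>Ln\<close>
  is the real logarithm.\<close>

lemma has_vector_derivative_bes_y:
  assumes "t > 0"
  shows "(bes_y \<nu> has_vector_derivative (bes_yd \<nu> t / of_real t)) (at t)"
    and "(bes_yd \<nu> has_vector_derivative (- of_real ((\<nu>\<^sup>2 + t\<^sup>2) / t) * bes_y \<nu> t)) (at t)"
proof -
  define \<mu> where "\<mu> = \<i> * complex_of_real \<nu>"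
  have re: "Re \<mu> \<ge> 0" by (simp add: \<mu>_def)
  define z where "z = complex_of_real t"
  have z: "z \<noteq> 0" "z / 2 \<notin> \<real>\<^sub>\<le>\<^sub>0" "z \<notin> \<real>\<^sub>\<le>\<^sub>0" using assms by (auto simp: z_def complex_nonpos_Reals_iff)
  define s where "s = (z / 2)\<^sup>2"
  obtain g where g: "(bes_fun' \<mu> has_field_derivative g) (at s)" "s * g + (\<mu> + 1) * bes_fun' \<mu> s + bes_fun \<mu> s = 0"
    using has_field_derivative_bes_fun'[OF re] by blast
  define E where "E = exp (\<mu> * Ln (z / 2))"
  have dE: "((\<lambda>z. exp (\<mu> * Ln (z / 2))) has_field_derivative E * \<mu> / z) (at z)"
    unfolding E_def using z by (auto intro!: derivative_eq_intros)
  have ds: "((\<lambda>z. (z / 2)\<^sup>2) has_field_derivative z / 2) (at z)"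
    by (auto intro!: derivative_eq_intros)
  have dF: "((\<lambda>z. bes_fun \<mu> ((z / 2)\<^sup>2)) has_field_derivative bes_fun' \<mu> s * (z / 2)) (at z)"
    using DERIV_chain2[OF has_field_derivative_bes_fun[OF re] ds] by (simp add: s_def)
  have dF': "((\<lambda>z. bes_fun' \<mu> ((z / 2)\<^sup>2)) has_field_derivative g * (z / 2)) (at z)"
    using DERIV_chain2[OF g(1)[unfolded s_def] ds] by (simp add: s_def)
  have 1: "((\<lambda>z. exp (\<mu> * Ln (z / 2)) * bes_fun \<mu> ((z / 2)\<^sup>2)) has_field_derivative
     (E * (\<mu> * bes_fun \<mu> s + 2 * s * bes_fun' \<mu> s) / z)) (at z)"
    by (rule derivative_eq_intros dE dF refl)+
       (use z in \<open>simp add: E_def[symmetric] s_def[symmetric] field_simps\<close>,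
        simp add: s_def power2_eq_square algebra_simps)
  have 2: "((\<lambda>z. exp (\<mu> * Ln (z / 2)) * (\<mu> * bes_fun \<mu> ((z / 2)\<^sup>2) + 2 * (z / 2)\<^sup>2 * bes_fun' \<mu> ((z / 2)\<^sup>2)))
     has_field_derivative ((\<mu>\<^sup>2 - z\<^sup>2) / z * (E * bes_fun \<mu> s))) (at z)"
  proof -
    have "E * \<mu> / z * (\<mu> * bes_fun \<mu> s + 2 * s * bes_fun' \<mu> s) +
       (\<mu> * (bes_fun' \<mu> s * (z / 2)) + (2 * (z / 2) * bes_fun' \<mu> s + g * (z / 2) * (2 * s))) * E
       = E / z * (\<mu>\<^sup>2 * bes_fun \<mu> s + 2 * s * \<mu> * bes_fun' \<mu> s + z\<^sup>2 * (\<mu> * bes_fun' \<mu> s / 2 + bes_fun' \<mu> s + s * g))"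
      using z by (simp add: field_simps power2_eq_square)
    also have "z\<^sup>2 = 4 * s" by (simp add: s_def power_divide)
    also have "E / z * (\<mu>\<^sup>2 * bes_fun \<mu> s + 2 * s * \<mu> * bes_fun' \<mu> s + 4 * s * (\<mu> * bes_fun' \<mu> s / 2 + bes_fun' \<mu> s + s * g))
      = E / z * (\<mu>\<^sup>2 * bes_fun \<mu> s + 4 * s * (s * g + (\<mu> + 1) * bes_fun' \<mu> s + bes_fun \<mu> s) - 4 * s * bes_fun \<mu> s)"
      by (simp add: algebra_simps)
    also have "\<dots> = (\<mu>\<^sup>2 - 4 * s) / z * (E * bes_fun \<mu> s)"
      unfolding g(2) by (simp add: algebra_simps diff_divide_distrib)
    also have "4 * s = z\<^sup>2" by (simp add: s_def power_divide)
    finally have eq: "E * \<mu> / z * (\<mu> * bes_fun \<mu> s + 2 * s * bes_fun' \<mu> s) +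
       (\<mu> * (bes_fun' \<mu> s * (z / 2)) + (2 * (z / 2) * bes_fun' \<mu> s + g * (z / 2) * (2 * s))) * E
       = (\<mu>\<^sup>2 - z\<^sup>2) / z * (E * bes_fun \<mu> s)" .
    show ?thesis
      by (rule DERIV_cong[OF DERIV_mult[OF dE DERIV_add[OF DERIV_cmult[OF dF] DERIV_mult[OF DERIV_cmult[OF ds] dF']]]])
         (use eq in \<open>simp only: E_def[symmetric] s_def[symmetric]\<close>)
  qed
  have Ln: "Ln (complex_of_real t' / 2) = of_real (ln (t' / 2))" if "t' > 0" for t'
    using Ln_of_real[of "t' / 2"] that by simp
  have ev: "\<forall>\<^sub>F t' in nhds t. t' > 0"
    using eventually_nhds_in_open[of "{0<..}" t] assms by simp
  have "((\<lambda>t. exp (\<mu> * Ln (of_real t / 2)) * bes_fun \<mu> ((of_real t / 2)\<^sup>2)) has_vector_derivative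
     (E * (\<mu> * bes_fun \<mu> s + 2 * s * bes_fun' \<mu> s) / z)) (at t)"
    using has_vector_derivative_real_field[OF 1[unfolded z_def]] by (simp add: z_def)
  moreover have "E * (\<mu> * bes_fun \<mu> s + 2 * s * bes_fun' \<mu> s) / z = bes_yd \<nu> t / of_real t"
    using Ln[OF assms] by (simp add: bes_yd_def E_def \<mu>_def s_def z_def)
  ultimately show "(bes_y \<nu> has_vector_derivative (bes_yd \<nu> t / of_real t)) (at t)"
    by (simp, elim has_vector_derivative_transform_within_open[of _ _ _ "{0<..}"])
       (use assms Ln in \<open>auto simp: bes_y_eq \<mu>_def\<close>)
  have "((\<lambda>t. exp (\<mu> * Ln (of_real t / 2)) * (\<mu> * bes_fun \<mu> ((of_real t / 2)\<^sup>2) + 2 * (of_real t / 2)\<^sup>2 * bes_fun' \<mu> ((of_real t / 2)\<^sup>2)))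
     has_vector_derivative ((\<mu>\<^sup>2 - z\<^sup>2) / z * (E * bes_fun \<mu> s))) (at t)"
    using has_vector_derivative_real_field[OF 2[unfolded z_def]] by (simp add: z_def)
  moreover have "(\<mu>\<^sup>2 - z\<^sup>2) / z * (E * bes_fun \<mu> s) = - of_real ((\<nu>\<^sup>2 + t\<^sup>2) / t) * bes_y \<nu> t"
  proof -
    have "E * bes_fun \<mu> s = bes_y \<nu> t"
      using Ln[OF assms] assms by (simp add: bes_y_eq E_def \<mu>_def s_def z_def)
    moreover have "\<mu>\<^sup>2 - z\<^sup>2 = - of_real (\<nu>\<^sup>2 + t\<^sup>2)"
      by (simp add: \<mu>_def z_def power_mult_distrib)
    ultimately show ?thesis
      by (simp only: of_real_divide z_def minus_divide_left)
  qed
  ultimately show "(bes_yd \<nu> has_vector_derivative (- of_real ((\<nu>\<^sup>2 + t\<^sup>2) / t) * bes_y \<nu> t)) (at t)"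
    by (simp, elim has_vector_derivative_transform_within_open[of _ _ _ "{0<..}"])
       (use assms Ln in \<open>auto simp: bes_yd_def \<mu>_def\<close>)
qed

text \<open>Both terms in the derivative of \<open>cnj y * (t y')\<close> are real, so the imaginary
  part is constant; the constant is found as the limit at \<open>0+\<close>.\<close>

lemma bes_wronskian:
  assumes "t > 0"
  shows "Im (cnj (bes_y \<nu> t) * bes_yd \<nu> t) = \<nu> * (cmod (rGamma (\<i> * of_real \<nu> + 1)))\<^sup>2"
proof -
  define \<mu> where "\<mu> = \<i> * complex_of_real \<nu>"
  have re: "Re \<mu> \<ge> 0" by (simp add: \<mu>_def)
  define f where "f t = Im (cnj (bes_y \<nu> t) * bes_yd \<nu> t)" for t
  define h where "h t = Im (cnj (bes_fun \<mu> (of_real ((t / 2)\<^sup>2))) * (\<mu> * bes_fun \<mu> (of_real ((t / 2)\<^sup>2))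
     + 2 * of_real ((t / 2)\<^sup>2) * bes_fun' \<mu> (of_real ((t / 2)\<^sup>2))))" for t :: real
  have "(f has_real_derivative 0) (at t)" if "t > 0" for t
  proof -
    have "((\<lambda>t. cnj (bes_y \<nu> t) * bes_yd \<nu> t) has_vector_derivative
        (cnj (bes_y \<nu> t) * (- of_real ((\<nu>\<^sup>2 + t\<^sup>2) / t) * bes_y \<nu> t)
          + cnj (bes_yd \<nu> t / of_real t) * bes_yd \<nu> t)) (at t)"
      by (intro has_vector_derivative_mult has_vector_derivative_cnj has_vector_derivative_bes_y that)
    from bounded_linear.has_vector_derivative[OF bounded_linear_Im this]
    have "(f has_vector_derivative Im (cnj (bes_y \<nu> t) * (- of_real ((\<nu>\<^sup>2 + t\<^sup>2) / t) * bes_y \<nu> t)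
          + cnj (bes_yd \<nu> t / of_real t) * bes_yd \<nu> t)) (at t)"
      by (simp add: f_def[abs_def])
    moreover have "cnj (bes_y \<nu> t) * (- of_real ((\<nu>\<^sup>2 + t\<^sup>2) / t) * bes_y \<nu> t)
          + cnj (bes_yd \<nu> t / of_real t) * bes_yd \<nu> t =
       of_real (- ((\<nu>\<^sup>2 + t\<^sup>2) / t) * (cmod (bes_y \<nu> t))\<^sup>2 + (cmod (bes_yd \<nu> t))\<^sup>2 / t)"
      by (simp only: of_real_add of_real_mult of_real_minus complex_norm_square of_real_divide complex_cnj_divide complex_cnj_complex_of_real)
         (simp add: mult_ac)
    ultimately show ?thesis
      by (simp only: Im_complex_of_real has_real_derivative_iff_has_vector_derivative)
  qed
  then have "\<exists>c. \<forall>t\<in>{0<..}. f t = c"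
    by (intro has_field_derivative_zero_constant) (auto intro: has_field_derivative_at_within)
  then obtain c where c: "f t = c" if "t > 0" for t
    by auto
  \<comment> \<open>The factor \<open>exp (\<i> \<nu> ln (t/2))\<close> has no limit at 0, but it
    has modulus 1 and cancels against its conjugate. What is left is \<open>h\<close>, which extends
    continuously to 0.\<close>
  have fh: "f t = h t" if "t > 0" for t
  proof -
    define e where "e = exp (\<mu> * of_real (ln (t / 2)))"
    have "cnj e * e = 1"
    proof -
      have "e = cis (\<nu> * ln (t / 2))" by (simp add: e_def \<mu>_def cis_conv_exp mult_ac)
      then show ?thesis by (simp add: cis_cnj cis_mult)
    qed
    moreover have "f t = Im ((cnj e * e) * (cnj (bes_fun \<mu> (of_real ((t / 2)\<^sup>2))) * (\<mu> * bes_fun \<mu> (of_real ((t / 2)\<^sup>2))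
     + 2 * of_real ((t / 2)\<^sup>2) * bes_fun' \<mu> (of_real ((t / 2)\<^sup>2)))))"
      unfolding f_def bes_y_eq[OF that] bes_yd_def \<mu>_def[symmetric] e_def[symmetric] complex_cnj_mult
      by (simp only: mult_ac)
    ultimately show ?thesis by (simp add: h_def)
  qed
  have cont: "isCont (\<lambda>t. bes_fun \<mu> (of_real ((t / 2)\<^sup>2))) (0::real)" "isCont (\<lambda>t. bes_fun' \<mu> (of_real ((t / 2)\<^sup>2))) (0::real)"
  proof -
    have q: "isCont (\<lambda>t. complex_of_real ((t / 2)\<^sup>2)) (0::real)"
      by (intro continuous_intros) simp
    show "isCont (\<lambda>t. bes_fun \<mu> (of_real ((t / 2)\<^sup>2))) (0::real)"
      by (rule isCont_o2[OF q]) (rule DERIV_isCont[OF has_field_derivative_bes_fun[OF re]])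
    obtain g where "(bes_fun' \<mu> has_field_derivative g) (at (complex_of_real ((0 / 2)\<^sup>2)))"
      using has_field_derivative_bes_fun'[OF re] by blast
    then show "isCont (\<lambda>t. bes_fun' \<mu> (of_real ((t / 2)\<^sup>2))) (0::real)"
      by (intro isCont_o2[OF q]) (rule DERIV_isCont)
  qed
  have "isCont h 0"
    unfolding h_def isCont_def by (intro cont[unfolded isCont_def] tendsto_intros) simp_all
  then have "(h \<longlongrightarrow> h 0) (at_right 0)"
    by (simp add: isCont_def filterlim_at_split)
  moreover have "(h \<longlongrightarrow> c) (at_right 0)"
    by (rule tendsto_eventually, rule eventually_mono[OF eventually_at_right_less[of 0]]) (metis c fh)
  ultimately have "h 0 = c"
    by (rule tendsto_unique[rotated]) simp
  moreover have "h 0 = \<nu> * (cmod (rGamma (\<i> * of_real \<nu> + 1)))\<^sup>2"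
  proof -
    have "bes_fun \<mu> 0 = rGamma (\<mu> + 1)"
      unfolding bes_fun_def powser_zero by (simp add: bes_coeff_def)
    then have "h 0 = Im (\<mu> * (cnj (rGamma (\<mu> + 1)) * rGamma (\<mu> + 1)))"
      by (simp add: h_def mult_ac)
    also have "cnj (rGamma (\<mu> + 1)) * rGamma (\<mu> + 1) = of_real ((cmod (rGamma (\<mu> + 1)))\<^sup>2)"
      unfolding complex_norm_square by (rule mult.commute)
    finally show ?thesis by (simp add: \<mu>_def)
  qed
  ultimately show ?thesis using c[OF assms] by (simp add: f_def)
qed

lemma bes_wronskian_pos:
  assumes "t > 0" "\<nu> > 0"
  shows "Im (cnj (bes_y \<nu> t) * bes_yd \<nu> t) > 0"
proof -
  have "\<i> * of_real \<nu> + 1 \<notin> \<int>\<^sub>\<le>\<^sub>0"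
    using assms by (auto simp: nonpos_Ints_def complex_eq_iff)
  then show ?thesis
    unfolding bes_wronskian[OF assms(1)] using assms by (simp add: rGamma_eq_zero_iff)
qed

lemma bes_y_nonzero: "t > 0 \<Longrightarrow> \<nu> > 0 \<Longrightarrow> bes_y \<nu> t \<noteq> 0"
  using bes_wronskian_pos[of t \<nu>] by auto

text \<open>Liouville's substitution: the factor \<open>sqrt t\<close> removes the first-derivative
  term and leaves \<open>u'' = - (1 + (\<nu>^2 + 1/4) / t^2) u\<close>, a decaying perturbation of
  the harmonic oscillator.\<close>

definition bes_u :: "real \<Rightarrow> real \<Rightarrow> complex" where
  "bes_u \<nu> t = of_real (sqrt t) * bes_y \<nu> t"

definition bes_ud :: "real \<Rightarrow> real \<Rightarrow> complex" where
  "bes_ud \<nu> t = of_real (1 / sqrt t) * (bes_y \<nu> t / 2 + bes_yd \<nu> t)"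

lemma has_vector_derivative_bes_u:
  assumes "t > 0"
  shows "(bes_u \<nu> has_vector_derivative bes_ud \<nu> t) (at t)"
    and "(bes_ud \<nu> has_vector_derivative (- of_real (1 + (\<nu>\<^sup>2 + 1/4) / t\<^sup>2) * bes_u \<nu> t)) (at t)"
proof -
  define q where "q = sqrt t"
  have q: "q > 0" "t = q * q" using assms by (auto simp: q_def)
  have 1: "((\<lambda>t. complex_of_real (sqrt t)) has_vector_derivative of_real (1 / (2 * q))) (at t)"
    by (intro has_vector_derivative_of_real)
       (use assms in \<open>auto intro!: derivative_eq_intros simp: q_def inverse_eq_divide\<close>)
  have "((\<lambda>t. 1 / sqrt t) has_real_derivative - (1 / (2 * q * t))) (at t)"
    using assms by (auto intro!: derivative_eq_intros simp: q_def inverse_eq_divide)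
  then have 2: "((\<lambda>t. complex_of_real (1 / sqrt t)) has_vector_derivative of_real (- (1 / (2 * q * t)))) (at t)"
    by (intro has_vector_derivative_of_real) (simp add: has_real_derivative_iff_has_vector_derivative)
  have qc: "complex_of_real q \<noteq> 0" using q by simp
  have tc: "complex_of_real t = of_real q * of_real q" using q by simp
  show "(bes_u \<nu> has_vector_derivative bes_ud \<nu> t) (at t)"
  proof -
    have "(bes_u \<nu> has_vector_derivative of_real (sqrt t) * (bes_yd \<nu> t / of_real t) + of_real (1 / (2 * q)) * bes_y \<nu> t) (at t)"
      unfolding bes_u_def[abs_def]
      by (intro has_vector_derivative_mult 1 has_vector_derivative_bes_y assms)
    moreover have "of_real (sqrt t) * (bes_yd \<nu> t / of_real t) + of_real (1 / (2 * q)) * bes_y \<nu> t = bes_ud \<nu> t"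
      using qc by (simp add: bes_ud_def q_def[symmetric] tc field_simps)
    ultimately show ?thesis by simp
  qed
  show "(bes_ud \<nu> has_vector_derivative (- of_real (1 + (\<nu>\<^sup>2 + 1/4) / t\<^sup>2) * bes_u \<nu> t)) (at t)"
  proof -
    have "(bes_ud \<nu> has_vector_derivative of_real (1 / sqrt t) * (bes_yd \<nu> t / of_real t / 2 + (- of_real ((\<nu>\<^sup>2 + t\<^sup>2) / t) * bes_y \<nu> t))
        + of_real (- (1 / (2 * q * t))) * (bes_y \<nu> t / 2 + bes_yd \<nu> t)) (at t)"
      unfolding bes_ud_def[abs_def]
      by (intro has_vector_derivative_mult 2 has_vector_derivative_add has_vector_derivative_divide has_vector_derivative_bes_y assms)
    moreover have "of_real (1 / sqrt t) * (bes_yd \<nu> t / of_real t / 2 + (- of_real ((\<nu>\<^sup>2 + t\<^sup>2) / t) * bes_y \<nu> t))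
        + of_real (- (1 / (2 * q * t))) * (bes_y \<nu> t / 2 + bes_yd \<nu> t) = - of_real (1 + (\<nu>\<^sup>2 + 1/4) / t\<^sup>2) * bes_u \<nu> t"
      using qc by (simp add: bes_u_def q_def[symmetric] tc power2_eq_square) (simp add: field_simps)
    ultimately show ?thesis by simp
  qed
qed

text \<open>The energy \<open>E\<close> is nonincreasing: the coefficient \<open>1 + k / t^2\<close>
  decreases, and the other terms of the derivative cancel by the equation. As the coefficient is at
  least 1, the energy dominates \<open>|u|^2\<close>.\<close>

lemma bes_u_bounded: "\<exists>C. \<forall>t\<ge>1. cmod (bes_u \<nu> t) \<le> C"
proof -
  define k where "k = \<nu>\<^sup>2 + 1/4"
  have k: "k > 0" by (simp add: k_def add_nonneg_pos)
  define E where "E t = (cmod (bes_ud \<nu> t))\<^sup>2 + (1 + k / t\<^sup>2) * (cmod (bes_u \<nu> t))\<^sup>2" for t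
  have dsq: "((\<lambda>t. (cmod (f t))\<^sup>2) has_real_derivative 2 * Re (cnj (f t) * f')) (at t)"
    if "(f has_vector_derivative f') (at t)" for f f' and t :: real
  proof -
    have "((\<lambda>t. Re (f t)) has_real_derivative Re f') (at t)" "((\<lambda>t. Im (f t)) has_real_derivative Im f') (at t)"
      using bounded_linear.has_vector_derivative[OF bounded_linear_Re that] bounded_linear.has_vector_derivative[OF bounded_linear_Im that]
      by (simp_all add: has_real_derivative_iff_has_vector_derivative)
    then have "((\<lambda>t. (Re (f t))\<^sup>2 + (Im (f t))\<^sup>2) has_real_derivative
        of_nat 2 * (Re f' * Re (f t) ^ (2 - Suc 0)) + of_nat 2 * (Im f' * Im (f t) ^ (2 - Suc 0))) (at t)"
      by (intro DERIV_add DERIV_power)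
    then show ?thesis
      unfolding cmod_power2 by (simp add: algebra_simps)
  qed
  have dE: "(E has_real_derivative (- 2 * k / t ^ 3 * (cmod (bes_u \<nu> t))\<^sup>2)) (at t)" if "t > 0" for t
  proof -
    have "((\<lambda>t. 1 + k / t\<^sup>2) has_real_derivative - 2 * k / t ^ 3) (at t)"
      using that by (auto intro!: derivative_eq_intros simp: field_simps power2_eq_square power3_eq_cube)
    then have "(E has_real_derivative 2 * Re (cnj (bes_ud \<nu> t) * (- of_real (1 + k / t\<^sup>2) * bes_u \<nu> t)) +
        (- 2 * k / t ^ 3 * (cmod (bes_u \<nu> t))\<^sup>2 + 2 * Re (cnj (bes_u \<nu> t) * bes_ud \<nu> t) * (1 + k / t\<^sup>2))) (at t)"
      unfolding E_def[abs_def] k_def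
      by (intro DERIV_add DERIV_mult dsq has_vector_derivative_bes_u that)
    moreover have "Re (cnj (bes_ud \<nu> t) * (- of_real (1 + k / t\<^sup>2) * bes_u \<nu> t)) = - (1 + k / t\<^sup>2) * Re (cnj (bes_u \<nu> t) * bes_ud \<nu> t)"
    proof -
      have "cnj (bes_ud \<nu> t) * (- of_real (1 + k / t\<^sup>2) * bes_u \<nu> t) = of_real (- (1 + k / t\<^sup>2)) * cnj (cnj (bes_u \<nu> t) * bes_ud \<nu> t)"
        by simp
      also have "Re \<dots> = - (1 + k / t\<^sup>2) * Re (cnj (cnj (bes_u \<nu> t) * bes_ud \<nu> t))"
        by simp 
      finally show ?thesis by (simp only: cnj.sel)
    qed
    moreover have "2 * (- c * w) + (- 2 * k / t ^ 3 * d + 2 * w * c) = - 2 * k / t ^ 3 * d" for c w d :: real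
      by (simp add: algebra_simps)
    ultimately show ?thesis by (simp only:)
  qed
  have "E t \<le> E 1" if "t \<ge> 1" for t
  proof (rule DERIV_nonpos_imp_nonincreasing[OF that])
    fix x :: real assume "1 \<le> x" "x \<le> t"
    then show "\<exists>y. (E has_real_derivative y) (at x) \<and> y \<le> 0"
      using k by (intro exI[of _ "- 2 * k / x ^ 3 * (cmod (bes_u \<nu> x))\<^sup>2"] conjI dE) auto
  qed
  moreover have "(cmod (bes_u \<nu> t))\<^sup>2 \<le> E t" if "t \<ge> 1" for t
  proof -
    have "1 * (cmod (bes_u \<nu> t))\<^sup>2 \<le> (1 + k / t\<^sup>2) * (cmod (bes_u \<nu> t))\<^sup>2"
      using k by (intro mult_right_mono) auto
    then show ?thesis
      unfolding E_def by (smt (verit) zero_le_power2)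
  qed
  ultimately have "(cmod (bes_u \<nu> t))\<^sup>2 \<le> E 1" if "t \<ge> 1" for t
    using that by force
  then have "cmod (bes_u \<nu> t) \<le> sqrt (E 1)" if "t \<ge> 1" for t
    using that by (simp add: real_le_rsqrt)
  then show ?thesis by blast
qed

text \<open>The bound on the derivative is integrable at infinity with tail integral
  \<open>C / t\<close>; this gives the limit and the rate at once.\<close>

lemma limit_of_inverse_square_derivative:
  fixes f :: "real \<Rightarrow> 'a :: banach"
  assumes d: "\<And>t. t \<ge> 1 \<Longrightarrow> (f has_vector_derivative f' t) (at t)"
    and b: "\<And>t. t \<ge> 1 \<Longrightarrow> norm (f' t) \<le> C / t\<^sup>2"
  obtains L where "\<And>t. t \<ge> 1 \<Longrightarrow> norm (f t - L) \<le> C / t"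
proof -
  have C: "C \<ge> 0" using order_trans[OF norm_ge_zero b[of 1]] by simp
  have cont: "continuous_on {s..t} f" if "1 \<le> s" for s t
    by (rule continuous_at_imp_continuous_on) (use has_vector_derivative_continuous[OF d] that in simp)
  have diff: "norm (f t - f s) \<le> C / s" if "1 \<le> s" "s \<le> t" for s t
  proof (cases "s = t")
    case False
    have "norm (f t - f s) \<le> - C / t - (- C / s)"
    proof (rule differentiable_bound_general[where f' = f' and \<phi>' = "\<lambda>t. C / t\<^sup>2"])
      show "continuous_on {s..t} (\<lambda>t. - C / t)"
        using that by (intro continuous_intros) auto
      show "((\<lambda>t. - C / t) has_vector_derivative C / x\<^sup>2) (at x)" if "s < x" for x
        unfolding has_real_derivative_iff_has_vector_derivative[symmetric]
        using that \<open>1 \<le> s\<close> by (auto intro!: derivative_eq_intros simp: power2_eq_square)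
    qed (use that False d b cont in auto)
    also have "\<dots> \<le> C / s"
      using that C by simp
    finally show ?thesis .
  qed (use that C in simp)
  have "Cauchy (\<lambda>n. f (real (Suc n)))"
  proof (rule CauchyI')
    fix e :: real assume e: "e > 0"
    obtain M :: nat where M: "real M > C / e" using reals_Archimedean2 by blast
    then have "C / real (Suc M) < e"
      using e C by (simp add: field_simps)
    moreover have "dist (f (real (Suc m))) (f (real (Suc n))) \<le> C / real (Suc M)" if "m \<ge> M" "n > m" for m n
    proof -
      have "dist (f (real (Suc m))) (f (real (Suc n))) \<le> C / real (Suc m)"
        using diff[of "real (Suc m)" "real (Suc n)"] that by (simp add: dist_norm norm_minus_commute)
      also have "\<dots> \<le> C / real (Suc M)"
        using that C by (intro divide_left_mono) auto
      finally show ?thesis .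
    qed
    ultimately show "\<exists>M. \<forall>m\<ge>M. \<forall>n>m. dist (f (real (Suc m))) (f (real (Suc n))) < e"
      by (meson order.strict_trans1)
  qed
  then obtain L where L: "(\<lambda>n. f (real (Suc n))) \<longlonglongrightarrow> L"
    by (auto simp: Cauchy_convergent_iff convergent_def)
  show thesis
  proof
    fix t :: real assume t: "t \<ge> 1"
    have "(\<lambda>n. norm (f (real (Suc n)) - f t)) \<longlonglongrightarrow> norm (L - f t)"
      by (intro tendsto_intros L)
    moreover have "\<forall>\<^sub>F n in sequentially. norm (f (real (Suc n)) - f t) \<le> C / t"
    proof -
      have "\<forall>\<^sub>F n in sequentially. n \<ge> nat \<lceil>t\<rceil>" by (rule eventually_ge_at_top)
      then show ?thesis
        proof eventually_elim
        case (elim n)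
        then show ?case by (intro diff t) linarith
      qed
    qed
    ultimately show "norm (f t - L) \<le> C / t"
      by (subst norm_minus_commute) (rule tendsto_upperbound, auto)
  qed
qed

text \<open>Variation of constants for \<open>u'' = - u\<close>. The amplitudes of the two waves
  would be constant without the perturbation; with it their derivatives are
  \<open>O(1 / t^2)\<close>, since \<open>u\<close> is bounded.\<close>

lemma bes_u_asymp:
  obtains a b C where
    "\<And>t. t \<ge> 1 \<Longrightarrow> cmod (bes_u \<nu> t - (a * cis t + b * cis (- t))) \<le> C / t"
proof -
  define k where "k = \<nu>\<^sup>2 + 1/4"
  have k: "k > 0" by (simp add: k_def add_nonneg_pos)
  obtain B where B: "\<And>t. t \<ge> 1 \<Longrightarrow> cmod (bes_u \<nu> t) \<le> B"
    using bes_u_bounded by blast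
  have dcis: "((\<lambda>t. cis (s * t)) has_vector_derivative \<i> * of_real s * cis (s * t)) (at t)" for s t :: real
  proof -
    have "((\<lambda>z. exp (\<i> * (of_real s * z))) has_field_derivative \<i> * of_real s * exp (\<i> * (of_real s * of_real t)))
        (at (complex_of_real t))"
      by (auto intro!: derivative_eq_intros)
    from has_vector_derivative_real_field[OF this] show ?thesis
      by (simp add: cis_conv_exp)
  qed
  \<comment> \<open>The values \<open>s = 1\<close> and \<open>s = -1\<close> give the amplitudes of
    \<open>cis t\<close> and \<open>cis (- t)\<close>. Because \<open>s^2 = 1\<close>, only the
    perturbation \<open>k / t^2\<close> survives in the derivative.\<close>
  define A where "A s t = (bes_u \<nu> t - \<i> * of_real s * bes_ud \<nu> t) * cis (- s * t) / 2" for s t :: real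
  have dA: "(A s has_vector_derivative \<i> * of_real s * of_real (k / t\<^sup>2) * bes_u \<nu> t * cis (- s * t) / 2) (at t)"
    if "t \<ge> 1" "s\<^sup>2 = 1" for s t
  proof -
    have s: "complex_of_real s * of_real s = 1" using that(2)
      by (metis of_real_1 of_real_mult power2_eq_square)
    have "(A s has_vector_derivative
       ((bes_u \<nu> t - \<i> * of_real s * bes_ud \<nu> t) * (\<i> * of_real (- s) * cis (- s * t))
       + (bes_ud \<nu> t - \<i> * of_real s * (- of_real (1 + k / t\<^sup>2) * bes_u \<nu> t)) * cis (- s * t)) / 2) (at t)"
      unfolding A_def[abs_def] k_def using that
      by (intro has_vector_derivative_divide has_vector_derivative_mult has_vector_derivative_diff
           has_vector_derivative_mult_right has_vector_derivative_bes_u dcis) auto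
    moreover have "(bes_u \<nu> t - \<i> * of_real s * bes_ud \<nu> t) * (\<i> * of_real (- s) * cis (- s * t))
       + (bes_ud \<nu> t - \<i> * of_real s * (- of_real (1 + k / t\<^sup>2) * bes_u \<nu> t)) * cis (- s * t)
       = \<i> * of_real s * of_real (k / t\<^sup>2) * bes_u \<nu> t * cis (- s * t)
         + (1 - complex_of_real s * of_real s) * bes_ud \<nu> t * cis (- s * t)"
      by (simp add: algebra_simps)
    ultimately show ?thesis by (simp add: s)
  qed
  have bA: "norm (\<i> * of_real s * of_real (k / t\<^sup>2) * bes_u \<nu> t * cis (- s * t) / 2) \<le> k * B / 2 / t\<^sup>2"
    if "t \<ge> 1" "s\<^sup>2 = 1" for s t :: real
  proof -
    have "\<bar>s\<bar> = 1" using that(2) by (simp add: power2_eq_1_iff) auto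
    then have "norm (\<i> * of_real s * of_real (k / t\<^sup>2) * bes_u \<nu> t * cis (- s * t) / 2) = k / t\<^sup>2 * cmod (bes_u \<nu> t) / 2"
      using k by (simp add: norm_mult norm_divide norm_power)
    also have "\<dots> \<le> k / t\<^sup>2 * B / 2"
      using k B[OF that(1)] by (intro divide_right_mono mult_left_mono) auto
    finally show ?thesis by (simp add: field_simps)
  qed
  obtain a where a: "\<And>t. t \<ge> 1 \<Longrightarrow> norm (A 1 t - a) \<le> k * B / 2 / t"
    using limit_of_inverse_square_derivative[of "A 1", OF dA bA] by auto
  obtain b where b: "\<And>t. t \<ge> 1 \<Longrightarrow> norm (A (-1) t - b) \<le> k * B / 2 / t"
    using limit_of_inverse_square_derivative[of "A (-1)", OF dA bA] by auto
  show thesis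
  proof
    fix t :: real assume t: "t \<ge> 1"
    have "bes_u \<nu> t = A 1 t * cis t + A (-1) t * cis (- t)"
      by (simp add: A_def cis_mult field_simps)
    then have "bes_u \<nu> t - (a * cis t + b * cis (- t)) = (A 1 t - a) * cis t + (A (-1) t - b) * cis (- t)"
      by (simp add: algebra_simps)
    also have "cmod \<dots> \<le> cmod ((A 1 t - a) * cis t) + cmod ((A (-1) t - b) * cis (- t))"
      by (rule norm_triangle_ineq)
    also have "\<dots> \<le> k * B / t"
    proof -
      have "cmod ((A 1 t - a) * cis t) + cmod ((A (-1) t - b) * cis (- t)) \<le> k * B / 2 / t + k * B / 2 / t"
        using a[OF t] b[OF t] by (intro add_mono) (simp_all add: norm_mult)
      also have "k * B / 2 / t + k * B / 2 / t = k * B / t" by (simp add: field_simps)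
      finally show ?thesis .
    qed
    finally show "cmod (bes_u \<nu> t - (a * cis t + b * cis (- t))) \<le> k * B / t" .
  qed
qed

subsection \<open>The Laplace transform and the amplitude at infinity\<close>

text \<open>Dominated convergence for the partial sums. The majorant bounds the sums of the norms,
  so it also bounds each term and yields its integrability.\<close>

lemma integral_sums_dominated:
  fixes f :: "nat \<Rightarrow> 'a \<Rightarrow> 'b :: {banach, second_countable_topology}"
  assumes [measurable]: "\<And>n. f n \<in> borel_measurable M" and w: "integrable M w"
    and bound: "\<And>n x. (\<Sum>i<n. norm (f i x)) \<le> w x"
    and sums: "\<And>x. (\<lambda>n. f n x) sums g x"
  shows "(\<lambda>n. integral\<^sup>L M (f n)) sums integral\<^sup>L M g"
proof -
  have le: "norm (f n x) \<le> w x" for n x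
    using bound[where n = "Suc n" and x = x] sum_nonneg[of "{..<n}" "\<lambda>i. norm (f i x)"] by simp
  have int: "integrable M (f n)" for n
    by (rule Bochner_Integration.integrable_bound[OF w]) (auto intro!: AE_I2 order_trans[OF le abs_ge_self])
  have [measurable]: "g \<in> borel_measurable M"
    by (rule borel_measurable_LIMSEQ_metric[where f = "\<lambda>n x. \<Sum>i<n. f i x"]) (use sums in \<open>auto simp: sums_def\<close>)
  have "(\<lambda>n. integral\<^sup>L M (\<lambda>x. \<Sum>i<n. f i x)) \<longlonglongrightarrow> integral\<^sup>L M g"
    by (rule integral_dominated_convergence[where w = w])
       (use sums w in \<open>auto simp: sums_def intro!: order_trans[OF norm_sum bound]\<close>)
  then show ?thesis
    unfolding sums_def using int by (simp add: Bochner_Integration.integral_sum)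
qed

lemma sum_exp_le:
  fixes x :: real
  assumes "x \<ge> 0"
  shows "(\<Sum>i<n. x ^ i / fact i) \<le> exp x"
proof -
  have "(\<lambda>n. x ^ n / fact n) sums exp x"
    using exp_converges[of x] by (simp add: field_simps)
  then show ?thesis
    using sum_le_suminf[of "\<lambda>n. x ^ n / fact n" "{..<n}"] assms by (auto simp: sums_iff)
qed

section \<open>The Laplace transform on the right half-plane\<close>

definition laplace :: "(real \<Rightarrow> complex) \<Rightarrow> complex \<Rightarrow> complex" where
  "laplace f p = (LBINT t:{0<..}. exp (- (p * of_real t)) * f t)"

text \<open>Integrability is demanded for every \<open>q > 0\<close>, so that the transform exists
  on the whole open half-plane, right up to the line that carries the singularity at
  \<open>\<i>\<close>.\<close>

definition laplace_ok :: "(real \<Rightarrow> complex) \<Rightarrow> bool" where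
  "laplace_ok f \<longleftrightarrow> set_borel_measurable lborel {0<..} f \<and>
     (\<forall>q>0. set_integrable lborel {0<..} (\<lambda>t. exp (- (q * t)) * norm (f t)))"

lemma laplace_ok_integrable:
  assumes f: "laplace_ok f" and p: "Re p > 0"
  shows "set_integrable lborel {0<..} (\<lambda>t. exp (- (p * of_real t)) * f t)"
  unfolding set_integrable_def
proof (rule Bochner_Integration.integrable_bound)
  show "integrable lborel (\<lambda>t. indicat_real {0<..} t *\<^sub>R (exp (- (Re p * t)) * norm (f t)))"
    using f p by (simp add: laplace_ok_def set_integrable_def)
  have [measurable]: "(\<lambda>t. indicat_real {0<..} t *\<^sub>R f t) \<in> borel_measurable borel"
    using f by (simp add: laplace_ok_def set_borel_measurable_def)
  have "(\<lambda>t. exp (- (p * of_real t)) * (indicat_real {0<..} t *\<^sub>R f t)) \<in> borel_measurable lborel"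
    by measurable
  then show "(\<lambda>t. indicat_real {0<..} t *\<^sub>R (exp (- (p * of_real t)) * f t)) \<in> borel_measurable lborel"
    by simp
qed (auto simp: norm_mult norm_exp_eq_Re)

text \<open>\<open>exp (- p t)\<close> is expanded about the real point \<open>p0\<close>. The sum
  of the norms is at most \<open>exp (- (p0 - |p - p0|) t) |f t|\<close>, which is integrable
  because \<open>|p - p0| < p0\<close> leaves a positive rate.\<close>

lemma laplace_power_series:
  assumes f: "laplace_ok f" and p: "norm (p - of_real p0) < p0"
  shows "(\<lambda>n. (LBINT t:{0<..}. exp (- (of_real p0 * of_real t)) * f t * ((- of_real t) ^ n / fact n))
            * (p - of_real p0) ^ n) sums laplace f p"
proof -
  define z where "z = p - of_real p0"
  define F where "F n t = indicat_real {0<..} t *\<^sub>R (exp (- (of_real p0 * of_real t)) * f t * ((- (z * of_real t)) ^ n / fact n))"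
    for n t
  have [measurable]: "(\<lambda>t. indicat_real {0<..} t *\<^sub>R f t) \<in> borel_measurable borel"
    using f by (simp add: laplace_ok_def set_borel_measurable_def)
  have "(\<lambda>n. integral\<^sup>L lborel (F n)) sums integral\<^sup>L lborel (\<lambda>t. indicat_real {0<..} t *\<^sub>R (exp (- (p * of_real t)) * f t))"
  proof (rule integral_sums_dominated)
    fix n
    have "(\<lambda>t. exp (- (of_real p0 * of_real t)) * (indicat_real {0<..} t *\<^sub>R f t) * ((- (z * of_real t)) ^ n / fact n))
        \<in> borel_measurable lborel"
      by measurable
    also have "(\<lambda>t. exp (- (of_real p0 * of_real t)) * (indicat_real {0<..} t *\<^sub>R f t) * ((- (z * of_real t)) ^ n / fact n)) = F n"
      by (rule ext) (simp add: F_def scaleR_conv_of_real)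
    finally show "F n \<in> borel_measurable lborel" .
  next
    show "integrable lborel (\<lambda>t. indicat_real {0<..} t *\<^sub>R (exp (- ((p0 - norm z) * t)) * norm (f t)))"
      using f p by (simp add: laplace_ok_def set_integrable_def z_def)
    fix n t
    have "(\<Sum>i<n. norm (F i t)) \<le> exp (norm z * t) * (exp (- (p0 * t)) * norm (f t))" if "t > 0"
    proof -
      have "(\<Sum>i<n. norm (F i t)) = (\<Sum>i<n. (norm z * t) ^ i / fact i) * (exp (- (p0 * t)) * norm (f t))"
        unfolding sum_distrib_right using that
        by (intro sum.cong) (auto simp: F_def norm_mult norm_power norm_divide norm_exp_eq_Re)
      also have "\<dots> \<le> exp (norm z * t) * (exp (- (p0 * t)) * norm (f t))"
      proof (rule mult_right_mono)
        show "(\<Sum>i<n. (norm z * t) ^ i / fact i) \<le> exp (norm z * t)"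
          using that by (intro sum_exp_le) simp
      qed simp
      finally show ?thesis .
    qed
    moreover have "exp (norm z * t) * (exp (- (p0 * t)) * norm (f t)) = exp (- ((p0 - norm z) * t)) * norm (f t)"
      by (simp only: mult.assoc[symmetric] exp_add[symmetric]) (simp add: algebra_simps)
    ultimately show "(\<Sum>i<n. norm (F i t)) \<le> indicat_real {0<..} t *\<^sub>R (exp (- ((p0 - norm z) * t)) * norm (f t))"
      by (cases "t > 0") (auto simp: F_def)
    have "(\<lambda>n. (- (z * of_real t)) ^ n /\<^sub>R fact n) sums exp (- (z * of_real t))"
      by (rule exp_converges)
    then have "(\<lambda>n. (indicat_real {0<..} t *\<^sub>R (exp (- (of_real p0 * of_real t)) * f t)) * ((- (z * of_real t)) ^ n /\<^sub>R fact n))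
       sums ((indicat_real {0<..} t *\<^sub>R (exp (- (of_real p0 * of_real t)) * f t)) * exp (- (z * of_real t)))"
      by (rule sums_mult)
    moreover have e: "exp (- (of_real p0 * of_real t)) * exp (- (z * of_real t)) = exp (- (p * of_real t))"
      by (simp add: exp_add[symmetric] z_def algebra_simps)
    have "(indicat_real {0<..} t *\<^sub>R (exp (- (of_real p0 * of_real t)) * f t)) * exp (- (z * of_real t))
        = indicat_real {0<..} t *\<^sub>R (exp (- (p * of_real t)) * f t)"
      unfolding e[symmetric] by (simp add: scaleR_conv_of_real mult_ac)
    moreover have "F n t = (indicat_real {0<..} t *\<^sub>R (exp (- (of_real p0 * of_real t)) * f t)) * ((- (z * of_real t)) ^ n /\<^sub>R fact n)" for n
      by (simp add: F_def scaleR_conv_of_real divide_inverse mult_ac)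
    ultimately show "(\<lambda>n. F n t) sums (indicat_real {0<..} t *\<^sub>R (exp (- (p * of_real t)) * f t))"
      by (simp only:)
  qed
  moreover have "integral\<^sup>L lborel (F n) = (LBINT t:{0<..}. exp (- (of_real p0 * of_real t)) * f t * ((- of_real t) ^ n / fact n)) * z ^ n" for n
    unfolding F_def set_lebesgue_integral_def integral_mult_left_zero[symmetric]
    by (intro Bochner_Integration.integral_cong) (auto simp: power_mult_distrib[symmetric] mult_ac)
  ultimately show ?thesis
    by (simp add: laplace_def set_lebesgue_integral_def z_def)
qed

text \<open>Every point of the half-plane lies in a disc around some real \<open>p0\<close> of
  radius \<open>p0\<close>, where the power series applies.\<close>

lemma laplace_holomorphic:
  assumes "laplace_ok f"
  shows "laplace f holomorphic_on {p. Re p > 0}"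
proof (rule holomorphic_onI)
  fix p assume "p \<in> {p. Re p > 0}"
  then have p: "Re p > 0" by simp
  \<comment> \<open>For \<open>Re p > 0\<close>, \<open>|p - p0|^2 < p0^2\<close> is equivalent to
    \<open>p0 > |p|^2 / (2 Re p)\<close>; the added 1 makes this strict.\<close>
  define p0 where "p0 = (norm p)\<^sup>2 / (2 * Re p) + 1"
  have p0: "p0 > 0" using p by (simp add: p0_def add_nonneg_pos)
  have "(norm (p - of_real p0))\<^sup>2 = (norm p)\<^sup>2 - 2 * p0 * Re p + p0\<^sup>2"
    by (simp only: cmod_power2) (simp add: power2_eq_square algebra_simps)
  also have "2 * p0 * Re p = (norm p)\<^sup>2 + 2 * Re p"
    using p by (simp add: p0_def field_simps)
  finally have "(norm (p - of_real p0))\<^sup>2 < p0\<^sup>2"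
    using p by simp
  then have "norm (p - of_real p0) < p0"
    using p0 by (simp add: power_less_imp_less_base)
  then have "p \<in> ball (of_real p0) p0"
    by (simp add: dist_norm norm_minus_commute)
  moreover have "laplace f holomorphic_on ball (of_real p0) p0"
    by (rule power_series_holomorphic) (auto simp: dist_norm norm_minus_commute intro: laplace_power_series assms)
  ultimately show "laplace f field_differentiable at p within {p. Re p > 0}"
    using holomorphic_on_imp_differentiable_at[of "laplace f" "ball (of_real p0) p0" p]
      field_differentiable_at_within by blast
qed

text \<open>Identity theorem on the connected half-plane, with 2 as a limit point of the ray. Closed
  forms are checked for real \<open>p > 1\<close>, where the Bessel series can be integrated term by
  term, and are then carried towards the imaginary axis.\<close>

lemma laplace_eqI:
  assumes f: "laplace_ok f" and H: "H holomorphic_on {p. Re p > 0}"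
    and eq: "\<And>p::real. p > 1 \<Longrightarrow> laplace f (of_real p) = H (of_real p)" and p: "Re p > 0"
  shows "laplace f p = H p"
proof -
  have "laplace f p - H p = 0"
  proof (rule analytic_continuation[where f = "\<lambda>p. laplace f p - H p" and S = "{p. Re p > 0}" and U = "of_real ` {1<..}" and \<xi> = 2])
    show "(2::complex) islimpt of_real ` {1<..}"
      unfolding islimpt_approachable
    proof (intro allI impI)
      fix e :: real assume "e > 0"
      then have "complex_of_real (2 + e / 2) \<noteq> 2 \<and> dist (complex_of_real (2 + e / 2)) 2 < e"
        by (auto simp: dist_norm norm_divide)
      moreover have "complex_of_real (2 + e / 2) \<in> complex_of_real ` {1<..}"
        using \<open>e > 0\<close> by (intro imageI) auto
      ultimately show "\<exists>x'\<in>complex_of_real ` {1<..}. x' \<noteq> 2 \<and> dist x' 2 < e"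
        by blast
    qed
    show "connected {p. Re p > 0}"
      by (intro convex_connected convex_halfspace_Re_gt)
  qed (use assms laplace_holomorphic in \<open>auto intro!: holomorphic_intros simp: open_halfspace_Re_gt\<close>)
  then show ?thesis by simp
qed

text \<open>Euler's integral after the substitution \<open>t -> p t\<close>. Powers are written as
  exponentials of logarithms, so that the scaling acts by adding \<open>ln p\<close> in the
  exponent.\<close>

lemma laplace_Gamma:
  assumes z: "Re z > 0" and p: "p > 0"
  shows "set_integrable lborel {0<..} (\<lambda>t. exp (- (of_real p * of_real t)) * exp ((z - 1) * of_real (ln t)))"
    and "laplace (\<lambda>t. exp ((z - 1) * of_real (ln t))) (of_real p) = Gamma z * exp (- (z * of_real (ln p)))"
proof -
  define f where "f t = indicat_real {0<..} t *\<^sub>R (exp (- of_real t) * exp ((z - 1) * of_real (ln t)))" for t :: real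
  have f_alt: "f t = indicat_real {0<..} t *\<^sub>R (of_real t powr (z - 1) / of_real (exp t))" for t :: real
    by (auto simp: f_def powr_def Ln_of_real exp_minus field_simps exp_of_real indicator_def)
  have fm: "f \<in> borel_measurable lborel"
    unfolding f_def[abs_def] by measurable
  have "integrable lebesgue f"
    using absolutely_integrable_Gamma_integral'[OF z] unfolding f_alt[abs_def] set_integrable_def .
  then have int: "integrable lborel f"
    using fm by (simp add: integrable_completion)
  have "integral\<^sup>L lborel f = integral {0<..} (\<lambda>t. of_real t powr (z - 1) / of_real (exp t))"
    using set_borel_integral_eq_integral(2)[of "{0<..}" "\<lambda>t. of_real t powr (z - 1) / of_real (exp t)"] int
    unfolding set_integrable_def set_lebesgue_integral_def f_alt[abs_def] by simp
  also have "\<dots> = Gamma z"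
    using Gamma_integral_complex'[OF z] by (rule integral_unique)
  finally have val: "integral\<^sup>L lborel f = Gamma z" .
  have eq: "indicat_real {0<..} t *\<^sub>R (exp (- (of_real p * of_real t)) * exp ((z - 1) * of_real (ln t)))
     = exp (- ((z - 1) * of_real (ln p))) * f (p * t)" for t
  proof (cases "t > 0")
    case True
    have "exp ((z - 1) * of_real (ln (p * t))) = exp ((z - 1) * of_real (ln p)) * exp ((z - 1) * of_real (ln t))"
      using True p by (simp add: ln_mult exp_add[symmetric] algebra_simps)
    then show ?thesis
      using True p by (simp add: f_def exp_minus)
  qed (use p in \<open>auto simp: f_def zero_less_mult_iff\<close>)
  have "integrable lborel (\<lambda>t. f (0 + p * t))"
    by (rule lborel_integrable_real_affine[OF int]) (use p in auto)
  then show "set_integrable lborel {0<..} (\<lambda>t. exp (- (of_real p * of_real t)) * exp ((z - 1) * of_real (ln t)))"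
    unfolding set_integrable_def eq by simp
  have "Gamma z = p *\<^sub>R (\<integral>t. f (0 + p * t) \<partial>lborel)"
    using lborel_integral_real_affine[of p f 0] p val by simp
  then have "(\<integral>t. f (p * t) \<partial>lborel) = Gamma z / of_real p"
    using p by (simp add: scaleR_conv_of_real field_simps)
  then have l: "laplace (\<lambda>t. exp ((z - 1) * of_real (ln t))) (of_real p) = exp (- ((z - 1) * of_real (ln p))) * (Gamma z / of_real p)"
    unfolding laplace_def set_lebesgue_integral_def eq by simp
  have q: "exp (- ((z - 1) * of_real (ln p))) / of_real p = exp (- (z * of_real (ln p)))"
  proof -
    have "complex_of_real p = exp (of_real (ln p))"
      using p by (simp add: exp_of_real)
    then have "exp (- ((z - 1) * of_real (ln p))) / of_real p = exp (- ((z - 1) * of_real (ln p)) - of_real (ln p))"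
      by (simp add: exp_diff)
    then show ?thesis by (simp add: algebra_simps)
  qed
  moreover from q have "exp (- ((z - 1) * of_real (ln p))) * (Gamma z / of_real p) = Gamma z * exp (- (z * of_real (ln p)))"
    by (metis mult.commute times_divide_eq_left times_divide_eq_right)
  ultimately show "laplace (\<lambda>t. exp ((z - 1) * of_real (ln t))) (of_real p) = Gamma z * exp (- (z * of_real (ln p)))"
    using l by simp
qed

lemma laplace_Gamma_real:
  fixes z p :: real
  assumes z: "z > 0" and p: "p > 0"
  shows "set_integrable lborel {0<..} (\<lambda>t. exp (- (p * t)) * t powr (z - 1))"
    and "(LBINT t:{0<..}. exp (- (p * t)) * t powr (z - 1)) = Gamma z * p powr (- z)"
proof -
  have z': "Re (complex_of_real z) > 0" using z by simp
  have eq: "indicat_real {0<..} t *\<^sub>R (exp (- (complex_of_real p * of_real t)) * exp ((complex_of_real z - 1) * of_real (ln t)))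
      = complex_of_real (indicat_real {0<..} t *\<^sub>R (exp (- (p * t)) * t powr (z - 1)))" for t
    by (auto simp: powr_def exp_of_real[symmetric] indicator_def)
  show "set_integrable lborel {0<..} (\<lambda>t. exp (- (p * t)) * t powr (z - 1))"
    using laplace_Gamma(1)[OF z' p] unfolding set_integrable_def eq complex_of_real_integrable_eq .
  have "complex_of_real (LBINT t:{0<..}. exp (- (p * t)) * t powr (z - 1)) = of_real (Gamma z * p powr (- z))"
    using laplace_Gamma(2)[OF z' p] unfolding laplace_def set_lebesgue_integral_def eq integral_complex_of_real
    using p by (simp add: powr_def exp_of_real[symmetric] Gamma_complex_of_real)
  then show "(LBINT t:{0<..}. exp (- (p * t)) * t powr (z - 1)) = Gamma z * p powr (- z)"
    by (simp only: of_real_eq_iff)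
qed

lemma laplace_ok_powr:
  assumes m: "set_borel_measurable lborel {0<..} f" and "z > 0"
    and b: "\<And>t. t > 0 \<Longrightarrow> norm (f t) \<le> C * t powr (z - 1)"
  shows "laplace_ok f"
  unfolding laplace_ok_def
proof (intro conjI m allI impI)
  fix q :: real assume q: "q > 0"
  have [measurable]: "(\<lambda>t. indicat_real {0<..} t *\<^sub>R f t) \<in> borel_measurable borel"
    using m by (simp add: set_borel_measurable_def)
  show "set_integrable lborel {0<..} (\<lambda>t. exp (- (q * t)) * norm (f t))"
    unfolding set_integrable_def
  proof (rule Bochner_Integration.integrable_bound)
    show "integrable lborel (\<lambda>t. C * (indicat_real {0<..} t *\<^sub>R (exp (- (q * t)) * t powr (z - 1))))"
      using laplace_Gamma_real(1)[OF assms(2) q] by (simp add: set_integrable_def)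
    have "(\<lambda>t. exp (- (q * t)) * norm (indicat_real {0<..} t *\<^sub>R f t)) \<in> borel_measurable lborel"
      by measurable
    then show "(\<lambda>t. indicat_real {0<..} t *\<^sub>R (exp (- (q * t)) * norm (f t))) \<in> borel_measurable lborel"
      by (simp add: mult_ac)
    show "AE t in lborel. norm (indicat_real {0<..} t *\<^sub>R (exp (- (q * t)) * norm (f t)))
        \<le> norm (C * (indicat_real {0<..} t *\<^sub>R (exp (- (q * t)) * t powr (z - 1))))"
    proof (rule AE_I2)
      fix t :: real
      show "norm (indicat_real {0<..} t *\<^sub>R (exp (- (q * t)) * norm (f t)))
        \<le> norm (C * (indicat_real {0<..} t *\<^sub>R (exp (- (q * t)) * t powr (z - 1))))"
      proof (cases "t > 0")
        case True
        have "exp (- (q * t)) * norm (f t) \<le> exp (- (q * t)) * (C * t powr (z - 1))"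
          using b[OF True] by (intro mult_left_mono) auto
        also have "\<dots> \<le> \<bar>C * (exp (- (q * t)) * t powr (z - 1))\<bar>"
          by (simp add: mult_ac)
        finally show ?thesis using True by simp
      qed simp
    qed
  qed
qed

text \<open>The quantitative half of the Abelian argument: a bound \<open>t^(z - 1)\<close> on
  \<open>f\<close> limits the growth of the transform towards the imaginary axis to
  \<open>(Re p)^(- z)\<close>.\<close>

lemma norm_laplace_le:
  assumes m: "set_borel_measurable lborel {0<..} f" and "z > 0"
    and b: "\<And>t. t > 0 \<Longrightarrow> norm (f t) \<le> C * t powr (z - 1)" and p: "Re p > 0"
  shows "norm (laplace f p) \<le> C * (Gamma z * Re p powr (- z))"
proof -
  have int: "integrable lborel (\<lambda>t. C * (indicat_real {0<..} t *\<^sub>R (exp (- (Re p * t)) * t powr (z - 1))))"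
    using laplace_Gamma_real(1)[OF assms(2) p] by (simp add: set_integrable_def)
  have "norm (laplace f p) \<le> integral\<^sup>L lborel (\<lambda>t. C * (indicat_real {0<..} t *\<^sub>R (exp (- (Re p * t)) * t powr (z - 1))))"
    unfolding laplace_def set_lebesgue_integral_def
  proof (rule Bochner_Integration.integral_norm_bound_integral[OF _ int])
    show "integrable lborel (\<lambda>t. indicat_real {0<..} t *\<^sub>R (exp (- (p * of_real t)) * f t))"
      using laplace_ok_integrable[OF laplace_ok_powr[OF assms(1-3)] p] by (simp add: set_integrable_def)
    fix t
    show "norm (indicat_real {0<..} t *\<^sub>R (exp (- (p * of_real t)) * f t))
        \<le> C * (indicat_real {0<..} t *\<^sub>R (exp (- (Re p * t)) * t powr (z - 1)))"
    proof (cases "t > 0")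
      case True
      have "exp (- (Re p * t)) * norm (f t) \<le> exp (- (Re p * t)) * (C * t powr (z - 1))"
        using b[OF True] by (intro mult_left_mono) auto
      then show ?thesis using True by (simp add: norm_mult norm_exp_eq_Re mult_ac)
    qed simp
  qed
  also have "\<dots> = C * (Gamma z * Re p powr (- z))"
    using laplace_Gamma_real(2)[OF assms(2) p] by (simp add: set_lebesgue_integral_def)
  finally show ?thesis .
qed

lemma bes_y_measurable: "set_borel_measurable lborel {0<..} (bes_y \<nu>)"
proof -
  have "continuous_on {0<..} (bes_y \<nu>)"
    by (intro continuous_at_imp_continuous_on ballI)
       (use has_vector_derivative_continuous[OF has_vector_derivative_bes_y(1)] in simp)
  then show ?thesis
    using set_measurable_continuous_on[of "{0<..}" "bes_y \<nu>"] by (simp add: set_borel_measurable_def)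
qed

text \<open>For purely imaginary order the power factor has modulus 1, so only the entire factor
  matters, and it is continuous on the closed interval.\<close>

lemma norm_bes_y_near_0: "\<exists>K. \<forall>t. 0 < t \<and> t \<le> 1 \<longrightarrow> cmod (bes_y \<nu> t) \<le> K"
proof -
  define \<mu> where "\<mu> = \<i> * complex_of_real \<nu>"
  have "continuous_on {0..1} (\<lambda>t::real. bes_fun \<mu> (of_real ((t / 2)\<^sup>2)))"
  proof (intro continuous_at_imp_continuous_on ballI)
    fix t :: real
    have "isCont (\<lambda>t. complex_of_real ((t / 2)\<^sup>2)) t"
      by (intro continuous_intros) simp
    then show "isCont (\<lambda>t. bes_fun \<mu> (of_real ((t / 2)\<^sup>2))) t"
      by (rule isCont_o2) (rule DERIV_isCont[OF has_field_derivative_bes_fun], simp add: \<mu>_def)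
  qed
  then have "bounded ((\<lambda>t::real. bes_fun \<mu> (of_real ((t / 2)\<^sup>2))) ` {0..1})"
    by (intro compact_imp_bounded compact_continuous_image) auto
  then obtain K where "\<forall>x\<in>(\<lambda>t::real. bes_fun \<mu> (of_real ((t / 2)\<^sup>2))) ` {0..1}. cmod x \<le> K"
    unfolding bounded_iff by blast
  then have K: "cmod (bes_fun \<mu> (of_real ((t / 2)\<^sup>2))) \<le> K" if "t \<in> {0..1}" for t
    using that by blast
  have "cmod (bes_y \<nu> t) \<le> K" if "0 < t" "t \<le> 1" for t
    using K[of t] that unfolding bes_y_eq[OF that(1)] \<mu>_def[symmetric]
    by (simp add: norm_mult norm_exp_eq_Re) (simp add: \<mu>_def)
  then show ?thesis by blast
qed

text \<open>One power serves the whole half-line: for \<open>t \<le> 1\<close> it is at least 1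
  while \<open>y\<close> is bounded, and for \<open>t \<ge> 1\<close> it is the decay that follows
  from the boundedness of \<open>bes_u\<close>.\<close>

lemma norm_bes_y_le:
  obtains K where "\<And>t. t > 0 \<Longrightarrow> cmod (bes_y \<nu> t) \<le> K * t powr (1 / 2 - 1)"
proof -
  obtain B where B: "\<And>t. t \<ge> 1 \<Longrightarrow> cmod (bes_u \<nu> t) \<le> B"
    using bes_u_bounded by blast
  obtain K where K: "\<And>t. 0 < t \<Longrightarrow> t \<le> 1 \<Longrightarrow> cmod (bes_y \<nu> t) \<le> K"
    using norm_bes_y_near_0 by blast
  have K0: "K \<ge> 0" using K[of 1] norm_ge_zero[of "bes_y \<nu> 1"] by linarith
  show thesis
  proof
    fix t :: real assume t: "t > 0"
    show "cmod (bes_y \<nu> t) \<le> max K B * t powr (1 / 2 - 1)"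
    proof (cases "t \<le> 1")
      case True
      have "1 \<le> t powr (1 / 2 - 1)"
        using t True powr_mono2'[of "1 / 2 - 1" t 1] by simp
      then have "max K B * 1 \<le> max K B * t powr (1 / 2 - 1)"
        using K0 by (intro mult_left_mono) auto
      then show ?thesis using K[OF t True] by simp
    next
      case False
      have "cmod (bes_y \<nu> t) * sqrt t = cmod (bes_u \<nu> t)"
        using t by (simp add: bes_u_def norm_mult)
      then have "cmod (bes_y \<nu> t) * sqrt t \<le> max K B"
        using B[of t] False by simp
      moreover have "t powr (1 / 2 - 1) = 1 / sqrt t"
        using t by (simp add: powr_half_sqrt[symmetric] powr_minus_divide[symmetric])
      ultimately show ?thesis
        using t by (simp only:) (simp add: pos_le_divide_eq)
    qed
  qed
qed

lemma bes_y_laplace_ok: "laplace_ok (bes_y \<nu>)"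
proof -
  obtain K where "\<And>t. t > 0 \<Longrightarrow> cmod (bes_y \<nu> t) \<le> K * t powr (1 / 2 - 1)"
    using norm_bes_y_le[of \<nu>] by blast
  then show ?thesis by (intro laplace_ok_powr[OF bes_y_measurable, of "1 / 2"]) auto
qed

text \<open>Coefficients of the Laplace transform of \<open>J_\<mu>\<close> in powers of
  \<open>1 / p^2\<close>, once the factor \<open>(2 p)^(- \<mu>) / p\<close> is taken out. Each one
  comes from integrating a single term of the Bessel series.\<close>

definition lap_coeff :: "complex \<Rightarrow> nat \<Rightarrow> complex" where
  "lap_coeff \<mu> k = bes_coeff \<mu> k * Gamma (\<mu> + of_nat (2 * k) + 1) / 4 ^ k"

lemma lap_coeff_0: "Re \<mu> \<ge> 0 \<Longrightarrow> lap_coeff \<mu> 0 = 1"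
proof -
  assume "Re \<mu> \<ge> 0"
  then have "\<mu> + 1 \<notin> \<int>\<^sub>\<le>\<^sub>0" by (auto simp: nonpos_Ints_def complex_eq_iff)
  then have "Gamma (\<mu> + 1) \<noteq> 0" by (simp add: Gamma_eq_zero_iff)
  then show ?thesis by (simp add: lap_coeff_def bes_coeff_def rGamma_inverse_Gamma)
qed

lemma lap_coeff_Suc:
  assumes "Re \<mu> \<ge> 0"
  shows "4 * of_nat (Suc k) * (of_nat (Suc k) + \<mu>) * lap_coeff \<mu> (Suc k) =
    - ((of_nat (2 * k) + 2 + \<mu>) * (of_nat (2 * k) + 1 + \<mu>) * lap_coeff \<mu> k)"
proof -
  define w where "w = \<mu> + of_nat (2 * k) + 1"
  have "w \<notin> \<int>\<^sub>\<le>\<^sub>0" "w + 1 \<notin> \<int>\<^sub>\<le>\<^sub>0"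
    using assms by (auto simp: nonpos_Ints_def complex_eq_iff w_def)
  then have G: "Gamma (w + 1 + 1) = (w + 1) * (w * Gamma w)"
    using Gamma_plus1[of w] Gamma_plus1[of "w + 1"] by metis
  have "\<mu> + of_nat (2 * Suc k) + 1 = w + 1 + 1" by (simp add: w_def)
  then have "4 * of_nat (Suc k) * (of_nat (Suc k) + \<mu>) * lap_coeff \<mu> (Suc k) =
     (of_nat (Suc k) * (of_nat (Suc k) + \<mu>) * bes_coeff \<mu> (Suc k)) * Gamma (w + 1 + 1) / 4 ^ k"
    by (simp add: lap_coeff_def del: of_nat_Suc)
  also have "\<dots> = - ((w + 1) * w * (bes_coeff \<mu> k * Gamma w / 4 ^ k))"
    unfolding bes_coeff_Suc G by simp
  finally show ?thesis by (simp add: w_def lap_coeff_def add_ac)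
qed

text \<open>The closed form \<open>h\<close> is treated together with its numerator
  \<open>e\<close>, where \<open>h = e / sqrt (1 + z)\<close>. The pair satisfies the linear
  first-order system \<open>E1\<close>, \<open>E2\<close>; comparing coefficients and eliminating
  those of \<open>e\<close> gives for \<open>h\<close> the recurrence
  \<open>lap_coeff_Suc\<close>.\<close>

lemma lap_coeff_sums:
  fixes \<mu> z :: complex
  assumes mu: "Re \<mu> \<ge> 0" and z: "norm z < 1"
  shows "(\<lambda>k. lap_coeff \<mu> k * z ^ k) sums (exp (- (\<mu> * Ln ((1 + csqrt (1 + z)) / 2))) / csqrt (1 + z))"
proof -
  define u where "u z = csqrt (1 + z)" for z
  define e where "e z = exp (- (\<mu> * Ln ((1 + u z) / 2)))" for z
  define h where "h z = e z / u z" for z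
  have u: "1 + z \<notin> \<real>\<^sub>\<le>\<^sub>0" "u z \<noteq> 0" "Re (u z) > 0" "(1 + u z) / 2 \<notin> \<real>\<^sub>\<le>\<^sub>0" "(u z)\<^sup>2 = 1 + z" "1 + u z \<noteq> 0"
    if "z \<in> ball 0 1" for z
  proof -
    have re: "Re (1 + z) > 0" using that complex_Re_le_cmod[of "- z"] by simp
    then show nr: "1 + z \<notin> \<real>\<^sub>\<le>\<^sub>0" by (auto simp: complex_nonpos_Reals_iff)
    show sq: "(u z)\<^sup>2 = 1 + z" by (simp add: u_def)
    show n0: "u z \<noteq> 0" using nr by (auto simp: u_def)
    have "Re (u z) \<noteq> 0"
    proof
      assume "Re (u z) = 0"
      then have "Re ((u z)\<^sup>2) \<le> 0" by (simp add: power2_eq_square)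
      with re sq show False by simp
    qed
    then show pos: "Re (u z) > 0" using Re_csqrt[of "1 + z"] by (simp add: u_def)
    then show "(1 + u z) / 2 \<notin> \<real>\<^sub>\<le>\<^sub>0" "1 + u z \<noteq> 0"
      by (auto simp: complex_nonpos_Reals_iff complex_eq_iff)
  qed
  have du: "(u has_field_derivative (1 / (2 * u z))) (at z)" if "z \<in> ball 0 1" for z
    unfolding u_def using u(1)[OF that] by (auto intro!: derivative_eq_intros)
  have de: "(e has_field_derivative (- (\<mu> * e z / (2 * u z * (1 + u z))))) (at z)" if "z \<in> ball 0 1" for z
  proof -
    have "((\<lambda>z. (1 + u z) / 2) has_field_derivative 1 / (4 * u z)) (at z)"
      using DERIV_cdivide[OF DERIV_add[OF DERIV_const du[OF that]], of 1 2] by simp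
    from DERIV_chain2[OF has_field_derivative_Ln[OF u(4)[OF that]] this]
    moreover have "inverse (a / 2) * (1 / (4 * b)) = 1 / (2 * b * a)" if "a \<noteq> 0" "b \<noteq> 0" for a b :: complex
      using that by (simp add: field_simps)
    ultimately have "((\<lambda>z. Ln ((1 + u z) / 2)) has_field_derivative 1 / (2 * u z * (1 + u z))) (at z)"
      using u(2,6)[OF that] by (simp add: mult.assoc)
    from DERIV_chain2[OF DERIV_exp DERIV_minus[OF DERIV_cmult[OF this, of \<mu>]]]
    show ?thesis unfolding e_def[abs_def] by (simp add: mult_ac)
  qed
  have dh: "(h has_field_derivative (- (\<mu> * e z / (2 * u z * (1 + u z))) / u z - e z / (2 * u z ^ 3))) (at z)"
    if "z \<in> ball 0 1" for z
  proof -
    have eq: "(D * w - v * (1 / (2 * w))) / (w * w) = D / w - v / (2 * w ^ 3)" if "w \<noteq> 0" for D v w :: complex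
      using that by (simp add: field_simps power3_eq_cube)
    show ?thesis
      unfolding h_def[abs_def] eq[OF u(2)[OF that], symmetric]
      by (rule DERIV_divide[OF de[OF that] du[OF that] u(2)[OF that]])
  qed
  \<comment> \<open>The factorisation \<open>z = (u - 1) (1 + u)\<close> removes the denominator
    \<open>1 + u\<close> from the derivative of \<open>e\<close>.\<close>
  have E1: "z * deriv e z = - (\<mu> / 2) * (e z - h z)" if "z \<in> ball 0 1" for z
  proof -
    have "z = (u z - 1) * (1 + u z)" using u(5)[OF that] by (simp add: power2_eq_square algebra_simps)
    then have "z * deriv e z = (u z - 1) * (1 + u z) * (- (\<mu> * e z / (2 * u z * (1 + u z))))"
      using DERIV_imp_deriv[OF de[OF that]] by metis
    also have "\<dots> = - (\<mu> / 2) * (e z - h z)"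
    proof -
      have "(w - 1) * c * (- (\<mu> * v / (2 * w * c))) = - (\<mu> / 2) * (v - v / w)" if "w \<noteq> 0" "c \<noteq> 0" for w c v :: complex
        using that by (simp add: field_simps)
      then show ?thesis using u(2,6)[OF that] by (simp add: h_def)
    qed
    finally show ?thesis .
  qed
  have E2: "z * ((1 + z) * deriv h z) = - (\<mu> / 2) * ((1 + z) * h z - e z) - 1 / 2 * (z * h z)" if "z \<in> ball 0 1" for z
  proof -
    have "(1 + z) * deriv h z = u z * deriv e z - h z / 2"
      unfolding DERIV_imp_deriv[OF dh[OF that]] DERIV_imp_deriv[OF de[OF that]] u(5)[OF that, symmetric] h_def
    proof -
      have "w\<^sup>2 * (d / w - v / (2 * w ^ 3)) = w * d - v / w / 2" if "w \<noteq> 0" for w d v :: complex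
        using that by (simp add: field_simps power2_eq_square power3_eq_cube)
      then show "(u z)\<^sup>2 * (- (\<mu> * e z / (2 * u z * (1 + u z))) / u z - e z / (2 * u z ^ 3)) =
          u z * (- (\<mu> * e z / (2 * u z * (1 + u z)))) - e z / u z / 2"
        using u(2)[OF that] by blast
    qed
    then have "z * ((1 + z) * deriv h z) = u z * (z * deriv e z) - z * h z / 2"
      by (simp only:) (simp add: algebra_simps)
    also have "\<dots> = - (\<mu> / 2) * (u z * e z - u z * h z) - z * h z / 2"
      unfolding E1[OF that] by (simp add: field_simps)
    also have "u z * e z = (1 + z) * h z"
      unfolding u(5)[OF that, symmetric] using u(2)[OF that] by (simp add: h_def power2_eq_square)
    also have "u z * h z = e z"
      using u[OF that] by (simp add: h_def)
    finally show ?thesis by simp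
  qed
  have hol: "e holomorphic_on ball 0 1" "h holomorphic_on ball 0 1"
    unfolding holomorphic_on_open[OF open_ball] using de dh by blast+
  define E where "E = fps_expansion e 0"
  define H where "H = fps_expansion h 0"
  have exE: "e has_fps_expansion E" and exH: "h has_fps_expansion H"
    unfolding E_def H_def using hol by (auto intro!: has_fps_expansion_fps_expansion[of "ball 0 1"])
  have nb: "\<forall>\<^sub>F z in nhds 0. z \<in> ball (0::complex) 1"
    by (rule eventually_nhds_in_open) auto
  have F1: "fps_X * fps_deriv E = - fps_const (\<mu> / 2) * (E - H)"
  proof (rule fps_expansion_unique_complex)
    show "(\<lambda>z. z * deriv e z) has_fps_expansion fps_X * fps_deriv E"
      by (intro fps_expansion_intros exE)
    have "(\<lambda>z. - (\<mu> / 2) * (e z - h z)) has_fps_expansion - fps_const (\<mu> / 2) * (E - H)"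
      using fps_expansion_intros exE exH
      by (intro has_fps_expansion_mult has_fps_expansion_minus has_fps_expansion_diff has_fps_expansion_const exE exH)
    then show "(\<lambda>z. z * deriv e z) has_fps_expansion - fps_const (\<mu> / 2) * (E - H)"
      by (subst has_fps_expansion_cong[OF eventually_mono[OF nb E1] refl]) auto
  qed
  have F2: "fps_X * ((1 + fps_X) * fps_deriv H) = - fps_const (\<mu> / 2) * ((1 + fps_X) * H - E) - fps_const (1 / 2) * (fps_X * H)"
  proof (rule fps_expansion_unique_complex)
    show "(\<lambda>z. z * ((1 + z) * deriv h z)) has_fps_expansion fps_X * ((1 + fps_X) * fps_deriv H)"
      by (intro fps_expansion_intros exH)
    have "(\<lambda>z. - (\<mu> / 2) * ((1 + z) * h z - e z) - 1 / 2 * (z * h z)) has_fps_expansion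
       - fps_const (\<mu> / 2) * ((1 + fps_X) * H - E) - fps_const (1 / 2) * (fps_X * H)"
      by (intro has_fps_expansion_mult has_fps_expansion_minus has_fps_expansion_diff has_fps_expansion_const
          has_fps_expansion_add has_fps_expansion_1 has_fps_expansion_fps_X exE exH)
    then show "(\<lambda>z. z * ((1 + z) * deriv h z)) has_fps_expansion
        - fps_const (\<mu> / 2) * ((1 + fps_X) * H - E) - fps_const (1 / 2) * (fps_X * H)"
      by (subst has_fps_expansion_cong[OF eventually_mono[OF nb E2] refl]) auto
  qed
  have c1: "(2 * of_nat (Suc k) + \<mu>) * fps_nth E (Suc k) = \<mu> * fps_nth H (Suc k)" for k
    using arg_cong[OF F1, of "\<lambda>F. fps_nth F (Suc k)"]
    by (simp add: field_simps del: of_nat_Suc)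
  have c2: "(2 * of_nat (Suc k) + \<mu>) * fps_nth H (Suc k) - \<mu> * fps_nth E (Suc k) = - ((of_nat (2 * k) + 1 + \<mu>) * fps_nth H k)" for k
  proof -
    have "fps_nth (fps_X * ((1 + fps_X) * fps_deriv H)) (Suc k) = of_nat (Suc k) * fps_nth H (Suc k) + of_nat k * fps_nth H k"
      by (cases k) (simp_all add: distrib_right del: of_nat_Suc)
    moreover have "fps_nth (- fps_const (\<mu> / 2) * ((1 + fps_X) * H - E) - fps_const (1 / 2) * (fps_X * H)) (Suc k)
      = - (\<mu> / 2) * (fps_nth H (Suc k) + fps_nth H k - fps_nth E (Suc k)) - fps_nth H k / 2"
      by (simp add: distrib_right)
    ultimately have "of_nat (Suc k) * fps_nth H (Suc k) + of_nat k * fps_nth H k = - (\<mu> / 2) * (fps_nth H (Suc k) + fps_nth H k - fps_nth E (Suc k)) - fps_nth H k / 2"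
      using F2 by simp
    then have "2 * (of_nat (Suc k) * fps_nth H (Suc k) + of_nat k * fps_nth H k) = 2 * (- (\<mu> / 2) * (fps_nth H (Suc k) + fps_nth H k - fps_nth E (Suc k)) - fps_nth H k / 2)"
      by (simp only:)
    also have "\<dots> = - \<mu> * (fps_nth H (Suc k) + fps_nth H k - fps_nth E (Suc k)) - fps_nth H k"
      by (simp add: field_simps)
    finally show ?thesis
      by (simp add: algebra_simps)
  qed
  \<comment> \<open>Multiplying \<open>c2\<close> by \<open>2 n + \<mu>\<close> with
    \<open>n = k + 1\<close> and inserting \<open>c1\<close> eliminates the coefficients of
    \<open>e\<close>; the left side arises as
    \<open>(2 n + \<mu>)^2 - \<mu>^2 = 4 n (n + \<mu>)\<close>.\<close>
  have rec: "4 * of_nat (Suc k) * (of_nat (Suc k) + \<mu>) * fps_nth H (Suc k) =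
    - ((of_nat (2 * k) + 2 + \<mu>) * (of_nat (2 * k) + 1 + \<mu>) * fps_nth H k)" for k
  proof -
    define n where "n = complex_of_nat (Suc k)"
    have k: "of_nat (2 * k) + 2 + \<mu> = 2 * n + \<mu>" by (simp add: n_def)
    have "4 * n * (n + \<mu>) * fps_nth H (Suc k) = (2 * n + \<mu>) * ((2 * n + \<mu>) * fps_nth H (Suc k)) - \<mu> * (\<mu> * fps_nth H (Suc k))"
      by (simp add: algebra_simps)
    also have "\<mu> * fps_nth H (Suc k) = (2 * n + \<mu>) * fps_nth E (Suc k)"
      using c1[of k] by (simp add: n_def)
    also have "(2 * n + \<mu>) * ((2 * n + \<mu>) * fps_nth H (Suc k)) - \<mu> * ((2 * n + \<mu>) * fps_nth E (Suc k))
       = (2 * n + \<mu>) * ((2 * n + \<mu>) * fps_nth H (Suc k) - \<mu> * fps_nth E (Suc k))"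
      by (simp add: algebra_simps)
    also have "\<dots> = - ((2 * n + \<mu>) * (of_nat (2 * k) + 1 + \<mu>) * fps_nth H k)"
      using c2[of k] by (simp add: n_def)
    finally show ?thesis unfolding k by (simp add: n_def)
  qed
  have "fps_nth H k = lap_coeff \<mu> k" for k
  proof (induction k)
    case 0
    have "fps_nth H 0 = h 0"
      using has_fps_expansion_imp_0_eq_fps_nth_0[OF exH] by simp
    then show ?case by (simp add: h_def e_def u_def lap_coeff_0[OF mu])
  next
    case (Suc k)
    have "Re (complex_of_nat (Suc k) + \<mu>) > 0" using mu by simp
    then have "complex_of_nat (Suc k) + \<mu> \<noteq> 0" by (metis less_irrefl zero_complex.sel(1))
    then have "4 * complex_of_nat (Suc k) * (of_nat (Suc k) + \<mu>) \<noteq> 0" by (simp del: of_nat_Suc)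
    moreover have "4 * of_nat (Suc k) * (of_nat (Suc k) + \<mu>) * fps_nth H (Suc k) = 4 * of_nat (Suc k) * (of_nat (Suc k) + \<mu>) * lap_coeff \<mu> (Suc k)"
      unfolding rec lap_coeff_Suc[OF mu] Suc ..
    ultimately show ?case by (metis mult_left_cancel)
  qed
  then have "(\<lambda>k. lap_coeff \<mu> k * z ^ k) sums h z"
    using has_fps_expansion_imp_sums_complex[OF exH, of 1 z] hol z by (simp add: one_ereal_def)
  then show ?thesis by (simp add: h_def e_def u_def)
qed

text \<open>The Bessel series is integrated term by term and summed by \<open>lap_coeff_sums\<close>
  at \<open>z = 1 / p^2\<close>. Here \<open>p > 1\<close> serves twice, for the majorant and for
  \<open>|z| < 1\<close>.\<close>

lemma laplace_bes_y_real:
  assumes p: "p > 1"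
  shows "laplace (bes_y \<nu>) (of_real p) =
     exp (- (\<i> * of_real \<nu> * of_real (ln (p + sqrt (1 + p\<^sup>2))))) / of_real (sqrt (1 + p\<^sup>2))"
proof -
  define \<mu> where "\<mu> = \<i> * complex_of_real \<nu>"
  have re: "Re \<mu> \<ge> 0" by (simp add: \<mu>_def)
  define z where "z k = \<mu> + of_nat (2 * k) + 1" for k
  have z: "Re (z k) > 0" for k by (simp add: z_def \<mu>_def)
  define A where "A k = bes_coeff \<mu> k / 4 ^ k * exp (- (\<mu> * of_real (ln 2)))" for k
  define f where "f k t = indicat_real {0<..} t *\<^sub>R (A k * (exp (- (of_real p * of_real t)) * exp ((z k - 1) * of_real (ln t))))"
    for k and t :: real
  have tm: "exp ((z k - 1) * of_real (ln t)) = exp (\<mu> * of_real (ln t)) * of_real (t ^ (2 * k))" if "t > 0" for k t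
  proof -
    have "exp ((z k - 1) * of_real (ln t)) = exp (\<mu> * of_real (ln t)) * exp (of_nat (2 * k) * of_real (ln t))"
      by (simp add: z_def exp_add[symmetric] algebra_simps)
    also have "exp (of_nat (2 * k) * complex_of_real (ln t)) = exp (of_real (ln t)) ^ (2 * k)"
      by (rule exp_of_nat_mult)
    finally show ?thesis using that by (simp add: exp_of_real)
  qed
  have "(\<lambda>k. integral\<^sup>L lborel (f k)) sums integral\<^sup>L lborel (\<lambda>t. indicat_real {0<..} t *\<^sub>R (exp (- (of_real p * of_real t)) * bes_y \<nu> t))"
  proof (rule integral_sums_dominated)
    show "f k \<in> borel_measurable lborel" for k
      unfolding f_def[abs_def] by measurable
    have "set_integrable lborel {0<..} (\<lambda>t. exp (- ((p - 1) * t)) * t powr (1 - 1))"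
      by (rule laplace_Gamma_real) (use p in auto)
    then have "integrable lborel (\<lambda>t. cmod (bes_coeff \<mu> 0) * (indicat_real {0<..} t *\<^sub>R (exp (- ((p - 1) * t)) * t powr (1 - 1))))"
      unfolding set_integrable_def by (intro integrable_mult_right)
    then show "integrable lborel (\<lambda>t. cmod (bes_coeff \<mu> 0) * (indicat_real {0<..} t *\<^sub>R (exp (- ((p - 1) * t)) * t powr (1 - 1))))" .
    fix n :: nat and t :: real
    show "(\<Sum>k<n. norm (f k t)) \<le> cmod (bes_coeff \<mu> 0) * (indicat_real {0<..} t *\<^sub>R (exp (- ((p - 1) * t)) * t powr (1 - 1)))"
    proof (cases "t > 0")
      case True
      \<comment> \<open>The norm of the \<open>k\<close>-th term is at most a constant times
        \<open>exp (- p t)\<close> and the square of \<open>(t/2)^k / k!\<close>. Bounding one of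
        the two factors by the partial sum \<open>S\<close> gives \<open>S^2 \<le> exp t\<close>,
        hence the majorant \<open>exp (- (p - 1) t)\<close>.\<close>
      define S where "S = (\<Sum>k<n. (t / 2) ^ k / fact k)"
      have S: "S \<le> exp (t / 2)"
        unfolding S_def using True by (intro sum_exp_le) simp
      have x: "(t / 2) ^ k / fact k \<le> S" if "k < n" for k
        unfolding S_def using that True by (intro member_le_sum) auto
      have "norm (f k t) \<le> cmod (bes_coeff \<mu> 0) * exp (- (p * t)) * (S * ((t / 2) ^ k / fact k))" if "k < n" for k
      proof -
        have "norm (f k t) = cmod (bes_coeff \<mu> k) * (exp (- (p * t)) * (t ^ (2 * k) / 4 ^ k))"
          using True by (simp add: f_def tm A_def norm_mult norm_divide norm_power norm_exp_eq_Re) (simp add: \<mu>_def)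
        also have "\<dots> \<le> (cmod (bes_coeff \<mu> 0) / fact k ^ 2) * (exp (- (p * t)) * (t ^ (2 * k) / 4 ^ k))"
          using True by (intro mult_right_mono norm_bes_coeff_le[OF re]) auto
        also have "\<dots> = cmod (bes_coeff \<mu> 0) * exp (- (p * t)) * (((t / 2) ^ k / fact k) * ((t / 2) ^ k / fact k))"
        proof -
          have "(4::real) ^ k = 2 ^ k * 2 ^ k" by (simp add: power_mult_distrib[symmetric])
          moreover have "t ^ (2 * k) = t ^ k * t ^ k" by (simp add: mult_2 power_add)
          ultimately show ?thesis by (simp add: power_divide power2_eq_square mult_ac)
        qed
        also have "\<dots> \<le> cmod (bes_coeff \<mu> 0) * exp (- (p * t)) * (S * ((t / 2) ^ k / fact k))"
          using x[OF that] True by (intro mult_left_mono mult_right_mono) auto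
        finally show ?thesis .
      qed
      then have "(\<Sum>k<n. norm (f k t)) \<le> (\<Sum>k<n. cmod (bes_coeff \<mu> 0) * exp (- (p * t)) * (S * ((t / 2) ^ k / fact k)))"
        by (intro sum_mono) auto
      also have "\<dots> = cmod (bes_coeff \<mu> 0) * exp (- (p * t)) * (S * S)"
        by (simp only: sum_distrib_left[symmetric] S_def[symmetric])
      also have "\<dots> \<le> cmod (bes_coeff \<mu> 0) * exp (- (p * t)) * (exp (t / 2) * exp (t / 2))"
        using S True by (intro mult_left_mono mult_mono) (auto simp: S_def intro!: sum_nonneg)
      also have "\<dots> = cmod (bes_coeff \<mu> 0) * exp (- ((p - 1) * t))"
        by (simp add: mult.assoc exp_add[symmetric] algebra_simps)
      finally show ?thesis using True by simp
    qed (simp add: f_def)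
    show "(\<lambda>k. f k t) sums (indicat_real {0<..} t *\<^sub>R (exp (- (of_real p * of_real t)) * bes_y \<nu> t))"
    proof (cases "t > 0")
      case True
      have "(\<lambda>k. bes_coeff \<mu> k * of_real ((t / 2)\<^sup>2) ^ k) sums bes_fun \<mu> (of_real ((t / 2)\<^sup>2))"
        unfolding bes_fun_def by (intro summable_sums summable_bes_coeff re)
      then have "(\<lambda>k. exp (- (of_real p * of_real t)) * exp (\<mu> * of_real (ln (t / 2))) * (bes_coeff \<mu> k * of_real ((t / 2)\<^sup>2) ^ k))
         sums (exp (- (of_real p * of_real t)) * exp (\<mu> * of_real (ln (t / 2))) * bes_fun \<mu> (of_real ((t / 2)\<^sup>2)))"
        by (rule sums_mult)
      moreover have "exp (- (of_real p * of_real t)) * exp (\<mu> * of_real (ln (t / 2))) * bes_fun \<mu> (of_real ((t / 2)\<^sup>2))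
          = exp (- (of_real p * of_real t)) * bes_y \<nu> t"
        using True by (simp add: bes_y_eq \<mu>_def)
      moreover have "exp (- (of_real p * of_real t)) * exp (\<mu> * of_real (ln (t / 2))) * (bes_coeff \<mu> k * of_real ((t / 2)\<^sup>2) ^ k) = f k t" for k
      proof -
        have "exp (\<mu> * of_real (ln (t / 2))) = exp (\<mu> * of_real (ln t)) * exp (- (\<mu> * of_real (ln 2)))"
          using True by (simp add: ln_div exp_add[symmetric] algebra_simps)
        moreover have "complex_of_real ((t / 2)\<^sup>2) ^ k = of_real (t ^ (2 * k)) / 4 ^ k"
          by (simp add: power_divide power_mult)
        ultimately show ?thesis
          using True by (simp add: f_def tm A_def)
      qed
      ultimately have "(\<lambda>k. f k t) sums (exp (- (of_real p * of_real t)) * bes_y \<nu> t)"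
        by (simp only:)
      then show ?thesis using True by simp
    qed (simp add: f_def)
  qed
  moreover have "integral\<^sup>L lborel (f k) = exp (- (\<mu> * of_real (ln (2 * p)))) / of_real p * (lap_coeff \<mu> k * of_real (1 / p\<^sup>2) ^ k)" for k
  proof -
    have "integral\<^sup>L lborel (f k) = integral\<^sup>L lborel (\<lambda>t. A k * (indicat_real {0<..} t *\<^sub>R (exp (- (of_real p * of_real t)) * exp ((z k - 1) * of_real (ln t)))))"
      by (intro Bochner_Integration.integral_cong) (auto simp: f_def)
    also have "\<dots> = A k * laplace (\<lambda>t. exp ((z k - 1) * of_real (ln t))) (of_real p)"
      unfolding laplace_def set_lebesgue_integral_def by (rule integral_mult_right_zero)
    also have "\<dots> = A k * (Gamma (z k) * exp (- (z k * of_real (ln p))))"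
      using laplace_Gamma(2)[OF z, of p k] p by simp
    also have "exp (- (z k * of_real (ln p))) = exp (- (\<mu> * of_real (ln p))) / of_real p * of_real (1 / p\<^sup>2) ^ k"
    proof -
      have "- (z k * of_real (ln p)) = - (\<mu> * of_real (ln p)) + (- of_real (ln p) + of_nat k * of_real (ln (1 / p\<^sup>2)))"
        using p by (simp add: z_def ln_div ln_realpow algebra_simps)
      then have "exp (- (z k * of_real (ln p))) = exp (- (\<mu> * of_real (ln p))) * (exp (- of_real (ln p)) * exp (of_nat k * of_real (ln (1 / p\<^sup>2))))"
        by (simp only: exp_add)
      also have "exp (of_nat k * complex_of_real (ln (1 / p\<^sup>2))) = exp (of_real (ln (1 / p\<^sup>2))) ^ k"
        by (rule exp_of_nat_mult)
      also have "exp (complex_of_real (ln (1 / p\<^sup>2))) = of_real (1 / p\<^sup>2)"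
        using p by (simp add: exp_of_real)
      also have "exp (- complex_of_real (ln p)) = 1 / of_real p"
        using p by (simp add: exp_minus exp_of_real field_simps)
      finally show ?thesis by simp
    qed
    also have "A k * (Gamma (z k) * (exp (- (\<mu> * of_real (ln p))) / of_real p * of_real (1 / p\<^sup>2) ^ k))
      = (exp (- (\<mu> * of_real (ln 2))) * exp (- (\<mu> * of_real (ln p)))) / of_real p * (lap_coeff \<mu> k * of_real (1 / p\<^sup>2) ^ k)"
      by (simp add: A_def lap_coeff_def z_def mult_ac)
    also have "exp (- (\<mu> * of_real (ln 2))) * exp (- (\<mu> * of_real (ln p))) = exp (- (\<mu> * of_real (ln (2 * p))))"
      using p by (simp add: ln_mult exp_add[symmetric] algebra_simps)
    finally show ?thesis .
  qed
  ultimately have "(\<lambda>k. exp (- (\<mu> * of_real (ln (2 * p)))) / of_real p * (lap_coeff \<mu> k * of_real (1 / p\<^sup>2) ^ k)) sums laplace (bes_y \<nu>) (of_real p)"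
    by (simp add: laplace_def set_lebesgue_integral_def)
  moreover have "(\<lambda>k. exp (- (\<mu> * of_real (ln (2 * p)))) / of_real p * (lap_coeff \<mu> k * of_real (1 / p\<^sup>2) ^ k)) sums
      (exp (- (\<mu> * of_real (ln (2 * p)))) / of_real p *
        (exp (- (\<mu> * Ln ((1 + csqrt (1 + of_real (1 / p\<^sup>2))) / 2))) / csqrt (1 + of_real (1 / p\<^sup>2))))"
  proof (intro sums_mult lap_coeff_sums re)
    have "1 < p\<^sup>2" using p by (simp add: one_less_power)
    then show "cmod (complex_of_real (1 / p\<^sup>2)) < 1" using p by (simp add: norm_divide norm_power)
  qed
  ultimately have "laplace (bes_y \<nu>) (of_real p) = exp (- (\<mu> * of_real (ln (2 * p)))) / of_real p *
        (exp (- (\<mu> * Ln ((1 + csqrt (1 + of_real (1 / p\<^sup>2))) / 2))) / csqrt (1 + of_real (1 / p\<^sup>2)))"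
    by (rule sums_unique2)
  also have "csqrt (1 + of_real (1 / p\<^sup>2)) = of_real (sqrt (1 + p\<^sup>2) / p)"
  proof -
    have "1 + complex_of_real (1 / p\<^sup>2) = of_real ((1 + p\<^sup>2) / p\<^sup>2)"
      using p by (simp add: field_simps)
    then show ?thesis
      using p by (simp add: csqrt_of_real_nonneg real_sqrt_divide del: of_real_divide)
  qed
  also have "Ln ((1 + of_real (sqrt (1 + p\<^sup>2) / p)) / 2) = of_real (ln ((p + sqrt (1 + p\<^sup>2)) / (2 * p)))"
  proof -
    have "(1 + complex_of_real (sqrt (1 + p\<^sup>2) / p)) / 2 = of_real ((p + sqrt (1 + p\<^sup>2)) / (2 * p))"
      using p by (simp add: field_simps)
    moreover have "(p + sqrt (1 + p\<^sup>2)) / (2 * p) > 0"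
      using p by (intro divide_pos_pos add_pos_nonneg) auto
    ultimately show ?thesis by (simp only: Ln_of_real)
  qed
  also have "exp (- (\<mu> * of_real (ln (2 * p)))) / of_real p *
        (exp (- (\<mu> * of_real (ln ((p + sqrt (1 + p\<^sup>2)) / (2 * p))))) / of_real (sqrt (1 + p\<^sup>2) / p))
     = exp (- (\<mu> * of_real (ln (2 * p)))) * exp (- (\<mu> * of_real (ln ((p + sqrt (1 + p\<^sup>2)) / (2 * p))))) / of_real (sqrt (1 + p\<^sup>2))"
    using p by simp
  also have "exp (- (\<mu> * of_real (ln (2 * p)))) * exp (- (\<mu> * of_real (ln ((p + sqrt (1 + p\<^sup>2)) / (2 * p)))))
     = exp (- (\<mu> * of_real (ln (p + sqrt (1 + p\<^sup>2)))))"
  proof -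
    have "p + sqrt (1 + p\<^sup>2) > 0" using p by (intro add_pos_nonneg) auto
    then have "ln ((p + sqrt (1 + p\<^sup>2)) / (2 * p)) = ln (p + sqrt (1 + p\<^sup>2)) - ln (2 * p)"
      using p ln_divide_pos[of "p + sqrt (1 + p\<^sup>2)" "2 * p"] by simp
    then show ?thesis
      by (simp only:) (simp add: exp_add[symmetric] algebra_simps)
  qed
  finally show ?thesis by (simp add: \<mu>_def)
qed

text \<open>If \<open>Re p > 0\<close> and \<open>p^2\<close> is real, then \<open>p\<close> is real
  and \<open>1 + p^2 > 0\<close>. So the principal branches in the closed form meet no cut inside
  the half-plane.\<close>

lemma csqrt_right_half_plane:
  assumes "Re p > 0"
  shows "1 + p\<^sup>2 \<notin> \<real>\<^sub>\<le>\<^sub>0" "csqrt (1 + p\<^sup>2) \<noteq> 0" "p + csqrt (1 + p\<^sup>2) \<notin> \<real>\<^sub>\<le>\<^sub>0"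
proof -
  show 1: "1 + p\<^sup>2 \<notin> \<real>\<^sub>\<le>\<^sub>0"
  proof
    assume *: "1 + p\<^sup>2 \<in> \<real>\<^sub>\<le>\<^sub>0"
    then have "Re p * Im p = 0" "1 + (Re p)\<^sup>2 - (Im p)\<^sup>2 \<le> 0"
      by (auto simp: complex_nonpos_Reals_iff power2_eq_square algebra_simps)
    with assms show False by (simp add: power2_eq_square) (smt (verit) zero_le_square)
  qed
  then show "csqrt (1 + p\<^sup>2) \<noteq> 0" by auto
  have "Re (p + csqrt (1 + p\<^sup>2)) > 0"
    using assms csqrt_principal[of "1 + p\<^sup>2"] unfolding plus_complex.sel by linarith
  then show "p + csqrt (1 + p\<^sup>2) \<notin> \<real>\<^sub>\<le>\<^sub>0"
    by (auto simp: complex_nonpos_Reals_iff)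
qed

lemma laplace_bes_y:
  assumes "Re p > 0"
  shows "laplace (bes_y \<nu>) p = exp (- (\<i> * of_real \<nu> * Ln (p + csqrt (1 + p\<^sup>2)))) / csqrt (1 + p\<^sup>2)"
proof (rule laplace_eqI[OF bes_y_laplace_ok _ _ assms])
  show "(\<lambda>p. exp (- (\<i> * of_real \<nu> * Ln (p + csqrt (1 + p\<^sup>2)))) / csqrt (1 + p\<^sup>2)) holomorphic_on {p. 0 < Re p}"
    using csqrt_right_half_plane by (intro holomorphic_intros) auto
  fix p :: real assume p: "p > 1"
  have "csqrt (1 + (of_real p)\<^sup>2) = of_real (sqrt (1 + p\<^sup>2))"
    using csqrt_of_real_nonneg[of "1 + p\<^sup>2"] by simp
  moreover have "Ln (of_real p + of_real (sqrt (1 + p\<^sup>2))) = of_real (ln (p + sqrt (1 + p\<^sup>2)))"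
    using Ln_of_real[of "p + sqrt (1 + p\<^sup>2)"] p by (simp add: add_pos_nonneg)
  ultimately show "laplace (bes_y \<nu>) (of_real p) = exp (- (\<i> * of_real \<nu> * Ln (of_real p + csqrt (1 + (of_real p)\<^sup>2)))) / csqrt (1 + (of_real p)\<^sup>2)"
    using laplace_bes_y_real[OF p] by simp
qed

text \<open>The model singularity: shifted by \<open>\<i>\<close> or \<open>- \<i>\<close>, it is
  the transform of each of the two leading waves.\<close>

lemma laplace_inverse_sqrt:
  assumes "Re p > 0"
  shows "laplace (\<lambda>t. of_real (t powr (1 / 2 - 1))) p = of_real (sqrt pi) / csqrt p"
proof (rule laplace_eqI[OF _ _ _ assms])
  have "set_borel_measurable lborel {0<..} (\<lambda>t. complex_of_real (t powr (1 / 2 - 1)))"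
    unfolding set_borel_measurable_def by measurable
  then show "laplace_ok (\<lambda>t. complex_of_real (t powr (1 / 2 - 1)))"
    by (rule laplace_ok_powr[where z = "1 / 2" and C = 1]) auto
  have "p \<notin> \<real>\<^sub>\<le>\<^sub>0" if "Re p > 0" for p using that by (auto simp: complex_nonpos_Reals_iff)
  then show "(\<lambda>p. of_real (sqrt pi) / csqrt p) holomorphic_on {p. 0 < Re p}"
    by (intro holomorphic_intros) auto
  fix p :: real assume p: "p > 1"
  have "laplace (\<lambda>t. of_real (t powr (1 / 2 - 1))) (of_real p) = of_real (LBINT t:{0<..}. exp (- (p * t)) * t powr (1 / 2 - 1))"
    unfolding laplace_def set_lebesgue_integral_def integral_complex_of_real[symmetric]
    by (intro Bochner_Integration.integral_cong) (auto simp: exp_of_real[symmetric] scaleR_conv_of_real)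
  also have "\<dots> = of_real (Gamma (1 / 2) * p powr (- (1 / 2)))"
    using laplace_Gamma_real(2)[of "1 / 2" p] p by simp
  also have "\<dots> = of_real (sqrt pi) / csqrt (of_real p)"
    using p by (simp add: Gamma_one_half_real powr_minus powr_half_sqrt field_simps)
  finally show "laplace (\<lambda>t. of_real (t powr (1 / 2 - 1))) (of_real p) = of_real (sqrt pi) / csqrt (of_real p)" .
qed

text \<open>At \<open>p = \<i> + e\<close> one has \<open>1 + p^2 = e (2 \<i> + e)\<close>, so
  \<open>sqrt e\<close> cancels the singularity and the rest is continuous at \<open>e = 0\<close>.
  The exponential comes from \<open>Ln \<i> = \<i> \<pi> / 2\<close>, and \<open>1 + \<i>\<close> is
  the principal root of \<open>2 \<i>\<close>.\<close>

lemma laplace_bes_y_near_i: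
  "((\<lambda>e. of_real (sqrt e) * laplace (bes_y \<nu>) (\<i> + of_real e)) \<longlongrightarrow> of_real (exp (pi * \<nu> / 2)) / (1 + \<i>)) (at_right 0)"
proof -
  have cs: "csqrt (2 * \<i>) = 1 + \<i>"
    by (rule csqrt_unique) (auto simp: power2_eq_square algebra_simps)
  have i: "\<i> \<notin> \<real>\<^sub>\<le>\<^sub>0" "2 * \<i> \<notin> \<real>\<^sub>\<le>\<^sub>0" by (auto simp: complex_nonpos_Reals_iff)
  have eq: "of_real (sqrt e) * laplace (bes_y \<nu>) (\<i> + of_real e) =
      exp (- (\<i> * of_real \<nu> * Ln (\<i> + of_real e + of_real (sqrt e) * csqrt (2 * \<i> + of_real e)))) / csqrt (2 * \<i> + of_real e)"
    if e: "e > 0" for e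
  proof -
    have "1 + (\<i> + complex_of_real e)\<^sup>2 = of_real e * (2 * \<i> + of_real e)"
      by (simp add: power2_eq_square algebra_simps)
    moreover have "csqrt (of_real e * (2 * \<i> + of_real e)) = of_real (sqrt e) * csqrt (2 * \<i> + of_real e)"
    proof (rule csqrt_unique)
      show "(of_real (sqrt e) * csqrt (2 * \<i> + of_real e))\<^sup>2 = of_real e * (2 * \<i> + of_real e)"
        using e by (simp add: power_mult_distrib flip: of_real_power)
      have "Re (csqrt (2 * \<i> + of_real e)) > 0"
        using csqrt_principal[of "2 * \<i> + of_real e"] e by (auto simp: complex_eq_iff csqrt.simps)
      then show "0 < Re (of_real (sqrt e) * csqrt (2 * \<i> + of_real e)) \<or>
         Re (of_real (sqrt e) * csqrt (2 * \<i> + of_real e)) = 0 \<and> 0 \<le> Im (of_real (sqrt e) * csqrt (2 * \<i> + of_real e))"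
        using e by simp
    qed
    ultimately show ?thesis
      using laplace_bes_y[of "\<i> + of_real e" \<nu>] e by simp
  qed
  have lim: "((\<lambda>e. exp (- (\<i> * of_real \<nu> * Ln (\<i> + of_real e + of_real (sqrt e) * csqrt (2 * \<i> + of_real e)))) / csqrt (2 * \<i> + of_real e))
      \<longlongrightarrow> exp (- (\<i> * of_real \<nu> * Ln (\<i> + of_real 0 + of_real (sqrt 0) * csqrt (2 * \<i> + of_real 0)))) / csqrt (2 * \<i> + of_real 0)) (at_right 0)"
    using i by (intro tendsto_intros isCont_tendsto_compose[where g = csqrt] isCont_tendsto_compose[where g = Ln] continuous_at_csqrt continuous_at_Ln)
      (auto simp: cs complex_eq_iff)
  have "exp (- (\<i> * of_real \<nu> * Ln (\<i> + of_real 0 + of_real (sqrt 0) * csqrt (2 * \<i> + of_real 0)))) / csqrt (2 * \<i> + of_real 0)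
     = of_real (exp (pi * \<nu> / 2)) / (1 + \<i>)"
  proof -
    have "exp (- (\<i> * of_real \<nu> * Ln (\<i> + of_real 0 + of_real (sqrt 0) * csqrt (2 * \<i> + of_real 0)))) / csqrt (2 * \<i> + of_real 0)
      = exp (- (\<i> * of_real \<nu> * (\<i> * of_real pi / 2))) / (1 + \<i>)"
      by (simp add: cs)
    also have "- (\<i> * complex_of_real \<nu> * (\<i> * of_real pi / 2)) = of_real (pi * \<nu> / 2)"
      by (simp add: field_simps)
    finally show ?thesis by (simp only: exp_of_real)
  qed
  with lim have "((\<lambda>e. exp (- (\<i> * of_real \<nu> * Ln (\<i> + of_real e + of_real (sqrt e) * csqrt (2 * \<i> + of_real e)))) / csqrt (2 * \<i> + of_real e))
      \<longlongrightarrow> of_real (exp (pi * \<nu> / 2)) / (1 + \<i>)) (at_right 0)"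
    by simp
  then show ?thesis
    by (rule Lim_transform_eventually)
       (rule eventually_mono[OF eventually_at_right_less[of 0]], simp add: eq)
qed

text \<open>An Abelian argument: the singularity of the Laplace transform at \<open>p = \<i>\<close> comes from the
  component \<open>a e\<^sup>i\<^sup>t / \<surd>t\<close> alone.\<close>

lemma bes_u_asymp_phase:
  assumes asy: "\<And>t. t \<ge> 1 \<Longrightarrow> cmod (bes_u \<nu> t - (a * cis t + b * cis (- t))) \<le> C / t"
  shows "a = of_real (exp (pi * \<nu> / 2) / sqrt (2 * pi)) * cis (- pi / 4)"
proof -
  obtain K where K: "\<And>t. t > 0 \<Longrightarrow> cmod (bes_y \<nu> t) \<le> K * t powr (1 / 2 - 1)"
    using norm_bes_y_le[of \<nu>] by blast
  define s where "s t = complex_of_real (t powr (1 / 2 - 1))" for t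
  define h where "h t = bes_y \<nu> t - (a * (cis t * s t) + b * (cis (- t) * s t))" for t
  define D where "D = max C (K + cmod a + cmod b)"
  have C0: "C \<ge> 0" using asy[of 1] by (smt (verit) div_by_1 norm_ge_zero)
  \<comment> \<open>A single power has to dominate \<open>t^(-1/2)\<close> for \<open>t < 1\<close>
    and \<open>t^(-3/2)\<close> beyond. The choice \<open>t^(z - 1)\<close> with
    \<open>z = 1/4\<close> does so, and because \<open>z < 1/2\<close> the transform of
    \<open>h\<close> is \<open>o(e^(-1/2))\<close> at \<open>\<i> + e\<close>.\<close>
  have hb: "cmod (h t) \<le> D * t powr (1 / 4 - 1)" if t: "t > 0" for t
  proof (cases "t \<ge> 1")
    case True
    have "complex_of_real (sqrt t) * s t = 1"
    proof -
      have "sqrt t * t powr (1 / 2 - 1) = 1"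
        using t by (simp add: powr_half_sqrt[symmetric] powr_add[symmetric])
      then show ?thesis unfolding s_def by (metis of_real_1 of_real_mult)
    qed
    then have "of_real (sqrt t) * h t = bes_u \<nu> t - (a * cis t + b * cis (- t))"
      by (simp add: h_def bes_u_def algebra_simps)
    then have "sqrt t * cmod (h t) \<le> C / t"
      using asy[OF True] t by (metis abs_of_nonneg norm_mult norm_of_real real_sqrt_ge_zero less_imp_le)
    then have "cmod (h t) \<le> C / t / sqrt t"
      using t by (simp add: field_simps)
    also have "C / t / sqrt t = C * t powr (- (3 / 2))"
    proof -
      have "- (3 / 2) = (- 1) + (- (1 / 2) :: real)" by simp
      then have "t powr (- (3 / 2)) = t powr (- 1) * t powr (- (1 / 2))"
        by (simp only: powr_add)
      also have "\<dots> = 1 / t / sqrt t"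
        using t by (simp add: powr_minus powr_half_sqrt field_simps)
      finally show ?thesis by simp
    qed
    also have "\<dots> \<le> C * t powr (1 / 4 - 1)"
      using True C0 by (intro mult_left_mono powr_mono) auto
    also have "\<dots> \<le> D * t powr (1 / 4 - 1)"
      by (intro mult_right_mono) (auto simp: D_def)
    finally show ?thesis .
  next
    case False
    have "cmod (h t) \<le> cmod (bes_y \<nu> t) + (cmod (a * (cis t * s t)) + cmod (b * (cis (- t) * s t)))"
      unfolding h_def by (intro order_trans[OF norm_triangle_ineq4] add_left_mono norm_triangle_ineq)
    also have "\<dots> \<le> K * t powr (1 / 2 - 1) + (cmod a * t powr (1 / 2 - 1) + cmod b * t powr (1 / 2 - 1))"
      using K[OF t] by (simp add: norm_mult s_def)
    also have "\<dots> = (K + cmod a + cmod b) * t powr (1 / 2 - 1)"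
      by (simp add: algebra_simps)
    also have "\<dots> \<le> D * t powr (1 / 2 - 1)"
      by (intro mult_right_mono) (auto simp: D_def)
    also have "\<dots> \<le> D * t powr (1 / 4 - 1)"
    proof -
      have "D \<ge> 0" using C0 by (simp add: D_def)
      moreover have "t powr (1 / 2 - 1) \<le> t powr (1 / 4 - 1)"
        using t False by (intro powr_mono') auto
      ultimately show ?thesis by (rule mult_left_mono[rotated])
    qed
    finally show ?thesis .
  qed
  have sm: "set_borel_measurable lborel {0<..} (\<lambda>t. c * (cis (k * t) * s t))" for c :: complex and k :: real
  proof -
    have "continuous_on UNIV (\<lambda>t. cis (k * t))" by (intro continuous_intros)
    then have [measurable]: "(\<lambda>t. cis (k * t)) \<in> borel_measurable borel"
      by (rule borel_measurable_continuous_onI)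
    show ?thesis unfolding set_borel_measurable_def s_def by measurable
  qed
  have hm: "set_borel_measurable lborel {0<..} h"
  proof -
    have [measurable]: "(\<lambda>t. indicat_real {0<..} t *\<^sub>R bes_y \<nu> t) \<in> borel_measurable borel"
       "(\<lambda>t. indicat_real {0<..} t *\<^sub>R (a * (cis (1 * t) * s t))) \<in> borel_measurable borel"
       "(\<lambda>t. indicat_real {0<..} t *\<^sub>R (b * (cis ((-1) * t) * s t))) \<in> borel_measurable borel"
      using bes_y_measurable sm[of a 1] sm[of b "-1"] by (simp_all add: set_borel_measurable_def)
    have "(\<lambda>t. indicat_real {0<..} t *\<^sub>R bes_y \<nu> t - (indicat_real {0<..} t *\<^sub>R (a * (cis (1 * t) * s t))
        + indicat_real {0<..} t *\<^sub>R (b * (cis ((-1) * t) * s t)))) \<in> borel_measurable lborel"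
      by measurable
    then show ?thesis
      by (simp add: set_borel_measurable_def h_def scaleR_diff_right scaleR_add_right)
  qed
  have okh: "laplace_ok h" by (rule laplace_ok_powr[OF hm _ hb]) auto
  have oks: "laplace_ok (\<lambda>t. cis (k * t) * s t)" for k
    using laplace_ok_powr[OF sm[of 1 k], of "1 / 2" 1] by (simp add: norm_mult s_def)
  have lap_cis: "laplace (\<lambda>t. cis (k * t) * s t) p = laplace s (p - \<i> * of_real k)" for k p
    unfolding laplace_def
  proof (intro set_lebesgue_integral_cong allI impI)
    fix t :: real
    have "exp (- (p * of_real t)) * cis (k * t) = exp (- ((p - \<i> * of_real k) * of_real t))"
      by (simp add: cis_conv_exp exp_add[symmetric] algebra_simps)
    then show "exp (- (p * of_real t)) * (cis (k * t) * s t) = exp (- ((p - \<i> * of_real k) * of_real t)) * s t"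
      by (metis mult.assoc)
  qed auto
  \<comment> \<open>A factor \<open>cis (k t)\<close> shifts the transform by \<open>\<i> k\<close>.
    The first wave is thus evaluated at \<open>e\<close>, where it is singular, and the second at
    \<open>2 \<i> + e\<close>, where it stays bounded.\<close>
  have split: "laplace (bes_y \<nu>) (\<i> + of_real e) =
      a * (of_real (sqrt pi) / csqrt (of_real e)) + b * (of_real (sqrt pi) / csqrt (2 * \<i> + of_real e)) + laplace h (\<i> + of_real e)"
    if e: "e > 0" for e
  proof -
    define p where "p = \<i> + complex_of_real e"
    have p: "Re p > 0" using e by (simp add: p_def)
    have int: "set_integrable lborel {0<..} (\<lambda>t. exp (- (p * of_real t)) * h t)"
        "set_integrable lborel {0<..} (\<lambda>t. a * (exp (- (p * of_real t)) * (cis (1 * t) * s t)))"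
        "set_integrable lborel {0<..} (\<lambda>t. b * (exp (- (p * of_real t)) * (cis ((-1) * t) * s t)))"
      using laplace_ok_integrable[OF okh p] laplace_ok_integrable[OF oks p, of 1] laplace_ok_integrable[OF oks p, of "-1"]
      by (auto intro!: set_integrable_mult_right)
    have "laplace (bes_y \<nu>) p = (LBINT t:{0<..}. (a * (exp (- (p * of_real t)) * (cis (1 * t) * s t))
        + b * (exp (- (p * of_real t)) * (cis ((-1) * t) * s t))) + exp (- (p * of_real t)) * h t)"
      unfolding laplace_def by (intro set_lebesgue_integral_cong) (auto simp: h_def algebra_simps)
    also have "\<dots> = a * laplace (\<lambda>t. cis (1 * t) * s t) p + b * laplace (\<lambda>t. cis ((-1) * t) * s t) p + laplace h p"
      using int by (simp only: set_integral_add set_integral_mult_right laplace_def)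
    also have "\<dots> = a * laplace s (of_real e) + b * laplace s (2 * \<i> + of_real e) + laplace h p"
      unfolding lap_cis by (simp add: p_def algebra_simps)
    finally show ?thesis
      using laplace_inverse_sqrt[of "of_real e"] laplace_inverse_sqrt[of "2 * \<i> + of_real e"] e
      by (simp add: s_def[abs_def] p_def)
  qed
  have "((\<lambda>e. of_real (sqrt e) * laplace (bes_y \<nu>) (\<i> + of_real e)) \<longlongrightarrow> a * of_real (sqrt pi)) (at_right 0)"
  proof -
    have cs: "csqrt (2 * \<i>) = 1 + \<i>"
      by (rule csqrt_unique) (auto simp: power2_eq_square algebra_simps)
    have i: "2 * \<i> \<notin> \<real>\<^sub>\<le>\<^sub>0" by (auto simp: complex_nonpos_Reals_iff)
    have l2: "((\<lambda>e. of_real (sqrt e) * (b * (of_real (sqrt pi) / csqrt (2 * \<i> + of_real e)))) \<longlongrightarrow>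
         of_real (sqrt 0) * (b * (of_real (sqrt pi) / csqrt (2 * \<i> + of_real 0)))) (at_right 0)"
      using i by (intro tendsto_intros isCont_tendsto_compose[where g = csqrt] continuous_at_csqrt) (auto simp: cs complex_eq_iff)
    have l3: "((\<lambda>e. of_real (sqrt e) * laplace h (\<i> + of_real e)) \<longlongrightarrow> 0) (at_right 0)"
    proof (rule Lim_null_comparison)
      have "((\<lambda>e. D * Gamma (1 / 4) * e powr (1 / 4)) \<longlongrightarrow> D * Gamma (1 / 4) * 0 powr (1 / 4)) (at_right (0::real))"
        by (intro tendsto_intros tendsto_powr') (auto simp: eventually_at_right_less intro: eventually_mono[OF eventually_at_right_less[of 0]])
      then show "((\<lambda>e. D * Gamma (1 / 4) * e powr (1 / 4)) \<longlongrightarrow> 0) (at_right (0::real))" by simp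
      show "\<forall>\<^sub>F e in at_right 0. norm (of_real (sqrt e) * laplace h (\<i> + of_real e)) \<le> D * Gamma (1 / 4) * e powr (1 / 4)"
      proof (rule eventually_mono[OF eventually_at_right_less[of 0]])
        fix e :: real assume e: "e > 0"
        have "norm (of_real (sqrt e) * laplace h (\<i> + of_real e)) = sqrt e * norm (laplace h (\<i> + of_real e))"
          using e by (simp add: norm_mult)
        also have "\<dots> \<le> sqrt e * (D * (Gamma (1 / 4) * e powr (- (1 / 4))))"
          using norm_laplace_le[OF hm _ hb, of "\<i> + of_real e"] e by (intro mult_left_mono) auto
        also have "\<dots> = D * Gamma (1 / 4) * (e powr (1 / 2) * e powr (- (1 / 4)))"
          using e by (simp add: powr_half_sqrt)
        also have "e powr (1 / 2) * e powr (- (1 / 4)) = e powr (1 / 4)"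
          by (simp add: powr_add[symmetric])
        finally show "norm (of_real (sqrt e) * laplace h (\<i> + of_real e)) \<le> D * Gamma (1 / 4) * e powr (1 / 4)" .
      qed
    qed
    have "((\<lambda>e. a * of_real (sqrt pi) + of_real (sqrt e) * (b * (of_real (sqrt pi) / csqrt (2 * \<i> + of_real e)))
        + of_real (sqrt e) * laplace h (\<i> + of_real e)) \<longlongrightarrow>
         a * of_real (sqrt pi) + of_real (sqrt 0) * (b * (of_real (sqrt pi) / csqrt (2 * \<i> + of_real 0))) + 0) (at_right 0)"
      by (intro tendsto_add tendsto_const l2 l3)
    then have "((\<lambda>e. a * of_real (sqrt pi) + of_real (sqrt e) * (b * (of_real (sqrt pi) / csqrt (2 * \<i> + of_real e)))
        + of_real (sqrt e) * laplace h (\<i> + of_real e)) \<longlongrightarrow> a * of_real (sqrt pi)) (at_right 0)"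
      by simp
    then show ?thesis
    proof (rule Lim_transform_eventually, intro eventually_mono[OF eventually_at_right_less[of 0]])
      fix e :: real assume e: "e > 0"
      have "csqrt (of_real e) = of_real (sqrt e)" using e by simp
      then show "a * of_real (sqrt pi) + of_real (sqrt e) * (b * (of_real (sqrt pi) / csqrt (2 * \<i> + of_real e)))
        + of_real (sqrt e) * laplace h (\<i> + of_real e) = of_real (sqrt e) * laplace (bes_y \<nu>) (\<i> + of_real e)"
        unfolding split[OF e] using e by (simp add: distrib_left)
    qed
  qed
  then have "a * of_real (sqrt pi) = of_real (exp (pi * \<nu> / 2)) / (1 + \<i>)"
    by (rule tendsto_unique[OF trivial_limit_at_right_real _ laplace_bes_y_near_i])
  moreover have "1 / (1 + \<i>) = of_real (1 / sqrt 2) * cis (- pi / 4)"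
    by (simp add: complex_eq_iff cos_45 sin_45 field_simps Re_divide Im_divide)
  ultimately have "a * of_real (sqrt pi) = of_real (exp (pi * \<nu> / 2) / sqrt 2) * cis (- pi / 4)"
    by (metis mult.assoc of_real_mult of_real_divide times_divide_eq_right mult.right_neutral of_real_1)
  then have "a = of_real (exp (pi * \<nu> / 2) / sqrt 2) * cis (- pi / 4) / of_real (sqrt pi)"
    by (simp add: field_simps)
  then show ?thesis by (simp add: real_sqrt_mult)
qed

subsection \<open>Uniform WKB approximation\<close>

text \<open>The weighted square \<open>|f|^2 exp (- 2 K g)\<close> is nonincreasing. As
  \<open>K\<close> times the increase of \<open>g\<close> is at most 1, the norm of \<open>f\<close>
  grows at most by the factor 3, because \<open>exp 2 \<le> 9\<close>. Integrating the bound on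
  \<open>f'\<close> then controls the difference.\<close>

lemma gronwall_forward:
  fixes f :: "real \<Rightarrow> 'a :: real_inner"
  assumes d: "\<And>x. x > 0 \<Longrightarrow> (f has_vector_derivative f' x) (at x)"
    and g: "\<And>x. x > 0 \<Longrightarrow> (g has_real_derivative g' x) (at x)"
    and b: "\<And>x. x > 0 \<Longrightarrow> norm (f' x) \<le> K * g' x * norm (f x)"
    and g': "\<And>x. x > 0 \<Longrightarrow> g' x \<ge> 0" and K: "0 \<le> K" "K \<le> 1"
    and g1: "\<And>x y. 0 < x \<Longrightarrow> x < y \<Longrightarrow> g y - g x \<le> 1"
    and xy: "0 < x" "x \<le> y"
  shows "norm (f y - f x) \<le> 3 * K * norm (f x)"
proof (cases "x = y")
  case False
  then have less: "x < y" using xy by simp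
  have bound: "norm (f z) \<le> 3 * norm (f x)" if z: "x \<le> z" "z \<le> y" for z
  proof -
    define h where "h x = (f x \<bullet> f x) * exp (- 2 * K * g x)" for x
    have dh: "(h has_real_derivative (2 * (f x \<bullet> f' x) - 2 * K * g' x * (f x \<bullet> f x)) * exp (- 2 * K * g x)) (at x)"
      if x: "x > 0" for x
    proof -
      have "((\<lambda>x. f x \<bullet> f x) has_derivative (\<lambda>t. f x \<bullet> (t *\<^sub>R f' x) + (t *\<^sub>R f' x) \<bullet> f x)) (at x)"
        using d[OF x] unfolding has_vector_derivative_def by (intro has_derivative_inner)
      then have "((\<lambda>x. f x \<bullet> f x) has_real_derivative (2 * (f x \<bullet> f' x))) (at x)"
        unfolding has_field_derivative_def
        by (rule has_derivative_eq_rhs) (auto simp: inner_commute algebra_simps)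
      from DERIV_mult[OF this DERIV_fun_exp[OF DERIV_cmult[OF g[OF x], of "- 2 * K"]]]
      show ?thesis unfolding h_def[abs_def] by (simp add: algebra_simps)
    qed
    have "h z \<le> h x"
    proof (rule DERIV_nonpos_imp_nonincreasing[OF z(1)])
      fix t assume "x \<le> t" "t \<le> z"
      then have t: "t > 0" using xy by simp
      have "f t \<bullet> f' t \<le> norm (f t) * norm (f' t)"
        by (rule norm_cauchy_schwarz)
      also have "\<dots> \<le> norm (f t) * (K * g' t * norm (f t))"
        by (intro mult_left_mono b t) auto
      finally have "2 * (f t \<bullet> f' t) - 2 * K * g' t * (f t \<bullet> f t) \<le> 0"
        by (simp add: dot_square_norm power2_eq_square mult_ac)
      then show "\<exists>y. (h has_real_derivative y) (at t) \<and> y \<le> 0"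
        using dh[OF t] by (intro exI conjI) (auto simp: mult_nonpos_nonneg)
    qed
    then have "(norm (f z))\<^sup>2 \<le> (norm (f x))\<^sup>2 * exp (2 * K * (g z - g x))"
      by (simp add: h_def dot_square_norm exp_minus exp_diff algebra_simps field_simps)
    also have "\<dots> \<le> (norm (f x))\<^sup>2 * exp 2"
    proof -
      have "g z - g x \<le> 1" using g1[of x z] z xy by (cases "x = z") auto
      have "K * (g z - g x) \<le> 1"
      proof (cases "g z - g x \<ge> 0")
        case True
        then have "K * (g z - g x) \<le> 1 * 1"
          using K \<open>g z - g x \<le> 1\<close> by (intro mult_mono) auto
        then show ?thesis by simp
      next
        case False
        then have "K * (g z - g x) \<le> 0" using K by (simp add: mult_nonneg_nonpos)
        then show ?thesis by simp
      qed
      then show ?thesis by (intro mult_left_mono) auto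
    qed
    also have "exp 2 \<le> (9 :: real)"
    proof -
      have "exp (1::real) \<le> 3" by (rule exp_le)
      then have "exp (1::real) ^ 2 \<le> 3 ^ 2" by (intro power_mono) auto
      then show ?thesis by (simp add: exp_double[symmetric] flip: exp_of_nat_mult)
    qed
    finally have "(norm (f z))\<^sup>2 \<le> (3 * norm (f x))\<^sup>2"
      by (simp add: power_mult_distrib mult_left_mono)
    then show ?thesis by (rule power2_le_imp_le) simp
  qed
  have cont: "continuous_on {x..y} f" "continuous_on {x..y} g"
    using has_vector_derivative_continuous[OF d] DERIV_isCont[OF g] xy
    by (auto intro!: continuous_at_imp_continuous_on)
  have "norm (f y - f x) \<le> 3 * K * norm (f x) * g y - 3 * K * norm (f x) * g x"
  proof (rule differentiable_bound_general[OF less, where f' = f' and \<phi>' = "\<lambda>z. 3 * K * norm (f x) * g' z"])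
    fix z assume z: "x < z" "z < y"
    then have z0: "z > 0" using xy by simp
    show "((\<lambda>z. 3 * K * norm (f x) * g z) has_vector_derivative 3 * K * norm (f x) * g' z) (at z)"
      using DERIV_cmult[OF g[OF z0], of "3 * K * norm (f x)"] by (simp add: has_real_derivative_iff_has_vector_derivative)
    have "norm (f' z) \<le> K * g' z * norm (f z)" by (rule b[OF z0])
    also have "\<dots> \<le> K * g' z * (3 * norm (f x))"
      using K g'[OF z0] z by (intro mult_left_mono bound) auto
    finally show "norm (f' z) \<le> 3 * K * norm (f x) * g' z" by (simp add: mult_ac)
    show "(f has_vector_derivative f' z) (at z)" by (rule d[OF z0])
  qed (use cont in \<open>auto intro!: continuous_intros\<close>)
  also have "\<dots> = 3 * K * norm (f x) * (g y - g x)" by (simp add: algebra_simps)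
  also have "\<dots> \<le> 3 * K * norm (f x) * 1"
    using K g1[of x y] xy less by (intro mult_left_mono) auto
  finally show ?thesis by simp
qed (use K in simp)

text \<open>With \<open>\<beta> = bet x\<close> and \<open>\<xi> = \<rho>(x)\<close> one has
  \<open>d\<beta>/d\<xi> = - \<i> T(\<beta>)\<close>; this weight governs the recursion for the
  \<open>E_s\<close>.\<close>

definition T_poly :: "complex poly" where
  "T_poly = [:0, 0, 1:] * [:1, 0, 1:]"

text \<open>Differentiation removes the antiderivative, and one formula then covers all
  \<open>s \<ge> 1\<close>: the explicit \<open>E_2\<close> equals \<open>T E_1' / 2\<close>, and
  \<open>E_0 = 0\<close> makes the end terms of the sum vanish.\<close>

lemma pderiv_E_poly_Suc:
  assumes "s \<ge> 1"
  shows "pderiv (E_poly (Suc s)) = smult (1 / 2) (pderiv (T_poly * pderiv (E_poly s)))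
     + smult (1 / 2) (T_poly * (\<Sum>j\<le>s. pderiv (E_poly j) * pderiv (E_poly (s - j))))"
proof (cases "s = 1")
  case True
  have "smult (1 / 16) ([:0, 0, 1:] * [:1, 0, 5:] * [:1, 0, 1:]) = smult (1 / 2) (T_poly * pderiv (E_poly 1))"
    by (simp add: T_poly_def pderiv_pCons)
  then have "pderiv (E_poly 2) = smult (1 / 2) (pderiv (T_poly * pderiv (E_poly 1)))"
    by (simp only: numeral_2_eq_2 One_nat_def E_poly.simps pderiv_smult)
  then show ?thesis using True by (simp add: numeral_2_eq_2)
next
  case False
  with assms obtain k where s: "s = k + 2" by (metis One_nat_def Suc_1 add.commute le_Suc_ex le_antisym not_less_eq_eq)
  have "(\<Sum>j\<le>s. pderiv (E_poly j) * pderiv (E_poly (s - j))) = (\<Sum>j\<in>{1..k + 1}. pderiv (E_poly j) * pderiv (E_poly (k + 2 - j)))"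
  proof (rule sum.mono_neutral_cong_right)
    show "\<forall>i\<in>{..s} - {1..k + 1}. pderiv (E_poly i) * pderiv (E_poly (s - i)) = 0"
    proof
      fix i assume "i \<in> {..s} - {1..k + 1}"
      then have "i = 0 \<or> i = s" unfolding s by auto
      then show "pderiv (E_poly i) * pderiv (E_poly (s - i)) = 0" by auto
    qed
  qed (auto simp: s)
  moreover have "E_poly (Suc s) = smult (1 / 2) (T_poly * pderiv (E_poly s)) +
     smult (1 / 2) (poly_antideriv (T_poly * (\<Sum>j\<in>{1..k + 1}. pderiv (E_poly j) * pderiv (E_poly (k + 2 - j)))))"
    unfolding s T_poly_def by (simp only: add_2_eq_Suc' E_poly.simps)
  ultimately show ?thesis
    by (simp only: pderiv_add pderiv_smult pderiv_poly_antideriv)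
qed

text \<open>With \<open>g = \<Sum>\<^sub>s \<delta>\<^sup>s E\<^sub>s'\<close> the exponent \<open>S\<close> of the approximation satisfies
  \<open>dS/d\<xi> = \<i>/\<delta> - \<i>Tg\<close>; the expression below is, up to the factor \<open>T\<close>, the residual in the Riccati equation.\<close>

lemma riccati_residual:
  shows "\<exists>C\<ge>0. \<forall>\<delta> z. 0 < \<delta> \<and> \<delta> \<le> 1 \<and> cmod z \<le> 1 \<longrightarrow>
    cmod (2 / of_real \<delta> * (\<Sum>s=1..N. of_real \<delta> ^ s * poly (pderiv (E_poly s)) z)
      - (\<Sum>s=1..N. of_real \<delta> ^ s * poly (pderiv (T_poly * pderiv (E_poly s))) z)
      - poly T_poly z * (\<Sum>s=1..N. of_real \<delta> ^ s * poly (pderiv (E_poly s)) z)\<^sup>2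
      - 2 * poly (pderiv (E_poly 1)) z) \<le> C * \<delta> ^ N"
proof (cases "N = 0")
  case True
  have "compact (cball (0::complex) 1)" by simp
  then have "bounded ((\<lambda>z. 2 * poly (pderiv (E_poly 1)) z) ` cball 0 1)"
    by (intro compact_imp_bounded compact_continuous_image continuous_intros)
  then obtain C where "\<forall>x\<in>(\<lambda>z. 2 * poly (pderiv (E_poly 1)) z) ` cball 0 1. norm x \<le> C"
    unfolding bounded_iff by blast
  then have C: "cmod (2 * poly (pderiv (E_poly 1)) z) \<le> C" if "cmod z \<le> 1" for z
    using that by auto
  show ?thesis
    by (rule exI[of _ "max C 0"]) (use C True in \<open>auto simp: le_max_iff_disj\<close>)
next
  case False
  define a where "a z s = poly (pderiv (E_poly s)) z" for z s
  define d where "d z s = poly (pderiv (T_poly * pderiv (E_poly s))) z" for z s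
  have "\<exists>C. \<forall>z. cmod z \<le> 1 \<longrightarrow> cmod (poly p z) \<le> C" for p
  proof -
    have "bounded (poly p ` cball 0 1)"
      by (intro compact_imp_bounded compact_continuous_image continuous_intros) auto
    then obtain C where "\<forall>x\<in>poly p ` cball 0 1. norm x \<le> C"
      unfolding bounded_iff by blast
    then show ?thesis by (intro exI[of _ C]) auto
  qed
  then obtain B where B: "\<And>p z. cmod z \<le> 1 \<Longrightarrow> cmod (poly p z) \<le> B p" by metis
  define A where "A = (\<Sum>s\<le>N. \<bar>B (pderiv (E_poly s))\<bar>)"
  have A: "cmod (a z s) \<le> A" if "cmod z \<le> 1" "s \<le> N" for z s
  proof -
    have "cmod (a z s) \<le> \<bar>B (pderiv (E_poly s))\<bar>"
      unfolding a_def using B[OF that(1), of "pderiv (E_poly s)"] by simp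
    also have "\<dots> \<le> A"
      unfolding A_def using that by (intro member_le_sum) auto
    finally show ?thesis .
  qed
  have A0: "A \<ge> 0" unfolding A_def by (intro sum_nonneg) auto
  define Bd Bt where "Bd = \<bar>B (pderiv (T_poly * pderiv (E_poly N)))\<bar>" and "Bt = \<bar>B T_poly\<bar>"
  \<comment> \<open>In the square of the sum, the pairs with \<open>i + j < N\<close> are cancelled
    by the recursion; those collected in \<open>I\<close> carry at least the factor
    \<open>\<delta>^N\<close>.\<close>
  define I where "I = {(i, j). i \<le> N \<and> j \<le> N \<and> N \<le> i + j}"
  have finI: "finite I" by (rule finite_subset[of _ "{..N} \<times> {..N}"]) (auto simp: I_def)
  show ?thesis
  proof (intro exI[of _ "Bd + Bt * (of_nat (card I) * A\<^sup>2)"] conjI allI impI)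
    show "0 \<le> Bd + Bt * (of_nat (card I) * A\<^sup>2)"
      by (simp add: Bd_def Bt_def)
    fix \<delta> :: real and z :: complex assume *: "0 < \<delta> \<and> \<delta> \<le> 1 \<and> cmod z \<le> 1"
    define e where "e = complex_of_real \<delta>"
    have e: "e \<noteq> 0" "cmod e = \<delta>" using * by (auto simp: e_def)
    have z: "cmod z \<le> 1" using * by simp
    have a0: "a z 0 = 0" by (simp add: a_def)
    have rec: "2 * a z (Suc s) = d z s + poly T_poly z * (\<Sum>j\<le>s. a z j * a z (s - j))" if "s \<ge> 1" for s
      unfolding a_def d_def pderiv_E_poly_Suc[OF that] by (simp add: poly_sum)
    have d0: "d z 0 = 0" by (simp add: d_def)
    \<comment> \<open>The shift \<open>s -> s + 1\<close> absorbs the division by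
      \<open>\<delta>\<close>. The term with \<open>s = 1\<close> is split off, since the recursion
      starts only after it; the last term of the residual cancels it.\<close>
    have s1: "2 / e * (\<Sum>s=1..N. e ^ s * a z s) = 2 * a z 1 + (\<Sum>s<N. e ^ s * d z s)
        + poly T_poly z * (\<Sum>s<N. e ^ s * (\<Sum>j\<le>s. a z j * a z (s - j)))"
    proof -
      obtain M where M: "N = Suc M" using False by (cases N) auto
      have "2 / e * (\<Sum>s=1..N. e ^ s * a z s) = (\<Sum>s=0..M. 2 * (e ^ s * a z (Suc s)))"
        unfolding M One_nat_def sum.shift_bounds_cl_Suc_ivl sum_distrib_left
        using e by (intro sum.cong) auto
      also have "\<dots> = 2 * a z 1 + (\<Sum>s=1..M. e ^ s * (2 * a z (Suc s)))"
        by (simp add: sum.atLeast_Suc_atMost mult_ac)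
      also have "(\<Sum>s=1..M. e ^ s * (2 * a z (Suc s))) = (\<Sum>s=1..M. e ^ s * (d z s + poly T_poly z * (\<Sum>j\<le>s. a z j * a z (s - j))))"
        by (intro sum.cong) (auto simp only: rec atLeastAtMost_iff)
      also have "\<dots> = (\<Sum>s=0..M. e ^ s * (d z s + poly T_poly z * (\<Sum>j\<le>s. a z j * a z (s - j))))"
        by (simp add: sum.atLeast_Suc_atMost a0 d0)
      also have "{0..M} = {..<N}" unfolding M by auto
      also have "2 * a z 1 + (\<Sum>s<N. e ^ s * (d z s + poly T_poly z * (\<Sum>j\<le>s. a z j * a z (s - j))))
         = 2 * a z 1 + (\<Sum>s<N. e ^ s * d z s)
        + poly T_poly z * (\<Sum>s<N. e ^ s * (\<Sum>j\<le>s. a z j * a z (s - j)))"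
        by (simp add: sum_distrib_left sum.distrib algebra_simps)
      finally show ?thesis .
    qed
    have s2: "(\<Sum>s=1..N. e ^ s * d z s) = (\<Sum>s<N. e ^ s * d z s) + e ^ N * d z N"
    proof -
      have "(\<Sum>s=1..N. e ^ s * d z s) = (\<Sum>s=0..N. e ^ s * d z s)"
        by (simp add: sum.atLeast_Suc_atMost d0)
      also have "{0..N} = insert N {..<N}" by auto
      finally show ?thesis by (simp add: add_ac)
    qed
    have s3: "(\<Sum>s=1..N. e ^ s * a z s)\<^sup>2 = (\<Sum>s<N. e ^ s * (\<Sum>j\<le>s. a z j * a z (s - j))) + (\<Sum>(i,j)\<in>I. e ^ (i + j) * (a z i * a z j))"
    proof -
      define J where "J = {(i, j). i + j < N}"
      have finJ: "finite J" by (rule finite_subset[of _ "{..N} \<times> {..N}"]) (auto simp: J_def)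
      have "(\<Sum>s=1..N. e ^ s * a z s) = (\<Sum>s\<le>N. e ^ s * a z s)"
        by (simp add: sum.atLeast_Suc_atMost a0 atMost_atLeast0)
      then have "(\<Sum>s=1..N. e ^ s * a z s)\<^sup>2 = (\<Sum>(i,j)\<in>{..N} \<times> {..N}. e ^ (i + j) * (a z i * a z j))"
        by (simp add: power2_eq_square sum_product sum.cartesian_product power_add mult_ac)
      also have "{..N} \<times> {..N} = J \<union> I" by (auto simp: I_def J_def)
      also have "(\<Sum>(i,j)\<in>J \<union> I. e ^ (i + j) * (a z i * a z j)) = (\<Sum>(i,j)\<in>J. e ^ (i + j) * (a z i * a z j)) + (\<Sum>(i,j)\<in>I. e ^ (i + j) * (a z i * a z j))"
        by (intro sum.union_disjoint finI finJ) (auto simp: I_def J_def)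
      also have "(\<Sum>(i,j)\<in>J. e ^ (i + j) * (a z i * a z j)) = (\<Sum>s<N. \<Sum>j\<le>s. e ^ (j + (s - j)) * (a z j * a z (s - j)))"
        unfolding J_def by (rule sum.triangle_reindex)
      also have "\<dots> = (\<Sum>s<N. e ^ s * (\<Sum>j\<le>s. a z j * a z (s - j)))"
        by (simp add: sum_distrib_left)
      finally show ?thesis .
    qed
    have "2 / e * (\<Sum>s=1..N. e ^ s * a z s) - (\<Sum>s=1..N. e ^ s * d z s) - poly T_poly z * (\<Sum>s=1..N. e ^ s * a z s)\<^sup>2 - 2 * a z 1
       = - (e ^ N * d z N) - poly T_poly z * (\<Sum>(i,j)\<in>I. e ^ (i + j) * (a z i * a z j))"
      unfolding s1 s2 s3 by (simp add: algebra_simps)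
    also have "cmod \<dots> \<le> cmod (e ^ N * d z N) + cmod (poly T_poly z * (\<Sum>(i,j)\<in>I. e ^ (i + j) * (a z i * a z j)))"
      by (rule order_trans[OF norm_triangle_ineq4]) simp
    also have "cmod (e ^ N * d z N) \<le> \<delta> ^ N * Bd"
      using B[OF z, of "pderiv (T_poly * pderiv (E_poly N))"] * by (auto simp: norm_mult norm_power e Bd_def d_def intro!: mult_left_mono)
    also have "cmod (poly T_poly z * (\<Sum>(i,j)\<in>I. e ^ (i + j) * (a z i * a z j))) \<le> Bt * (of_nat (card I) * (\<delta> ^ N * A\<^sup>2))"
      unfolding norm_mult
    proof (rule mult_mono)
      show "cmod (poly T_poly z) \<le> Bt" using B[OF z, of T_poly] by (simp add: Bt_def)
      show "cmod (\<Sum>(i,j)\<in>I. e ^ (i + j) * (a z i * a z j)) \<le> of_nat (card I) * (\<delta> ^ N * A\<^sup>2)"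
      proof (rule sum_norm_bound)
        fix p assume "p \<in> I"
        then obtain i j where p: "p = (i, j)" "i \<le> N" "j \<le> N" "N \<le> i + j" by (auto simp: I_def)
        have "cmod (e ^ (i + j) * (a z i * a z j)) = \<delta> ^ (i + j) * (cmod (a z i) * cmod (a z j))"
          by (simp add: norm_mult norm_power e)
        also have "\<dots> \<le> \<delta> ^ N * (A * A)"
          using * A[OF z] p A0 by (intro mult_mono power_decreasing) auto
        finally show "cmod (case p of (i, j) \<Rightarrow> e ^ (i + j) * (a z i * a z j)) \<le> \<delta> ^ N * A\<^sup>2"
          by (simp add: p power2_eq_square)
      qed
    qed (auto simp: Bt_def)
    finally show "cmod (2 / of_real \<delta> * (\<Sum>s=1..N. of_real \<delta> ^ s * poly (pderiv (E_poly s)) z)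
      - (\<Sum>s=1..N. of_real \<delta> ^ s * poly (pderiv (T_poly * pderiv (E_poly s))) z)
      - poly T_poly z * (\<Sum>s=1..N. of_real \<delta> ^ s * poly (pderiv (E_poly s)) z)\<^sup>2
      - 2 * poly (pderiv (E_poly 1)) z) \<le> (Bd + Bt * (of_nat (card I) * A\<^sup>2)) * \<delta> ^ N"
      by (simp add: a_def d_def e_def algebra_simps)
  qed
qed

section \<open>The approximate solutions in the variable \<open>\<rho>(x)\<close>\<close>

definition rt :: "real \<Rightarrow> real" where "rt x = sqrt (1 + x\<^sup>2)"

lemma rt_pos [simp]: "rt x > 0" by (simp add: rt_def add_pos_nonneg)
lemma rt_nonzero [simp]: "rt x \<noteq> 0" using rt_pos[of x] by linarith
lemma rt_sq: "rt x * rt x = 1 + x\<^sup>2" by (simp add: rt_def)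
lemma rt_ge_1: "rt x \<ge> 1" by (simp add: rt_def)

lemma has_real_derivative_rt: "(rt has_real_derivative x / rt x) (at x)"
proof -
  have "1 + x\<^sup>2 > 0" by (simp add: add_pos_nonneg)
  then show ?thesis
    unfolding rt_def[abs_def] by (auto intro!: derivative_eq_intros simp: divide_simps)
qed

definition bet :: "real \<Rightarrow> complex" where "bet x = - \<i> * of_real (1 / rt x)"

lemma norm_bet: "cmod (bet x) \<le> 1"
  using rt_ge_1[of x] by (simp add: bet_def norm_mult norm_divide)

lemma T_poly_bet: "poly T_poly (bet x) = - of_real (x\<^sup>2 / (1 + x\<^sup>2)\<^sup>2)"
proof -
  have "1 + x\<^sup>2 \<noteq> 0" by (metis add_pos_nonneg less_irrefl zero_le_power2 zero_less_one)
  have b: "bet x * bet x = - of_real (1 / (1 + x\<^sup>2))"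
    by (simp add: bet_def rt_sq[symmetric] flip: of_real_mult)
  have "poly T_poly (bet x) = (bet x * bet x) * (1 + bet x * bet x)"
    by (simp add: T_poly_def)
  also have "\<dots> = of_real (- (1 / (1 + x\<^sup>2)) * (1 - 1 / (1 + x\<^sup>2)))"
    unfolding b by simp
  also have "- (1 / (1 + x\<^sup>2)) * (1 - 1 / (1 + x\<^sup>2)) = - (x\<^sup>2 / (1 + x\<^sup>2)\<^sup>2)"
    using \<open>1 + x\<^sup>2 \<noteq> 0\<close> by (simp add: power2_eq_square divide_simps)
  finally show ?thesis by simp
qed

text \<open>The chain rule through \<open>\<xi> = \<rho>(x)\<close>: the factor
  \<open>rt x / x\<close> is the derivative of \<open>\<rho>\<close> and is kept apart, so that the
  second factor is the derivative with respect to \<open>\<xi>\<close>.\<close>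

lemma has_vector_derivative_poly_bet:
  assumes "x > 0"
  shows "((\<lambda>x. poly p (bet x)) has_vector_derivative
     of_real (rt x / x) * (- \<i> * poly T_poly (bet x) * poly (pderiv p) (bet x))) (at x)"
proof -
  have "((\<lambda>x. 1 / rt x) has_real_derivative - (x / rt x ^ 3)) (at x)"
    by (auto intro!: derivative_eq_intros has_real_derivative_rt simp: power3_eq_cube)
  then have "((\<lambda>x. complex_of_real (1 / rt x)) has_vector_derivative of_real (- (x / rt x ^ 3))) (at x)"
    by (intro has_vector_derivative_of_real) (simp add: has_real_derivative_iff_has_vector_derivative)
  then have "(bet has_vector_derivative - \<i> * of_real (- (x / rt x ^ 3))) (at x)"
    unfolding bet_def[abs_def] by (rule has_vector_derivative_mult_right)
  moreover have "- \<i> * of_real (- (x / rt x ^ 3)) = of_real (rt x / x) * (- \<i> * poly T_poly (bet x))"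
  proof -
    have "(1 + x\<^sup>2)\<^sup>2 = rt x ^ 4" unfolding rt_sq[symmetric] by (simp add: power2_eq_square power4_eq_xxxx)
    then have "- (x / rt x ^ 3) = rt x / x * (- (x\<^sup>2 / (1 + x\<^sup>2)\<^sup>2))"
      using assms by (simp add: divide_simps power2_eq_square power3_eq_cube power4_eq_xxxx)
    then show ?thesis unfolding T_poly_bet by (simp only: of_real_mult of_real_minus) simp
  qed
  ultimately have "(bet has_vector_derivative of_real (rt x / x) * (- \<i> * poly T_poly (bet x))) (at x)"
    by (simp only:)
  from field_vector_diff_chain_at[OF this poly_DERIV, of p] show ?thesis
    by (simp add: o_def mult.assoc)
qed

text \<open>\<open>wkb_g\<close> and \<open>wkb_gd\<close> are the truncations at order
  \<open>N\<close> of \<open>g\<close> and of the \<open>\<beta>\<close>-derivative of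
  \<open>T g\<close>, with \<open>\<delta> = 1 / \<nu>\<close>. The function \<open>wkb_sg\<close>
  below is the derivative of \<open>wkb_S\<close> with respect to \<open>\<xi>\<close>.\<close>

definition wkb_g :: "nat \<Rightarrow> real \<Rightarrow> complex \<Rightarrow> complex" where
  "wkb_g N \<nu> z = (\<Sum>s=1..N. of_real (1 / \<nu>) ^ s * poly (pderiv (E_poly s)) z)"

definition wkb_gd :: "nat \<Rightarrow> real \<Rightarrow> complex \<Rightarrow> complex" where
  "wkb_gd N \<nu> z = (\<Sum>s=1..N. of_real (1 / \<nu>) ^ s * poly (pderiv (T_poly * pderiv (E_poly s))) z)"

definition wkb_Sr :: "nat \<Rightarrow> real \<Rightarrow> real \<Rightarrow> complex" where
  "wkb_Sr N \<nu> x = (\<Sum>s=1..N. of_real (1 / \<nu>) ^ s * poly (E_poly s) (bet x))"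

definition wkb_S :: "nat \<Rightarrow> real \<Rightarrow> real \<Rightarrow> complex" where
  "wkb_S N \<nu> x = \<i> * of_real (\<nu> * rho x) + wkb_Sr N \<nu> x"

definition wkb_sg :: "nat \<Rightarrow> real \<Rightarrow> real \<Rightarrow> complex" where
  "wkb_sg N \<nu> x = \<i> * of_real \<nu> - \<i> * (poly T_poly (bet x) * wkb_g N \<nu> (bet x))"

lemma has_vector_derivative_wkb_S:
  assumes "x > 0"
  shows "(wkb_S N \<nu> has_vector_derivative of_real (rt x / x) * wkb_sg N \<nu> x) (at x)"
proof -
  have "(rho has_real_derivative rt x / x) (at x)"
    using has_real_derivative_rho[OF assms] by (simp add: rt_def add.commute)
  from has_vector_derivative_mult_right[OF has_vector_derivative_of_real[OF DERIV_cmult[OF this, of \<nu>]], of \<i>]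
  have 1: "((\<lambda>x. \<i> * complex_of_real (\<nu> * rho x)) has_vector_derivative \<i> * of_real (\<nu> * (rt x / x))) (at x)" .
  have 2: "(wkb_Sr N \<nu> has_vector_derivative (\<Sum>s=1..N. of_real (1 / \<nu>) ^ s *
      (of_real (rt x / x) * (- \<i> * poly T_poly (bet x) * poly (pderiv (E_poly s)) (bet x))))) (at x)"
    unfolding wkb_Sr_def[abs_def]
    by (intro has_vector_derivative_sum has_vector_derivative_mult_right has_vector_derivative_poly_bet assms)
  have "(\<Sum>s=1..N. of_real (1 / \<nu>) ^ s *
      (of_real (rt x / x) * (- \<i> * poly T_poly (bet x) * poly (pderiv (E_poly s)) (bet x))))
     = of_real (rt x / x) * (- \<i> * (poly T_poly (bet x) * wkb_g N \<nu> (bet x)))"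
    unfolding wkb_g_def sum_distrib_left by (intro sum.cong) (auto simp: mult_ac)
  with has_vector_derivative_add[OF 1 2] show ?thesis
    unfolding wkb_S_def[abs_def] wkb_sg_def by (simp add: algebra_simps)
qed

lemma has_vector_derivative_wkb_sg:
  assumes "x > 0"
  shows "(wkb_sg N \<nu> has_vector_derivative of_real (rt x / x) * (- (poly T_poly (bet x) * wkb_gd N \<nu> (bet x)))) (at x)"
proof -
  have eq: "wkb_sg N \<nu> = (\<lambda>x. \<i> * of_real \<nu> - \<i> * (\<Sum>s=1..N. of_real (1 / \<nu>) ^ s * poly (T_poly * pderiv (E_poly s)) (bet x)))"
    unfolding wkb_sg_def[abs_def] wkb_g_def sum_distrib_left
    by (intro ext arg_cong2[of _ _ _ _ "(-)"] sum.cong refl) (simp add: mult_ac)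
  have "(wkb_sg N \<nu> has_vector_derivative (0 - \<i> * (\<Sum>s=1..N. of_real (1 / \<nu>) ^ s *
      (of_real (rt x / x) * (- \<i> * poly T_poly (bet x) * poly (pderiv (T_poly * pderiv (E_poly s))) (bet x)))))) (at x)"
    unfolding eq
    by (intro has_vector_derivative_diff has_vector_derivative_const has_vector_derivative_sum
        has_vector_derivative_mult_right has_vector_derivative_poly_bet assms)
  moreover have "0 - \<i> * (\<Sum>s=1..N. of_real (1 / \<nu>) ^ s *
      (of_real (rt x / x) * (- \<i> * poly T_poly (bet x) * poly (pderiv (T_poly * pderiv (E_poly s))) (bet x))))
     = of_real (rt x / x) * (- (poly T_poly (bet x) * wkb_gd N \<nu> (bet x)))"
  proof -
    have "(\<Sum>s=1..N. of_real (1 / \<nu>) ^ s *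
      (of_real (rt x / x) * (- \<i> * poly T_poly (bet x) * poly (pderiv (T_poly * pderiv (E_poly s))) (bet x))))
      = - \<i> * (of_real (rt x / x) * (poly T_poly (bet x) * wkb_gd N \<nu> (bet x)))"
      unfolding wkb_gd_def sum_distrib_left by (intro sum.cong) (auto simp: mult_ac)
    then show ?thesis by simp
  qed
  ultimately show ?thesis by (simp only:)
qed

text \<open>The potential in the Liouville-transformed Bessel equation: as a function of
  \<open>\<xi>\<close>, \<open>bes_v\<close> has second derivative
  \<open>- (\<nu>^2 + wkb_psi) bes_v\<close>.\<close>

definition wkb_psi :: "real \<Rightarrow> real" where
  "wkb_psi x = x\<^sup>2 * (x\<^sup>2 - 4) / (4 * (1 + x\<^sup>2) ^ 3)"

text \<open>This is \<open>S'^2 + S'' + \<nu>^2 + wkb_psi\<close> with derivatives in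
  \<open>\<xi>\<close>, the residual of \<open>exp S\<close> in the transformed equation.\<close>

definition wkb_res :: "nat \<Rightarrow> real \<Rightarrow> real \<Rightarrow> complex" where
  "wkb_res N \<nu> x = (wkb_sg N \<nu> x)\<^sup>2 - poly T_poly (bet x) * wkb_gd N \<nu> (bet x) + of_real (\<nu>\<^sup>2 + wkb_psi x)"

text \<open>A factor \<open>T\<close> comes out of the whole residual. It is what makes the residual
  integrable: against \<open>d\<xi> = (rt x / x) dx\<close> the weight
  \<open>x^2 / (1 + x^2)^2\<close> becomes \<open>x / rt x^3\<close>.\<close>

lemma wkb_res_bound:
  obtains C where "C \<ge> 0" "\<And>\<nu> x. \<nu> \<ge> 1 \<Longrightarrow> cmod (wkb_res N \<nu> x) \<le> C * (1 / \<nu>) ^ N * (x\<^sup>2 / (1 + x\<^sup>2)\<^sup>2)"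
proof -
  obtain C where C: "C \<ge> 0" "\<And>\<delta> z. 0 < \<delta> \<Longrightarrow> \<delta> \<le> 1 \<Longrightarrow> cmod z \<le> 1 \<Longrightarrow>
     cmod (2 / of_real \<delta> * (\<Sum>s=1..N. of_real \<delta> ^ s * poly (pderiv (E_poly s)) z)
      - (\<Sum>s=1..N. of_real \<delta> ^ s * poly (pderiv (T_poly * pderiv (E_poly s))) z)
      - poly T_poly z * (\<Sum>s=1..N. of_real \<delta> ^ s * poly (pderiv (E_poly s)) z)\<^sup>2
      - 2 * poly (pderiv (E_poly 1)) z) \<le> C * \<delta> ^ N"
    using riccati_residual[of N] by blast
  show thesis
  proof (rule that[OF C(1)])
    fix \<nu> x :: real assume nu: "\<nu> \<ge> 1"
    define z where "z = bet x"
    define T where "T = poly T_poly z"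
    define g where "g = wkb_g N \<nu> z"
    \<comment> \<open>The reason for the form of \<open>E_1\<close>: the part of the residual of
      order \<open>\<nu>^0\<close> is \<open>2 T E_1' + wkb_psi\<close>, and it vanishes.\<close>
    have psi: "of_real (wkb_psi x) = - 2 * T * poly (pderiv (E_poly 1)) z"
    proof -
      have p0: "1 + x\<^sup>2 \<noteq> 0" by (metis add_pos_nonneg less_irrefl zero_le_power2 zero_less_one)
      have b: "z * z = - of_real (1 / (1 + x\<^sup>2))"
        by (simp add: z_def bet_def rt_sq[symmetric] flip: of_real_mult)
      have "poly (pderiv (E_poly 1)) z = (1 + 5 * (z * z)) / 8"
        by (simp add: pderiv_smult pderiv_pCons field_simps)
      also have "\<dots> = of_real ((1 - 5 / (1 + x\<^sup>2)) / 8)"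
        unfolding b by simp
      finally have e1: "poly (pderiv (E_poly 1)) z = of_real ((1 - 5 / (1 + x\<^sup>2)) / 8)" .
      have "- 2 * T * poly (pderiv (E_poly 1)) z = of_real (2 * (x\<^sup>2 / (1 + x\<^sup>2)\<^sup>2) * ((1 - 5 / (1 + x\<^sup>2)) / 8))"
        unfolding e1 T_def unfolding z_def T_poly_bet by simp
      also have "2 * (x\<^sup>2 / (1 + x\<^sup>2)\<^sup>2) * ((1 - 5 / (1 + x\<^sup>2)) / 8) = wkb_psi x"
      proof -
        have "2 * (y / q\<^sup>2) * ((1 - 5 / q) / 8) = y * (q - 5) / (4 * q ^ 3)" if "q \<noteq> 0" for y q :: real
          using that by (simp add: field_simps power2_eq_square power3_eq_cube)
        from this[OF p0, of "x\<^sup>2"] show ?thesis by (simp add: wkb_psi_def)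
      qed
      finally show ?thesis by simp
    qed
    have n: "2 / complex_of_real (1 / \<nu>) = 2 * of_real \<nu>" by simp
    have "wkb_res N \<nu> x = T * (2 * of_real \<nu> * g - wkb_gd N \<nu> z - T * g\<^sup>2 - 2 * poly (pderiv (E_poly 1)) z)"
      unfolding wkb_res_def wkb_sg_def of_real_add psi z_def[symmetric] T_def[symmetric] g_def[symmetric]
      by (simp add: power2_eq_square algebra_simps)
    also have "cmod \<dots> \<le> (x\<^sup>2 / (1 + x\<^sup>2)\<^sup>2) * (C * (1 / \<nu>) ^ N)"
      unfolding norm_mult
    proof (rule mult_mono)
      show "cmod T \<le> x\<^sup>2 / (1 + x\<^sup>2)\<^sup>2"
        unfolding T_def z_def T_poly_bet norm_minus_cancel norm_of_real by simp
      show "cmod (2 * of_real \<nu> * g - wkb_gd N \<nu> z - T * g\<^sup>2 - 2 * poly (pderiv (E_poly 1)) z) \<le> C * (1 / \<nu>) ^ N"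
        using C(2)[of "1 / \<nu>" z] nu norm_bet[of x] unfolding n g_def wkb_g_def wkb_gd_def T_def z_def by simp
    qed auto
    finally show "cmod (wkb_res N \<nu> x) \<le> C * (1 / \<nu>) ^ N * (x\<^sup>2 / (1 + x\<^sup>2)\<^sup>2)"
      by (simp add: mult_ac)
  qed
qed

lemma wkb_sg_bound:
  obtains C where "C \<ge> 0" "\<And>\<nu> x. \<nu> \<ge> 1 \<Longrightarrow> cmod (wkb_sg N \<nu> x - \<i> * of_real \<nu>) \<le> C * (x\<^sup>2 / (1 + x\<^sup>2)\<^sup>2)"
proof -
  have "\<exists>C. \<forall>z. cmod z \<le> 1 \<longrightarrow> cmod (poly p z) \<le> C" for p
  proof -
    have "bounded (poly p ` cball 0 1)"
      by (intro compact_imp_bounded compact_continuous_image continuous_intros) auto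
    then obtain C where "\<forall>x\<in>poly p ` cball 0 1. norm x \<le> C"
      unfolding bounded_iff by blast
    then show ?thesis by (intro exI[of _ C]) auto
  qed
  then obtain B where B: "\<And>p z. cmod z \<le> 1 \<Longrightarrow> cmod (poly p z) \<le> B p" by metis
  define C where "C = (\<Sum>s=1..N. \<bar>B (pderiv (E_poly s))\<bar>)"
  show thesis
  proof (rule that)
    show "C \<ge> 0" unfolding C_def by (intro sum_nonneg) auto
    fix \<nu> x :: real assume nu: "\<nu> \<ge> 1"
    have "cmod (wkb_g N \<nu> (bet x)) \<le> C"
      unfolding wkb_g_def C_def
    proof (intro sum_norm_le)
      fix s
      have "cmod (of_real (1 / \<nu>) ^ s * poly (pderiv (E_poly s)) (bet x)) = (1 / \<nu>) ^ s * cmod (poly (pderiv (E_poly s)) (bet x))"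
        using nu by (simp add: norm_mult norm_power norm_divide)
      also have "\<dots> \<le> 1 * \<bar>B (pderiv (E_poly s))\<bar>"
        using B[OF norm_bet[of x], of "pderiv (E_poly s)"] nu by (intro mult_mono power_le_one) auto
      finally show "cmod (of_real (1 / \<nu>) ^ s * poly (pderiv (E_poly s)) (bet x)) \<le> \<bar>B (pderiv (E_poly s))\<bar>" by simp
    qed
    then have "(x\<^sup>2 / (1 + x\<^sup>2)\<^sup>2) * cmod (wkb_g N \<nu> (bet x)) \<le> (x\<^sup>2 / (1 + x\<^sup>2)\<^sup>2) * C"
      by (intro mult_left_mono) auto
    moreover have "cmod (wkb_sg N \<nu> x - \<i> * of_real \<nu>) = (x\<^sup>2 / (1 + x\<^sup>2)\<^sup>2) * cmod (wkb_g N \<nu> (bet x))"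
      unfolding wkb_sg_def T_poly_bet by (simp add: norm_mult del: of_real_divide of_real_power)
    ultimately show "cmod (wkb_sg N \<nu> x - \<i> * of_real \<nu>) \<le> C * (x\<^sup>2 / (1 + x\<^sup>2)\<^sup>2)"
      by (simp add: mult_ac)
  qed
qed

text \<open>\<open>bes_v = (1 + x\<^sup>2)\<^sup>1\<^sup>/\<^sup>4 J\<^sub>i\<^sub>\<nu>(\<nu>x)\<close>, and \<open>bes_vd\<close> is its derivative with respect to \<open>\<xi> = \<rho>(x)\<close>.\<close>

definition bes_v :: "real \<Rightarrow> real \<Rightarrow> complex" where
  "bes_v \<nu> x = of_real (sqrt (rt x)) * bes_y \<nu> (\<nu> * x)"

definition bes_vd :: "real \<Rightarrow> real \<Rightarrow> complex" where
  "bes_vd \<nu> x = of_real (1 / sqrt (rt x)) * bes_yd \<nu> (\<nu> * x)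
     + of_real (x\<^sup>2 / 2 * (sqrt (rt x) / rt x ^ 3)) * bes_y \<nu> (\<nu> * x)"

text \<open>All coefficients are expressed through \<open>m = (1 + x^2)^(1/4)\<close>. In the
  derivative of \<open>bes_vd\<close> the coefficient of \<open>bes_yd\<close> cancels, which is the
  purpose of the factor \<open>sqrt (rt x)\<close>; the coefficient of \<open>bes_y\<close> produces
  \<open>wkb_psi\<close>.\<close>

lemma has_vector_derivative_bes_v:
  assumes x: "x > 0" and nu: "\<nu> > 0"
  shows "(bes_v \<nu> has_vector_derivative of_real (rt x / x) * bes_vd \<nu> x) (at x)"
    and "(bes_vd \<nu> has_vector_derivative of_real (rt x / x) * (- of_real (\<nu>\<^sup>2 + wkb_psi x) * bes_v \<nu> x)) (at x)"
proof -
  define y yd where "y = bes_y \<nu> (\<nu> * x)" and "yd = bes_yd \<nu> (\<nu> * x)"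
  define m where "m = sqrt (rt x)"
  have m: "m > 0" "rt x = m * m" by (auto simp: m_def order.strict_implies_order)
  have m4: "m * m * m * m = 1 + x * x" using rt_sq[of x] m by (simp add: power2_eq_square mult_ac)
  have t: "\<nu> * x > 0" using assms by simp
  have lin: "((\<lambda>x. \<nu> * x) has_real_derivative \<nu>) (at x)" by (auto intro!: derivative_eq_intros)
  have dy: "((\<lambda>x. bes_y \<nu> (\<nu> * x)) has_vector_derivative yd / of_real x) (at x)"
    using vector_diff_chain_at[OF lin[unfolded has_real_derivative_iff_has_vector_derivative] has_vector_derivative_bes_y(1)[OF t]] nu
    by (simp add: o_def yd_def scaleR_conv_of_real)
  have dyd: "((\<lambda>x. bes_yd \<nu> (\<nu> * x)) has_vector_derivative - of_real (\<nu>\<^sup>2 * (1 + x\<^sup>2) / x) * y) (at x)"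
  proof -
    have "of_real \<nu> * (- of_real ((\<nu>\<^sup>2 + (\<nu> * x)\<^sup>2) / (\<nu> * x)) * y) = - of_real (\<nu>\<^sup>2 * (1 + x\<^sup>2) / x) * y"
    proof -
      have "\<nu> * ((\<nu>\<^sup>2 + (\<nu> * x)\<^sup>2) / (\<nu> * x)) = \<nu>\<^sup>2 * (1 + x\<^sup>2) / x"
        using assms by (simp add: field_simps power2_eq_square)
      then have "complex_of_real \<nu> * of_real ((\<nu>\<^sup>2 + (\<nu> * x)\<^sup>2) / (\<nu> * x)) = of_real (\<nu>\<^sup>2 * (1 + x\<^sup>2) / x)"
        by (simp only: of_real_mult[symmetric])
      then show ?thesis by (metis mult.assoc mult_minus_left mult_minus_right)
    qed
    then show ?thesis
      using vector_diff_chain_at[OF lin[unfolded has_real_derivative_iff_has_vector_derivative] has_vector_derivative_bes_y(2)[OF t, of \<nu>]]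
      by (simp only: o_def scaleR_conv_of_real y_def)
  qed
  have dm: "((\<lambda>x. sqrt (rt x)) has_real_derivative x / (2 * m ^ 3)) (at x)"
    using DERIV_chain2[OF DERIV_real_sqrt[OF rt_pos[of x]] has_real_derivative_rt] m
    by (simp add: m_def[symmetric] field_simps power3_eq_cube)
  have dA: "((\<lambda>x. 1 / sqrt (rt x)) has_real_derivative - (x / (2 * m ^ 5))) (at x)"
    using DERIV_divide[OF DERIV_const[of 1] dm] m by (simp add: m_def[symmetric] field_simps eval_nat_numeral)
  have dx: "((\<lambda>x. x\<^sup>2 / 2) has_real_derivative x) (at x)"
    by (auto intro!: derivative_eq_intros)
  have "((\<lambda>x. x\<^sup>2 / 2 * (sqrt (rt x) / rt x ^ 3)) has_real_derivative
     x * (m / rt x ^ 3) + (x / (2 * m ^ 3) * rt x ^ 3 - m * (of_nat 3 * (x / rt x * rt x ^ (3 - Suc 0)))) / (rt x ^ 3 * rt x ^ 3) * (x\<^sup>2 / 2)) (at x)"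
    unfolding m_def by (intro DERIV_mult dx DERIV_divide dm[unfolded m_def] DERIV_power has_real_derivative_rt) simp
  moreover have "x * (m / rt x ^ 3) + (x / (2 * m ^ 3) * rt x ^ 3 - m * (of_nat 3 * (x / rt x * rt x ^ (3 - Suc 0)))) / (rt x ^ 3 * rt x ^ 3) * (x\<^sup>2 / 2)
     = x / m ^ 5 - 5 / 4 * x ^ 3 / m ^ 9"
    using m(1) unfolding m(2) by (simp add: field_simps eval_nat_numeral)
  ultimately have dB: "((\<lambda>x. x\<^sup>2 / 2 * (sqrt (rt x) / rt x ^ 3)) has_real_derivative x / m ^ 5 - 5 / 4 * x ^ 3 / m ^ 9) (at x)"
    by (simp only:)
  have ofr: "((\<lambda>x. complex_of_real (f x)) has_vector_derivative of_real d) (at x)" if "(f has_real_derivative d) (at x)" for f d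
    using that by (rule has_vector_derivative_of_real)
  show "(bes_v \<nu> has_vector_derivative of_real (rt x / x) * bes_vd \<nu> x) (at x)"
  proof -
    have c: "x / (2 * m ^ 3) = rt x / x * (x\<^sup>2 / 2 * (m / rt x ^ 3))" "m / x = rt x / x * (1 / m)"
      using m x by (simp_all add: field_simps eval_nat_numeral)
    have "(bes_v \<nu> has_vector_derivative of_real m * (yd / of_real x) + of_real (x / (2 * m ^ 3)) * y) (at x)"
      unfolding bes_v_def[abs_def] m_def y_def
      by (intro has_vector_derivative_mult dy ofr dm[unfolded m_def])
    moreover have "of_real m * (yd / of_real x) + of_real (x / (2 * m ^ 3)) * y = of_real (m / x) * yd + of_real (x / (2 * m ^ 3)) * y"
      by simp
    ultimately show ?thesis
      unfolding c bes_vd_def by (simp only: m_def y_def yd_def of_real_mult distrib_left mult.assoc)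
  qed
  show "(bes_vd \<nu> has_vector_derivative of_real (rt x / x) * (- of_real (\<nu>\<^sup>2 + wkb_psi x) * bes_v \<nu> x)) (at x)"
  proof -
    define B where "B = x\<^sup>2 / 2 * (m / rt x ^ 3)"
    have "(bes_vd \<nu> has_vector_derivative (of_real (1 / m) * (- of_real (\<nu>\<^sup>2 * (1 + x\<^sup>2) / x) * y) + of_real (- (x / (2 * m ^ 5))) * yd)
      + (of_real B * (yd / of_real x) + of_real (x / m ^ 5 - 5 / 4 * x ^ 3 / m ^ 9) * y)) (at x)"
      unfolding bes_vd_def[abs_def] m_def y_def yd_def B_def
      by (intro has_vector_derivative_add has_vector_derivative_mult ofr dA[unfolded m_def] dB[unfolded m_def] dy[unfolded yd_def] dyd[unfolded y_def])
    moreover have "(of_real (1 / m) * (- of_real (\<nu>\<^sup>2 * (1 + x\<^sup>2) / x) * y) + of_real (- (x / (2 * m ^ 5))) * yd)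
      + (of_real B * (yd / of_real x) + of_real (x / m ^ 5 - 5 / 4 * x ^ 3 / m ^ 9) * y)
      = of_real (B / x - x / (2 * m ^ 5)) * yd + of_real (- (1 / m * (\<nu>\<^sup>2 * (1 + x\<^sup>2) / x)) + (x / m ^ 5 - 5 / 4 * x ^ 3 / m ^ 9)) * y"
      by (simp add: algebra_simps)
    moreover have "B / x - x / (2 * m ^ 5) = 0"
      using m x by (simp add: B_def field_simps eval_nat_numeral)
    moreover have "- (1 / m * (\<nu>\<^sup>2 * (1 + x\<^sup>2) / x)) + (x / m ^ 5 - 5 / 4 * x ^ 3 / m ^ 9) = rt x / x * (- (\<nu>\<^sup>2 + wkb_psi x) * m)"
    proof -
      have q: "1 + x\<^sup>2 = m ^ 4" using m4 by (simp add: eval_nat_numeral mult_ac)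
      have "x\<^sup>2 = m ^ 4 - 1" using q by simp
      then have "x / m ^ 5 - 5 / 4 * x ^ 3 / m ^ 9 = - (m\<^sup>2 / x * (x\<^sup>2 * (x\<^sup>2 - 4) / (4 * (m ^ 4) ^ 3)) * m)"
        using m x by (simp add: divide_simps eval_nat_numeral) algebra
      moreover have "1 / m * (\<nu>\<^sup>2 * m ^ 4 / x) = m\<^sup>2 / x * \<nu>\<^sup>2 * m"
        using m x by (simp add: field_simps eval_nat_numeral)
      ultimately show ?thesis
        unfolding wkb_psi_def q m(2) by (simp add: power2_eq_square algebra_simps)
    qed
    ultimately show ?thesis
      by (simp only: bes_v_def m_def y_def of_real_mult of_real_minus of_real_0 mult_zero_left add_0_left mult.assoc)
  qed
qed

text \<open>Up to normalization, \<open>wkb_P\<close> and \<open>wkb_R\<close> are the Wronskians of \<open>bes_v\<close> with the two approximate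
  solutions \<open>exp (cnj S)\<close> and \<open>exp S\<close>; their derivatives are of the size of the residual.\<close>

definition wkb_P :: "nat \<Rightarrow> real \<Rightarrow> real \<Rightarrow> complex" where
  "wkb_P N \<nu> x = exp (cnj (wkb_S N \<nu> x)) * (bes_v \<nu> x * cnj (wkb_sg N \<nu> x) - bes_vd \<nu> x)"

definition wkb_R :: "nat \<Rightarrow> real \<Rightarrow> real \<Rightarrow> complex" where
  "wkb_R N \<nu> x = exp (wkb_S N \<nu> x) * (bes_v \<nu> x * wkb_sg N \<nu> x - bes_vd \<nu> x)"

lemma has_vector_derivative_exp_compose:
  fixes f :: "real \<Rightarrow> complex"
  assumes "(f has_vector_derivative f') (at x)"
  shows "((\<lambda>x. exp (f x)) has_vector_derivative f' * exp (f x)) (at x)"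
  using field_vector_diff_chain_at[OF assms DERIV_exp] by (simp add: o_def)

text \<open>As for any Wronskian, the terms with \<open>bes_vd\<close> cancel; what remains is the
  residual of the approximate solution times \<open>bes_v\<close>.\<close>

lemma has_vector_derivative_wkb_PR:
  assumes "x > 0" "\<nu> > 0"
  shows "(wkb_P N \<nu> has_vector_derivative of_real (rt x / x) * (cnj (wkb_res N \<nu> x) * (bes_v \<nu> x * exp (cnj (wkb_S N \<nu> x))))) (at x)"
    and "(wkb_R N \<nu> has_vector_derivative of_real (rt x / x) * (wkb_res N \<nu> x * (bes_v \<nu> x * exp (wkb_S N \<nu> x)))) (at x)"
proof -
  define k where "k = complex_of_real (rt x / x)"
  have kc: "cnj k = k" by (simp add: k_def)
  define S sg v vd X where "S = wkb_S N \<nu> x" and "sg = wkb_sg N \<nu> x" and "v = bes_v \<nu> x" and "vd = bes_vd \<nu> x"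
    and "X = poly T_poly (bet x) * wkb_gd N \<nu> (bet x)"
  define q where "q = complex_of_real (\<nu>\<^sup>2 + wkb_psi x)"
  have qc: "cnj q = q" by (simp add: q_def)
  have dS: "(wkb_S N \<nu> has_vector_derivative k * sg) (at x)"
    unfolding k_def sg_def by (rule has_vector_derivative_wkb_S[OF assms(1)])
  have dsg: "(wkb_sg N \<nu> has_vector_derivative k * (- X)) (at x)"
    unfolding k_def X_def by (rule has_vector_derivative_wkb_sg[OF assms(1)])
  have dv: "(bes_v \<nu> has_vector_derivative k * vd) (at x)"
    unfolding k_def vd_def by (rule has_vector_derivative_bes_v(1)[OF assms])
  have dvd: "(bes_vd \<nu> has_vector_derivative k * (- q * v)) (at x)"
    unfolding k_def v_def q_def by (rule has_vector_derivative_bes_v(2)[OF assms])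
  have res: "wkb_res N \<nu> x = sg\<^sup>2 - X + q"
    by (simp add: wkb_res_def sg_def X_def q_def)
  have "(wkb_R N \<nu> has_vector_derivative exp S * (v * (k * (- X)) + k * vd * sg - k * (- q * v)) + k * sg * exp S * (v * sg - vd)) (at x)"
    unfolding wkb_R_def[abs_def] S_def sg_def v_def vd_def
    by (intro has_vector_derivative_mult has_vector_derivative_diff has_vector_derivative_exp_compose
        dS[unfolded sg_def] dsg[unfolded sg_def] dv[unfolded vd_def] dvd[unfolded v_def])
  moreover have "exp S * (v * (k * (- X)) + k * vd * sg - k * (- q * v)) + k * sg * exp S * (v * sg - vd)
     = k * ((sg\<^sup>2 - X + q) * (v * exp S))"
    by (simp add: power2_eq_square algebra_simps)
  ultimately show "(wkb_R N \<nu> has_vector_derivative of_real (rt x / x) * (wkb_res N \<nu> x * (bes_v \<nu> x * exp (wkb_S N \<nu> x)))) (at x)"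
    by (simp only: res k_def[symmetric] v_def[symmetric] S_def[symmetric])
  have "(wkb_P N \<nu> has_vector_derivative exp (cnj S) * (v * cnj (k * (- X)) + k * vd * cnj sg - k * (- q * v)) + cnj (k * sg) * exp (cnj S) * (v * cnj sg - vd)) (at x)"
    unfolding wkb_P_def[abs_def] S_def sg_def v_def vd_def
    by (intro has_vector_derivative_mult has_vector_derivative_diff has_vector_derivative_exp_compose has_vector_derivative_cnj
        dS[unfolded sg_def] dsg[unfolded sg_def] dv[unfolded vd_def] dvd[unfolded v_def])
  moreover have "exp (cnj S) * (v * cnj (k * (- X)) + k * vd * cnj sg - k * (- q * v)) + cnj (k * sg) * exp (cnj S) * (v * cnj sg - vd)
     = k * (cnj (sg\<^sup>2 - X + q) * (v * exp (cnj S)))"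
    by (simp add: kc qc power2_eq_square algebra_simps)
  ultimately show "(wkb_P N \<nu> has_vector_derivative of_real (rt x / x) * (cnj (wkb_res N \<nu> x) * (bes_v \<nu> x * exp (cnj (wkb_S N \<nu> x))))) (at x)"
    by (simp only: res k_def[symmetric] v_def[symmetric] S_def[symmetric])
qed

text \<open>The two amplitudes determine \<open>bes_v\<close> without its derivative, by
  subtraction; the multiplier is \<open>cnj sg - sg\<close>. This makes the system for
  \<open>P\<close> and \<open>R\<close> closed. The real part of \<open>S\<close> affects only the
  modulus.\<close>

lemma wkb_v_eq:
  "wkb_P N \<nu> x * exp (\<i> * of_real (Im (wkb_S N \<nu> x))) - wkb_R N \<nu> x * exp (- (\<i> * of_real (Im (wkb_S N \<nu> x))))
    = of_real (exp (Re (wkb_S N \<nu> x))) * (bes_v \<nu> x * (- 2 * \<i> * of_real (Im (wkb_sg N \<nu> x))))"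
proof -
  define S where "S = wkb_S N \<nu> x"
  have S: "exp S = of_real (exp (Re S)) * exp (\<i> * of_real (Im S))" "exp (cnj S) = of_real (exp (Re S)) * exp (- (\<i> * of_real (Im S)))"
  proof -
    have "S = of_real (Re S) + \<i> * of_real (Im S)" "cnj S = of_real (Re S) + (- (\<i> * of_real (Im S)))"
      by (simp_all add: complex_eq_iff)
    then have "exp S = exp (of_real (Re S) + \<i> * of_real (Im S))" "exp (cnj S) = exp (of_real (Re S) + (- (\<i> * of_real (Im S))))"
      by metis+
    then show "exp S = of_real (exp (Re S)) * exp (\<i> * of_real (Im S))" "exp (cnj S) = of_real (exp (Re S)) * exp (- (\<i> * of_real (Im S)))"
      by (simp_all only: exp_add exp_of_real)
  qed
  define e f where "e = exp (\<i> * complex_of_real (Im S))" and "f = exp (- (\<i> * complex_of_real (Im S)))"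
  have ef: "e * f = 1" by (simp add: e_def f_def exp_add[symmetric])
  have sg: "cnj (wkb_sg N \<nu> x) = wkb_sg N \<nu> x + (- 2 * \<i> * of_real (Im (wkb_sg N \<nu> x)))"
    by (simp add: complex_eq_iff)
  have "wkb_P N \<nu> x * e - wkb_R N \<nu> x * f = (e * f) * of_real (exp (Re S)) * (bes_v \<nu> x * cnj (wkb_sg N \<nu> x) - bes_v \<nu> x * wkb_sg N \<nu> x)"
    unfolding wkb_P_def wkb_R_def S_def[symmetric] S e_def[symmetric] f_def[symmetric]
    by (simp add: algebra_simps)
  also have "\<dots> = of_real (exp (Re S)) * (bes_v \<nu> x * (- 2 * \<i> * of_real (Im (wkb_sg N \<nu> x))))"
    unfolding ef sg by (simp add: algebra_simps)
  finally show ?thesis by (simp only: e_def f_def S_def)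
qed

text \<open>The correction to the leading term \<open>\<i> \<nu>\<close> is bounded uniformly in
  \<open>x\<close>, so it cannot use up more than half of \<open>\<nu>\<close> once
  \<open>\<nu>\<close> is large.\<close>

lemma Im_wkb_sg_ge:
  obtains n0 where "n0 \<ge> 1" "\<And>\<nu> x. \<nu> \<ge> n0 \<Longrightarrow> Im (wkb_sg N \<nu> x) \<ge> \<nu> / 2"
proof -
  obtain C where C: "C \<ge> 0" "\<And>\<nu> x. \<nu> \<ge> 1 \<Longrightarrow> cmod (wkb_sg N \<nu> x - \<i> * of_real \<nu>) \<le> C * (x\<^sup>2 / (1 + x\<^sup>2)\<^sup>2)"
    using wkb_sg_bound[of N] by blast
  show thesis
  proof (rule that[of "max 1 (2 * C)"])
    fix \<nu> x :: real assume nu: "\<nu> \<ge> max 1 (2 * C)"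
    have "x\<^sup>2 * 1 \<le> (1 + x\<^sup>2) * (1 + x\<^sup>2)" by (intro mult_mono) auto
    then have "x\<^sup>2 / (1 + x\<^sup>2)\<^sup>2 \<le> 1" by (simp add: power2_eq_square[of "1 + x\<^sup>2"] divide_le_eq_1 add_pos_nonneg)
    then have "C * (x\<^sup>2 / (1 + x\<^sup>2)\<^sup>2) \<le> C * 1" using C(1) by (intro mult_left_mono)
    then have "cmod (wkb_sg N \<nu> x - \<i> * of_real \<nu>) \<le> C"
      using C(2)[of \<nu> x] nu by simp
    moreover have "\<bar>Im (wkb_sg N \<nu> x - \<i> * of_real \<nu>)\<bar> \<le> cmod (wkb_sg N \<nu> x - \<i> * of_real \<nu>)"
      by (rule abs_Im_le_cmod)
    ultimately show "Im (wkb_sg N \<nu> x) \<ge> \<nu> / 2"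
      using nu by (simp, linarith)
  qed simp
qed

text \<open>By \<open>wkb_v_eq\<close> and \<open>Im sg \<ge> \<nu> / 2\<close>,
  \<open>bes_v\<close> times \<open>exp (Re S)\<close> is bounded by the pair divided by
  \<open>\<nu>\<close>. Hence the pair satisfies a linear differential inequality whose total weight
  is \<open>O(\<nu>^(-N-1))\<close>: \<open>\<nu>^(-N)\<close> from the residual and one more power
  from this division.\<close>

lemma wkb_PR_nearly_constant:
  obtains n0 C where "n0 \<ge> 1" "C \<ge> 0"
    "\<And>\<nu> x y. \<nu> \<ge> n0 \<Longrightarrow> 0 < x \<Longrightarrow> x \<le> y \<Longrightarrow>
       norm ((wkb_P N \<nu> y, wkb_R N \<nu> y) - (wkb_P N \<nu> x, wkb_R N \<nu> x))
         \<le> C / \<nu> ^ (N + 1) * norm (wkb_P N \<nu> x, wkb_R N \<nu> x)"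
proof -
  obtain C where C: "C \<ge> 0" "\<And>\<nu> x. \<nu> \<ge> 1 \<Longrightarrow> cmod (wkb_res N \<nu> x) \<le> C * (1 / \<nu>) ^ N * (x\<^sup>2 / (1 + x\<^sup>2)\<^sup>2)"
    using wkb_res_bound[of N] by blast
  obtain n0 where n0: "n0 \<ge> 1" "\<And>\<nu> x. \<nu> \<ge> n0 \<Longrightarrow> Im (wkb_sg N \<nu> x) \<ge> \<nu> / 2"
    using Im_wkb_sg_ge[of N] by blast
  show thesis
  \<comment> \<open>The bound \<open>4 * C\<close> on \<open>\<nu>\<close> gives
    \<open>K \<le> 1\<close>. The 4 is a 2 for the two components times a 2 from the bound on
    \<open>V\<close>; the 12 contains the further factor 3 of
    \<open>gronwall_forward\<close>.\<close>
  proof (rule that[of "max n0 (4 * C)" "12 * C"])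
    show "max n0 (4 * C) \<ge> 1" using n0 by simp
    show "12 * C \<ge> 0" using C by simp
    fix \<nu> x y :: real assume nu: "\<nu> \<ge> max n0 (4 * C)" and xy: "0 < x" "x \<le> y"
    have nu1: "\<nu> \<ge> 1" "\<nu> \<ge> n0" using nu n0 by auto
    define K where "K = 4 * C / \<nu> ^ (N + 1)"
    have K0: "K \<ge> 0" using C nu1 by (simp add: K_def)
    have "\<nu> \<le> \<nu> ^ (N + 1)" using nu1 by (simp add: self_le_power)
    then have "4 * C \<le> \<nu> ^ (N + 1)" using nu by simp
    then have K1: "K \<le> 1" using nu1 by (simp add: K_def divide_le_eq_1)
    define f where "f x = (wkb_P N \<nu> x, wkb_R N \<nu> x)" for x
    define P' R' where "P' x = of_real (rt x / x) * (cnj (wkb_res N \<nu> x) * (bes_v \<nu> x * exp (cnj (wkb_S N \<nu> x))))"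
      and "R' x = of_real (rt x / x) * (wkb_res N \<nu> x * (bes_v \<nu> x * exp (wkb_S N \<nu> x)))" for x
    have "norm (f y - f x) \<le> 3 * K * norm (f x)"
    \<comment> \<open>\<open>- 1 / rt x\<close> is a primitive of \<open>x / rt x^3\<close>, the
      residual weight with respect to \<open>x\<close>; it increases by at most 1 over the
      half-line.\<close>
    proof (rule gronwall_forward[where f' = "\<lambda>x. (P' x, R' x)" and g = "\<lambda>x. - (1 / rt x)" and g' = "\<lambda>x. x / rt x ^ 3"])
      fix x :: real assume x: "x > 0"
      have nu0: "\<nu> > 0" using nu1 by simp
      show "(f has_vector_derivative (P' x, R' x)) (at x)"
      proof -
        have "(wkb_P N \<nu> has_derivative (\<lambda>h. h *\<^sub>R P' x)) (at x)" "(wkb_R N \<nu> has_derivative (\<lambda>h. h *\<^sub>R R' x)) (at x)"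
          using has_vector_derivative_wkb_PR[OF x nu0] unfolding P'_def R'_def has_vector_derivative_def by auto
        from has_derivative_Pair[OF this] show ?thesis
          unfolding f_def[abs_def] has_vector_derivative_def by simp
      qed
      show "((\<lambda>x. - (1 / rt x)) has_real_derivative x / rt x ^ 3) (at x)"
        by (auto intro!: derivative_eq_intros has_real_derivative_rt simp: power3_eq_cube)
      show "x / rt x ^ 3 \<ge> 0" using x by (simp add: order.strict_implies_order)
      define V where "V = cmod (bes_v \<nu> x) * exp (Re (wkb_S N \<nu> x))"
      have "\<nu> * V \<le> cmod (wkb_P N \<nu> x) + cmod (wkb_R N \<nu> x)"
      proof -
        have "\<nu> / 2 \<le> Im (wkb_sg N \<nu> x)" using n0(2)[OF nu1(2)] .
        then have "\<nu> * V \<le> 2 * Im (wkb_sg N \<nu> x) * V"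
          by (intro mult_right_mono) (auto simp: V_def)
        also have "\<dots> = cmod (of_real (exp (Re (wkb_S N \<nu> x))) * (bes_v \<nu> x * (- 2 * \<i> * of_real (Im (wkb_sg N \<nu> x)))))"
          using \<open>\<nu> / 2 \<le> Im (wkb_sg N \<nu> x)\<close> nu0 by (simp add: V_def norm_mult)
        also have "\<dots> \<le> cmod (wkb_P N \<nu> x * exp (\<i> * of_real (Im (wkb_S N \<nu> x)))) + cmod (wkb_R N \<nu> x * exp (- (\<i> * of_real (Im (wkb_S N \<nu> x)))))"
          unfolding wkb_v_eq[symmetric] by (rule norm_triangle_ineq4)
        finally show ?thesis by (simp add: norm_mult norm_exp_eq_Re)
      qed
      moreover have "cmod (wkb_P N \<nu> x) \<le> norm (f x)" "cmod (wkb_R N \<nu> x) \<le> norm (f x)"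
        using norm_fst_le[of "wkb_P N \<nu> x" "wkb_R N \<nu> x"] norm_snd_le[of "wkb_R N \<nu> x" "wkb_P N \<nu> x"] by (auto simp: f_def)
      ultimately have V: "V \<le> 2 * norm (f x) / \<nu>"
        using nu0 by (simp add: field_simps)
      have k: "rt x / x * (x\<^sup>2 / (1 + x\<^sup>2)\<^sup>2) = x / rt x ^ 3"
        using x unfolding rt_sq[symmetric] by (simp add: field_simps eval_nat_numeral)
      have n: "cmod (P' x) = rt x / x * cmod (wkb_res N \<nu> x) * V" "cmod (R' x) = rt x / x * cmod (wkb_res N \<nu> x) * V"
        using x rt_pos[of x] unfolding P'_def R'_def V_def
        by (simp_all add: norm_mult norm_divide norm_exp_eq_Re order.strict_implies_order)
      have "norm (P' x, R' x) \<le> cmod (P' x) + cmod (R' x)" by (rule norm_Pair_le)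
      also have "\<dots> = 2 * (rt x / x * cmod (wkb_res N \<nu> x) * V)" unfolding n by simp
      also have "\<dots> \<le> 2 * (rt x / x * (C * (1 / \<nu>) ^ N * (x\<^sup>2 / (1 + x\<^sup>2)\<^sup>2)) * (2 * norm (f x) / \<nu>))"
        using C(2)[OF nu1(1), of x] V x rt_pos[of x] C(1) nu0
        by (intro mult_left_mono mult_mono) (auto simp: V_def order.strict_implies_order)
      also have "\<dots> = 4 * C / \<nu> ^ (N + 1) * (rt x / x * (x\<^sup>2 / (1 + x\<^sup>2)\<^sup>2)) * norm (f x)"
        by (simp add: power_divide mult_ac)
      also have "\<dots> = K * (x / rt x ^ 3) * norm (f x)"
        unfolding k K_def ..
      finally show "norm (P' x, R' x) \<le> K * (x / rt x ^ 3) * norm (f x)" .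
    next
      fix x y :: real
      have "1 / rt x \<le> 1" "1 / rt y \<ge> 0" using rt_ge_1[of x] rt_pos[of y] by (auto simp: order.strict_implies_order)
      then show "- (1 / rt y) - - (1 / rt x) \<le> 1" by linarith
    qed (use xy K0 K1 in auto)
    then show "norm ((wkb_P N \<nu> y, wkb_R N \<nu> y) - (wkb_P N \<nu> x, wkb_R N \<nu> x))
         \<le> 12 * C / \<nu> ^ (N + 1) * norm (wkb_P N \<nu> x, wkb_R N \<nu> x)"
      by (simp add: f_def K_def)
  qed
qed

section \<open>Limits of the amplitudes at the two ends of the half-line\<close>

lemma isCont_bes_fun_compose: "isCont (\<lambda>x. bes_fun (\<i> * of_real \<nu>) (of_real ((\<nu> * x / 2)\<^sup>2))) x"
proof -
  have "isCont (\<lambda>x. complex_of_real ((\<nu> * x / 2)\<^sup>2)) x" by (intro continuous_intros) auto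
  then show ?thesis
    by (rule isCont_o2) (rule DERIV_isCont[OF has_field_derivative_bes_fun], simp)
qed

lemma isCont_bes_fun'_compose: "isCont (\<lambda>x. bes_fun' (\<i> * of_real \<nu>) (of_real ((\<nu> * x / 2)\<^sup>2))) x"
proof -
  have "isCont (\<lambda>x. complex_of_real ((\<nu> * x / 2)\<^sup>2)) x" by (intro continuous_intros) auto
  moreover obtain g where "(bes_fun' (\<i> * of_real \<nu>) has_field_derivative g) (at (of_real ((\<nu> * x / 2)\<^sup>2)))"
    using has_field_derivative_bes_fun'[of "\<i> * of_real \<nu>"] by fastforce
  ultimately show ?thesis
    using isCont_o2[OF _ DERIV_isCont] by blast
qed

lemma bes_fun_0: "bes_fun \<mu> 0 = rGamma (\<mu> + 1)"
  unfolding bes_fun_def powser_zero by (simp add: bes_coeff_def)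

text \<open>In \<open>P\<close> the oscillating factors \<open>exp (- \<i> \<nu> ln x)\<close> and
  \<open>exp (\<i> \<nu> ln x)\<close> cancel and leave a function \<open>p\<close> that is
  continuous and nonzero at 0. In \<open>R\<close> they reinforce each other, but they do not affect
  the modulus, and the remaining factor vanishes at 0.\<close>

lemma wkb_PR_at_0:
  assumes nu: "\<nu> > 0"
  obtains P0 where "(wkb_P N \<nu> \<longlongrightarrow> P0) (at_right 0)" "(wkb_R N \<nu> \<longlongrightarrow> 0) (at_right 0)" "P0 \<noteq> 0"
proof -
  define \<mu> where "\<mu> = \<i> * complex_of_real \<nu>"
  define G where "G x = bes_fun \<mu> (of_real ((\<nu> * x / 2)\<^sup>2))" for x :: real
  define G' where "G' x = bes_fun' \<mu> (of_real ((\<nu> * x / 2)\<^sup>2))" for x :: real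
  define H where "H x = of_real (1 / sqrt (rt x)) * (\<mu> * G x + 2 * of_real ((\<nu> * x / 2)\<^sup>2) * G' x)
     + of_real (x\<^sup>2 / 2 * (sqrt (rt x) / rt x ^ 3)) * G x" for x
  define a where "a x = \<i> * of_real (\<nu> * (ln (\<nu> / 2) - rt x + ln (1 + rt x)))" for x
  define p where "p x = exp (a x + cnj (wkb_Sr N \<nu> x)) * (of_real (sqrt (rt x)) * G x * cnj (wkb_sg N \<nu> x) - H x)" for x
  define q where "q x = exp (Re (wkb_Sr N \<nu> x)) * cmod (of_real (sqrt (rt x)) * G x * wkb_sg N \<nu> x - H x)" for x
  have c_rt: "isCont rt x" for x by (rule DERIV_isCont[OF has_real_derivative_rt])
  have c_bet: "isCont bet x" for x
    unfolding bet_def[abs_def] by (intro continuous_intros c_rt) auto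
  have c_poly: "isCont (\<lambda>x. poly p (bet x)) x" for p x
    by (intro isCont_o2[OF c_bet]) simp
  have c_g: "isCont (\<lambda>x. wkb_g N \<nu> (bet x)) x" for x
    unfolding wkb_g_def by (intro continuous_intros c_poly)
  have c_Sr: "isCont (wkb_Sr N \<nu>) x" for x
    unfolding wkb_Sr_def[abs_def] by (intro continuous_intros c_poly)
  have c_sg: "isCont (wkb_sg N \<nu>) x" for x
    unfolding wkb_sg_def[abs_def] by (intro continuous_intros c_poly c_g)
  have c_G: "isCont G x" "isCont G' x" for x
    unfolding G_def[abs_def] G'_def[abs_def] \<mu>_def by (rule isCont_bes_fun_compose isCont_bes_fun'_compose)+
  have c_H: "isCont H x" for x
    unfolding H_def[abs_def] by (intro continuous_intros c_rt c_G) auto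
  have one_rt: "1 + rt x \<noteq> 0" for x using rt_pos[of x] by linarith
  have c_a: "isCont a x" for x
    unfolding a_def[abs_def] using one_rt by (intro continuous_intros c_rt) auto
  have c_p: "isCont p 0"
    unfolding p_def[abs_def] isCont_def
    by (intro tendsto_intros c_Sr[unfolded isCont_def] c_sg[unfolded isCont_def] c_H[unfolded isCont_def]
        c_a[unfolded isCont_def] c_G[unfolded isCont_def] c_rt[unfolded isCont_def])
  have c_q: "isCont q 0"
    unfolding q_def[abs_def] isCont_def
    by (intro tendsto_intros c_Sr[unfolded isCont_def] c_sg[unfolded isCont_def] c_H[unfolded isCont_def]
        c_a[unfolded isCont_def] c_G[unfolded isCont_def] c_rt[unfolded isCont_def])
  have v: "bes_v \<nu> x = exp (\<mu> * of_real (ln (\<nu> * x / 2))) * (of_real (sqrt (rt x)) * G x)" if "x > 0" for x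
    using that nu by (simp add: bes_v_def bes_y_eq G_def \<mu>_def)
  have vd: "bes_vd \<nu> x = exp (\<mu> * of_real (ln (\<nu> * x / 2))) * H x" if "x > 0" for x
    using that nu bes_y_eq[of "\<nu> * x" \<nu>]
    by (simp add: bes_vd_def bes_yd_def G_def G'_def H_def \<mu>_def algebra_simps)
  have rho: "rho x = rt x - ln (1 + rt x) + ln x" if "x > 0" for x
  proof -
    have "1 + rt x > 0" using rt_pos[of x] by linarith
    then show ?thesis using that by (simp add: rho_def rt_def ln_div add.commute)
  qed
  have P: "wkb_P N \<nu> x = p x" if x: "x > 0" for x
  proof -
    have "exp (cnj (wkb_S N \<nu> x)) * exp (\<mu> * of_real (ln (\<nu> * x / 2))) = exp (a x + cnj (wkb_Sr N \<nu> x))"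
    proof -
      have "ln (\<nu> * x / 2) = ln (\<nu> / 2) + ln x"
        using x nu by (simp add: ln_div ln_mult)
      then have "cnj (wkb_S N \<nu> x) + \<mu> * of_real (ln (\<nu> * x / 2)) = a x + cnj (wkb_Sr N \<nu> x)"
        unfolding wkb_S_def rho[OF x] a_def \<mu>_def by (simp add: algebra_simps)
      then show ?thesis by (simp only: exp_add[symmetric])
    qed
    moreover have "wkb_P N \<nu> x = (exp (cnj (wkb_S N \<nu> x)) * exp (\<mu> * of_real (ln (\<nu> * x / 2)))) * (of_real (sqrt (rt x)) * G x * cnj (wkb_sg N \<nu> x) - H x)"
      unfolding wkb_P_def v[OF x] vd[OF x] by (simp add: algebra_simps)
    ultimately show ?thesis by (simp add: p_def)
  qed
  have R: "cmod (wkb_R N \<nu> x) = q x" if x: "x > 0" for x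
  proof -
    have "wkb_R N \<nu> x = (exp (wkb_S N \<nu> x) * exp (\<mu> * of_real (ln (\<nu> * x / 2)))) * (of_real (sqrt (rt x)) * G x * wkb_sg N \<nu> x - H x)"
      unfolding wkb_R_def v[OF x] vd[OF x] by (simp add: algebra_simps)
    then show ?thesis
      by (simp add: q_def norm_mult norm_exp_eq_Re wkb_S_def) (simp add: \<mu>_def)
  qed
  have rt0: "rt 0 = 1" by (simp add: rt_def)
  \<comment> \<open>\<open>T\<close> vanishes at \<open>bet 0 = - \<i>\<close>, so all corrections
    to \<open>dS/d\<xi>\<close> disappear at \<open>x = 0\<close>; this is why the second amplitude
    is exactly zero there.\<close>
  have sg0: "wkb_sg N \<nu> 0 = \<mu>"
    by (simp add: wkb_sg_def T_poly_bet \<mu>_def)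
  have G0: "G 0 \<noteq> 0"
  proof -
    have "\<mu> + 1 \<notin> \<int>\<^sub>\<le>\<^sub>0" using nu by (auto simp: nonpos_Ints_def complex_eq_iff \<mu>_def)
    then show ?thesis by (simp add: G_def bes_fun_0 rGamma_eq_zero_iff)
  qed
  have H0: "H 0 = \<mu> * G 0" by (simp add: H_def rt0)
  have q0: "q 0 = 0" by (simp add: q_def rt0 sg0 H0)
  have "cnj \<mu> = - \<mu>" by (simp add: \<mu>_def)
  then have p0: "p 0 \<noteq> 0"
    using G0 nu by (simp add: p_def rt0 sg0 H0) (simp add: \<mu>_def)
  have lim: "(f \<longlongrightarrow> l) (at_right 0)" if "isCont h 0" "\<And>x. x > 0 \<Longrightarrow> f x = h x" "l = h 0" for f h :: "real \<Rightarrow> 'b :: real_normed_vector" and l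
  proof -
    have "(h \<longlongrightarrow> h 0) (at_right 0)"
      using that(1) by (simp add: isCont_def filterlim_at_split)
    then show ?thesis unfolding that(3)
      by (rule Lim_transform_eventually) (rule eventually_mono[OF eventually_at_right_less[of 0]], simp add: that(2))
  qed
  have "((\<lambda>x. cmod (wkb_R N \<nu> x)) \<longlongrightarrow> 0) (at_right 0)"
    by (rule lim[OF c_q]) (auto simp: R q0)
  then have "(wkb_R N \<nu> \<longlongrightarrow> 0) (at_right 0)"
    by (rule tendsto_norm_zero_cancel)
  moreover have "(wkb_P N \<nu> \<longlongrightarrow> p 0) (at_right 0)"
    by (rule lim[OF c_p]) (auto simp: P)
  ultimately show thesis using that p0 by blast
qed

lemma Im_wkb_S: "Im (wkb_S N \<nu> x) = \<nu> * rho x + (\<Sum>s=1..N. (1 / \<nu>) ^ s * E_hat s (1 / rt x))"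
proof -
  have eq: "Im (of_real (1 / \<nu>) ^ s * poly (E_poly s) (bet x)) = (1 / \<nu>) ^ s * E_hat s (1 / rt x)" for s
  proof -
    have "Im (of_real (1 / \<nu>) ^ s * poly (E_poly s) (bet x)) = (1 / \<nu>) ^ s * Im (poly (E_poly s) (bet x))"
      by (simp only: of_real_power[symmetric] times_complex.sel Re_complex_of_real Im_complex_of_real mult_zero_left add_0_right)
    then show ?thesis by (simp add: E_hat_def bet_def)
  qed
  show ?thesis
    by (simp only: wkb_S_def wkb_Sr_def plus_complex.sel Im_sum eq) simp
qed

text \<open>All \<open>E_s\<close> have constant term 0 and \<open>bet\<close> tends to 0, so no
  correction of any order is left at infinity.\<close>

lemma tendsto_wkb_Sr: "(wkb_Sr N \<nu> \<longlongrightarrow> 0) at_top"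
proof -
  have "((\<lambda>x. 1 / rt x) \<longlongrightarrow> 0) at_top"
    unfolding rt_def by real_asymp
  from tendsto_mult[OF tendsto_const[of "- \<i>"] tendsto_of_real[OF this]] have bet: "(bet \<longlongrightarrow> 0) at_top"
    unfolding bet_def[abs_def] by simp
  have "poly (E_poly s) 0 = 0" for s
    by (induction s rule: E_poly.induct) (simp_all add: poly_poly_antideriv_0)
  then have "((\<lambda>x. poly (E_poly s) (bet x)) \<longlongrightarrow> 0) at_top" for s
    using isCont_tendsto_compose[OF poly_isCont bet, of "E_poly s"] by simp
  then have "(wkb_Sr N \<nu> \<longlongrightarrow> (\<Sum>s=1..N. of_real (1 / \<nu>) ^ s * 0)) at_top"
    unfolding wkb_Sr_def[abs_def] by (intro tendsto_intros)
  then show ?thesis by simp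
qed

lemma tendsto_wkb_sg: "\<nu> \<ge> 1 \<Longrightarrow> ((\<lambda>x. Im (wkb_sg N \<nu> x)) \<longlongrightarrow> \<nu>) at_top"
proof -
  assume nu: "\<nu> \<ge> 1"
  obtain C where "C \<ge> 0" and C: "\<And>\<nu> x. \<nu> \<ge> 1 \<Longrightarrow> cmod (wkb_sg N \<nu> x - \<i> * of_real \<nu>) \<le> C * (x\<^sup>2 / (1 + x\<^sup>2)\<^sup>2)"
    using wkb_sg_bound[of N] by blast
  have "((\<lambda>x::real. x\<^sup>2 / (1 + x\<^sup>2)\<^sup>2) \<longlongrightarrow> 0) at_top" by real_asymp
  from tendsto_mult[OF tendsto_const[of C] this]
  have "((\<lambda>x. C * (x\<^sup>2 / (1 + x\<^sup>2)\<^sup>2)) \<longlongrightarrow> 0) at_top" by simp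
  then have "((\<lambda>x. wkb_sg N \<nu> x - \<i> * of_real \<nu>) \<longlongrightarrow> 0) at_top"
    by (rule Lim_null_comparison[rotated]) (use C[OF nu] in \<open>auto intro: always_eventually\<close>)
  from tendsto_Im[OF this] have "((\<lambda>x. Im (wkb_sg N \<nu> x) - \<nu>) \<longlongrightarrow> 0) at_top" by simp
  then show ?thesis by (simp add: LIM_zero_iff)
qed

text \<open>Since \<open>\<rho>(x) - x\<close> tends to 0, the approximate phase at infinity is that
  of the free wave \<open>cis (\<nu> x)\<close>, without an additional constant.\<close>

lemma wkb_phase_minus_linear: "((\<lambda>x. Im (wkb_S N \<nu> x) - \<nu> * x) \<longlongrightarrow> 0) at_top"
proof -
  have "((\<lambda>x. rho x - x) \<longlongrightarrow> 0) at_top"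
    unfolding rho_def by real_asymp
  then have "((\<lambda>x. \<nu> * (rho x - x) + Im (wkb_Sr N \<nu> x)) \<longlongrightarrow> \<nu> * 0 + Im 0) at_top"
    by (intro tendsto_intros tendsto_wkb_Sr)
  then show ?thesis by (simp add: wkb_S_def algebra_simps)
qed

text \<open>For all \<open>x\<close>, \<open>(P, R)\<close> stays within \<open>K |P0|\<close> of
  its limit \<open>(P0, 0)\<close> at 0. Only the argument of \<open>P0\<close> is then unknown;
  comparison with the behaviour at infinity replaces \<open>P0\<close> by \<open>W * a\<close>,
  whose argument is explicit.\<close>

lemma bes_y_uniform:
  obtains n0 C where "n0 \<ge> 1" "C \<ge> 0"
    "\<And>\<nu> x. \<nu> \<ge> n0 \<Longrightarrow> x > 0 \<Longrightarrow> \<exists>c>0. \<exists>\<eta>. cmod \<eta> \<le> C / \<nu> ^ (N + 1) \<and>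
       bes_y \<nu> (\<nu> * x) = of_real c * cis (Im (wkb_S N \<nu> x) - pi / 4) * (1 + \<eta>)"
proof -
  obtain n0 C where n0: "n0 \<ge> 1" "C \<ge> 0" and near:
    "\<And>\<nu> x y. \<nu> \<ge> n0 \<Longrightarrow> 0 < x \<Longrightarrow> x \<le> y \<Longrightarrow>
       norm ((wkb_P N \<nu> y, wkb_R N \<nu> y) - (wkb_P N \<nu> x, wkb_R N \<nu> x))
         \<le> C / \<nu> ^ (N + 1) * norm (wkb_P N \<nu> x, wkb_R N \<nu> x)"
    using wkb_PR_nearly_constant[of N] by blast
  obtain n1 where n1: "n1 \<ge> 1" "\<And>\<nu> x. \<nu> \<ge> n1 \<Longrightarrow> Im (wkb_sg N \<nu> x) \<ge> \<nu> / 2"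
    using Im_wkb_sg_ge[of N] by blast
  show thesis
  proof (rule that[of "max (max n0 n1) (4 * C)" "8 * C"])
    show "max (max n0 n1) (4 * C) \<ge> 1" "8 * C \<ge> 0" using n0 by auto
    fix \<nu> x0 :: real assume nu: "\<nu> \<ge> max (max n0 n1) (4 * C)" and x0: "x0 > 0"
    have nu1: "\<nu> \<ge> 1" "\<nu> \<ge> n0" "\<nu> \<ge> n1" using nu n0 by auto
    then have nu0: "\<nu> > 0" by simp
    define K where "K = C / \<nu> ^ (N + 1)"
    have K0: "K \<ge> 0" using n0 nu0 by (simp add: K_def)
    have "\<nu> \<le> \<nu> ^ (N + 1)" using nu1 by (simp add: self_le_power)
    then have "4 * C \<le> \<nu> ^ (N + 1)" using nu by simp
    then have K1: "K \<le> 1 / 4" using nu0 by (simp add: K_def field_simps)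
    obtain P0 where P0: "(wkb_P N \<nu> \<longlongrightarrow> P0) (at_right 0)" "(wkb_R N \<nu> \<longlongrightarrow> 0) (at_right 0)" "P0 \<noteq> 0"
      using wkb_PR_at_0[OF nu0] by blast
    have PR: "cmod (wkb_P N \<nu> y - P0) \<le> K * cmod P0" "cmod (wkb_R N \<nu> y) \<le> K * cmod P0" if y: "y > 0" for y
    proof -
      have l1: "((\<lambda>x. norm ((wkb_P N \<nu> y, wkb_R N \<nu> y) - (wkb_P N \<nu> x, wkb_R N \<nu> x))) \<longlongrightarrow>
          norm ((wkb_P N \<nu> y, wkb_R N \<nu> y) - (P0, 0))) (at_right 0)"
        by (intro tendsto_intros P0)
      have l2: "((\<lambda>x. K * norm (wkb_P N \<nu> x, wkb_R N \<nu> x)) \<longlongrightarrow> K * norm (P0, 0::complex)) (at_right 0)"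
        by (intro tendsto_intros P0)
      have l3: "\<forall>\<^sub>F x in at_right 0. norm ((wkb_P N \<nu> y, wkb_R N \<nu> y) - (wkb_P N \<nu> x, wkb_R N \<nu> x))
          \<le> K * norm (wkb_P N \<nu> x, wkb_R N \<nu> x)"
        using eventually_at_right_real[OF y]
        by eventually_elim (use near[OF nu1(2)] in \<open>auto simp: K_def\<close>)
      have "norm ((wkb_P N \<nu> y, wkb_R N \<nu> y) - (P0, 0)) \<le> K * norm (P0, 0::complex)"
        by (rule tendsto_le[OF trivial_limit_at_right_real l2 l1 l3])
      then have *: "norm (wkb_P N \<nu> y - P0, wkb_R N \<nu> y) \<le> K * cmod P0" by (simp add: norm_Pair)
      show "cmod (wkb_P N \<nu> y - P0) \<le> K * cmod P0" using norm_fst_le order_trans[OF _ *] by blast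
      show "cmod (wkb_R N \<nu> y) \<le> K * cmod P0" using norm_snd_le order_trans[OF _ *] by blast
    qed
    define L where "L x = wkb_P N \<nu> x * exp (\<i> * of_real (Im (wkb_S N \<nu> x))) - wkb_R N \<nu> x * exp (- (\<i> * of_real (Im (wkb_S N \<nu> x))))" for x
    have L: "cmod (L x - P0 * cis (Im (wkb_S N \<nu> x))) \<le> 2 * (K * cmod P0)" if "x > 0" for x
    proof -
      have "L x - P0 * cis (Im (wkb_S N \<nu> x)) = (wkb_P N \<nu> x - P0) * exp (\<i> * of_real (Im (wkb_S N \<nu> x))) - wkb_R N \<nu> x * exp (- (\<i> * of_real (Im (wkb_S N \<nu> x))))"
        by (simp add: L_def cis_conv_exp algebra_simps)
      also have "cmod \<dots> \<le> cmod (wkb_P N \<nu> x - P0) + cmod (wkb_R N \<nu> x)"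
        by (rule order_trans[OF norm_triangle_ineq4]) (simp add: norm_mult norm_exp_eq_Re)
      finally show ?thesis using PR[OF that] by simp
    qed
    obtain a b D where asy: "\<And>t. t \<ge> 1 \<Longrightarrow> cmod (bes_u \<nu> t - (a * cis t + b * cis (- t))) \<le> D / t"
      using bes_u_asymp[of \<nu>] by blast
    define A where "A = exp (pi * \<nu> / 2) / sqrt (2 * pi)"
    have A: "A > 0" by (simp add: A_def)
    have a: "a = of_real A * cis (- pi / 4)"
      unfolding A_def by (rule bes_u_asymp_phase[OF asy])
    \<comment> \<open>\<open>w\<close> collects the prefactors between \<open>L\<close> and
      \<open>bes_u\<close>. It converges to \<open>W\<close>, because \<open>Re S\<close> tends to 0
      and \<open>Im sg\<close> tends to \<open>\<nu>\<close>.\<close>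
    define w where "w x = of_real (exp (Re (wkb_S N \<nu> x)) * (sqrt (rt x) / sqrt (\<nu> * x)) * Im (wkb_sg N \<nu> x)) * (- 2 * \<i>)" for x
    define W where "W = of_real (sqrt \<nu>) * (- 2 * \<i>)"
    have Lw: "L x = w x * bes_u \<nu> (\<nu> * x)" if "x > 0" for x
    proof -
      have "sqrt (\<nu> * x) > 0" using that nu0 by simp
      then have "complex_of_real (sqrt (\<nu> * x)) \<noteq> 0" by (metis of_real_eq_0_iff less_irrefl)
      then show ?thesis
        unfolding L_def wkb_v_eq bes_v_def w_def bes_u_def by (simp add: field_simps del: of_real_mult) (simp add: mult_ac)
    qed
    have wlim: "(w \<longlongrightarrow> W) at_top"
    proof -
      have "((\<lambda>x. sqrt (rt x) / sqrt (\<nu> * x)) \<longlongrightarrow> inverse (\<nu> powr (1 / 2))) at_top"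
        unfolding rt_def using nu0 by real_asymp
      then have "((\<lambda>x. sqrt (rt x) / sqrt (\<nu> * x)) \<longlongrightarrow> 1 / sqrt \<nu>) at_top"
        using nu0 by (simp add: powr_half_sqrt inverse_eq_divide)
      moreover have "((\<lambda>x. Re (wkb_S N \<nu> x)) \<longlongrightarrow> Re 0) at_top"
        using tendsto_Re[OF tendsto_wkb_Sr[of N \<nu>]] by (simp add: wkb_S_def)
      ultimately have "(w \<longlongrightarrow> of_real (exp (Re 0) * (1 / sqrt \<nu>) * \<nu>) * (- 2 * \<i>)) at_top"
        unfolding w_def[abs_def] using tendsto_wkb_sg[OF nu1(1), of N]
        by (intro tendsto_mult tendsto_of_real tendsto_exp tendsto_const)
      moreover have "exp (Re 0) * (1 / sqrt \<nu>) * \<nu> = sqrt \<nu>"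
        using nu0 by (simp add: real_div_sqrt)
      ultimately show ?thesis by (simp only: W_def)
    qed
    have cW: "cmod (W * a - P0) \<le> 2 * (K * cmod P0)"
    proof -
      have F1: "((\<lambda>x. bes_u \<nu> (\<nu> * x) - (a * cis (\<nu> * x) + b * cis (- (\<nu> * x)))) \<longlongrightarrow> 0) at_top"
      proof (rule Lim_null_comparison)
        have "((\<lambda>x. D / (\<nu> * x)) \<longlongrightarrow> 0) at_top" using nu0 by real_asymp
        then show "((\<lambda>x. D / (\<nu> * x)) \<longlongrightarrow> 0) at_top" .
        show "\<forall>\<^sub>F x in at_top. norm (bes_u \<nu> (\<nu> * x) - (a * cis (\<nu> * x) + b * cis (- (\<nu> * x)))) \<le> D / (\<nu> * x)"
          using eventually_ge_at_top[of 1]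
        proof eventually_elim
          case (elim x)
          then have "\<nu> * x \<ge> 1 * 1" using nu1 by (intro mult_mono) auto
          then show ?case by (intro asy) simp
        qed
      qed
      define M where "M = cmod a + cmod b + 1"
      have bnd: "\<forall>\<^sub>F x in at_top. cmod (bes_u \<nu> (\<nu> * x)) \<le> M"
      proof -
        have "\<forall>\<^sub>F x in at_top. cmod (bes_u \<nu> (\<nu> * x) - (a * cis (\<nu> * x) + b * cis (- (\<nu> * x)))) < 1"
          using tendstoD[OF F1, of 1] by (simp add: dist_norm)
        then show ?thesis
        proof eventually_elim
          case (elim x)
          have "cmod (bes_u \<nu> (\<nu> * x)) \<le> cmod (bes_u \<nu> (\<nu> * x) - (a * cis (\<nu> * x) + b * cis (- (\<nu> * x)))) + cmod (a * cis (\<nu> * x) + b * cis (- (\<nu> * x)))"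
            using norm_triangle_ineq[of "bes_u \<nu> (\<nu> * x) - (a * cis (\<nu> * x) + b * cis (- (\<nu> * x)))" "a * cis (\<nu> * x) + b * cis (- (\<nu> * x))"] by simp
          also have "cmod (a * cis (\<nu> * x) + b * cis (- (\<nu> * x))) \<le> cmod a + cmod b"
            by (rule order_trans[OF norm_triangle_ineq]) (simp add: norm_mult)
          finally show ?case using elim by (simp add: M_def)
        qed
      qed
      have F2: "((\<lambda>x. (w x - W) * bes_u \<nu> (\<nu> * x)) \<longlongrightarrow> 0) at_top"
      proof (rule Lim_null_comparison)
        have "((\<lambda>x. cmod (w x - W) * M) \<longlongrightarrow> cmod (W - W) * M) at_top"
          by (intro tendsto_intros wlim)
        then show "((\<lambda>x. cmod (w x - W) * M) \<longlongrightarrow> 0) at_top" by simp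
        show "\<forall>\<^sub>F x in at_top. norm ((w x - W) * bes_u \<nu> (\<nu> * x)) \<le> cmod (w x - W) * M"
          using bnd by eventually_elim (auto simp: norm_mult intro: mult_left_mono)
      qed
      have F3: "((\<lambda>x. P0 * (cis (Im (wkb_S N \<nu> x) - \<nu> * x) - 1)) \<longlongrightarrow> P0 * (cis 0 - 1)) at_top"
        by (intro tendsto_intros wkb_phase_minus_linear isCont_tendsto_compose[where g = cis])
      \<comment> \<open>After multiplication by \<open>cis (- \<nu> x)\<close> the wanted wave
        becomes the constant \<open>a\<close> and the other one
        \<open>b * cis (- 2 * \<nu> * x)\<close>.\<close>
      define Q where "Q x = cmod (W * (a + b * cis (- 2 * \<nu> * x)) - P0)" for x
      have Q: "\<forall>\<^sub>F x in at_top. Q x \<le> 2 * (K * cmod P0) + e" if e: "e > 0" for e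
      proof -
        have "\<forall>\<^sub>F x in at_top. cmod ((w x - W) * bes_u \<nu> (\<nu> * x)) < e / 3"
          "\<forall>\<^sub>F x in at_top. cmod (W * (bes_u \<nu> (\<nu> * x) - (a * cis (\<nu> * x) + b * cis (- (\<nu> * x))))) < e / 3"
          "\<forall>\<^sub>F x in at_top. cmod (P0 * (cis (Im (wkb_S N \<nu> x) - \<nu> * x) - 1)) < e / 3"
          using tendstoD[OF F2, of "e / 3"] tendstoD[OF tendsto_mult[OF tendsto_const[of W] F1], of "e / 3"] tendstoD[OF F3, of "e / 3"] e
          by (simp_all add: dist_norm)
        then show ?thesis
          using eventually_gt_at_top[of 0]
        proof eventually_elim
          case (elim x)
          define z where "z = cis (- (\<nu> * x))"
          have z: "cmod z = 1" by (simp add: z_def)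
          have c: "cis (\<nu> * x) * z = 1" "cis (- (\<nu> * x)) * z = cis (- 2 * \<nu> * x)"
             "cis (Im (wkb_S N \<nu> x)) * z = cis (Im (wkb_S N \<nu> x) - \<nu> * x)"
            by (simp_all add: z_def cis_mult mult.assoc)
          have "W * (a + b * cis (- 2 * \<nu> * x)) - P0 = z * (L x - P0 * cis (Im (wkb_S N \<nu> x)))
             + P0 * (cis (Im (wkb_S N \<nu> x) - \<nu> * x) - 1)
             - z * ((w x - W) * bes_u \<nu> (\<nu> * x)) - z * (W * (bes_u \<nu> (\<nu> * x) - (a * cis (\<nu> * x) + b * cis (- (\<nu> * x)))))"
          proof -
            have "z * (L x - P0 * cis (Im (wkb_S N \<nu> x)))
             + P0 * (cis (Im (wkb_S N \<nu> x) - \<nu> * x) - 1)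
             - z * ((w x - W) * bes_u \<nu> (\<nu> * x)) - z * (W * (bes_u \<nu> (\<nu> * x) - (a * cis (\<nu> * x) + b * cis (- (\<nu> * x)))))
             = W * (a * (cis (\<nu> * x) * z) + b * (cis (- (\<nu> * x)) * z)) - P0 * (cis (Im (wkb_S N \<nu> x)) * z) + P0 * (cis (Im (wkb_S N \<nu> x) - \<nu> * x) - 1)"
              unfolding Lw[OF elim(4)] by (simp only: algebra_simps)
            then show ?thesis unfolding c by (simp add: algebra_simps)
          qed
          then have "Q x \<le> cmod (z * (L x - P0 * cis (Im (wkb_S N \<nu> x)))) + cmod (P0 * (cis (Im (wkb_S N \<nu> x) - \<nu> * x) - 1))
             + cmod (z * ((w x - W) * bes_u \<nu> (\<nu> * x))) + cmod (z * (W * (bes_u \<nu> (\<nu> * x) - (a * cis (\<nu> * x) + b * cis (- (\<nu> * x))))))"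
            unfolding Q_def by (simp only:) (intro order_trans[OF norm_triangle_ineq4] add_mono norm_triangle_ineq order_refl)
          also have "\<dots> = cmod (L x - P0 * cis (Im (wkb_S N \<nu> x))) + cmod (P0 * (cis (Im (wkb_S N \<nu> x) - \<nu> * x) - 1))
             + cmod ((w x - W) * bes_u \<nu> (\<nu> * x)) + cmod (W * (bes_u \<nu> (\<nu> * x) - (a * cis (\<nu> * x) + b * cis (- (\<nu> * x)))))"
            by (simp only: norm_mult[of z] z mult_1)
          also have "\<dots> \<le> 2 * (K * cmod P0) + e"
            using L[OF elim(4)] elim(1-3) by linarith
          finally show ?case .
        qed
      qed
      \<comment> \<open>Arbitrarily large \<open>x\<close> realise every value of
        \<open>2 \<nu> x\<close> modulo \<open>2 \<pi>\<close>, so the bound on \<open>Q\<close>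
        holds for an arbitrary relative phase \<open>th\<close>.\<close>
      have Qn: "cmod (W * (a + b * cis (- th)) - P0) \<le> 2 * (K * cmod P0)" for th
      proof (rule field_le_epsilon)
        fix e :: real assume e: "e > 0"
        obtain X where X: "\<And>x. x \<ge> X \<Longrightarrow> Q x \<le> 2 * (K * cmod P0) + e"
          using Q[OF e] unfolding eventually_at_top_linorder by blast
        obtain n :: nat where n: "real n > (2 * \<nu> * \<bar>X\<bar> + \<bar>th\<bar>) / (2 * pi)" using reals_Archimedean2 by blast
        define x where "x = (2 * pi * real n + th) / (2 * \<nu>)"
        have "2 * pi * real n > 2 * \<nu> * \<bar>X\<bar> + \<bar>th\<bar>"
          using n by (simp add: field_simps)
        then have "2 * pi * real n + th \<ge> 2 * \<nu> * \<bar>X\<bar>" by linarith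
        then have "x \<ge> \<bar>X\<bar>"
          using nu0 by (simp add: x_def pos_le_divide_eq mult_ac)
        then have "Q x \<le> 2 * (K * cmod P0) + e" by (intro X) simp
        moreover have "- 2 * \<nu> * x = - th - 2 * pi * real n"
          using nu0 by (simp add: x_def)
        moreover have "cis (- th - 2 * pi * real n) = cis (- th)"
          using cis_multiple_2pi[of "real n"] by (simp add: cis_divide[symmetric])
        ultimately show "cmod (W * (a + b * cis (- th)) - P0) \<le> 2 * (K * cmod P0) + e"
          by (simp add: Q_def)
      qed
      \<comment> \<open>Averaging over the relative phases 0 and \<open>\<pi>\<close> eliminates the
        unknown amplitude \<open>b\<close>.\<close>
      have cm: "cis (- pi) = - 1" by (simp add: complex_eq_iff)
      have "2 * (W * a - P0) = (W * (a + b * cis (- 0)) - P0) + (W * (a + b * cis (- pi)) - P0)"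
        by (simp add: algebra_simps cm)
      then have "cmod (2 * (W * a - P0)) \<le> 2 * (K * cmod P0) + 2 * (K * cmod P0)"
        by (simp only:) (intro norm_triangle_mono Qn)
      then show ?thesis by (simp only: norm_mult) simp
    qed
    define c where "c = W * a"
    have cn: "cmod c = 2 * sqrt \<nu> * A"
      using A nu0 by (simp add: c_def W_def a norm_mult)
    then have c0: "c \<noteq> 0" using A nu0 by auto
    \<comment> \<open>With \<open>K \<le> 1/4\<close> an error relative to \<open>P0\<close> becomes
      one relative to \<open>c\<close>, at the cost of a factor 2.\<close>
    have P0c: "cmod P0 \<le> 2 * cmod c"
    proof -
      have "cmod P0 \<le> cmod c + cmod (c - P0)"
        using norm_triangle_sub[of P0 c] by (simp add: norm_minus_commute)
      also have "\<dots> \<le> cmod c + 2 * (1 / 4 * cmod P0)"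
        using cW K1 by (intro add_left_mono order_trans[OF cW[folded c_def]] mult_left_mono mult_right_mono) auto
      finally show ?thesis by simp
    qed
    define \<eta> where "\<eta> = (L x0 - c * cis (Im (wkb_S N \<nu> x0))) / (c * cis (Im (wkb_S N \<nu> x0)))"
    have "L x0 - c * cis (Im (wkb_S N \<nu> x0)) = (L x0 - P0 * cis (Im (wkb_S N \<nu> x0))) - (c - P0) * cis (Im (wkb_S N \<nu> x0))"
      by (simp add: algebra_simps)
    then have "cmod (L x0 - c * cis (Im (wkb_S N \<nu> x0))) \<le> cmod (L x0 - P0 * cis (Im (wkb_S N \<nu> x0))) + cmod ((c - P0) * cis (Im (wkb_S N \<nu> x0)))"
      by (metis norm_triangle_ineq4)
    also have "\<dots> \<le> 2 * (K * cmod P0) + 2 * (K * cmod P0)"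
      using L[OF x0] cW by (simp add: norm_mult c_def)
    also have "\<dots> = 4 * (K * cmod P0)" by simp
    also have "\<dots> \<le> 4 * (K * (2 * cmod c))"
      using P0c K0 by (intro mult_left_mono) auto
    finally have eta: "cmod \<eta> \<le> 8 * K"
      using c0 by (simp add: \<eta>_def norm_divide norm_mult divide_le_eq)
    have "L x0 = c * cis (Im (wkb_S N \<nu> x0)) * (1 + \<eta>)"
      using c0 by (simp add: \<eta>_def field_simps)
    define B where "B = exp (Re (wkb_S N \<nu> x0)) * sqrt (rt x0) * Im (wkb_sg N \<nu> x0)"
    have "Im (wkb_sg N \<nu> x0) > 0" using n1(2)[OF nu1(3), of x0] nu0 by linarith
    then have B: "B > 0" by (simp add: B_def)
    have "L x0 = of_real B * bes_y \<nu> (\<nu> * x0) * (- 2 * \<i>)"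
      unfolding L_def wkb_v_eq bes_v_def B_def by simp
    then have "of_real B * bes_y \<nu> (\<nu> * x0) * (- 2 * \<i>) = of_real (sqrt \<nu> * A) * (cis (- pi / 4) * cis (Im (wkb_S N \<nu> x0))) * (1 + \<eta>) * (- 2 * \<i>)"
      using \<open>L x0 = c * cis (Im (wkb_S N \<nu> x0)) * (1 + \<eta>)\<close> by (simp add: c_def W_def a mult_ac)
    then have "of_real B * bes_y \<nu> (\<nu> * x0) = of_real (sqrt \<nu> * A) * (cis (- pi / 4) * cis (Im (wkb_S N \<nu> x0))) * (1 + \<eta>)"
      by (subst (asm) mult_right_cancel) auto
    moreover have "cis (- pi / 4) * cis (Im (wkb_S N \<nu> x0)) = cis (Im (wkb_S N \<nu> x0) - pi / 4)"
      by (simp add: cis_mult)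
    ultimately have "bes_y \<nu> (\<nu> * x0) = of_real (sqrt \<nu> * A / B) * cis (Im (wkb_S N \<nu> x0) - pi / 4) * (1 + \<eta>)"
      using B by (simp add: field_simps)
    moreover have "sqrt \<nu> * A / B > 0" using A B nu0 by simp
    ultimately show "\<exists>c>0. \<exists>\<eta>. cmod \<eta> \<le> 8 * C / \<nu> ^ (N + 1) \<and>
       bes_y \<nu> (\<nu> * x0) = of_real c * cis (Im (wkb_S N \<nu> x0) - pi / 4) * (1 + \<eta>)"
      using eta unfolding K_def
      by (intro exI[of _ "sqrt \<nu> * A / B"] conjI exI[of _ \<eta>]) (simp_all only: times_divide_eq_right)
  qed
qed

subsection \<open>Taylor series of smooth functions as formal power series\<close>

definition taylor :: "(real \<Rightarrow> real) \<Rightarrow> real \<Rightarrow> real fps" where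
  "taylor f x = Abs_fps (\<lambda>k. (deriv ^^ k) f x / fact k)"

lemma formal_subst_taylor: "formal_subst f c = taylor f (c 0) oo (Abs_fps c - fps_const (c 0))"
  by (simp add: formal_subst_def taylor_def)

text \<open>A family of Taylor series is described by how it depends on the base point: the
  derivative of the \<open>k\<close>-th coefficient is the \<open>k\<close>-th coefficient of the
  formal derivative. In this form the Leibniz rule gives closure under products, and iterated
  derivatives need not be computed.\<close>

definition taylor_on_pos :: "(real \<Rightarrow> real) \<Rightarrow> (real \<Rightarrow> real fps) \<Rightarrow> bool" where
  "taylor_on_pos f T \<longleftrightarrow> (\<forall>x>0. fps_nth (T x) 0 = f x \<and>
     (\<forall>k. ((\<lambda>x. fps_nth (T x) k) has_real_derivative fps_nth (fps_deriv (T x)) k) (at x)))"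

text \<open>The condition on coefficient \<open>k\<close> determines coefficient
  \<open>k + 1\<close>, starting from \<open>f\<close> itself.\<close>

lemma taylor_on_pos_unique:
  assumes "taylor_on_pos f T" "x > 0"
  shows "taylor f x = T x"
proof -
  have ev: "\<forall>\<^sub>F y in nhds x. y > 0" if "x > 0" for x :: real
    using eventually_nhds_in_open[of "{0<..}" x] that by simp
  have "(deriv ^^ k) f x = fact k * fps_nth (T x) k" if "x > 0" for k x
    using that
  proof (induction k arbitrary: x)
    case 0
    then show ?case using assms(1) by (simp add: taylor_on_pos_def)
  next
    case (Suc k)
    have "((\<lambda>x. fact k * fps_nth (T x) k) has_real_derivative fact k * fps_nth (fps_deriv (T x)) k) (at x)"
      using assms(1) Suc.prems by (intro DERIV_cmult) (auto simp: taylor_on_pos_def)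
    then have "((deriv ^^ k) f has_real_derivative fact k * fps_nth (fps_deriv (T x)) k) (at x)"
      by (subst DERIV_cong_ev[OF refl _ refl]) (use ev[OF Suc.prems] Suc.IH in \<open>auto elim: eventually_mono\<close>)
    then show ?case
      by (simp add: DERIV_imp_deriv algebra_simps)
  qed
  with assms(2) show ?thesis
    by (intro fps_ext) (simp add: taylor_def)
qed

lemma taylor_on_pos_cong:
  assumes "taylor_on_pos f T" "\<And>x. x > 0 \<Longrightarrow> f x = g x"
  shows "taylor_on_pos g T"
  using assms by (simp add: taylor_on_pos_def)

lemma taylor_on_pos_const: "taylor_on_pos (\<lambda>_. c) (\<lambda>_. fps_const c)"
  by (simp add: taylor_on_pos_def)

lemma taylor_on_pos_id: "taylor_on_pos (\<lambda>x. x) (\<lambda>x. fps_const x + fps_X)"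
proof -
  have "((\<lambda>x. fps_nth (fps_const x + fps_X) k) has_real_derivative (if k = 0 then 1 else 0)) (at x)" for k and x :: real
    by (cases k) (auto intro!: derivative_eq_intros)
  then show ?thesis by (simp add: taylor_on_pos_def)
qed

lemma taylor_on_pos_add:
  assumes "taylor_on_pos f T" "taylor_on_pos g U"
  shows "taylor_on_pos (\<lambda>x. f x + g x) (\<lambda>x. T x + U x)"
  using assms unfolding taylor_on_pos_def by (auto intro!: DERIV_add simp: distrib_left)

lemma taylor_on_pos_mult:
  assumes "taylor_on_pos f T" "taylor_on_pos g U"
  shows "taylor_on_pos (\<lambda>x. f x * g x) (\<lambda>x. T x * U x)"
  unfolding taylor_on_pos_def
proof (intro allI impI conjI)
  fix x :: real and k assume x: "x > 0"
  show "fps_nth (T x * U x) 0 = f x * g x"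
    using assms x by (simp add: taylor_on_pos_def)
  have "((\<lambda>x. \<Sum>i=0..k. fps_nth (T x) i * fps_nth (U x) (k - i)) has_real_derivative
     (\<Sum>i=0..k. fps_nth (T x) i * fps_nth (fps_deriv (U x)) (k - i) + fps_nth (fps_deriv (T x)) i * fps_nth (U x) (k - i))) (at x)"
  proof (intro DERIV_sum)
    fix i
    have "((\<lambda>x. fps_nth (T x) i * fps_nth (U x) (k - i)) has_real_derivative
       fps_nth (fps_deriv (T x)) i * fps_nth (U x) (k - i) + fps_nth (fps_deriv (U x)) (k - i) * fps_nth (T x) i) (at x)"
      using assms x unfolding taylor_on_pos_def by (intro DERIV_mult) auto
    then show "((\<lambda>x. fps_nth (T x) i * fps_nth (U x) (k - i)) has_real_derivative
       fps_nth (T x) i * fps_nth (fps_deriv (U x)) (k - i) + fps_nth (fps_deriv (T x)) i * fps_nth (U x) (k - i)) (at x)"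
      by (simp only: mult.commute add.commute)
  qed
  moreover have "(\<Sum>i=0..k. fps_nth (T x) i * fps_nth (fps_deriv (U x)) (k - i) + fps_nth (fps_deriv (T x)) i * fps_nth (U x) (k - i))
     = fps_nth (fps_deriv (T x * U x)) k"
    by (simp only: fps_deriv_mult fps_add_nth fps_mult_nth sum.distrib)
  ultimately show "((\<lambda>x. fps_nth (T x * U x) k) has_real_derivative fps_nth (fps_deriv (T x * U x)) k) (at x)"
    by (simp only: fps_mult_nth)
qed

definition bh :: "real \<Rightarrow> real" where "bh x = 1 / sqrt (1 + x\<^sup>2)"

lemma bh_pos [simp]: "bh x > 0" by (simp add: bh_def add_pos_nonneg)

lemma bh_sq: "bh x * bh x * (1 + x\<^sup>2) = 1"
proof -
  have "1 + x\<^sup>2 > 0" by (simp add: add_pos_nonneg)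
  then show ?thesis by (simp add: bh_def)
qed

lemma has_real_derivative_bh: "(bh has_real_derivative - (x * (bh x * bh x * bh x))) (at x)"
proof -
  have p: "1 + x\<^sup>2 > 0" by (simp add: add_pos_nonneg)
  then have "(bh has_real_derivative - (x / (sqrt (1 + x\<^sup>2) * sqrt (1 + x\<^sup>2) * sqrt (1 + x\<^sup>2)))) (at x)"
    unfolding bh_def[abs_def] by (auto intro!: derivative_eq_intros simp: field_simps)
  then show ?thesis by (simp add: bh_def)
qed

text \<open>A class of functions closed under differentiation; it contains the derivative of \<open>rho\<close>.\<close>

inductive elem :: "(real \<Rightarrow> real) \<Rightarrow> bool" where
  elem_const: "elem (\<lambda>_. c)"
| elem_id: "elem (\<lambda>x. x)"
| elem_inverse: "elem (\<lambda>x. 1 / x)"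
| elem_bh: "elem bh"
| elem_add: "elem f \<Longrightarrow> elem g \<Longrightarrow> elem (\<lambda>x. f x + g x)"
| elem_mult: "elem f \<Longrightarrow> elem g \<Longrightarrow> elem (\<lambda>x. f x * g x)"

lemma elem_deriv: "elem f \<Longrightarrow> \<exists>g. elem g \<and> (\<forall>x>0. (f has_real_derivative g x) (at x))"
proof (induction rule: elem.induct)
  case (elem_const c)
  show ?case by (intro exI[of _ "\<lambda>_. 0"]) (auto intro: elem.intros)
next
  case elem_id
  show ?case by (intro exI[of _ "\<lambda>_. 1"]) (auto intro: elem.intros)
next
  case elem_inverse
  have "elem (\<lambda>x. (- 1) * ((1 / x) * (1 / x)))" by (intro elem.intros)
  moreover have "((\<lambda>x. 1 / x) has_real_derivative (- 1) * ((1 / x) * (1 / x))) (at x)" if "x > 0" for x :: real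
    using that by (auto intro!: derivative_eq_intros)
  ultimately show ?case by blast
next
  case elem_bh
  have "elem (\<lambda>x. (- 1) * (x * (bh x * bh x * bh x)))" by (intro elem.intros)
  moreover have "(bh has_real_derivative (- 1) * (x * (bh x * bh x * bh x))) (at x)" for x
    using has_real_derivative_bh[of x] by simp
  ultimately show ?case by blast
next
  case (elem_add f g)
  then obtain f' g' where "elem f'" "elem g'" "\<And>x. x > 0 \<Longrightarrow> (f has_real_derivative f' x) (at x)"
    "\<And>x. x > 0 \<Longrightarrow> (g has_real_derivative g' x) (at x)" by blast
  then show ?case by (intro exI[of _ "\<lambda>x. f' x + g' x"]) (auto intro: elem.intros DERIV_add)
next
  case (elem_mult f g)
  then obtain f' g' where fg: "elem f'" "elem g'" "\<And>x. x > 0 \<Longrightarrow> (f has_real_derivative f' x) (at x)"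
    "\<And>x. x > 0 \<Longrightarrow> (g has_real_derivative g' x) (at x)" by blast
  have "elem (\<lambda>x. f' x * g x + g' x * f x)" using elem_mult fg by (auto intro: elem.intros)
  moreover have "((\<lambda>x. f x * g x) has_real_derivative f' x * g x + g' x * f x) (at x)" if "x > 0" for x
    using fg that by (intro DERIV_mult) auto
  ultimately show ?case by blast
qed

text \<open>Derivatives of functions in the class stay in it, so all iterated derivatives exist.
  Only the derivative of \<open>f\<close> is required to lie in the class, because
  \<open>\<rho>\<close> itself contains a logarithm.\<close>

lemma taylor_on_pos_if_elem_deriv:
  assumes g: "elem g" and fg: "\<And>x. x > 0 \<Longrightarrow> (f has_real_derivative g x) (at x)"
  shows "taylor_on_pos f (taylor f)"
proof -
  have "\<exists>h. elem h \<and> (\<forall>x>0. ((deriv ^^ k) f has_real_derivative h x) (at x))" for k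
  proof (induction k)
    case (Suc k)
    then obtain h where h: "elem h" "\<And>x. x > 0 \<Longrightarrow> ((deriv ^^ k) f has_real_derivative h x) (at x)" by blast
    obtain h' where h': "elem h'" "\<And>x. x > 0 \<Longrightarrow> (h has_real_derivative h' x) (at x)"
      using elem_deriv[OF h(1)] by blast
    have "((deriv ^^ Suc k) f has_real_derivative h' x) (at x)" if "x > 0" for x
    proof -
      have "\<forall>\<^sub>F y in nhds x. (deriv ^^ Suc k) f y = h y"
        using eventually_nhds_in_open[of "{0<..}" x] that DERIV_imp_deriv[OF h(2)] by (auto elim!: eventually_mono)
      then show ?thesis using h'(2)[OF that] by (subst DERIV_cong_ev[OF refl _ refl])
    qed
    with h'(1) show ?case by blast
  qed (use g fg in auto)
  then have d: "((deriv ^^ k) f has_real_derivative (deriv ^^ Suc k) f x) (at x)" if x: "x > 0" for k x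
  proof -
    obtain h where "((deriv ^^ k) f has_real_derivative h x) (at x)"
      using \<open>\<And>k. \<exists>h. elem h \<and> (\<forall>x>0. ((deriv ^^ k) f has_real_derivative h x) (at x))\<close> x by blast
    then show ?thesis by (simp add: DERIV_imp_deriv)
  qed
  show ?thesis
    unfolding taylor_on_pos_def
  proof (intro allI impI conjI)
    fix x :: real and k assume x: "x > 0"
    show "fps_nth (taylor f x) 0 = f x" by (simp add: taylor_def)
    show "((\<lambda>x. fps_nth (taylor f x) k) has_real_derivative fps_nth (fps_deriv (taylor f x)) k) (at x)"
      using DERIV_cdivide[OF d[OF x, of k], of "fact k"] by (simp add: taylor_def field_simps del: of_nat_Suc)
  qed
qed

lemma taylor_on_pos_bh: "taylor_on_pos bh (taylor bh)"
proof (rule taylor_on_pos_if_elem_deriv)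
  show "elem (\<lambda>x. (- 1) * (x * (bh x * bh x * bh x)))" by (intro elem.intros)
qed (use has_real_derivative_bh in simp)

lemma taylor_on_pos_rho: "taylor_on_pos rho (taylor rho)"
proof (rule taylor_on_pos_if_elem_deriv)
  show "elem (\<lambda>x. (1 / x) * ((1 + x * x) * bh x))" by (intro elem.intros)
  fix x :: real assume x: "x > 0"
  have "sqrt (x\<^sup>2 + 1) = (1 + x * x) * bh x"
    using real_div_sqrt[of "1 + x * x"] by (simp add: bh_def power2_eq_square add.commute)
  then have "sqrt (x\<^sup>2 + 1) / x = (1 / x) * ((1 + x * x) * bh x)"
    by simp
  then show "(rho has_real_derivative (1 / x) * ((1 + x * x) * bh x)) (at x)"
    using has_real_derivative_rho[OF x] by (simp only:)
qed

text \<open>An identity between functions passes to their Taylor series by uniqueness. This relation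
  and the next one give algebraic equations that survive the formal substitution.\<close>

lemma taylor_bh_identity:
  assumes "x > 0"
  shows "taylor bh x * taylor bh x * (1 + (fps_const x + fps_X) * (fps_const x + fps_X)) = 1"
proof -
  have 1: "taylor_on_pos (\<lambda>x. bh x * bh x * (1 + x * x)) (\<lambda>x. taylor bh x * taylor bh x * (fps_const 1 + (fps_const x + fps_X) * (fps_const x + fps_X)))"
    by (intro taylor_on_pos_mult taylor_on_pos_add taylor_on_pos_const taylor_on_pos_id taylor_on_pos_bh)
  have "taylor_on_pos (\<lambda>x. bh x * bh x * (1 + x * x)) (\<lambda>_. fps_const 1)"
    by (rule taylor_on_pos_cong[OF taylor_on_pos_const]) (use bh_sq in \<open>simp add: power2_eq_square\<close>)
  then show ?thesis
    using taylor_on_pos_unique[OF 1 assms] taylor_on_pos_unique[of _ "\<lambda>_. fps_const 1", OF _ assms] by simp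
qed

lemma fps_deriv_taylor_rho:
  assumes "x > 0"
  shows "fps_deriv (taylor rho x) * ((fps_const x + fps_X) * taylor bh x) = 1"
proof -
  have d: "taylor_on_pos (deriv rho) (\<lambda>x. fps_deriv (taylor rho x))"
    unfolding taylor_on_pos_def
  proof (intro allI impI conjI)
    fix x :: real and k assume x: "x > 0"
    show "fps_nth (fps_deriv (taylor rho x)) 0 = deriv rho x" by (simp add: taylor_def)
    have "((\<lambda>x. of_nat (k + 1) * fps_nth (taylor rho x) (k + 1)) has_real_derivative of_nat (k + 1) * fps_nth (fps_deriv (taylor rho x)) (k + 1)) (at x)"
      using taylor_on_pos_rho x unfolding taylor_on_pos_def by (intro DERIV_cmult) blast
    then show "((\<lambda>x. fps_nth (fps_deriv (taylor rho x)) k) has_real_derivative fps_nth (fps_deriv (fps_deriv (taylor rho x))) k) (at x)"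
      by simp
  qed
  have 1: "taylor_on_pos (\<lambda>x. deriv rho x * (x * bh x)) (\<lambda>x. fps_deriv (taylor rho x) * ((fps_const x + fps_X) * taylor bh x))"
    by (intro taylor_on_pos_mult taylor_on_pos_id taylor_on_pos_bh d)
  have "taylor_on_pos (\<lambda>x. deriv rho x * (x * bh x)) (\<lambda>_. fps_const 1)"
  proof (rule taylor_on_pos_cong[OF taylor_on_pos_const])
    fix x :: real assume x: "x > 0"
    have "sqrt (1 + x\<^sup>2) \<noteq> 0" using add_pos_nonneg[of 1 "x\<^sup>2"] by simp
    then show "1 = deriv rho x * (x * bh x)"
      using x DERIV_imp_deriv[OF has_real_derivative_rho[OF x]] by (simp add: bh_def add.commute)
  qed
  then show ?thesis
    using taylor_on_pos_unique[OF 1 assms] taylor_on_pos_unique[of _ "\<lambda>_. fps_const 1", OF _ assms] by simp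
qed

subsection \<open>The polynomials \<open>P\<^sub>s\<close> with \<open>E\<^sub>2\<^sub>s\<^sub>+\<^sub>1(b) = b P\<^sub>s(b\<^sup>2)\<close>\<close>

text \<open>The sign is the value of \<open>(- \<i>)^(2k + 2)\<close>, one factor
  \<open>- \<i>\<close> coming from \<open>E_hat\<close> and the others from its argument; only odd
  powers occur in \<open>E_(2s+1)\<close>.\<close>

definition P_poly :: "nat \<Rightarrow> real poly" where
  "P_poly s = (\<Sum>k\<le>degree (E_poly (2 * s + 1)). monom ((-1) ^ (k + 1) * Re (coeff (E_poly (2 * s + 1)) (2 * k + 1))) k)"

lemma coeff_P_poly: "coeff (P_poly s) k = (-1) ^ (k + 1) * Re (coeff (E_poly (2 * s + 1)) (2 * k + 1))"
proof -
  have "coeff (P_poly s) k = (\<Sum>j\<le>degree (E_poly (2 * s + 1)). if j = k then (-1) ^ (k + 1) * Re (coeff (E_poly (2 * s + 1)) (2 * k + 1)) else 0)"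
    unfolding P_poly_def coeff_sum by (intro sum.cong) auto
  then show ?thesis
    by (cases "k \<le> degree (E_poly (2 * s + 1))") (auto simp: coeff_eq_0)
qed

lemma E_hat_odd: "E_hat (2 * s + 1) b = b * poly (P_poly s) (b\<^sup>2)"
proof -
  define E where "E = E_poly (2 * s + 1)"
  define d where "d = degree E"
  have real: "coeff E i \<in> \<real>" and ev: "even i \<Longrightarrow> coeff E i = 0" for i
    using real_graded_E_poly[of "2 * s + 1"] by (auto simp: real_graded_def E_def)
  have "poly E (- \<i> * of_real b) = (\<Sum>i\<le>2 * d + 1. coeff E i * (- \<i> * of_real b) ^ i)"
    unfolding poly_altdef d_def by (intro sum.mono_neutral_left) (auto simp: coeff_eq_0)
  also have "\<dots> = (\<Sum>i\<in>(\<lambda>k. 2 * k + 1) ` {..d}. coeff E i * (- \<i> * of_real b) ^ i)"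
  proof (intro sum.mono_neutral_right ballI)
    fix i assume i: "i \<in> {..2 * d + 1} - (\<lambda>k. 2 * k + 1) ` {..d}"
    have "even i"
    proof (rule ccontr)
      assume "odd i"
      then obtain k where "i = 2 * k + 1" by (auto elim: oddE)
      with i show False by auto
    qed
    then show "coeff E i * (- \<i> * of_real b) ^ i = 0" by (simp add: ev)
  qed auto
  also have "\<dots> = (\<Sum>k\<le>d. coeff E (2 * k + 1) * (- \<i> * of_real b) ^ (2 * k + 1))"
    by (subst sum.reindex) (auto simp: inj_on_def)
  also have "- \<i> * \<dots> = (\<Sum>k\<le>d. of_real ((-1) ^ (k + 1) * Re (coeff E (2 * k + 1)) * (b * (b\<^sup>2) ^ k)))"
    unfolding sum_distrib_left
  proof (intro sum.cong refl)
    fix k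
    have "(- \<i> * complex_of_real b)\<^sup>2 = of_real (- (b\<^sup>2))" by (simp add: power_mult_distrib)
    then have "(- \<i> * complex_of_real b) ^ (2 * k + 1) = of_real ((- (b\<^sup>2)) ^ k) * (- \<i> * of_real b)"
      by (simp only: power_add power_mult power_one_right of_real_power)
    moreover have "coeff E (2 * k + 1) = of_real (Re (coeff E (2 * k + 1)))"
      using real by (simp add: of_real_Re)
    moreover have "(- (b\<^sup>2)) ^ k = (- 1) ^ k * (b\<^sup>2) ^ k" by (rule power_minus)
    ultimately have "- \<i> * (coeff E (2 * k + 1) * (- \<i> * of_real b) ^ (2 * k + 1))
      = - \<i> * (of_real (Re (coeff E (2 * k + 1))) * (of_real ((- 1) ^ k * (b\<^sup>2) ^ k) * (- \<i> * of_real b)))"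
      by metis
    also have "\<dots> = (\<i> * \<i>) * (of_real (Re (coeff E (2 * k + 1))) * (of_real ((- 1) ^ k * (b\<^sup>2) ^ k) * of_real b))"
      by algebra
    also have "\<dots> = of_real ((-1) ^ (k + 1) * Re (coeff E (2 * k + 1)) * (b * (b\<^sup>2) ^ k))"
      unfolding i_squared by simp
    finally show "- \<i> * (coeff E (2 * k + 1) * (- \<i> * of_real b) ^ (2 * k + 1))
      = of_real ((-1) ^ (k + 1) * Re (coeff E (2 * k + 1)) * (b * (b\<^sup>2) ^ k))" .
  qed
  finally have "E_hat (2 * s + 1) b = (\<Sum>k\<le>d. (-1) ^ (k + 1) * Re (coeff E (2 * k + 1)) * (b * (b\<^sup>2) ^ k))"
    unfolding E_hat_def E_def[symmetric] by (simp only: of_real_sum[symmetric] Re_complex_of_real)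
  also have "\<dots> = b * poly (P_poly s) (b\<^sup>2)"
    by (simp add: P_poly_def poly_sum poly_monom sum_distrib_left E_def d_def mult_ac)
  finally show ?thesis .
qed

definition pfps :: "real poly \<Rightarrow> real fps \<Rightarrow> real fps" where
  "pfps p F = poly (map_poly fps_const p) F"

lemma pfps_0 [simp]: "pfps 0 F = 0" by (simp add: pfps_def)

lemma pfps_pCons [simp]: "pfps (pCons a p) F = fps_const a + F * pfps p F"
  by (simp add: pfps_def map_poly_pCons)

lemma pfps_compose: "fps_nth G 0 = 0 \<Longrightarrow> pfps p F oo G = pfps p (F oo G)"
  by (induction p) (simp_all add: fps_compose_add_distrib fps_compose_mult_distrib)

lemma taylor_on_pos_poly:
  assumes "taylor_on_pos f T"
  shows "taylor_on_pos (\<lambda>x. poly p (f x)) (\<lambda>x. pfps p (T x))"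
proof (induction p)
  case 0
  show ?case using taylor_on_pos_const[of 0] by simp
next
  case (pCons a p)
  have "taylor_on_pos (\<lambda>x. a + f x * poly p (f x)) (\<lambda>x. fps_const a + T x * pfps p (T x))"
    by (intro taylor_on_pos_add taylor_on_pos_mult taylor_on_pos_const assms pCons)
  then show ?case by simp
qed

lemma taylor_E_hat:
  assumes "x > 0"
  shows "taylor (\<lambda>x. E_hat (2 * s + 1) (1 / sqrt (1 + x\<^sup>2))) x = taylor bh x * pfps (P_poly s) (taylor bh x * taylor bh x)"
proof (rule taylor_on_pos_unique[OF _ assms])
  have "taylor_on_pos (\<lambda>x. bh x * poly (P_poly s) (bh x * bh x)) (\<lambda>x. taylor bh x * pfps (P_poly s) (taylor bh x * taylor bh x))"
    by (intro taylor_on_pos_mult taylor_on_pos_poly taylor_on_pos_bh)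
  then show "taylor_on_pos (\<lambda>x. E_hat (2 * s + 1) (1 / sqrt (1 + x\<^sup>2))) (\<lambda>x. taylor bh x * pfps (P_poly s) (taylor bh x * taylor bh x))"
    by (rule taylor_on_pos_cong) (simp only: E_hat_odd bh_def power2_eq_square)
qed

subsection \<open>The formal equation for the zeros\<close>

text \<open>The series sought is written as \<open>x (1 + b v)\<close> with
  \<open>b = 1 / (1 + x^2)\<close>. Then \<open>1 + x^2 (1 + b v)^2 = (1 + x^2) (1 + v_u)\<close>,
  since \<open>x^2 / (1 + x^2) = 1 - b\<close>.\<close>

definition v_u :: "real \<Rightarrow> real fps \<Rightarrow> real fps" where
  "v_u b v = fps_const (1 - b) * (fps_const (2 * b) * v + fps_const (b\<^sup>2) * (v * v))"

text \<open>\<open>v_I\<close> and \<open>v_A\<close> are the powers of \<open>1 + v_u\<close> with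
  exponents \<open>-1/2\<close> and \<open>1/2\<close>.\<close>

definition v_I :: "real \<Rightarrow> real fps \<Rightarrow> real fps" where
  "v_I b v = fps_binomial (- 1 / 2) oo v_u b v"

definition v_A :: "real \<Rightarrow> real fps \<Rightarrow> real fps" where
  "v_A b v = fps_binomial (1 / 2) oo v_u b v"

text \<open>\<open>sqrt (1 + v_u) / (1 + b v)\<close>: up to the constant \<open>bh x\<close>, the
  factor of \<open>v'\<close> in the derivative of the series substituted into
  \<open>\<rho>\<close>.\<close>

definition v_W :: "real \<Rightarrow> real fps \<Rightarrow> real fps" where
  "v_W b v = v_A b v * (fps_binomial (- 1) oo (fps_const b * v))"

text \<open>The substituted \<open>E_(2s+1)\<close> term divided by \<open>bh x\<close>. The same
  factor comes out of the \<open>\<rho>\<close> term, since \<open>\<rho>'(x) x b = bh x\<close>;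
  after division only integral powers of \<open>b\<close> remain.\<close>

definition v_H :: "real \<Rightarrow> nat \<Rightarrow> real fps \<Rightarrow> real fps" where
  "v_H b s v = v_I b v * pfps (P_poly s) (fps_const b * (v_I b v * v_I b v))"

text \<open>The equation for the coefficient of index \<open>n\<close> solved for
  \<open>v_n\<close>. The \<open>\<rho>\<close> part enters through its derivative, hence the
  division by \<open>n\<close>, and \<open>v_n\<close> appears with factor 1 because
  \<open>v_W\<close> has constant term 1.\<close>

definition v_next :: "real \<Rightarrow> real fps \<Rightarrow> nat \<Rightarrow> real" where
  "v_next b v n = - (1 / real n) * (\<Sum>i=1..<n. fps_nth (v_W b v) i * (real (n - i) * fps_nth v (n - i)))
     - (\<Sum>s<n. fps_nth (v_H b s v) (n - Suc s))"

lemma v_u_0: "fps_nth v 0 = 0 \<Longrightarrow> fps_nth (v_u b v) 0 = 0"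
  by (simp add: v_u_def)

lemma fps_binomial_compose:
  fixes u :: "real fps"
  assumes "fps_nth u 0 = 0"
  shows "(fps_binomial c oo u) * (fps_binomial d oo u) = fps_binomial (c + d) oo u"
    and "fps_binomial 0 oo u = 1" "fps_binomial 1 oo u = 1 + u" "fps_nth (fps_binomial c oo u) 0 = 1"
  using assms by (simp_all add: fps_binomial_add_mult fps_compose_mult_distrib fps_binomial_1 fps_compose_add_distrib fps_compose_nth)

lemma v_I_sq:
  assumes "fps_nth v 0 = 0"
  shows "v_I b v * v_I b v * (1 + v_u b v) = 1" "v_A b v * v_I b v = 1" "v_A b v * v_A b v = 1 + v_u b v"
    "fps_nth (v_I b v) 0 = 1" "fps_nth (v_A b v) 0 = 1"
proof -
  note c = fps_binomial_compose[OF v_u_0[OF assms, of b]]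
  have "v_I b v * v_I b v * (1 + v_u b v) = (v_I b v * v_I b v) * (fps_binomial 1 oo v_u b v)"
    by (simp only: c)
  also have "\<dots> = fps_binomial ((- 1 / 2 + - 1 / 2) + 1) oo v_u b v"
    unfolding v_I_def by (simp only: c(1))
  also have "\<dots> = 1" by (simp add: c(2) del: fps_binomial_0)
  finally show "v_I b v * v_I b v * (1 + v_u b v) = 1" .
  have "v_A b v * v_I b v = fps_binomial (1 / 2 + - 1 / 2) oo v_u b v"
    unfolding v_I_def v_A_def by (simp only: c(1))
  then show "v_A b v * v_I b v = 1" by (simp add: c(2) del: fps_binomial_0)
  have "v_A b v * v_A b v = fps_binomial (1 / 2 + 1 / 2) oo v_u b v"
    unfolding v_A_def by (simp only: c(1))
  then show "v_A b v * v_A b v = 1 + v_u b v" by (simp add: c(3) del: fps_binomial_1)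
  show "fps_nth (v_I b v) 0 = 1" "fps_nth (v_A b v) 0 = 1"
    unfolding v_I_def v_A_def by (rule c(4))+
qed

lemma v_W_eq:
  assumes "fps_nth v 0 = 0"
  shows "v_W b v * (1 + fps_const b * v) = v_A b v" "fps_nth (v_W b v) 0 = 1"
proof -
  have 0: "fps_nth (fps_const b * v) 0 = 0" using assms by simp
  note c = fps_binomial_compose[OF 0]
  have "(fps_binomial (- 1) oo (fps_const b * v)) * (1 + fps_const b * v) = fps_binomial (- 1 + 1) oo (fps_const b * v)"
    by (simp only: c(1) c(3)[symmetric])
  also have "\<dots> = 1" by (simp add: c(2) del: fps_binomial_0)
  finally show "v_W b v * (1 + fps_const b * v) = v_A b v"
    by (simp add: v_W_def mult.assoc)
  show "fps_nth (v_W b v) 0 = 1"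
    using v_I_sq(5)[OF assms] c(4) by (simp add: v_W_def)
qed

text \<open>Composing \<open>taylor_bh_identity\<close> and \<open>fps_deriv_taylor_rho\<close> with
  the series \<open>Y\<close> gives algebraic equations for the substituted series;
  \<open>v_I\<close> and \<open>v_W\<close> solve them, and the higher Taylor coefficients stay
  implicit.\<close>

lemma formal_subst_scaled:
  fixes c :: "nat \<Rightarrow> real" and v :: "real fps"
  assumes x: "x > 0" and b: "b = 1 / (1 + x\<^sup>2)" and v0: "fps_nth v 0 = 0"
    and c0: "c 0 = x" and cn: "\<And>n. n \<ge> 1 \<Longrightarrow> c n = x * b * fps_nth v n"
  shows "fps_deriv (formal_subst rho c) = fps_const (bh x) * (v_W b v * fps_deriv v)"
    and "formal_subst (\<lambda>x. E_hat (2 * s + 1) (1 / sqrt (1 + x\<^sup>2))) c = fps_const (bh x) * v_H b s v"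
proof -
  define Y where "Y = Abs_fps c - fps_const (c 0)"
  define C where "C = fps_const x + Y"
  define B where "B = taylor bh x oo Y"
  have Y0: "fps_nth Y 0 = 0" by (simp add: Y_def)
  have p: "1 + x\<^sup>2 > 0" by (simp add: add_pos_nonneg)
  have b0: "b > 0" "1 - b = b * x\<^sup>2" "1 / b = 1 + x\<^sup>2" using p by (simp_all add: b field_simps)
  have bb: "bh x * bh x = b" using bh_sq[of x] p by (simp add: b field_simps)
  have Y: "Y = fps_const (x * b) * v"
    by (rule fps_ext) (simp add: Y_def cn v0)
  have C: "C = fps_const x * (1 + fps_const b * v)"
    by (simp add: C_def Y algebra_simps flip: fps_const_mult)
  have "(fps_const x + fps_X) oo Y = C"
    by (simp add: C_def fps_compose_add_distrib fps_X_fps_compose_startby0[OF Y0])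
  then have BC: "B * B * (1 + C * C) = 1"
    using arg_cong[OF taylor_bh_identity[OF x], of "\<lambda>F. F oo Y"]
    by (simp add: fps_compose_mult_distrib[OF Y0] fps_compose_add_distrib B_def)
  have SC: "(fps_deriv (taylor rho x) oo Y) * (C * B) = 1"
    using arg_cong[OF fps_deriv_taylor_rho[OF x], of "\<lambda>F. F oo Y"] \<open>(fps_const x + fps_X) oo Y = C\<close>
    by (simp add: fps_compose_mult_distrib[OF Y0] B_def)
  have CU: "fps_const b * (1 + C * C) = 1 + v_u b v"
  proof -
    have "fps_const b * (1 + C * C) = fps_const b + fps_const (b * x\<^sup>2) * ((1 + fps_const b * v) * (1 + fps_const b * v))"
      by (simp add: C algebra_simps power2_eq_square flip: fps_const_mult)
    also have "\<dots> = fps_const b + fps_const (1 - b) * (1 + (fps_const (2 * b) * v + fps_const (b\<^sup>2) * (v * v)))"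
      unfolding b0(2) by (simp add: algebra_simps power2_eq_square flip: fps_const_mult fps_numeral_fps_const)
    also have "\<dots> = 1 + v_u b v"
      by (simp add: v_u_def distrib_left flip: fps_const_sub)
    finally show ?thesis .
  qed
  \<comment> \<open>Both sides have the same square; the sign is decided by the constant terms, both
    equal to \<open>bh x > 0\<close>.\<close>
  have BI: "B = fps_const (bh x) * v_I b v"
  proof -
    define D where "D = fps_const (bh x) * v_I b v"
    have bn: "fps_const b \<noteq> 0" using b0 by simp
    have "(B * B) * (1 + v_u b v) = fps_const b"
      using BC by (simp add: CU[symmetric] mult_ac)
    moreover have "(D * D) * (1 + v_u b v) = fps_const b"
    proof -
      have "(D * D) * (1 + v_u b v) = fps_const (bh x * bh x) * (v_I b v * v_I b v * (1 + v_u b v))"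
        unfolding D_def fps_const_mult[symmetric] by (simp only: mult_ac)
      then show ?thesis unfolding bb v_I_sq(1)[OF v0] by simp
    qed
    moreover have "1 + v_u b v \<noteq> 0"
      using v_u_0[OF v0, of b] by (metis add.right_neutral fps_add_nth fps_one_nth fps_zero_nth zero_neq_one)
    ultimately have "B * B = D * D" by (metis mult_right_cancel)
    then have "(B - D) * (B + D) = 0" by (simp add: algebra_simps)
    moreover have "fps_nth (B + D) 0 = 2 * bh x"
      by (simp add: D_def B_def taylor_def v_I_sq(4)[OF v0])
    then have "B + D \<noteq> 0" using bh_pos[of x] by (metis fps_zero_nth mult_eq_0_iff less_irrefl zero_neq_numeral)
    ultimately show ?thesis by (simp add: D_def)
  qed
  define S where "S = formal_subst rho c"
  have S: "S = taylor rho x oo Y" by (simp add: S_def formal_subst_taylor Y_def c0)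
  have dS: "fps_deriv S = (fps_deriv (taylor rho x) oo Y) * fps_deriv Y"
    unfolding S by (rule fps_compose_deriv[OF Y0])
  have "fps_deriv S * (C * B) = fps_deriv Y * ((fps_deriv (taylor rho x) oo Y) * (C * B))"
    unfolding dS by (simp only: mult_ac)
  also have "\<dots> = fps_const (x * b) * fps_deriv v"
    unfolding SC by (simp add: Y)
  also have "fps_deriv S * (C * B) = fps_const (x * bh x) * (fps_deriv S * ((1 + fps_const b * v) * v_I b v))"
    unfolding C BI fps_const_mult[symmetric] by (simp only: mult_ac)
  also have "fps_const (x * b) * fps_deriv v = fps_const (x * bh x) * (fps_const (bh x) * fps_deriv v)"
    unfolding bb[symmetric] fps_const_mult[symmetric] by (simp only: mult_ac)
  finally have "fps_deriv S * ((1 + fps_const b * v) * v_I b v) = fps_const (bh x) * fps_deriv v"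
    using x bh_pos[of x] by (metis fps_const_eq_0_iff less_irrefl mult_eq_0_iff mult_left_cancel)
  then have e: "fps_deriv S * ((1 + fps_const b * v) * v_I b v) = fps_const (bh x) * fps_deriv v" .
  have "fps_deriv S = fps_deriv S * (v_A b v * v_I b v)"
    by (simp add: v_I_sq(2)[OF v0])
  also have "\<dots> = fps_deriv S * ((v_W b v * (1 + fps_const b * v)) * v_I b v)"
    by (simp only: v_W_eq(1)[OF v0])
  also have "\<dots> = v_W b v * (fps_deriv S * ((1 + fps_const b * v) * v_I b v))"
    by (simp only: mult_ac)
  also have "\<dots> = fps_const (bh x) * (v_W b v * fps_deriv v)"
    unfolding e by (simp only: mult_ac)
  finally show "fps_deriv (formal_subst rho c) = fps_const (bh x) * (v_W b v * fps_deriv v)"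
    by (simp only: S_def)
  have "formal_subst (\<lambda>x. E_hat (2 * s + 1) (1 / sqrt (1 + x\<^sup>2))) c = (taylor bh x * pfps (P_poly s) (taylor bh x * taylor bh x)) oo Y"
    unfolding formal_subst_taylor c0 taylor_E_hat[OF x] by (simp add: Y_def c0)
  also have "\<dots> = B * pfps (P_poly s) (B * B)"
    by (simp add: fps_compose_mult_distrib[OF Y0] pfps_compose[OF Y0] B_def)
  also have "B * B = fps_const b * (v_I b v * v_I b v)"
    unfolding BI bb[symmetric] fps_const_mult[symmetric] by (simp only: mult_ac)
  finally show "formal_subst (\<lambda>x. E_hat (2 * s + 1) (1 / sqrt (1 + x\<^sup>2))) c = fps_const (bh x) * v_H b s v"
    by (simp add: v_H_def BI)
qed

text \<open>The equation of index 0 is \<open>rho x = M\<close>. For \<open>n \<ge> 1\<close> the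
  left side of the equation equals \<open>bh x * (v_n - v_next b v n)\<close>, and
  \<open>bh x\<close> is positive.\<close>

lemma solves_formally_iff:
  fixes c :: "nat \<Rightarrow> real" and v :: "real fps"
  assumes x: "x > 0" and b: "b = 1 / (1 + x\<^sup>2)" and v0: "fps_nth v 0 = 0"
    and c0: "c 0 = x" and cn: "\<And>n. n \<ge> 1 \<Longrightarrow> c n = x * b * fps_nth v n"
  shows "solves_formally M c \<longleftrightarrow> rho x = M \<and> (\<forall>n\<ge>1. fps_nth v n = v_next b v n)"
proof -
  define S where "S = formal_subst rho c"
  define F where "F s = formal_subst (\<lambda>x. E_hat (2 * s + 1) (1 / sqrt (1 + x\<^sup>2))) c" for s
  note sc = formal_subst_scaled[OF assms]
  have dS: "fps_deriv S = fps_const (bh x) * (v_W b v * fps_deriv v)"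
    unfolding S_def by (rule sc(1))
  have F: "F s = fps_const (bh x) * v_H b s v" for s
    unfolding F_def by (rule sc(2))
  have S0: "fps_nth S 0 = rho x"
    by (simp add: S_def formal_subst_taylor c0 taylor_def)
  have eq: "fps_nth S n + (\<Sum>s<n. fps_nth (F s) (n - (s + 1))) = bh x * (fps_nth v n - v_next b v n)" if n: "n \<ge> 1" for n
  proof -
    obtain m where m: "n = Suc m" using n by (cases n) auto
    have "real n * fps_nth S n = fps_nth (fps_deriv S) m" by (simp add: m)
    also have "\<dots> = bh x * fps_nth (v_W b v * fps_deriv v) m"
      unfolding dS by simp
    also have "fps_nth (v_W b v * fps_deriv v) m = (\<Sum>i=0..m. fps_nth (v_W b v) i * (real (n - i) * fps_nth v (n - i)))"
      unfolding fps_mult_nth by (intro sum.cong) (auto simp: m Suc_diff_le)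
    also have "\<dots> = real n * fps_nth v n + (\<Sum>i=1..<n. fps_nth (v_W b v) i * (real (n - i) * fps_nth v (n - i)))"
      by (simp add: sum.atLeast_Suc_atMost v_W_eq(2)[OF v0] m atLeastLessThanSuc_atLeastAtMost)
    finally have "fps_nth S n = bh x * (fps_nth v n + 1 / real n * (\<Sum>i=1..<n. fps_nth (v_W b v) i * (real (n - i) * fps_nth v (n - i))))"
      using n by (simp add: field_simps)
    moreover have "(\<Sum>s<n. fps_nth (F s) (n - (s + 1))) = bh x * (\<Sum>s<n. fps_nth (v_H b s v) (n - Suc s))"
      unfolding F by (simp add: sum_distrib_left)
    ultimately show ?thesis
      by (simp add: v_next_def algebra_simps)
  qed
  have "solves_formally M c \<longleftrightarrow> (\<forall>n. fps_nth S n + (\<Sum>s<n. fps_nth (F s) (n - (s + 1))) = fps_nth (fps_const M) n)"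
    using x c0 by (simp add: solves_formally_def S_def F_def)
  also have "\<dots> \<longleftrightarrow> rho x = M \<and> (\<forall>n\<ge>1. bh x * (fps_nth v n - v_next b v n) = 0)"
  proof (intro iffI conjI allI impI)
    assume *: "\<forall>n. fps_nth S n + (\<Sum>s<n. fps_nth (F s) (n - (s + 1))) = fps_nth (fps_const M) n"
    show "rho x = M" using *[rule_format, of 0] S0 by simp
    fix n :: nat assume n: "n \<ge> 1"
    show "bh x * (fps_nth v n - v_next b v n) = 0"
      using *[rule_format, of n] n unfolding eq[OF n] by simp
  next
    fix n assume *: "rho x = M \<and> (\<forall>n\<ge>1. bh x * (fps_nth v n - v_next b v n) = 0)"
    show "fps_nth S n + (\<Sum>s<n. fps_nth (F s) (n - (s + 1))) = fps_nth (fps_const M) n"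
    proof (cases "n = 0")
      case True
      then show ?thesis using * S0 by simp
    next
      case False
      then have n: "n \<ge> 1" by simp
      show ?thesis unfolding eq[OF n] using * n by simp
    qed
  qed
  also have "\<dots> \<longleftrightarrow> rho x = M \<and> (\<forall>n\<ge>1. fps_nth v n = v_next b v n)"
    using bh_pos[of x] by (metis eq_iff_diff_eq_0 less_irrefl mult_eq_0_iff)
  finally show ?thesis .
qed

subsection \<open>Existence and uniqueness of the formal solution\<close>

text \<open>Every operation in the recursion respects agreement below order \<open>n\<close>. This
  expresses that \<open>v_next b v n\<close> depends only on the coefficients of \<open>v\<close>
  with index below \<open>n\<close>.\<close>

definition fps_agree :: "nat \<Rightarrow> real fps \<Rightarrow> real fps \<Rightarrow> bool" where
  "fps_agree n F G \<longleftrightarrow> (\<forall>k<n. fps_nth F k = fps_nth G k)"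

lemma fps_agree_refl: "fps_agree n F F" by (simp add: fps_agree_def)

lemma fps_agree_add: "fps_agree n F G \<Longrightarrow> fps_agree n F' G' \<Longrightarrow> fps_agree n (F + F') (G + G')"
  by (simp add: fps_agree_def)

lemma fps_agree_mult: "fps_agree n F G \<Longrightarrow> fps_agree n F' G' \<Longrightarrow> fps_agree n (F * F') (G * G')"
  by (auto simp: fps_agree_def fps_mult_nth intro!: sum.cong)

lemma fps_agree_power: "fps_agree n F G \<Longrightarrow> fps_agree n (F ^ k) (G ^ k)"
  by (induction k) (auto intro: fps_agree_mult fps_agree_refl)

lemma fps_agree_compose: "fps_agree n F G \<Longrightarrow> fps_agree n (H oo F) (H oo G)"
  using fps_agree_power[of n F G] by (auto simp: fps_agree_def fps_compose_nth)

lemma fps_agree_pfps: "fps_agree n F G \<Longrightarrow> fps_agree n (pfps p F) (pfps p G)"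
  by (induction p) (auto intro: fps_agree_mult fps_agree_add fps_agree_refl)

lemma fps_agree_v:
  assumes "fps_agree n v w"
  shows "fps_agree n (v_W b v) (v_W b w)" "fps_agree n (v_H b s v) (v_H b s w)"
  unfolding v_W_def v_H_def v_A_def v_I_def v_u_def using assms
  by (intro fps_agree_mult fps_agree_add fps_agree_compose fps_agree_pfps fps_agree_refl; assumption)+

lemma v_next_cong:
  assumes "fps_agree n v w"
  shows "v_next b v n = v_next b w n"
  using fps_agree_v[OF assms] assms unfolding v_next_def fps_agree_def
  by (intro arg_cong2[of _ _ _ _ "(-)"] arg_cong2[of _ _ _ _ "(*)"] sum.cong refl) auto

primrec v_approx :: "real \<Rightarrow> nat \<Rightarrow> real fps" where
  "v_approx b 0 = 0"
| "v_approx b (Suc n) = v_approx b n + fps_const (v_next b (v_approx b n) (Suc n)) * fps_X ^ Suc n"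

text \<open>The diagonal of the approximations: the coefficient of index \<open>n\<close> does not
  change after stage \<open>n\<close>.\<close>

definition v_sol :: "real \<Rightarrow> real fps" where
  "v_sol b = Abs_fps (\<lambda>n. fps_nth (v_approx b n) n)"

lemma v_approx_nth: "fps_nth (v_approx b (n + d)) n = fps_nth (v_approx b n) n"
  by (induction d) (simp_all add: fps_X_power_nth del: power_Suc)

lemma v_sol_0 [simp]: "fps_nth (v_sol b) 0 = 0" by (simp add: v_sol_def)

lemma v_sol_next:
  assumes "n \<ge> 1"
  shows "fps_nth (v_sol b) n = v_next b (v_sol b) n"
proof -
  obtain m where m: "n = Suc m" using assms by (cases n) auto
  have "fps_nth (v_approx b m) k = 0" if "k > m" for k m
    using that by (induction m) (auto simp: fps_X_power_nth simp del: power_Suc)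
  then have "fps_nth (v_sol b) n = v_next b (v_approx b m) n"
    by (simp add: v_sol_def m)
  also have "\<dots> = v_next b (v_sol b) n"
  proof (rule v_next_cong)
    have "fps_nth (v_approx b m) k = fps_nth (v_approx b k) k" if "k < n" for k
      using v_approx_nth[of b k "m - k"] that m by simp
    then show "fps_agree n (v_approx b m) (v_sol b)"
      by (simp add: fps_agree_def v_sol_def)
  qed
  finally show ?thesis .
qed

lemma v_sol_unique:
  assumes "fps_nth v 0 = 0" "\<And>n. n \<ge> 1 \<Longrightarrow> fps_nth v n = v_next b v n"
  shows "v = v_sol b"
proof (rule fps_ext)
  fix n
  show "fps_nth v n = fps_nth (v_sol b) n"
  proof (induction n rule: less_induct)
    case (less n)
    show ?case
    proof (cases "n = 0")
      case False
      have "fps_agree n v (v_sol b)" using less by (simp add: fps_agree_def)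
      from v_next_cong[OF this] show ?thesis
        using assms(2)[of n] v_sol_next[of n b] False by simp
    qed (use assms in simp)
  qed
qed

definition q_coeff :: "nat \<Rightarrow> real \<Rightarrow> real" where
  "q_coeff s x = (if s = 0 then x else x * (1 / (1 + x\<^sup>2)) * fps_nth (v_sol (1 / (1 + x\<^sup>2))) s)"

text \<open>The equation of index 0 fixes \<open>c 0\<close>, as \<open>\<rho>\<close> is a
  bijection. Dividing the other coefficients by the positive number \<open>x * b\<close> turns the
  rest into the recursion for \<open>v\<close>.\<close>

lemma solves_formally_unique:
  "solves_formally M c \<longleftrightarrow> c = (\<lambda>s. q_coeff s (inv_into {0<..} rho M))"
proof -
  define x where "x = inv_into {0<..} rho M"
  have im: "M \<in> rho ` {0<..}" using bij_betw_rho by (simp add: bij_betw_def)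
  have x: "x > 0" "rho x = M"
    using inv_into_into[OF im] f_inv_into_f[OF im] by (auto simp: x_def)
  define b where "b = 1 / (1 + x\<^sup>2)"
  have b0: "b > 0" by (simp add: b_def add_pos_nonneg)
  have "solves_formally M (\<lambda>s. q_coeff s x) \<longleftrightarrow> rho x = M \<and> (\<forall>n\<ge>1. fps_nth (v_sol b) n = v_next b (v_sol b) n)"
    by (rule solves_formally_iff[OF x(1) b_def v_sol_0]) (simp_all add: q_coeff_def b_def)
  then have "solves_formally M (\<lambda>s. q_coeff s x)"
    using x(2) v_sol_next by simp
  moreover have "c = (\<lambda>s. q_coeff s x)" if c: "solves_formally M c"
  proof -
    have "c 0 > 0" using c by (simp add: solves_formally_def)
    moreover have "rho (c 0) = M"
      using c by (auto simp: solves_formally_def formal_subst_taylor taylor_def dest: spec[of _ 0])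
    ultimately have c0: "c 0 = x"
      using bij_betw_rho x unfolding bij_betw_def inj_on_def by auto
    define v where "v = Abs_fps (\<lambda>n. if n = 0 then 0 else c n / (x * b))"
    have v0: "fps_nth v 0 = 0" by (simp add: v_def)
    have cn: "c n = x * b * fps_nth v n" if "n \<ge> 1" for n
      using that x(1) b0 by (simp add: v_def)
    have "v = v_sol b"
      using solves_formally_iff[OF x(1) b_def v0 c0 cn, of M] c v0 by (intro v_sol_unique) auto
    then show ?thesis
      using cn c0 by (auto simp: q_coeff_def b_def fun_eq_iff)
  qed
  ultimately show ?thesis unfolding x_def by blast
qed

lemma zero_coeff_eq: "zero_coeff r \<nu> m s = q_coeff s (inv_into {0<..} rho (zero_param r \<nu> m))"
  unfolding zero_coeff_def solves_formally_unique by simp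

subsection \<open>Polynomial dependence on \<open>b\<close>\<close>

text \<open>The restriction to indices below \<open>n\<close> is what the strong induction for
  \<open>v_sol\<close> works with, since the next coefficient is computed from the earlier ones
  alone.\<close>

definition fps_poly_coeffs :: "nat \<Rightarrow> (real \<Rightarrow> real fps) \<Rightarrow> bool" where
  "fps_poly_coeffs n \<Phi> \<longleftrightarrow> (\<forall>k<n. \<exists>p. \<forall>b. fps_nth (\<Phi> b) k = poly p b)"

lemma poly_fun_sum:
  assumes "\<And>i. i \<in> A \<Longrightarrow> \<exists>p. \<forall>b. f i b = poly p (b :: real)"
  shows "\<exists>p. \<forall>b. (\<Sum>i\<in>A. f i b) = poly p b"
proof -
  obtain p where "\<And>i b. i \<in> A \<Longrightarrow> f i b = poly (p i) b" using assms by metis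
  then show ?thesis by (intro exI[of _ "\<Sum>i\<in>A. p i"]) (simp add: poly_sum)
qed

lemma poly_fun_mult:
  assumes "\<exists>p. \<forall>b. f b = poly p (b :: real)" "\<exists>p. \<forall>b. g b = poly p b"
  shows "\<exists>p. \<forall>b. f b * g b = poly p b"
  using assms by (metis poly_mult)

lemma poly_fun_const: "\<exists>p. \<forall>b. c = poly p (b :: real)"
  by (intro exI[of _ "[:c:]"]) simp

lemma fps_poly_coeffs_const:
  assumes "\<exists>p. \<forall>b. f b = poly p b"
  shows "fps_poly_coeffs n (\<lambda>b. fps_const (f b))"
  unfolding fps_poly_coeffs_def
proof (intro allI impI)
  fix k
  show "\<exists>p. \<forall>b. fps_nth (fps_const (f b)) k = poly p b"
    using assms poly_fun_const[of 0] by (cases "k = 0") simp_all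
qed

lemma fps_poly_coeffs_add:
  "fps_poly_coeffs n F \<Longrightarrow> fps_poly_coeffs n G \<Longrightarrow> fps_poly_coeffs n (\<lambda>b. F b + G b)"
  unfolding fps_poly_coeffs_def by (metis fps_add_nth poly_add)

lemma fps_poly_coeffs_mult:
  "fps_poly_coeffs n F \<Longrightarrow> fps_poly_coeffs n G \<Longrightarrow> fps_poly_coeffs n (\<lambda>b. F b * G b)"
  unfolding fps_poly_coeffs_def fps_mult_nth by (auto intro!: poly_fun_sum poly_fun_mult)

lemma fps_poly_coeffs_power: "fps_poly_coeffs n F \<Longrightarrow> fps_poly_coeffs n (\<lambda>b. F b ^ k)"
  using fps_poly_coeffs_const[of "\<lambda>_. 1" n, OF poly_fun_const]
  by (induction k) (auto intro: fps_poly_coeffs_mult)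

lemma fps_poly_coeffs_compose: "fps_poly_coeffs n F \<Longrightarrow> fps_poly_coeffs n (\<lambda>b. H oo F b)"
  using fps_poly_coeffs_power[of n F]
  unfolding fps_poly_coeffs_def fps_compose_nth by (auto intro!: poly_fun_sum poly_fun_mult poly_fun_const)

lemma fps_poly_coeffs_pfps: "fps_poly_coeffs n F \<Longrightarrow> fps_poly_coeffs n (\<lambda>b. pfps p (F b))"
proof (induction p)
  case 0
  then show ?case using fps_poly_coeffs_const[of "\<lambda>_. 0" n, OF poly_fun_const] by simp
next
  case (pCons a p)
  then show ?case
    by (auto intro!: fps_poly_coeffs_add fps_poly_coeffs_mult fps_poly_coeffs_const poly_fun_const)
qed

lemma poly_funs:
  "\<exists>p. \<forall>b::real. b = poly p b" "\<exists>p. \<forall>b::real. 1 - b = poly p b"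
  "\<exists>p. \<forall>b::real. 2 * b = poly p b" "\<exists>p. \<forall>b::real. b\<^sup>2 = poly p b"
  by (rule exI[of _ "[:0, 1:]"] exI[of _ "[:1, -1:]"] exI[of _ "[:0, 2:]"] exI[of _ "[:0, 0, 1:]"];
      simp add: power2_eq_square; fail)+

lemma fps_poly_coeffs_v:
  assumes "fps_poly_coeffs n v"
  shows "fps_poly_coeffs n (\<lambda>b. v_u b (v b))" "fps_poly_coeffs n (\<lambda>b. v_I b (v b))" "fps_poly_coeffs n (\<lambda>b. v_A b (v b))"
    "fps_poly_coeffs n (\<lambda>b. v_W b (v b))" "fps_poly_coeffs n (\<lambda>b. v_H b s (v b))"
  unfolding v_W_def v_H_def v_A_def v_I_def v_u_def
  by (intro fps_poly_coeffs_mult fps_poly_coeffs_add fps_poly_coeffs_compose fps_poly_coeffs_pfps fps_poly_coeffs_const poly_funs assms)+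

lemma fps_poly_coeffs_v_sol: "fps_poly_coeffs n v_sol"
proof -
  have "\<exists>p. \<forall>b. fps_nth (v_sol b) n = poly p b" for n
  proof (induction n rule: less_induct)
    case (less n)
    have pc: "fps_poly_coeffs n v_sol" using less by (simp add: fps_poly_coeffs_def)
    show ?case
    proof (cases "n = 0")
      case True
      then show ?thesis using poly_fun_const[of 0] by simp
    next
      case False
      have "\<exists>p. \<forall>b. (\<Sum>i=1..<n. fps_nth (v_W b (v_sol b)) i * (real (n - i) * fps_nth (v_sol b) (n - i))) = poly p b"
        using pc fps_poly_coeffs_v(4)[OF pc] unfolding fps_poly_coeffs_def
        by (intro poly_fun_sum poly_fun_mult poly_fun_const) auto
      then obtain p where p: "\<And>b. (\<Sum>i=1..<n. fps_nth (v_W b (v_sol b)) i * (real (n - i) * fps_nth (v_sol b) (n - i))) = poly p b" by blast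
      have "\<exists>p. \<forall>b. (\<Sum>s<n. fps_nth (v_H b s (v_sol b)) (n - Suc s)) = poly p b"
        using fps_poly_coeffs_v(5)[OF pc] False unfolding fps_poly_coeffs_def by (intro poly_fun_sum) auto
      then obtain q where q: "\<And>b. (\<Sum>s<n. fps_nth (v_H b s (v_sol b)) (n - Suc s)) = poly q b" by blast
      have "fps_nth (v_sol b) n = poly (smult (- (1 / real n)) p - q) b" for b
        using v_sol_next[of n b] False unfolding v_next_def p q by simp
      then show ?thesis by blast
    qed
  qed
  then show ?thesis by (simp add: fps_poly_coeffs_def)
qed

text \<open>A polynomial of degree \<open>d\<close> in \<open>1 / (1 + x^2)\<close> becomes a
  fraction with denominator \<open>(1 + x^2)^d\<close>; the prefactor \<open>x * b\<close>
  contributes one more power.\<close>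

lemma q_coeff_rational: "\<exists>A B :: real poly. \<forall>x>0. poly B x \<noteq> 0 \<and> q_coeff s x = poly A x / poly B x"
proof (cases "s = 0")
  case True
  then show ?thesis by (intro exI[of _ "[:0, 1:]"] exI[of _ "[:1:]"]) (simp add: q_coeff_def)
next
  case False
  obtain p where p: "\<And>b. fps_nth (v_sol b) s = poly p b"
    using fps_poly_coeffs_v_sol[of "Suc s"] by (auto simp: fps_poly_coeffs_def)
  define d where "d = degree p"
  define Q where "Q = [:1, 0, 1 :: real:]"
  have Q: "poly Q x = 1 + x\<^sup>2" "poly Q x \<noteq> 0" for x
    using add_pos_nonneg[of 1 "x\<^sup>2"] by (simp_all add: Q_def power2_eq_square)
  define A where "A = [:0, 1:] * (\<Sum>i\<le>d. smult (coeff p i) (Q ^ (d - i)))"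
  have "q_coeff s x = poly A x / poly (Q ^ (d + 1)) x" for x
  proof -
    define w where "w = poly Q x"
    have w: "w \<noteq> 0" using Q by (simp add: w_def)
    have "poly p (1 / w) = (\<Sum>i\<le>d. coeff p i * (1 / w) ^ i)"
      by (simp add: poly_altdef d_def)
    also have "\<dots> = (\<Sum>i\<le>d. coeff p i * w ^ (d - i) / w ^ d)"
      using w by (intro sum.cong) (auto simp: power_diff power_divide)
    also have "\<dots> = (\<Sum>i\<le>d. coeff p i * w ^ (d - i)) / w ^ d"
      by (simp add: sum_divide_distrib)
    finally show ?thesis
      using False by (simp add: q_coeff_def p A_def Q(1)[symmetric] w_def[symmetric] poly_sum poly_power)
  qed
  then show ?thesis using Q(2) by (intro exI[of _ A] exI[of _ "Q ^ (d + 1)"]) (simp add: poly_power)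
qed

subsection \<open>The first four coefficients\<close>

lemma poly_E_poly_0: "coeff (E_poly s) 0 = 0"
proof -
  have "poly (E_poly s) 0 = 0"
    by (induction s rule: E_poly.induct) (simp_all add: poly_poly_antideriv_0)
  then show ?thesis by (simp add: poly_0_coeff_0)
qed

text \<open>A polynomial without constant term is determined by its derivative, so an explicit
  \<open>E_s\<close> is verified by differentiation instead of evaluating
  \<open>poly_antideriv\<close>. Indices up to 7 are required because \<open>q_4\<close> involves
  \<open>P_3\<close>.\<close>

lemma E_poly_SucI:
  assumes "s \<ge> 1" "coeff q 0 = 0"
    "pderiv q = smult (1 / 2) (pderiv (T_poly * pderiv (E_poly s)))
      + smult (1 / 2) (T_poly * (\<Sum>j\<le>s. pderiv (E_poly j) * pderiv (E_poly (s - j))))"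
  shows "E_poly (Suc s) = q"
proof -
  have "pderiv (E_poly (Suc s)) = pderiv q"
    unfolding assms(3) by (rule pderiv_E_poly_Suc[OF assms(1)])
  then have "coeff (E_poly (Suc s)) (Suc k) = coeff q (Suc k)" for k
  proof -
    have "of_nat (Suc k) * coeff (E_poly (Suc s)) (Suc k) = of_nat (Suc k) * coeff q (Suc k)"
      using \<open>pderiv (E_poly (Suc s)) = pderiv q\<close> by (metis coeff_pderiv)
    then show ?thesis by (simp del: of_nat_Suc E_poly.simps)
  qed
  then show ?thesis
    using poly_E_poly_0[of "Suc s"] assms(2) by (intro poly_eqI) (metis not0_implies_Suc)
qed

lemma T_poly_explicit: "T_poly = [:0, 0, 1, 0, 1:]"
  by (simp add: T_poly_def)

lemma E_poly_1: "E_poly 1 = [:0, 1 / 8, 0, 5 / 24:]" by simp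

lemma pderiv_E_poly_1: "pderiv (E_poly 1) = [:1 / 8, 0, 5 / 8:]"
  unfolding E_poly_1 by (simp add: pderiv_pCons)

lemma E_conv_1: "(\<Sum>j\<le>1. pderiv (E_poly j) * pderiv (E_poly (1 - j))) = 0"
  by (simp add: numeral_eq_Suc algebra_simps del: E_poly.simps(2-)) 

lemma E_poly_2: "E_poly 2 = [:0, 0, 1 / 16, 0, 3 / 8, 0, 5 / 16:]"
proof -
  have "E_poly (Suc 1) = [:0, 0, 1 / 16, 0, 3 / 8, 0, 5 / 16:]"
    by (rule E_poly_SucI) (unfold E_conv_1 pderiv_E_poly_1 T_poly_explicit, simp_all add: pderiv_pCons)
  moreover have "Suc 1 = 2" by simp
  ultimately show ?thesis by (simp only:)
qed

lemma pderiv_E_poly_2: "pderiv (E_poly 2) = [:0, 1 / 8, 0, 3 / 2, 0, 15 / 8:]"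
  unfolding E_poly_2 by (simp add: pderiv_pCons)

lemma E_conv_2: "(\<Sum>j\<le>2. pderiv (E_poly j) * pderiv (E_poly (2 - j))) = pderiv (E_poly 1) * pderiv (E_poly 1)"
  by (simp add: numeral_eq_Suc algebra_simps del: E_poly.simps(2-)) 

lemma E_poly_3: "E_poly 3 = [:0, 0, 0, 25 / 384, 0, 531 / 640, 0, 221 / 128, 0, 1105 / 1152:]"
proof -
  have "E_poly (Suc 2) = [:0, 0, 0, 25 / 384, 0, 531 / 640, 0, 221 / 128, 0, 1105 / 1152:]"
    by (rule E_poly_SucI) (unfold E_conv_2 pderiv_E_poly_1 pderiv_E_poly_2 T_poly_explicit, simp_all add: pderiv_pCons)
  moreover have "Suc 2 = 3" by simp
  ultimately show ?thesis by (simp only:)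
qed

lemma pderiv_E_poly_3: "pderiv (E_poly 3) = [:0, 0, 25 / 128, 0, 531 / 128, 0, 1547 / 128, 0, 1105 / 128:]"
  unfolding E_poly_3 by (simp add: pderiv_pCons)

lemma E_conv_3: "(\<Sum>j\<le>3. pderiv (E_poly j) * pderiv (E_poly (3 - j))) = (pderiv (E_poly 1) * pderiv (E_poly 2) + pderiv (E_poly 1) * pderiv (E_poly 2))"
  by (simp add: numeral_eq_Suc algebra_simps del: E_poly.simps(2-)) 

lemma E_poly_4: "E_poly 4 = [:0, 0, 0, 0, 13 / 128, 0, 71 / 32, 0, 531 / 64, 0, 339 / 32, 0, 565 / 128:]"
proof -
  have "E_poly (Suc 3) = [:0, 0, 0, 0, 13 / 128, 0, 71 / 32, 0, 531 / 64, 0, 339 / 32, 0, 565 / 128:]"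
    by (rule E_poly_SucI) (unfold E_conv_3 pderiv_E_poly_1 pderiv_E_poly_2 pderiv_E_poly_3 T_poly_explicit, simp_all add: pderiv_pCons)
  moreover have "Suc 3 = 4" by simp
  ultimately show ?thesis by (simp only:)
qed

lemma pderiv_E_poly_4: "pderiv (E_poly 4) = [:0, 0, 0, 13 / 32, 0, 213 / 16, 0, 531 / 8, 0, 1695 / 16, 0, 1695 / 32:]"
  unfolding E_poly_4 by (simp add: pderiv_pCons)

lemma E_conv_4: "(\<Sum>j\<le>4. pderiv (E_poly j) * pderiv (E_poly (4 - j))) = (pderiv (E_poly 1) * pderiv (E_poly 3) + pderiv (E_poly 1) * pderiv (E_poly 3)) + pderiv (E_poly 2) * pderiv (E_poly 2)"
  by (simp add: numeral_eq_Suc algebra_simps del: E_poly.simps(2-)) 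

lemma E_poly_5: "E_poly 5 = [:0, 0, 0, 0, 0, 1073 / 5120, 0, 50049 / 7168, 0, 186821 / 4608, 0, 44899 / 512, 0, 82825 / 1024, 0, 82825 / 3072:]"
proof -
  have "E_poly (Suc 4) = [:0, 0, 0, 0, 0, 1073 / 5120, 0, 50049 / 7168, 0, 186821 / 4608, 0, 44899 / 512, 0, 82825 / 1024, 0, 82825 / 3072:]"
    by (rule E_poly_SucI) (unfold E_conv_4 pderiv_E_poly_1 pderiv_E_poly_2 pderiv_E_poly_3 pderiv_E_poly_4 T_poly_explicit, simp_all add: pderiv_pCons)
  moreover have "Suc 4 = 5" by simp
  ultimately show ?thesis by (simp only:)
qed

lemma pderiv_E_poly_5: "pderiv (E_poly 5) = [:0, 0, 0, 0, 1073 / 1024, 0, 50049 / 1024, 0, 186821 / 512, 0, 493889 / 512, 0, 1076725 / 1024, 0, 414125 / 1024:]"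
  unfolding E_poly_5 by (simp add: pderiv_pCons)

lemma E_conv_5: "(\<Sum>j\<le>5. pderiv (E_poly j) * pderiv (E_poly (5 - j))) = (pderiv (E_poly 1) * pderiv (E_poly 4) + pderiv (E_poly 1) * pderiv (E_poly 4)) + (pderiv (E_poly 2) * pderiv (E_poly 3) + pderiv (E_poly 2) * pderiv (E_poly 3))"
  by (simp add: numeral_eq_Suc algebra_simps del: E_poly.simps(2-)) 

lemma E_poly_6: "E_poly 6 = [:0, 0, 0, 0, 0, 0, 103 / 192, 0, 405 / 16, 0, 1677 / 8, 0, 5389 / 8, 0, 65385 / 64, 0, 11805 / 16, 0, 19675 / 96:]"
proof -
  have "E_poly (Suc 5) = [:0, 0, 0, 0, 0, 0, 103 / 192, 0, 405 / 16, 0, 1677 / 8, 0, 5389 / 8, 0, 65385 / 64, 0, 11805 / 16, 0, 19675 / 96:]"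
    by (rule E_poly_SucI) (unfold E_conv_5 pderiv_E_poly_1 pderiv_E_poly_2 pderiv_E_poly_3 pderiv_E_poly_4 pderiv_E_poly_5 T_poly_explicit, simp_all add: pderiv_pCons)
  moreover have "Suc 5 = 6" by simp
  ultimately show ?thesis by (simp only:)
qed

lemma pderiv_E_poly_6: "pderiv (E_poly 6) = [:0, 0, 0, 0, 0, 103 / 32, 0, 405 / 2, 0, 8385 / 4, 0, 16167 / 2, 0, 457695 / 32, 0, 11805, 0, 59025 / 16:]"
  unfolding E_poly_6 by (simp add: pderiv_pCons)

lemma E_conv_6: "(\<Sum>j\<le>6. pderiv (E_poly j) * pderiv (E_poly (6 - j))) = (pderiv (E_poly 1) * pderiv (E_poly 5) + pderiv (E_poly 1) * pderiv (E_poly 5)) + (pderiv (E_poly 2) * pderiv (E_poly 4) + pderiv (E_poly 2) * pderiv (E_poly 4)) + pderiv (E_poly 3) * pderiv (E_poly 3)"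
  by (simp add: numeral_eq_Suc algebra_simps del: E_poly.simps(2-)) 

lemma E_poly_7: "E_poly 7 = [:0, 0, 0, 0, 0, 0, 0, 375733 / 229376, 0, 3407083 / 32768, 0, 38038059 / 32768, 0, 168434443 / 32768, 0, 1852155413 / 163840, 0, 432038457 / 32768, 0, 256406305 / 32768, 0, 1282031525 / 688128:]"
proof -
  have "E_poly (Suc 6) = [:0, 0, 0, 0, 0, 0, 0, 375733 / 229376, 0, 3407083 / 32768, 0, 38038059 / 32768, 0, 168434443 / 32768, 0, 1852155413 / 163840, 0, 432038457 / 32768, 0, 256406305 / 32768, 0, 1282031525 / 688128:]"
    by (rule E_poly_SucI) (unfold E_conv_6 pderiv_E_poly_1 pderiv_E_poly_2 pderiv_E_poly_3 pderiv_E_poly_4 pderiv_E_poly_5 pderiv_E_poly_6 T_poly_explicit, simp_all add: pderiv_pCons)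
  moreover have "Suc 6 = 7" by simp
  ultimately show ?thesis by (simp only:)
qed

lemma P_poly_eqI:
  assumes "degree (E_poly (2 * s + 1)) \<le> 2 * n + 1" "degree p \<le> n"
    "\<And>k. k \<le> n \<Longrightarrow> coeff p k = (-1) ^ (k + 1) * Re (coeff (E_poly (2 * s + 1)) (2 * k + 1))"
  shows "P_poly s = p"
proof (rule poly_eqI)
  fix k
  show "coeff (P_poly s) k = coeff p k"
    using assms by (cases "k \<le> n") (simp_all add: coeff_P_poly coeff_eq_0)
qed

lemma P_poly_0: "P_poly 0 = [:- (1 / 8), 5 / 24:]"
proof (rule P_poly_eqI[where n = 1])
  have E: "E_poly (2 * 0 + 1) = [:0, 1 / 8, 0, 5 / 24:]" using E_poly_1 by (simp del: E_poly.simps)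
  show "degree (E_poly (2 * 0 + 1)) \<le> 2 * 1 + 1" unfolding E by simp
  show "degree ([:- (1 / 8), 5 / 24:] :: real poly) \<le> 1" by simp
  fix k :: nat assume "k \<le> 1"
  then have "k \<in> set [0..<2]" by simp
  then show "coeff [:- (1 / 8), 5 / 24:] k = (-1) ^ (k + 1) * Re (coeff (E_poly (2 * 0 + 1)) (2 * k + 1))"
    unfolding E by (auto simp: upt_rec eval_nat_numeral)
qed

lemma P_poly_1: "P_poly 1 = [:0, 25 / 384, - (531 / 640), 221 / 128, - (1105 / 1152):]"
proof (rule P_poly_eqI[where n = 4])
  have E: "E_poly (2 * 1 + 1) = [:0, 0, 0, 25 / 384, 0, 531 / 640, 0, 221 / 128, 0, 1105 / 1152:]" using E_poly_3 by (simp del: E_poly.simps)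
  show "degree (E_poly (2 * 1 + 1)) \<le> 2 * 4 + 1" unfolding E by simp
  show "degree ([:0, 25 / 384, - (531 / 640), 221 / 128, - (1105 / 1152):] :: real poly) \<le> 4" by simp
  fix k :: nat assume "k \<le> 4"
  then have "k \<in> set [0..<5]" by simp
  then show "coeff [:0, 25 / 384, - (531 / 640), 221 / 128, - (1105 / 1152):] k = (-1) ^ (k + 1) * Re (coeff (E_poly (2 * 1 + 1)) (2 * k + 1))"
    unfolding E by (auto simp: upt_rec eval_nat_numeral)
qed

lemma P_poly_2: "P_poly 2 = [:0, 0, - (1073 / 5120), 50049 / 7168, - (186821 / 4608), 44899 / 512, - (82825 / 1024), 82825 / 3072:]"
proof (rule P_poly_eqI[where n = 7])
  have E: "E_poly (2 * 2 + 1) = [:0, 0, 0, 0, 0, 1073 / 5120, 0, 50049 / 7168, 0, 186821 / 4608, 0, 44899 / 512, 0, 82825 / 1024, 0, 82825 / 3072:]" using E_poly_5 by (simp del: E_poly.simps)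
  show "degree (E_poly (2 * 2 + 1)) \<le> 2 * 7 + 1" unfolding E by simp
  show "degree ([:0, 0, - (1073 / 5120), 50049 / 7168, - (186821 / 4608), 44899 / 512, - (82825 / 1024), 82825 / 3072:] :: real poly) \<le> 7" by simp
  fix k :: nat assume "k \<le> 7"
  then have "k \<in> set [0..<8]" by simp
  then show "coeff [:0, 0, - (1073 / 5120), 50049 / 7168, - (186821 / 4608), 44899 / 512, - (82825 / 1024), 82825 / 3072:] k = (-1) ^ (k + 1) * Re (coeff (E_poly (2 * 2 + 1)) (2 * k + 1))"
    unfolding E by (auto simp: upt_rec eval_nat_numeral)
qed

lemma P_poly_3: "P_poly 3 = [:0, 0, 0, 375733 / 229376, - (3407083 / 32768), 38038059 / 32768, - (168434443 / 32768), 1852155413 / 163840, - (432038457 / 32768), 256406305 / 32768, - (1282031525 / 688128):]"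
proof (rule P_poly_eqI[where n = 10])
  have E: "E_poly (2 * 3 + 1) = [:0, 0, 0, 0, 0, 0, 0, 375733 / 229376, 0, 3407083 / 32768, 0, 38038059 / 32768, 0, 168434443 / 32768, 0, 1852155413 / 163840, 0, 432038457 / 32768, 0, 256406305 / 32768, 0, 1282031525 / 688128:]" using E_poly_7 by (simp del: E_poly.simps)
  show "degree (E_poly (2 * 3 + 1)) \<le> 2 * 10 + 1" unfolding E by simp
  show "degree ([:0, 0, 0, 375733 / 229376, - (3407083 / 32768), 38038059 / 32768, - (168434443 / 32768), 1852155413 / 163840, - (432038457 / 32768), 256406305 / 32768, - (1282031525 / 688128):] :: real poly) \<le> 10" by simp
  fix k :: nat assume "k \<le> 10"
  then have "k \<in> set [0..<11]" by simp
  then show "coeff [:0, 0, 0, 375733 / 229376, - (3407083 / 32768), 38038059 / 32768, - (168434443 / 32768), 1852155413 / 163840, - (432038457 / 32768), 256406305 / 32768, - (1282031525 / 688128):] k = (-1) ^ (k + 1) * Re (coeff (E_poly (2 * 3 + 1)) (2 * k + 1))"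
    unfolding E by (auto simp: upt_rec eval_nat_numeral)
qed

lemma fps_mult_nth_2_3:
  fixes F G :: "real fps"
  shows "fps_nth (F * G) 2 = fps_nth F 0 * fps_nth G 2 + fps_nth F 1 * fps_nth G 1 + fps_nth F 2 * fps_nth G 0"
    "fps_nth (F * G) 3 = fps_nth F 0 * fps_nth G 3 + fps_nth F 1 * fps_nth G 2 + fps_nth F 2 * fps_nth G 1 + fps_nth F 3 * fps_nth G 0"
  by (simp_all add: fps_mult_nth numeral_eq_Suc)

lemma pfps_nth_0: "fps_nth (pfps p F) 0 = poly p (fps_nth F 0)"
  by (induction p) simp_all

lemma pfps_nth_1: "fps_nth (pfps p F) 1 = poly (pderiv p) (fps_nth F 0) * fps_nth F 1"
  by (induction p) (simp_all add: fps_mult_nth_1 pfps_nth_0 pderiv_pCons algebra_simps)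

lemma pfps_nth_2: "fps_nth (pfps p F) 2 = poly (pderiv p) (fps_nth F 0) * fps_nth F 2
    + poly (pderiv (pderiv p)) (fps_nth F 0) / 2 * (fps_nth F 1 * fps_nth F 1)"
proof (induction p)
  case (pCons a p)
  show ?case
    by (simp add: fps_mult_nth_2_3 pfps_nth_0 pfps_nth_1[simplified] pCons.IH pderiv_pCons pderiv_add field_simps)
qed simp

text \<open>Once \<open>v_k\<close> is known, so are the coefficients of index \<open>k\<close> of
  \<open>A\<close>, \<open>I\<close>, \<open>W\<close> and \<open>J\<close>, and with them the
  \<open>H\<close> terms in \<open>v_(k+1)\<close>. The polynomials in \<open>b\<close> are kept in
  Horner form.\<close>

lemma v_sol_explicit:

  shows "fps_nth (v_sol b) 1 = 1 / 8 + b * (- (5 / 24))"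
    "fps_nth (v_sol b) 2 = b * (- (31 / 384) + b * (919 / 960 + b * (- (763 / 384) + b * (10 / 9))))"
    "fps_nth (v_sol b) 3 = b * (b * (3779 / 15360 + b * (- (279127 / 35840) + b * (2062963 / 46080 + b * (- (890255 / 9216) + b * (77005 / 864 + b * (- (77125 / 2592))))))))"
    "fps_nth (v_sol b) 4 = b * (b * (b * (- (6277237 / 3440640) + b * (290218807 / 2580480 + b * (- (917227511 / 737280) + b * (212375752261 / 38707200 + b * (- (159857624569 / 13271040) + b * (48524869 / 3456 + b * (- (57602065 / 6912) + b * (108056875 / 54432))))))))))"
proof -
  define V where "V = v_sol b"
  define v where "v k = fps_nth V k" for k
  define A where "A k = fps_nth (v_A b V) k" for k
  define I where "I k = fps_nth (v_I b V) k" for k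
  define W where "W k = fps_nth (v_W b V) k" for k
  define JJ where "JJ = fps_const b * (v_I b V * v_I b V)"
  define J where "J k = fps_nth JJ k" for k
  define H where "H s k = fps_nth (v_H b s V) k" for s k
  define u where "u k = fps_nth (v_u b V) k" for k
  have V0: "fps_nth V 0 = 0" by (simp add: V_def)
  have v0: "v 0 = 0" by (simp add: v_def V0)
  have A0: "A 0 = 1" and I0: "I 0 = 1" and W0: "W 0 = 1"
    using v_I_sq[OF V0, of b] v_W_eq[OF V0, of b] by (simp_all add: A_def I_def W_def)
  note mult_nth = fps_mult_nth_1 fps_mult_nth_2_3
  have u1: "u 1 = (1 - b) * (2 * b * v 1)"
    and u2: "u 2 = (1 - b) * (2 * b * v 2 + b\<^sup>2 * (v 1 * v 1))"
    and u3: "u 3 = (1 - b) * (2 * b * v 3 + b\<^sup>2 * (2 * v 1 * v 2))"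
    by (simp_all add: u_def v_u_def mult_nth v_def V0)
  \<comment> \<open>The square root is extracted from \<open>v_A * v_A = 1 + v_u\<close> and
    inverted through \<open>v_A * v_I = 1\<close>, coefficient by coefficient, instead of expanding
    the binomial series.\<close>
  have A1: "2 * A 1 = u 1"
    using arg_cong[OF v_I_sq(3)[OF V0, of b], of "\<lambda>F. fps_nth F 1"] A0 by (simp add: mult_nth u_def[symmetric] A_def[symmetric] algebra_simps)
  have A2: "2 * A 2 = u 2 - A 1 * A 1"
    using arg_cong[OF v_I_sq(3)[OF V0, of b], of "\<lambda>F. fps_nth F 2"] A0 by (simp add: mult_nth u_def[symmetric] A_def[symmetric] algebra_simps)
  have A3: "2 * A 3 = u 3 - 2 * A 1 * A 2"
    using arg_cong[OF v_I_sq(3)[OF V0, of b], of "\<lambda>F. fps_nth F 3"] A0 by (simp add: mult_nth u_def[symmetric] A_def[symmetric] algebra_simps)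
  have I1: "I 1 = - A 1"
    using arg_cong[OF v_I_sq(2)[OF V0, of b], of "\<lambda>F. fps_nth F 1"] A0 I0 by (simp add: mult_nth A_def[symmetric] I_def[symmetric])
  have I2: "I 2 = - (A 1 * I 1 + A 2)"
    using arg_cong[OF v_I_sq(2)[OF V0, of b], of "\<lambda>F. fps_nth F 2"] A0 I0 by (simp add: mult_nth A_def[symmetric] I_def[symmetric])
  have I3: "I 3 = - (A 1 * I 2 + A 2 * I 1 + A 3)"
    using arg_cong[OF v_I_sq(2)[OF V0, of b], of "\<lambda>F. fps_nth F 3"] A0 I0 by (simp add: mult_nth A_def[symmetric] I_def[symmetric])
  have W1: "W 1 = A 1 - b * v 1"
    using arg_cong[OF v_W_eq(1)[OF V0, of b], of "\<lambda>F. fps_nth F 1"] W0 V0 by (simp add: mult_nth W_def[symmetric] A_def[symmetric] v_def[symmetric] v0 algebra_simps)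
  have W2: "W 2 = A 2 - b * (v 2 + W 1 * v 1)"
    using arg_cong[OF v_W_eq(1)[OF V0, of b], of "\<lambda>F. fps_nth F 2"] W0 V0 by (simp add: mult_nth W_def[symmetric] A_def[symmetric] v_def[symmetric] v0 algebra_simps)
  have W3: "W 3 = A 3 - b * (v 3 + W 1 * v 2 + W 2 * v 1)"
    using arg_cong[OF v_W_eq(1)[OF V0, of b], of "\<lambda>F. fps_nth F 3"] W0 V0 by (simp add: mult_nth W_def[symmetric] A_def[symmetric] v_def[symmetric] v0 algebra_simps)
  have J0: "J 0 = b" and J1: "J 1 = b * (2 * I 1)" and J2: "J 2 = b * (2 * I 2 + I 1 * I 1)" and J3: "J 3 = b * (2 * I 3 + 2 * I 1 * I 2)"
    using I0 by (simp_all add: J_def JJ_def mult_nth I_def)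
  have H_0: "H s 0 = poly (P_poly s) b" for s
    using I0 J0 unfolding H_def v_H_def JJ_def[symmetric] by (simp add: pfps_nth_0 I_def J_def)
  have H_1: "H s 1 = poly (pderiv (P_poly s)) b * J 1 + I 1 * poly (P_poly s) b" for s
    using I0 J0 unfolding H_def v_H_def JJ_def[symmetric] by (simp add: mult_nth pfps_nth_0 pfps_nth_1[simplified] I_def J_def)
  have H_2: "H s 2 = (poly (pderiv (P_poly s)) b * J 2 + poly (pderiv (pderiv (P_poly s))) b / 2 * (J 1 * J 1))
      + I 1 * (poly (pderiv (P_poly s)) b * J 1) + I 2 * poly (P_poly s) b" for s
    using I0 J0 unfolding H_def v_H_def JJ_def[symmetric] by (simp add: mult_nth pfps_nth_0 pfps_nth_1[simplified] pfps_nth_2 I_def J_def)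

  \<comment> \<open>\<open>P_0\<close> is linear, so order 3 of \<open>H 0\<close> is read off
    directly; the other \<open>H\<close> terms in \<open>v 4\<close> have order at most 2.\<close>
  have H_03: "H 0 3 = 5 / 24 * J 3 + I 1 * (5 / 24 * J 2) + I 2 * (5 / 24 * J 1) + I 3 * (- (1 / 8) + 5 / 24 * b)"
    using I0 J0 unfolding H_def v_H_def P_poly_0 JJ_def[symmetric] by (simp add: mult_nth I_def[symmetric] J_def[symmetric] mult.commute)
  have next_eq: "v n = - (1 / real n) * (\<Sum>i=1..<n. W i * (real (n - i) * v (n - i))) - (\<Sum>s<n. H s (n - Suc s))" if "n \<ge> 1" for n
    using v_sol_next[OF that, of b] by (simp add: v_next_def v_def V_def W_def H_def)
  have n1: "v 1 = - H 0 0" using next_eq[of 1] by simp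
  have n2: "v 2 = - (1 / 2) * (W 1 * v 1) - (H 0 1 + H 1 0)"
    using next_eq[of 2] by (simp add: numeral_eq_Suc)
  have n3: "v 3 = - (1 / 3) * (W 1 * (2 * v 2) + W 2 * v 1) - (H 0 2 + H 1 1 + H 2 0)"
    using next_eq[of 3] by (simp add: numeral_eq_Suc)
  have n4: "v 4 = - (1 / 4) * (W 1 * (3 * v 3) + W 2 * (2 * v 2) + W 3 * v 1) - (H 0 3 + H 1 2 + H 2 1 + H 3 0)"
    using next_eq[of 4] by (simp add: numeral_eq_Suc)

  have hv1: "v 1 = 1 / 8 + b * (- (5 / 24))"
    unfolding n1 H_0 P_poly_0 by simp
  have hA1: "A 1 = b * (1 / 8 + b * (- (1 / 3) + b * (5 / 24)))"
    using A1 unfolding u1 hv1  by (simp add: field_simps eval_nat_numeral)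
  have hI1: "I 1 = b * (- (1 / 8) + b * (1 / 3 + b * (- (5 / 24))))"
    unfolding I1 hA1  by (simp add: field_simps eval_nat_numeral)
  have hW1: "W 1 = b * (b * (- (1 / 8) + b * (5 / 24)))"
    unfolding W1 hA1 hv1  by (simp add: field_simps eval_nat_numeral)
  have hJ1: "J 1 = b * (b * (- (1 / 4) + b * (2 / 3 + b * (- (5 / 12)))))"
    unfolding J1 hI1 by (simp add: field_simps eval_nat_numeral)
  have hv2: "v 2 = b * (- (31 / 384) + b * (919 / 960 + b * (- (763 / 384) + b * (10 / 9))))"
    unfolding n2 H_0 H_1 P_poly_0 P_poly_1 hv1 hW1 hI1 hJ1 by (simp add: pderiv_pCons field_simps eval_nat_numeral)
  have hA2: "A 2 = b * (b * (- (31 / 384) + b * (251 / 240 + b * (- (953 / 320) + b * (151 / 48 + b * (- (145 / 128)))))))"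
    using A2 unfolding u2 hv1 hv2 hA1 by (simp add: field_simps eval_nat_numeral)
  have hI2: "I 2 = b * (b * (37 / 384 + b * (- (271 / 240) + b * (9047 / 2880 + b * (- (473 / 144) + b * (1355 / 1152))))))"
    unfolding I2 hA1 hA2 hI1 by (simp add: field_simps eval_nat_numeral)
  have hW2: "W 2 = b * (b * (b * (5 / 48 + b * (- (2003 / 1920) + b * (133 / 64 + b * (- (145 / 128)))))))"
    unfolding W2 hA2 hv1 hv2 hW1 by (simp add: field_simps eval_nat_numeral)
  have hJ2: "J 2 = b * (b * (b * (5 / 24 + b * (- (281 / 120) + b * (1547 / 240 + b * (- (161 / 24) + b * (115 / 48)))))))"
    unfolding J2 hI1 hI2 by (simp add: field_simps eval_nat_numeral)
  have hv3: "v 3 = b * (b * (3779 / 15360 + b * (- (279127 / 35840) + b * (2062963 / 46080 + b * (- (890255 / 9216) + b * (77005 / 864 + b * (- (77125 / 2592))))))))"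
    unfolding n3 H_0 H_1 H_2 P_poly_0 P_poly_1 P_poly_2 hv1 hv2 hW1 hW2 hI1 hI2 hJ1 hJ2 by (simp add: pderiv_pCons field_simps eval_nat_numeral)
  have hA3: "A 3 = b * (b * (b * (3779 / 15360 + b * (- (3379 / 420) + b * (17002367 / 322560 + b * (- (408877 / 2880) + b * (5163301 / 27648 + b * (- (620435 / 5184) + b * (2487575 / 82944)))))))))"
    using A3 unfolding u3 hv1 hv2 hv3 hA1 hA2 by (simp add: field_simps eval_nat_numeral)
  have hI3: "I 3 = b * (b * (b * (- (1373 / 5120) + b * (168863 / 20160 + b * (- (17494859 / 322560) + b * (251023 / 1728 + b * (- (5265793 / 27648) + b * (315685 / 2592 + b * (- (2527475 / 82944))))))))))"
    unfolding I3 hA1 hA2 hA3 hI1 hI2 by (simp add: field_simps eval_nat_numeral)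
  have hW3: "W 3 = b * (b * (b * (b * (- (269 / 960) + b * (36871 / 4480 + b * (- (2133377 / 46080) + b * (2730311 / 27648 + b * (- (2499245 / 27648) + b * (2487575 / 82944)))))))))"
    unfolding W3 hA3 hv1 hv2 hv3 hW1 hW2 by (simp add: field_simps eval_nat_numeral)
  have hJ3: "J 3 = b * (b * (b * (b * (- (269 / 480) + b * (14363 / 840 + b * (- (443735 / 4032) + b * (634871 / 2160 + b * (- (332389 / 864) + b * (318475 / 1296 + b * (- (318475 / 5184)))))))))))"
    unfolding J3 hI1 hI2 hI3 by (simp add: field_simps eval_nat_numeral)
  have hH03: "H 0 3 = b * (b * (b * (1373 / 40960 + b * (- (3174203 / 2580480) + b * (31571179 / 2580480 + b * (- (82142989 / 1548288) + b * (77459411 / 663552 + b * (- (90673595 / 663552) + b * (665875 / 8192 + b * (- (475625 / 24576)))))))))))"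
    unfolding H_03 hJ1 hJ2 hJ3 hI1 hI2 hI3 by (simp add: field_simps eval_nat_numeral)
  have hH12: "H 1 2 = b * (b * (b * (1075 / 49152 + b * (- (12553 / 16384) + b * (5715509 / 737280 + b * (- (24399637 / 737280) + b * (52734223 / 737280 + b * (- (4066249 / 49152) + b * (2405585 / 49152 + b * (- (1718275 / 147456)))))))))))"
    unfolding H_2 P_poly_1 hJ1 hJ2 hI1 hI2 by (simp add: pderiv_pCons field_simps eval_nat_numeral)
  have hH21: "H 2 1 = b * (b * (b * (1073 / 8192 + b * (- (158731 / 24576) + b * (1526683 / 24576 + b * (- (6202715 / 24576) + b * (13000609 / 24576 + b * (- (14795065 / 24576) + b * (2898875 / 8192 + b * (- (2070625 / 24576)))))))))))"
    unfolding H_1 P_poly_2 hJ1 hI1 by (simp add: pderiv_pCons field_simps eval_nat_numeral)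
  have hH30: "H 3 0 = b * (b * (b * (375733 / 229376 + b * (- (3407083 / 32768) + b * (38038059 / 32768 + b * (- (168434443 / 32768) + b * (1852155413 / 163840 + b * (- (432038457 / 32768) + b * (256406305 / 32768 + b * (- (1282031525 / 688128)))))))))))"
    unfolding H_0 P_poly_3 by simp
  have hv4: "v 4 = b * (b * (b * (- (6277237 / 3440640) + b * (290218807 / 2580480 + b * (- (917227511 / 737280) + b * (212375752261 / 38707200 + b * (- (159857624569 / 13271040) + b * (48524869 / 3456 + b * (- (57602065 / 6912) + b * (108056875 / 54432))))))))))"
    unfolding n4 hH03 hH12 hH21 hH30 hv1 hv2 hv3 hW1 hW2 hW3 by (simp add: field_simps eval_nat_numeral)
  show "fps_nth (v_sol b) 1 = 1 / 8 + b * (- (5 / 24))"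
    "fps_nth (v_sol b) 2 = b * (- (31 / 384) + b * (919 / 960 + b * (- (763 / 384) + b * (10 / 9))))"
    "fps_nth (v_sol b) 3 = b * (b * (3779 / 15360 + b * (- (279127 / 35840) + b * (2062963 / 46080 + b * (- (890255 / 9216) + b * (77005 / 864 + b * (- (77125 / 2592))))))))"
    "fps_nth (v_sol b) 4 = b * (b * (b * (- (6277237 / 3440640) + b * (290218807 / 2580480 + b * (- (917227511 / 737280) + b * (212375752261 / 38707200 + b * (- (159857624569 / 13271040) + b * (48524869 / 3456 + b * (- (57602065 / 6912) + b * (108056875 / 54432))))))))))"
    using hv1 hv2 hv3 hv4 by (simp_all only: v_def V_def)
qed

lemma q_coeff_explicit:
  assumes "x > 0"
  shows "q_coeff 1 x = x * (3 * x^2 - 2) / (24 * (x^2 + 1)^2)"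
    "q_coeff 2 x = - (x * (465 * x^6 - 4119 * x^4 + 1812 * x^2 - 4) / (5760 * (x^2 + 1)^5))"
    "q_coeff 3 x = x / (2903040 * (x^2 + 1)^8) *
       (714231 * x^10 - 19038132 * x^8 + 46671831 * x^6 - 19043730 * x^4 + 910164 * x^2 - 1912)"
    "q_coeff 4 x = - (x / (1393459200 * (x^2 + 1)^11)) *
       (2542280985 * x^14 - 138922188885 * x^12 + 846638961795 * x^10 - 1239519604671 * x^8
        + 493158930936 * x^6 - 45022408056 * x^4 + 452367216 * x^2 + 742544)"
proof -
  \<comment> \<open>With \<open>w = 1 + x^2\<close> the coefficients are polynomials in
    \<open>1 / w\<close>, and the even powers of \<open>x\<close> on the right become powers of
    \<open>w - 1\<close>.\<close>
  define w where "w = 1 + x\<^sup>2"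
  have w: "w > 0" by (simp add: w_def add_pos_nonneg)
  have x2: "x\<^sup>2 = w - 1" by (simp add: w_def)
  have xp: "x ^ 4 = (w - 1) ^ 2" "x ^ 6 = (w - 1) ^ 3" "x ^ 8 = (w - 1) ^ 4" "x ^ 10 = (w - 1) ^ 5" "x ^ 12 = (w - 1) ^ 6" "x ^ 14 = (w - 1) ^ 7"
    unfolding x2[symmetric] by (simp_all add: power_mult[symmetric])
  have w1: "w - 1 + 1 = w" by simp

  have "q_coeff 1 x = x * (3 * (w - 1) - 2) / (24 * w ^ 2)"
    using w unfolding q_coeff_def v_sol_explicit w_def[symmetric] by (simp add: divide_simps) algebra
  then show "q_coeff 1 x = x * (3 * x^2 - 2) / (24 * (x^2 + 1)^2)"
    unfolding xp x2 w1 .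
  have "q_coeff 2 x = - (x * (465 * (w - 1) ^ 3 - 4119 * (w - 1) ^ 2 + 1812 * (w - 1) - 4) / (5760 * w ^ 5))"
    using w unfolding q_coeff_def v_sol_explicit w_def[symmetric] by (simp add: divide_simps) algebra
  then show "q_coeff 2 x = - (x * (465 * x^6 - 4119 * x^4 + 1812 * x^2 - 4) / (5760 * (x^2 + 1)^5))"
    unfolding xp x2 w1 .
  have "q_coeff 3 x = x / (2903040 * w ^ 8) * (714231 * (w - 1) ^ 5 - 19038132 * (w - 1) ^ 4 + 46671831 * (w - 1) ^ 3 - 19043730 * (w - 1) ^ 2 + 910164 * (w - 1) - 1912)"
    using w unfolding q_coeff_def v_sol_explicit w_def[symmetric] by (simp add: divide_simps) algebra
  then show "q_coeff 3 x = x / (2903040 * (x^2 + 1)^8) *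
       (714231 * x^10 - 19038132 * x^8 + 46671831 * x^6 - 19043730 * x^4 + 910164 * x^2 - 1912)"
    unfolding xp x2 w1 .
  have "q_coeff 4 x = - (x / (1393459200 * w ^ 11)) * (2542280985 * (w - 1) ^ 7 - 138922188885 * (w - 1) ^ 6 + 846638961795 * (w - 1) ^ 5 - 1239519604671 * (w - 1) ^ 4 + 493158930936 * (w - 1) ^ 3 - 45022408056 * (w - 1) ^ 2 + 452367216 * (w - 1) + 742544)"
    using w unfolding q_coeff_def v_sol_explicit w_def[symmetric] by (simp add: divide_simps) algebra
  then show "q_coeff 4 x = - (x / (1393459200 * (x^2 + 1)^11)) *
       (2542280985 * x^14 - 138922188885 * x^12 + 846638961795 * x^10 - 1239519604671 * x^8
        + 493158930936 * x^6 - 45022408056 * x^4 + 452367216 * x^2 + 742544)"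
    unfolding xp x2 w1 .
qed

subsection \<open>Expansions with uniform remainder\<close>

text \<open>An expansion of order \<open>n\<close> as \<open>e\<close> tends to 0 from above,
  uniform for \<open>b\<close> in the closed interval. Boundedness of the coefficients is part of
  the notion, so that products and truncations keep a uniform remainder.\<close>

definition unif :: "nat \<Rightarrow> (real \<Rightarrow> real \<Rightarrow> real) \<Rightarrow> (real \<Rightarrow> real fps) \<Rightarrow> bool" where
  "unif n F \<Phi> \<longleftrightarrow> (\<forall>k<n. \<exists>B. \<forall>b\<in>{0..1}. \<bar>fps_nth (\<Phi> b) k\<bar> \<le> B) \<and>
     (\<exists>C e0. e0 > 0 \<and> e0 \<le> 1 \<and> C \<ge> 0 \<and> (\<forall>b\<in>{0..1}. \<forall>e\<in>{0..e0}. \<bar>F b e - (\<Sum>k<n. fps_nth (\<Phi> b) k * e ^ k)\<bar> \<le> C * e ^ n))"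

lemma unifE:
  assumes "unif n F \<Phi>"
  obtains C e0 where "e0 > 0" "e0 \<le> 1" "C \<ge> 0"
    "\<And>b e. 0 \<le> b \<Longrightarrow> b \<le> 1 \<Longrightarrow> 0 \<le> e \<Longrightarrow> e \<le> e0 \<Longrightarrow> \<bar>F b e - (\<Sum>k<n. fps_nth (\<Phi> b) k * e ^ k)\<bar> \<le> C * e ^ n"
  using assms unfolding unif_def by (metis atLeastAtMost_iff)

lemma unifI:
  assumes "\<And>k. k < n \<Longrightarrow> \<exists>B. \<forall>b\<in>{0..1}. \<bar>fps_nth (\<Phi> b) k\<bar> \<le> B" "e0 > 0"
    "\<And>b e. 0 \<le> b \<Longrightarrow> b \<le> 1 \<Longrightarrow> 0 \<le> e \<Longrightarrow> e \<le> e0 \<Longrightarrow> e \<le> 1 \<Longrightarrow> \<bar>F b e - (\<Sum>k<n. fps_nth (\<Phi> b) k * e ^ k)\<bar> \<le> C * e ^ n"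
  shows "unif n F \<Phi>"
proof -
  have "\<bar>F b e - (\<Sum>k<n. fps_nth (\<Phi> b) k * e ^ k)\<bar> \<le> max C 0 * e ^ n" if "b \<in> {0..1}" "e \<in> {0..min e0 1}" for b e
  proof -
    have "C * e ^ n \<le> max C 0 * e ^ n" using that by (intro mult_right_mono) auto
    then show ?thesis using assms(3)[of b e] that by force
  qed
  then show ?thesis
    using assms(1,2) unfolding unif_def by (intro conjI exI[of _ "max C 0"] exI[of _ "min e0 1"]) auto
qed

lemma unif_coeffs:
  assumes "unif n F \<Phi>"
  obtains B where "B \<ge> 0" "\<And>b k. 0 \<le> b \<Longrightarrow> b \<le> 1 \<Longrightarrow> k < n \<Longrightarrow> \<bar>fps_nth (\<Phi> b) k\<bar> \<le> B"
proof -
  obtain B where B: "\<And>k b. k < n \<Longrightarrow> b \<in> {0..1} \<Longrightarrow> \<bar>fps_nth (\<Phi> b) k\<bar> \<le> B k"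
    using assms unfolding unif_def by metis
  have "\<bar>fps_nth (\<Phi> b) k\<bar> \<le> (\<Sum>k<n. \<bar>B k\<bar>)" if "0 \<le> b" "b \<le> 1" "k < n" for b k
  proof -
    have "\<bar>fps_nth (\<Phi> b) k\<bar> \<le> \<bar>B k\<bar>" using B[OF that(3), of b] that by simp
    also have "\<dots> \<le> (\<Sum>k<n. \<bar>B k\<bar>)" using that by (intro member_le_sum) auto
    finally show ?thesis .
  qed
  then show thesis by (rule that[rotated]) (auto intro: sum_nonneg)
qed

lemma unif_bounded:
  assumes "unif n F \<Phi>"
  obtains M e0 where "e0 > 0" "e0 \<le> 1" "M \<ge> 0"
    "\<And>b e. 0 \<le> b \<Longrightarrow> b \<le> 1 \<Longrightarrow> 0 \<le> e \<Longrightarrow> e \<le> e0 \<Longrightarrow> \<bar>F b e\<bar> \<le> M"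
    "\<And>b e. 0 \<le> b \<Longrightarrow> b \<le> 1 \<Longrightarrow> 0 \<le> e \<Longrightarrow> e \<le> e0 \<Longrightarrow> \<bar>\<Sum>k<n. fps_nth (\<Phi> b) k * e ^ k\<bar> \<le> M"
proof -
  obtain C e0 where C: "e0 > 0" "e0 \<le> 1" "C \<ge> 0"
    "\<And>b e. 0 \<le> b \<Longrightarrow> b \<le> 1 \<Longrightarrow> 0 \<le> e \<Longrightarrow> e \<le> e0 \<Longrightarrow> \<bar>F b e - (\<Sum>k<n. fps_nth (\<Phi> b) k * e ^ k)\<bar> \<le> C * e ^ n"
    using unifE[OF assms] by metis
  obtain B where B: "B \<ge> 0" "\<And>b k. 0 \<le> b \<Longrightarrow> b \<le> 1 \<Longrightarrow> k < n \<Longrightarrow> \<bar>fps_nth (\<Phi> b) k\<bar> \<le> B"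
    using unif_coeffs[OF assms] by metis
  have s: "\<bar>\<Sum>k<n. fps_nth (\<Phi> b) k * e ^ k\<bar> \<le> real n * B" if "0 \<le> b" "b \<le> 1" "0 \<le> e" "e \<le> e0" for b e
  proof -
    have "\<bar>\<Sum>k<n. fps_nth (\<Phi> b) k * e ^ k\<bar> \<le> (\<Sum>k<n. \<bar>fps_nth (\<Phi> b) k * e ^ k\<bar>)" by (rule sum_abs)
    also have "\<dots> \<le> (\<Sum>k<n. B * 1)"
    proof (intro sum_mono)
      fix k assume "k \<in> {..<n}"
      then show "\<bar>fps_nth (\<Phi> b) k * e ^ k\<bar> \<le> B * 1"
        unfolding abs_mult using B that C by (intro mult_mono) (auto intro: power_le_one)
    qed
    finally show ?thesis by simp
  qed
  have f: "\<bar>F b e\<bar> \<le> C + real n * B" if "0 \<le> b" "b \<le> 1" "0 \<le> e" "e \<le> e0" for b e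
  proof -
    have "C * e ^ n \<le> C * 1" using that C by (intro mult_left_mono power_le_one) auto
    then show ?thesis using s[OF that] C(4)[OF that] by linarith
  qed
  show thesis
    by (rule that[OF C(1,2), of "C + real n * B"]) (use f s B(1) C(3) in \<open>fastforce+\<close>)
qed

lemma unif_cong:
  assumes "unif n F \<Phi>" "\<And>b k. k < n \<Longrightarrow> fps_nth (\<Phi> b) k = fps_nth (\<Psi> b) k"
    and "e1 > 0" "\<And>b e. 0 \<le> b \<Longrightarrow> b \<le> 1 \<Longrightarrow> 0 \<le> e \<Longrightarrow> e \<le> e1 \<Longrightarrow> F b e = G b e"
  shows "unif n G \<Psi>"
proof -
  obtain C e0 where C: "e0 > 0" "e0 \<le> 1" "C \<ge> 0"
    "\<And>b e. 0 \<le> b \<Longrightarrow> b \<le> 1 \<Longrightarrow> 0 \<le> e \<Longrightarrow> e \<le> e0 \<Longrightarrow> \<bar>F b e - (\<Sum>k<n. fps_nth (\<Phi> b) k * e ^ k)\<bar> \<le> C * e ^ n"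
    using unifE[OF assms(1)] by metis
  have "\<bar>G b e - (\<Sum>k<n. fps_nth (\<Psi> b) k * e ^ k)\<bar> \<le> C * e ^ n" if "0 \<le> b" "b \<le> 1" "0 \<le> e" "e \<le> min e0 e1" for b e
    using C(4)[of b e] that assms(2,4) by simp
  then show ?thesis
    using assms(1-3) C(1-3) unfolding unif_def
    by (intro conjI exI[of _ C] exI[of _ "min e0 e1"]) auto
qed

text \<open>Compactness of the range of \<open>b\<close> enters here: a polynomial coefficient is
  bounded on it.\<close>

lemma unif_poly:
  assumes "\<And>b k. k < n \<Longrightarrow> fps_nth (\<Phi> b) k = poly (p k) b"
  shows "unif n (\<lambda>b e. \<Sum>k<n. fps_nth (\<Phi> b) k * e ^ k) \<Phi>"
  unfolding unif_def
proof (intro conjI allI impI)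
  fix k assume k: "k < n"
  have "bounded (poly (p k) ` {0..1})"
    by (intro compact_imp_bounded compact_continuous_image continuous_intros) auto
  then obtain B where "\<forall>x\<in>poly (p k) ` {0..1}. norm x \<le> B" unfolding bounded_iff by blast
  then show "\<exists>B. \<forall>b\<in>{0..1}. \<bar>fps_nth (\<Phi> b) k\<bar> \<le> B"
    using assms[OF k] by auto
qed (intro exI[of _ 0] exI[of _ 1], simp)

lemma unif_truncation:
  assumes "fps_poly_coeffs n \<Phi>"
  shows "unif n (\<lambda>b e. \<Sum>k<n. fps_nth (\<Phi> b) k * e ^ k) \<Phi>"
proof -
  obtain p where "\<And>k b. k < n \<Longrightarrow> fps_nth (\<Phi> b) k = poly (p k) b"
    using assms unfolding fps_poly_coeffs_def by metis
  then show ?thesis by (rule unif_poly)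
qed

lemma unif_Suc:
  assumes "unif (Suc n) F \<Phi>"
  shows "unif n F \<Phi>"
proof -
  obtain C e0 where C: "e0 > 0" "e0 \<le> 1" "C \<ge> 0"
    "\<And>b e. 0 \<le> b \<Longrightarrow> b \<le> 1 \<Longrightarrow> 0 \<le> e \<Longrightarrow> e \<le> e0 \<Longrightarrow> \<bar>F b e - (\<Sum>k<Suc n. fps_nth (\<Phi> b) k * e ^ k)\<bar> \<le> C * e ^ Suc n"
    using unifE[OF assms] by metis
  obtain B where B: "B \<ge> 0" "\<And>b k. 0 \<le> b \<Longrightarrow> b \<le> 1 \<Longrightarrow> k < Suc n \<Longrightarrow> \<bar>fps_nth (\<Phi> b) k\<bar> \<le> B"
    using unif_coeffs[OF assms] by metis
  show ?thesis
  proof (rule unifI[of _ _ e0 _ "C + B"])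
    fix b e :: real assume be: "0 \<le> b" "b \<le> 1" "0 \<le> e" "e \<le> e0" "e \<le> 1"
    have "C * e ^ Suc n \<le> C * e ^ n" using be C(3) by (intro mult_left_mono power_decreasing) auto
    moreover have "\<bar>fps_nth (\<Phi> b) n * e ^ n\<bar> \<le> B * e ^ n"
      unfolding abs_mult using B(2)[OF be(1,2), of n] be by (intro mult_mono) auto
    moreover have "\<bar>F b e - ((\<Sum>k<n. fps_nth (\<Phi> b) k * e ^ k) + fps_nth (\<Phi> b) n * e ^ n)\<bar> \<le> C * e ^ Suc n"
      using C(4)[OF be(1-4)] by simp
    ultimately show "\<bar>F b e - (\<Sum>k<n. fps_nth (\<Phi> b) k * e ^ k)\<bar> \<le> (C + B) * e ^ n"
      unfolding distrib_right by linarith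
  next
    fix k assume "k < n"
    then show "\<exists>B. \<forall>b\<in>{0..1}. \<bar>fps_nth (\<Phi> b) k\<bar> \<le> B" using B(2) by (intro exI[of _ B]) auto
  qed (use C in auto)
qed

lemma unif_add:
  assumes "unif n F \<Phi>" "unif n G \<Psi>"
  shows "unif n (\<lambda>b e. F b e + G b e) (\<lambda>b. \<Phi> b + \<Psi> b)"
proof -
  obtain C e0 where C: "e0 > 0" "e0 \<le> 1" "C \<ge> 0"
    "\<And>b e. 0 \<le> b \<Longrightarrow> b \<le> 1 \<Longrightarrow> 0 \<le> e \<Longrightarrow> e \<le> e0 \<Longrightarrow> \<bar>F b e - (\<Sum>k<n. fps_nth (\<Phi> b) k * e ^ k)\<bar> \<le> C * e ^ n"
    using unifE[OF assms(1)] by metis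
  obtain D e1 where D: "e1 > 0" "e1 \<le> 1" "D \<ge> 0"
    "\<And>b e. 0 \<le> b \<Longrightarrow> b \<le> 1 \<Longrightarrow> 0 \<le> e \<Longrightarrow> e \<le> e1 \<Longrightarrow> \<bar>G b e - (\<Sum>k<n. fps_nth (\<Psi> b) k * e ^ k)\<bar> \<le> D * e ^ n"
    using unifE[OF assms(2)] by metis
  obtain B where B: "\<And>b k. 0 \<le> b \<Longrightarrow> b \<le> 1 \<Longrightarrow> k < n \<Longrightarrow> \<bar>fps_nth (\<Phi> b) k\<bar> \<le> B"
    using unif_coeffs[OF assms(1)] by metis
  obtain B' where B': "\<And>b k. 0 \<le> b \<Longrightarrow> b \<le> 1 \<Longrightarrow> k < n \<Longrightarrow> \<bar>fps_nth (\<Psi> b) k\<bar> \<le> B'"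
    using unif_coeffs[OF assms(2)] by metis
  show ?thesis
  proof (rule unifI[of _ _ "min e0 e1" _ "C + D"])
    fix k assume k: "k < n"
    have "\<bar>fps_nth (\<Phi> b + \<Psi> b) k\<bar> \<le> B + B'" if "b \<in> {0..1}" for b
    proof -
      have "\<bar>fps_nth (\<Phi> b) k\<bar> \<le> B" "\<bar>fps_nth (\<Psi> b) k\<bar> \<le> B'" using B B' that k by simp_all
      then show ?thesis unfolding fps_add_nth by linarith
    qed
    then show "\<exists>B. \<forall>b\<in>{0..1}. \<bar>fps_nth (\<Phi> b + \<Psi> b) k\<bar> \<le> B" by blast
  next
    fix b e :: real assume "0 \<le> b" "b \<le> 1" "0 \<le> e" "e \<le> min e0 e1"
    then have *: "\<bar>F b e - (\<Sum>k<n. fps_nth (\<Phi> b) k * e ^ k)\<bar> \<le> C * e ^ n" "\<bar>G b e - (\<Sum>k<n. fps_nth (\<Psi> b) k * e ^ k)\<bar> \<le> D * e ^ n"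
      using C(4) D(4) by auto
    have "(\<Sum>k<n. fps_nth (\<Phi> b + \<Psi> b) k * e ^ k) = (\<Sum>k<n. fps_nth (\<Phi> b) k * e ^ k) + (\<Sum>k<n. fps_nth (\<Psi> b) k * e ^ k)"
      by (simp add: distrib_right sum.distrib)
    then show "\<bar>F b e + G b e - (\<Sum>k<n. fps_nth (\<Phi> b + \<Psi> b) k * e ^ k)\<bar> \<le> (C + D) * e ^ n"
      using * unfolding distrib_right by linarith
  qed (use C D in auto)
qed

text \<open>The product of the two truncations and the truncation of the product differ by the pairs
  with \<open>i + j \<ge> n\<close>, finitely many terms each of size \<open>O(e^n)\<close>.\<close>

lemma unif_mult:
  assumes "unif n F \<Phi>" "unif n G \<Psi>"
  shows "unif n (\<lambda>b e. F b e * G b e) (\<lambda>b. \<Phi> b * \<Psi> b)"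
proof -
  obtain C e0 where C: "e0 > 0" "e0 \<le> 1" "C \<ge> 0"
    "\<And>b e. 0 \<le> b \<Longrightarrow> b \<le> 1 \<Longrightarrow> 0 \<le> e \<Longrightarrow> e \<le> e0 \<Longrightarrow> \<bar>F b e - (\<Sum>k<n. fps_nth (\<Phi> b) k * e ^ k)\<bar> \<le> C * e ^ n"
    using unifE[OF assms(1)] by metis
  obtain D e1 where D: "e1 > 0" "e1 \<le> 1" "D \<ge> 0"
    "\<And>b e. 0 \<le> b \<Longrightarrow> b \<le> 1 \<Longrightarrow> 0 \<le> e \<Longrightarrow> e \<le> e1 \<Longrightarrow> \<bar>G b e - (\<Sum>k<n. fps_nth (\<Psi> b) k * e ^ k)\<bar> \<le> D * e ^ n"
    using unifE[OF assms(2)] by metis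
  obtain M e2 where M: "e2 > 0" "e2 \<le> 1" "M \<ge> 0"
    "\<And>b e. 0 \<le> b \<Longrightarrow> b \<le> 1 \<Longrightarrow> 0 \<le> e \<Longrightarrow> e \<le> e2 \<Longrightarrow> \<bar>\<Sum>k<n. fps_nth (\<Phi> b) k * e ^ k\<bar> \<le> M"
    using unif_bounded[OF assms(1)] by metis
  obtain M' e3 where M': "e3 > 0" "e3 \<le> 1" "M' \<ge> 0"
    "\<And>b e. 0 \<le> b \<Longrightarrow> b \<le> 1 \<Longrightarrow> 0 \<le> e \<Longrightarrow> e \<le> e3 \<Longrightarrow> \<bar>G b e\<bar> \<le> M'"
    using unif_bounded[OF assms(2)] by metis
  obtain B where B: "B \<ge> 0" "\<And>b k. 0 \<le> b \<Longrightarrow> b \<le> 1 \<Longrightarrow> k < n \<Longrightarrow> \<bar>fps_nth (\<Phi> b) k\<bar> \<le> B"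
    using unif_coeffs[OF assms(1)] by metis
  obtain B' where B': "B' \<ge> 0" "\<And>b k. 0 \<le> b \<Longrightarrow> b \<le> 1 \<Longrightarrow> k < n \<Longrightarrow> \<bar>fps_nth (\<Psi> b) k\<bar> \<le> B'"
    using unif_coeffs[OF assms(2)] by metis
  define I where "I = {(i, j). i < n \<and> j < n \<and> n \<le> i + j}"
  define J where "J = {(i, j). i + j < n}"
  have finI: "finite I" by (rule finite_subset[of _ "{..n} \<times> {..n}"]) (auto simp: I_def)
  have finJ: "finite J" by (rule finite_subset[of _ "{..n} \<times> {..n}"]) (auto simp: J_def)
  have prod: "\<bar>(\<Sum>k<n. fps_nth (\<Phi> b) k * e ^ k) * (\<Sum>k<n. fps_nth (\<Psi> b) k * e ^ k) - (\<Sum>k<n. fps_nth (\<Phi> b * \<Psi> b) k * e ^ k)\<bar>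
     \<le> real (card I) * (B * B') * e ^ n" if b: "0 \<le> b" "b \<le> 1" and e: "0 \<le> e" "e \<le> 1" for b e
  proof -
    define f where "f i j = fps_nth (\<Phi> b) i * fps_nth (\<Psi> b) j * e ^ (i + j)" for i j
    have "(\<Sum>k<n. fps_nth (\<Phi> b) k * e ^ k) * (\<Sum>k<n. fps_nth (\<Psi> b) k * e ^ k) = (\<Sum>(i,j)\<in>{..<n} \<times> {..<n}. f i j)"
      by (simp add: sum_product sum.cartesian_product f_def power_add mult_ac)
    also have "{..<n} \<times> {..<n} = J \<union> I" by (auto simp: I_def J_def)
    also have "(\<Sum>(i,j)\<in>J \<union> I. f i j) = (\<Sum>(i,j)\<in>J. f i j) + (\<Sum>(i,j)\<in>I. f i j)"
      by (intro sum.union_disjoint finI finJ) (auto simp: I_def J_def)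
    also have "(\<Sum>(i,j)\<in>J. f i j) = (\<Sum>k<n. \<Sum>i\<le>k. f i (k - i))"
      unfolding J_def by (rule sum.triangle_reindex)
    also have "\<dots> = (\<Sum>k<n. fps_nth (\<Phi> b * \<Psi> b) k * e ^ k)"
      by (intro sum.cong refl) (simp add: f_def fps_mult_nth sum_distrib_right atMost_atLeast0)
    finally have "(\<Sum>k<n. fps_nth (\<Phi> b) k * e ^ k) * (\<Sum>k<n. fps_nth (\<Psi> b) k * e ^ k) - (\<Sum>k<n. fps_nth (\<Phi> b * \<Psi> b) k * e ^ k) = (\<Sum>(i,j)\<in>I. f i j)"
      by simp
    moreover have "norm (\<Sum>(i,j)\<in>I. f i j) \<le> of_nat (card I) * (B * B' * e ^ n)"
    proof (rule sum_norm_bound)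
      fix p assume "p \<in> I"
      then obtain i j where p: "p = (i, j)" "i < n" "j < n" "n \<le> i + j" by (auto simp: I_def)
      have "\<bar>f i j\<bar> = \<bar>fps_nth (\<Phi> b) i\<bar> * \<bar>fps_nth (\<Psi> b) j\<bar> * e ^ (i + j)"
        using e by (simp add: f_def abs_mult)
      also have "\<dots> \<le> B * B' * e ^ n"
        using B(2)[OF b p(2)] B'(2)[OF b p(3)] B(1) B'(1) e p(4) by (intro mult_mono power_decreasing) auto
      finally show "norm (case p of (i, j) \<Rightarrow> f i j) \<le> B * B' * e ^ n" by (simp add: p)
    qed
    ultimately show ?thesis by (simp add: mult_ac)
  qed
  show ?thesis
  proof (rule unifI[of _ _ "min (min e0 e1) (min e2 e3)" _ "C * M' + M * D + real (card I) * (B * B')"])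
    fix k assume k: "k < n"
    have "\<bar>fps_nth (\<Phi> b * \<Psi> b) k\<bar> \<le> real (k + 1) * (B * B')" if "b \<in> {0..1}" for b
    proof -
      have "norm (\<Sum>i=0..k. fps_nth (\<Phi> b) i * fps_nth (\<Psi> b) (k - i)) \<le> of_nat (card {0..k}) * (B * B')"
      proof (rule sum_norm_bound)
        fix i assume "i \<in> {0..k}"
        then show "norm (fps_nth (\<Phi> b) i * fps_nth (\<Psi> b) (k - i)) \<le> B * B'"
          using B(2)[of b i] B'(2)[of b "k - i"] that k B(1) by (auto simp: abs_mult intro!: mult_mono)
      qed
      then show ?thesis by (simp add: fps_mult_nth)
    qed
    then show "\<exists>B. \<forall>b\<in>{0..1}. \<bar>fps_nth (\<Phi> b * \<Psi> b) k\<bar> \<le> B" by blast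
  next
    fix b e :: real assume be: "0 \<le> b" "b \<le> 1" "0 \<le> e" "e \<le> min (min e0 e1) (min e2 e3)" "e \<le> 1"
    then have b: "0 \<le> b" "b \<le> 1" and e: "0 \<le> e" "e \<le> e0" "e \<le> e1" "e \<le> e2" "e \<le> e3" "e \<le> 1" using C(2) by auto
    define p q r where "p = (\<Sum>k<n. fps_nth (\<Phi> b) k * e ^ k)" and "q = (\<Sum>k<n. fps_nth (\<Psi> b) k * e ^ k)"
      and "r = (\<Sum>k<n. fps_nth (\<Phi> b * \<Psi> b) k * e ^ k)"
    have "F b e * G b e - r = (F b e - p) * G b e + p * (G b e - q) + (p * q - r)"
      by (simp add: algebra_simps)
    then have "\<bar>F b e * G b e - r\<bar> \<le> \<bar>F b e - p\<bar> * \<bar>G b e\<bar> + \<bar>p\<bar> * \<bar>G b e - q\<bar> + \<bar>p * q - r\<bar>"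
      unfolding abs_mult[symmetric] by linarith
    also have "\<dots> \<le> (C * e ^ n) * M' + M * (D * e ^ n) + real (card I) * (B * B') * e ^ n"
      using C(4)[OF b e(1,2)] D(4)[OF b e(1,3)] M(4)[OF b e(1,4)] M'(4)[OF b e(1,5)] prod[OF b e(1,6)] C(3) M(3) e
      by (intro add_mono mult_mono) (auto simp: p_def q_def r_def)
    finally show "\<bar>F b e * G b e - (\<Sum>k<n. fps_nth (\<Phi> b * \<Psi> b) k * e ^ k)\<bar> \<le> (C * M' + M * D + real (card I) * (B * B')) * e ^ n"
      by (simp add: r_def algebra_simps)
  qed (use C(1) D(1) M(1) M'(1) in simp)
qed

lemma unif_poly_const:
  assumes "\<And>b. f b = poly p b"
  shows "unif n (\<lambda>b _. f b) (\<lambda>b. fps_const (f b))"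
proof (cases "n = 0")
  case True
  have "bounded (poly p ` {0..1})"
    by (intro compact_imp_bounded compact_continuous_image continuous_intros) auto
  then obtain B where "\<forall>x\<in>poly p ` {0..1}. norm x \<le> B" unfolding bounded_iff by blast
  then have "\<bar>f b\<bar> \<le> B" if "0 \<le> b" "b \<le> 1" for b using that by (simp add: assms)
  then show ?thesis using True by (intro unifI[of _ _ 1 _ B]) auto
next
  case False
  have "unif n (\<lambda>b e. \<Sum>k<n. fps_nth (fps_const (f b)) k * e ^ k) (\<lambda>b. fps_const (f b))"
    by (rule unif_poly[of _ _ "\<lambda>k. if k = 0 then p else 0"]) (auto simp: assms)
  then show ?thesis
  proof (rule unif_cong[OF _ refl zero_less_one])
    fix b e :: real
    have "(\<Sum>k<n. fps_nth (fps_const (f b)) k * e ^ k) = (\<Sum>k<n. if k = 0 then f b else 0)"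
      by (intro sum.cong) auto
    then show "(\<Sum>k<n. fps_nth (fps_const (f b)) k * e ^ k) = f b" using False by simp
  qed
qed

lemma unif_sum:
  assumes "\<And>i. i \<in> A \<Longrightarrow> unif n (F i) (\<Phi> i)"
  shows "unif n (\<lambda>b e. \<Sum>i\<in>A. F i b e) (\<lambda>b. \<Sum>i\<in>A. \<Phi> i b)"
proof (cases "finite A")
  case True
  then show ?thesis using assms
  proof (induction A rule: finite_induct)
    case empty
    then show ?case using unif_poly_const[of "\<lambda>_. 0" 0 n] by simp
  next
    case (insert a A)
    then show ?case by (simp add: unif_add)
  qed
next
  case False
  then show ?thesis using unif_poly_const[of "\<lambda>_. 0" 0 n] by simp
qed

lemma unif_power:
  assumes "unif n F \<Phi>"
  shows "unif n (\<lambda>b e. F b e ^ k) (\<lambda>b. \<Phi> b ^ k)"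
proof (induction k)
  case 0
  show ?case using unif_poly_const[of "\<lambda>_. 1" "[:1:]" n] by simp
next
  case (Suc k)
  show ?case unfolding power_Suc by (intro unif_mult assms Suc)
qed

lemma unif_X: "unif n (\<lambda>_ e. e) (\<lambda>_. fps_X)"
proof -
  have "unif (n + 2) (\<lambda>b e. \<Sum>k<n+2. fps_nth fps_X k * e ^ k) (\<lambda>_. fps_X)"
    by (rule unif_poly[of _ _ "\<lambda>k. if k = 1 then 1 else 0"]) auto
  moreover have "(\<Sum>k<n+2. fps_nth fps_X k * e ^ k) = (e :: real)" for e
  proof -
    have "(\<Sum>k<n+2. fps_nth fps_X k * e ^ k) = (\<Sum>k<n+2. if k = 1 then e else 0)"
      by (intro sum.cong) auto
    then show ?thesis by simp
  qed
  ultimately have 1: "unif (n + 2) (\<lambda>_ e. e) (\<lambda>_. fps_X)" by simp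
  show ?thesis
  proof (cases "n \<ge> 2")
    case True
    have "(\<Sum>k<n. fps_nth fps_X k * e ^ k) = (e :: real)" for e
    proof -
      have "(\<Sum>k<n. fps_nth fps_X k * e ^ k) = (\<Sum>k<n. if k = 1 then e else 0)"
        by (intro sum.cong) auto
      then show ?thesis using True by simp
    qed
    then show ?thesis unfolding unif_def by (intro conjI allI impI exI[of _ 0] exI[of _ 1]) auto
  next
    case False
    then have "n = 0 \<or> n = 1" by auto
    then show ?thesis unfolding unif_def
      by (intro conjI allI impI exI[of _ 1] exI[of _ 1]) auto
  qed
qed

lemma unif_pfps:
  assumes "unif n F \<Phi>"
  shows "unif n (\<lambda>b e. poly p (F b e)) (\<lambda>b. pfps p (\<Phi> b))"
proof (induction p)
  case 0
  then show ?case using unif_poly_const[of "\<lambda>_. 0" 0 n] by simp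
next
  case (pCons a p)
  have "unif n (\<lambda>b e. a + F b e * poly p (F b e)) (\<lambda>b. fps_const a + \<Phi> b * pfps p (\<Phi> b))"
    by (intro unif_add unif_mult assms pCons unif_poly_const[of _ "[:a:]"]) simp
  then show ?case by simp
qed

lemma unif_zeroE:
  assumes "unif n F (\<lambda>_. 0)"
  obtains C e0 where "e0 > 0" "e0 \<le> 1" "C \<ge> 0"
    "\<And>b e. 0 \<le> b \<Longrightarrow> b \<le> 1 \<Longrightarrow> 0 \<le> e \<Longrightarrow> e \<le> e0 \<Longrightarrow> \<bar>F b e\<bar> \<le> C * e ^ n"
proof -
  obtain C e0 where C: "e0 > 0" "e0 \<le> 1" "C \<ge> 0"
    "\<And>b e. 0 \<le> b \<Longrightarrow> b \<le> 1 \<Longrightarrow> 0 \<le> e \<Longrightarrow> e \<le> e0 \<Longrightarrow> \<bar>F b e - (\<Sum>k<n. fps_nth (0 :: real fps) k * e ^ k)\<bar> \<le> C * e ^ n"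
    using unifE[OF assms] by metis
  then show thesis by (intro that[of e0 C]) auto
qed

text \<open>If \<open>\<Psi>\<close> solves the same equation as \<open>G\<close> formally, the truncation of \<open>\<Psi>\<close> solves it up to \<open>O(\<epsilon>\<^sup>n)\<close>.\<close>

lemma unif_inverse:
  assumes F: "unif n F \<Phi>" and eq: "\<And>b. \<Psi> b * \<Phi> b = 1" and P: "fps_poly_coeffs n \<Psi>"
    and e1: "e1 > 0" "\<And>b e. 0 \<le> b \<Longrightarrow> b \<le> 1 \<Longrightarrow> 0 \<le> e \<Longrightarrow> e \<le> e1 \<Longrightarrow> F b e \<ge> 1 / 2"
  shows "unif n (\<lambda>b e. 1 / F b e) \<Psi>"
proof -
  define W where "W b e = (\<Sum>k<n. fps_nth (\<Psi> b) k * e ^ k)" for b e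
  have W: "unif n W \<Psi>" unfolding W_def[abs_def] by (rule unif_truncation[OF P])
  define Z where "Z b e = W b e * F b e + (- 1)" for b e
  have "\<Psi> b * \<Phi> b + fps_const (- 1) = 0" for b unfolding eq by (simp flip: fps_const_neg)
  moreover have "unif n Z (\<lambda>b. \<Psi> b * \<Phi> b + fps_const (- 1))"
    unfolding Z_def by (intro unif_add unif_mult W F unif_poly_const[of _ "[:-1:]"]) simp
  ultimately have 1: "unif n Z (\<lambda>_. 0)" by simp
  obtain C e0 where C: "e0 > 0" "e0 \<le> 1" "C \<ge> 0" "\<And>b e. 0 \<le> b \<Longrightarrow> b \<le> 1 \<Longrightarrow> 0 \<le> e \<Longrightarrow> e \<le> e0 \<Longrightarrow> \<bar>Z b e\<bar> \<le> C * e ^ n"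
    using unif_zeroE[OF 1] by metis
  show ?thesis
  proof (rule unifI[of _ _ "min e0 e1" _ "2 * C"])
    fix b e :: real assume "0 \<le> b" "b \<le> 1" "0 \<le> e" "e \<le> min e0 e1"
    then have be: "0 \<le> b" "b \<le> 1" "0 \<le> e" "e \<le> e0" "e \<le> e1" by auto
    have f: "F b e \<ge> 1 / 2" by (rule e1(2)[OF be(1-3,5)])
    have c: "\<bar>W b e * F b e - 1\<bar> \<le> C * e ^ n" using C(4)[OF be(1-4)] by (simp add: Z_def)
    have "1 / F b e - W b e = - (W b e * F b e - 1) / F b e" using f by (simp add: field_simps)
    then have "\<bar>1 / F b e - W b e\<bar> = \<bar>W b e * F b e - 1\<bar> / F b e" using f by (simp add: abs_minus_commute)
    also have "\<dots> \<le> C * e ^ n / (1 / 2)" using c f C(3) be by (intro frac_le) auto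
    finally show "\<bar>1 / F b e - (\<Sum>k<n. fps_nth (\<Psi> b) k * e ^ k)\<bar> \<le> 2 * C * e ^ n" by (simp add: W_def)
  qed (use W C e1 in \<open>auto simp: unif_def\<close>)
qed

text \<open>The truncation \<open>W\<close> satisfies \<open>W^2 F = 1 + O(e^n)\<close>. With
  \<open>s = sqrt F\<close> the left side minus 1 is \<open>(W s - 1) (W s + 1)\<close>, and the
  second factor is at least 1 as soon as \<open>W \<ge> 0\<close>.\<close>

lemma unif_inverse_sqrt:
  assumes F: "unif n F \<Phi>" and eq: "\<And>b. \<Psi> b * \<Psi> b * \<Phi> b = 1" and P: "fps_poly_coeffs n \<Psi>"
    and P0: "\<And>b. fps_nth (\<Psi> b) 0 = 1"
    and e1: "e1 > 0" "\<And>b e. 0 \<le> b \<Longrightarrow> b \<le> 1 \<Longrightarrow> 0 \<le> e \<Longrightarrow> e \<le> e1 \<Longrightarrow> F b e \<ge> 1 / 4"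
  shows "unif n (\<lambda>b e. 1 / sqrt (F b e)) \<Psi>"
proof -
  define W where "W b e = (\<Sum>k<n. fps_nth (\<Psi> b) k * e ^ k)" for b e
  have W: "unif n W \<Psi>" unfolding W_def[abs_def] by (rule unif_truncation[OF P])
  obtain B where B: "B \<ge> 0" "\<And>b k. 0 \<le> b \<Longrightarrow> b \<le> 1 \<Longrightarrow> k < n \<Longrightarrow> \<bar>fps_nth (\<Psi> b) k\<bar> \<le> B"
    using unif_coeffs[OF W] by metis
  \<comment> \<open>So small that the terms of positive order in \<open>W\<close> add up to at most
    1, the leading coefficient.\<close>
  define e2 where "e2 = min 1 (1 / (1 + real n * B))"
  have nB: "1 + real n * B > 0" using B(1) by (simp add: add_pos_nonneg)
  have e2: "e2 > 0" "e2 \<le> 1" using nB by (simp_all add: e2_def)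
  have Wpos: "W b e \<ge> 0" if "0 \<le> b" "b \<le> 1" "0 \<le> e" "e \<le> e2" for b e
  proof (cases "n = 0")
    case False
    then obtain m where m: "n = Suc m" by (cases n) auto
    have "\<bar>\<Sum>k<m. fps_nth (\<Psi> b) (Suc k) * e ^ Suc k\<bar> \<le> (\<Sum>k<m. \<bar>fps_nth (\<Psi> b) (Suc k) * e ^ Suc k\<bar>)"
      by (rule sum_abs)
    also have "\<dots> \<le> (\<Sum>k<m. B * e)"
    proof (intro sum_mono)
      fix k assume "k \<in> {..<m}"
      moreover have "e ^ Suc k \<le> e"
        using that e2 power_le_one[of e k] by (simp add: mult_left_le)
      ultimately show "\<bar>fps_nth (\<Psi> b) (Suc k) * e ^ Suc k\<bar> \<le> B * e"
        unfolding abs_mult using B that m by (intro mult_mono) auto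
    qed
    also have "\<dots> = real m * (B * e)" by simp
    also have "\<dots> \<le> real n * (B * e)" using B(1) that m by (intro mult_right_mono) auto
    also have "\<dots> \<le> 1"
    proof -
      have "e \<le> 1 / (1 + real n * B)" using that by (simp add: e2_def)
      then have "e * (1 + real n * B) \<le> 1" using nB by (simp add: field_simps)
      then show ?thesis using that by (simp add: algebra_simps)
    qed
    finally have "\<bar>\<Sum>k<m. fps_nth (\<Psi> b) (Suc k) * e ^ Suc k\<bar> \<le> 1" .
    moreover have "W b e = 1 + (\<Sum>k<m. fps_nth (\<Psi> b) (Suc k) * e ^ Suc k)"
      unfolding W_def m sum.lessThan_Suc_shift by (simp add: P0)
    ultimately show ?thesis by linarith
  qed (simp add: W_def)
  define Z where "Z b e = W b e * W b e * F b e + (- 1)" for b e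
  have "\<Psi> b * \<Psi> b * \<Phi> b + fps_const (- 1) = 0" for b unfolding eq by (simp flip: fps_const_neg)
  moreover have "unif n Z (\<lambda>b. \<Psi> b * \<Psi> b * \<Phi> b + fps_const (- 1))"
    unfolding Z_def by (intro unif_add unif_mult W F unif_poly_const[of _ "[:-1:]"]) simp
  ultimately have 1: "unif n Z (\<lambda>_. 0)" by simp
  obtain C e0 where C: "e0 > 0" "e0 \<le> 1" "C \<ge> 0" "\<And>b e. 0 \<le> b \<Longrightarrow> b \<le> 1 \<Longrightarrow> 0 \<le> e \<Longrightarrow> e \<le> e0 \<Longrightarrow> \<bar>Z b e\<bar> \<le> C * e ^ n"
    using unif_zeroE[OF 1] by metis
  show ?thesis
  proof (rule unifI[of _ _ "min e0 (min e1 e2)" _ "2 * C"])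
    fix b e :: real assume "0 \<le> b" "b \<le> 1" "0 \<le> e" "e \<le> min e0 (min e1 e2)"
    then have be: "0 \<le> b" "b \<le> 1" "0 \<le> e" "e \<le> e0" "e \<le> e1" "e \<le> e2" by auto
    define s where "s = sqrt (F b e)"
    have f: "F b e \<ge> 1 / 4" by (rule e1(2)[OF be(1-3,5)])
    then have "sqrt (1 / 4) \<le> s" unfolding s_def by (rule real_sqrt_le_mono)
    then have s: "s \<ge> 1 / 2" "s * s = F b e" using f by (simp_all add: s_def real_sqrt_divide)
    have w: "W b e \<ge> 0" by (rule Wpos[OF be(1-3,6)])
    have c: "\<bar>W b e * W b e * F b e - 1\<bar> \<le> C * e ^ n" using C(4)[OF be(1-4)] by (simp add: Z_def)
    have "W b e * W b e * F b e - 1 = (W b e * s - 1) * (W b e * s + 1)"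
      unfolding s(2)[symmetric] by (simp add: algebra_simps)
    then have "\<bar>W b e * s - 1\<bar> * \<bar>W b e * s + 1\<bar> \<le> C * e ^ n" using c by (simp add: abs_mult)
    moreover have "\<bar>W b e * s - 1\<bar> * 1 \<le> \<bar>W b e * s - 1\<bar> * \<bar>W b e * s + 1\<bar>"
      using w s by (intro mult_left_mono) auto
    ultimately have c': "\<bar>W b e * s - 1\<bar> \<le> C * e ^ n" by (metis mult_1_right order_trans)
    have "1 / s - W b e = - (W b e * s - 1) / s" using s by (simp add: field_simps)
    then have "\<bar>1 / s - W b e\<bar> = \<bar>W b e * s - 1\<bar> / s" using s by (simp add: abs_minus_commute)
    also have "\<dots> \<le> C * e ^ n / (1 / 2)" using c' s C(3) be by (intro frac_le) auto
    finally show "\<bar>1 / sqrt (F b e) - (\<Sum>k<n. fps_nth (\<Psi> b) k * e ^ k)\<bar> \<le> 2 * C * e ^ n" by (simp add: W_def s_def)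
  qed (use W C e1 e2 in \<open>auto simp: unif_def\<close>)
qed

subsection \<open>The truncated expansion solves the phase equation up to a uniform remainder\<close>

lemma bh_nonneg [simp]: "0 \<le> bh x"
  by (rule less_imp_le) simp

lemma bh_le_1: "bh x \<le> 1"
proof -
  have "1 + x\<^sup>2 > 0" by (simp add: add_pos_nonneg)
  moreover have "1 \<le> sqrt (1 + x\<^sup>2)" by simp
  ultimately show ?thesis unfolding bh_def by (simp add: divide_le_eq_1 add_pos_nonneg)
qed

definition V_sum :: "nat \<Rightarrow> real \<Rightarrow> real \<Rightarrow> real" where
  "V_sum n b e = (\<Sum>k<n. fps_nth (v_sol b) k * e ^ k)"

definition U_sum :: "nat \<Rightarrow> real \<Rightarrow> real \<Rightarrow> real" where
  "U_sum n b e = 1 + (1 - b) * ((2 * b) * V_sum n b e + b\<^sup>2 * (V_sum n b e * V_sum n b e))"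

lemma unif_V_sum: "unif n (V_sum n) v_sol"
  unfolding V_sum_def[abs_def] by (rule unif_truncation[OF fps_poly_coeffs_v_sol])

lemma V_sum_0: "V_sum n b 0 = 0"
proof -
  have "(\<Sum>k<n. fps_nth (v_sol b) k * 0 ^ k) = (\<Sum>k<n. 0 :: real)"
    by (intro sum.cong refl) (simp add: power_0_left)
  then show ?thesis by (simp add: V_sum_def)
qed

text \<open>The constant term of \<open>v_sol\<close> is 0, so the truncation is
  \<open>O(e)\<close>. The value \<open>1/8\<close> keeps \<open>U_sum\<close> and
  \<open>1 + b V\<close> away from 0.\<close>

lemma V_sum_small:
  obtains e0 where "e0 > 0" "e0 \<le> 1" "\<And>b e. 0 \<le> b \<Longrightarrow> b \<le> 1 \<Longrightarrow> 0 \<le> e \<Longrightarrow> e \<le> e0 \<Longrightarrow> \<bar>V_sum n b e\<bar> \<le> 1 / 8"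
proof -
  obtain B where B: "B \<ge> 0" "\<And>b k. 0 \<le> b \<Longrightarrow> b \<le> 1 \<Longrightarrow> k < n \<Longrightarrow> \<bar>fps_nth (v_sol b) k\<bar> \<le> B"
    using unif_coeffs[OF unif_V_sum[of n]] by metis
  define e0 where "e0 = 1 / (8 * (1 + real n * B))"
  have nB: "real n * B \<ge> 0" using B(1) by simp
  have e0: "e0 > 0" "e0 \<le> 1" "real n * B * e0 \<le> 1 / 8"
    using nB by (simp_all add: e0_def field_simps)
  have "\<bar>V_sum n b e\<bar> \<le> 1 / 8" if "0 \<le> b" "b \<le> 1" "0 \<le> e" "e \<le> e0" for b e
  proof -
    have "\<bar>V_sum n b e\<bar> \<le> (\<Sum>k<n. \<bar>fps_nth (v_sol b) k * e ^ k\<bar>)" unfolding V_sum_def by (rule sum_abs)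
    also have "\<dots> \<le> (\<Sum>k<n. B * e)"
    proof (intro sum_mono)
      fix k assume k: "k \<in> {..<n}"
      show "\<bar>fps_nth (v_sol b) k * e ^ k\<bar> \<le> B * e"
      proof (cases k)
        case (Suc j)
        have "e ^ j \<le> 1" using that e0 by (intro power_le_one) auto
        then have "e ^ k \<le> e" using that unfolding Suc power_Suc by (intro mult_left_le) auto
        then show ?thesis unfolding abs_mult using B k that by (intro mult_mono) auto
      qed (use B(1) that in simp)
    qed
    also have "\<dots> = real n * B * e" by simp
    also have "\<dots> \<le> real n * B * e0" using that nB by (intro mult_left_mono)
    finally show ?thesis using e0(3) by linarith
  qed
  then show thesis using that e0 by blast
qed

lemma U_sum_bounds:
  assumes b: "0 \<le> b" "b \<le> 1" and V: "\<bar>V_sum n b e\<bar> \<le> 1 / 8"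
  shows "U_sum n b e \<ge> 1 / 4" "1 + b * V_sum n b e \<ge> 1 / 2"
proof -
  define V where "V = V_sum n b e"
  have v: "\<bar>V\<bar> \<le> 1 / 8" using V by (simp add: V_def)
  have "\<bar>b * V\<bar> \<le> 1 * (1 / 8)" unfolding abs_mult using v b by (intro mult_mono) auto
  then have bv: "\<bar>b * V\<bar> \<le> 1 / 8" by simp
  then show "1 + b * V_sum n b e \<ge> 1 / 2" unfolding V_def by linarith
  have "\<bar>(1 - b) * (2 * (b * V))\<bar> \<le> 1 * (2 * (1 / 8))"
    unfolding abs_mult using b bv by (intro mult_mono) (auto simp: abs_mult)
  moreover have "U_sum n b e = 1 + (1 - b) * (2 * (b * V)) + (1 - b) * (b * V)\<^sup>2"
    by (simp add: U_sum_def V_def algebra_simps power2_eq_square)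
  moreover have "(1 - b) * (b * V)\<^sup>2 \<ge> 0" using b by simp
  ultimately show "U_sum n b e \<ge> 1 / 4" by linarith
qed

lemma unif_U_sum: "unif n (U_sum n) (\<lambda>b. 1 + v_u b (v_sol b))"
proof -
  have "unif n (\<lambda>b e. 1 + (1 - b) * ((2 * b) * V_sum n b e + b\<^sup>2 * (V_sum n b e * V_sum n b e)))
     (\<lambda>b. fps_const 1 + fps_const (1 - b) * (fps_const (2 * b) * v_sol b + fps_const (b\<^sup>2) * (v_sol b * v_sol b)))"
    by (intro unif_add unif_mult unif_V_sum unif_poly_const[of _ "[:1:]"] unif_poly_const[of _ "[:1, -1:]"]
        unif_poly_const[of _ "[:0, 2:]"] unif_poly_const[of _ "[:0, 0, 1:]"]) (simp_all add: power2_eq_square)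
  then show ?thesis by (simp add: U_sum_def[abs_def] v_u_def)
qed

lemma unif_I_sum: "unif n (\<lambda>b e. 1 / sqrt (U_sum n b e)) (\<lambda>b. v_I b (v_sol b))"
proof -
  obtain e0 where e0: "e0 > 0" "\<And>b e. 0 \<le> b \<Longrightarrow> b \<le> 1 \<Longrightarrow> 0 \<le> e \<Longrightarrow> e \<le> e0 \<Longrightarrow> \<bar>V_sum n b e\<bar> \<le> 1 / 8"
    using V_sum_small[of n] by metis
  show ?thesis
    by (rule unif_inverse_sqrt[OF unif_U_sum _ _ _ e0(1)])
      (use e0 U_sum_bounds(1) v_I_sq fps_poly_coeffs_v(2)[OF fps_poly_coeffs_v_sol] in auto)
qed

text \<open>The quotient is read as \<open>U\<close> times \<open>U^(-1/2)\<close> times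
  \<open>(1 + b V)^(-1)\<close>, to which the two inversion lemmas apply.\<close>

lemma unif_W_sum: "unif n (\<lambda>b e. sqrt (U_sum n b e) / (1 + b * V_sum n b e)) (\<lambda>b. v_W b (v_sol b))"
proof -
  obtain e0 where e0: "e0 > 0" "\<And>b e. 0 \<le> b \<Longrightarrow> b \<le> 1 \<Longrightarrow> 0 \<le> e \<Longrightarrow> e \<le> e0 \<Longrightarrow> \<bar>V_sum n b e\<bar> \<le> 1 / 8"
    using V_sum_small[of n] by metis
  define Q where "Q b = fps_binomial (- 1) oo (fps_const b * v_sol b)" for b
  have "unif n (\<lambda>b e. 1 + b * V_sum n b e) (\<lambda>b. fps_const 1 + fps_const b * v_sol b)"
    by (intro unif_add unif_mult unif_V_sum unif_poly_const[of _ "[:1:]"] unif_poly_const[of _ "[:0, 1:]"]) simp_all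
  then have 1: "unif n (\<lambda>b e. 1 + b * V_sum n b e) (\<lambda>b. 1 + fps_const b * v_sol b)" by simp
  have Q1: "Q b * (1 + fps_const b * v_sol b) = 1" for b
  proof -
    have 0: "fps_nth (fps_const b * v_sol b) 0 = 0" by simp
    note c = fps_binomial_compose[OF 0]
    have "Q b * (1 + fps_const b * v_sol b) = fps_binomial (- 1 + 1) oo (fps_const b * v_sol b)"
      unfolding Q_def by (simp only: c(1) c(3)[symmetric])
    then show ?thesis by (simp add: c(2) del: fps_binomial_0)
  qed
  have "fps_poly_coeffs n Q"
    unfolding Q_def[abs_def] by (intro fps_poly_coeffs_compose fps_poly_coeffs_mult fps_poly_coeffs_const poly_funs fps_poly_coeffs_v_sol)
  then have 2: "unif n (\<lambda>b e. 1 / (1 + b * V_sum n b e)) Q"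
    by (intro unif_inverse[OF 1 Q1 _ e0(1)]) (use e0 U_sum_bounds(2) in auto)
  have A: "(1 + v_u b (v_sol b)) * v_I b (v_sol b) * Q b = v_W b (v_sol b)" for b
  proof -
    note i = v_I_sq[OF v_sol_0, of b b]
    have "(1 + v_u b (v_sol b)) * v_I b (v_sol b) = v_A b (v_sol b) * (v_A b (v_sol b) * v_I b (v_sol b))"
      by (simp only: i(3)[symmetric] mult.assoc)
    then show ?thesis by (simp add: i(2) v_W_def Q_def)
  qed
  show ?thesis
  proof (rule unif_cong[OF unif_mult[OF unif_mult[OF unif_U_sum unif_I_sum] 2] _ e0(1)])
    fix b e :: real assume be: "0 \<le> b" "b \<le> 1" "0 \<le> e" "e \<le> e0"
    then have "U_sum n b e \<ge> 1 / 4" using U_sum_bounds(1) e0 by blast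
    then show "U_sum n b e * (1 / sqrt (U_sum n b e)) * (1 / (1 + b * V_sum n b e)) = sqrt (U_sum n b e) / (1 + b * V_sum n b e)"
      by (simp add: real_div_sqrt)
  qed (simp add: A)
qed

text \<open>With \<open>e = 1 / \<nu>^2\<close> and \<open>x\<close> the leading coefficient, this
  is the partial sum that approximates the zero.\<close>

definition X_sum :: "nat \<Rightarrow> real \<Rightarrow> real \<Rightarrow> real" where
  "X_sum n x e = (\<Sum>s<n. q_coeff s x * e ^ s)"

lemma X_sum_eq:
  assumes "n \<ge> 1" "b = 1 / (1 + x\<^sup>2)"
  shows "X_sum n x e = x * (1 + b * V_sum n b e)"
proof -
  obtain m where m: "n = Suc m" using assms(1) by (cases n) auto
  show ?thesis
    unfolding X_sum_def V_sum_def m sum.lessThan_Suc_shift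
    by (simp add: q_coeff_def assms(2)[symmetric] sum_distrib_left algebra_simps)
qed

lemma bh_X_sum:
  assumes "n \<ge> 1" "b = 1 / (1 + x\<^sup>2)"
  shows "1 + (X_sum n x e)\<^sup>2 = (1 + x\<^sup>2) * U_sum n b e" "bh (X_sum n x e) = bh x * (1 / sqrt (U_sum n b e))"
proof -
  define V where "V = V_sum n b e"
  have p: "1 + x\<^sup>2 > 0" by (simp add: add_pos_nonneg)
  have b: "(1 + x\<^sup>2) * (1 - b) = x\<^sup>2" using p by (simp add: assms(2) field_simps)
  have "(1 + x\<^sup>2) * U_sum n b e = (1 + x\<^sup>2) + ((1 + x\<^sup>2) * (1 - b)) * ((2 * b) * V + b\<^sup>2 * (V * V))"
    by (simp only: U_sum_def V_def distrib_left mult.assoc mult_1_right)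
  also have "\<dots> = 1 + (X_sum n x e)\<^sup>2"
    unfolding b X_sum_eq[OF assms] V_def by algebra
  finally show *: "1 + (X_sum n x e)\<^sup>2 = (1 + x\<^sup>2) * U_sum n b e" by simp
  show "bh (X_sum n x e) = bh x * (1 / sqrt (U_sum n b e))"
    unfolding bh_def * real_sqrt_mult by simp
qed

lemma E_hat_X_sum:
  assumes "n \<ge> 1" "b = 1 / (1 + x\<^sup>2)" "U_sum n b e \<ge> 0"
  shows "E_hat (2 * s + 1) (bh (X_sum n x e)) = bh x * (1 / sqrt (U_sum n b e) *
    poly (P_poly s) (b * (1 / sqrt (U_sum n b e) * (1 / sqrt (U_sum n b e)))))"
proof -
  have p: "1 + x\<^sup>2 > 0" by (simp add: add_pos_nonneg)
  have bb: "bh x * bh x = b" using bh_sq[of x] p by (simp add: assms(2) field_simps)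
  have "(bh x * c)\<^sup>2 = (bh x * bh x) * (c * c)" for c by algebra
  then have "(bh (X_sum n x e))\<^sup>2 = b * (1 / sqrt (U_sum n b e) * (1 / sqrt (U_sum n b e)))"
    unfolding bh_X_sum(2)[OF assms(1,2)] bb .
  then show ?thesis
    unfolding E_hat_odd bh_X_sum(2)[OF assms(1,2)] by (simp only: mult.assoc)
qed

text \<open>The recursion \<open>v_sol_next\<close> at \<open>n = j + 1\<close>, rewritten for the
  product \<open>v_W * v'\<close> in which it is needed.\<close>

lemma v_sol_residual:
  "fps_nth (v_W b (v_sol b) * fps_deriv (v_sol b)) j = - real (Suc j) * (\<Sum>s<Suc j. fps_nth (v_H b s (v_sol b)) (j - s))"
proof -
  define n where "n = Suc j"
  have "fps_nth (v_W b (v_sol b) * fps_deriv (v_sol b)) j = (\<Sum>i=0..j. fps_nth (v_W b (v_sol b)) i * (real (n - i) * fps_nth (v_sol b) (n - i)))"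
    unfolding fps_mult_nth by (intro sum.cong) (auto simp: n_def Suc_diff_le)
  also have "\<dots> = real n * fps_nth (v_sol b) n + (\<Sum>i=1..<n. fps_nth (v_W b (v_sol b)) i * (real (n - i) * fps_nth (v_sol b) (n - i)))"
    by (simp add: sum.atLeast_Suc_atMost v_W_eq(2) n_def atLeastLessThanSuc_atLeastAtMost)
  also have "fps_nth (v_sol b) n = v_next b (v_sol b) n" by (rule v_sol_next) (simp add: n_def)
  also have "real n * v_next b (v_sol b) n + (\<Sum>i=1..<n. fps_nth (v_W b (v_sol b)) i * (real (n - i) * fps_nth (v_sol b) (n - i)))
     = - real n * (\<Sum>s<n. fps_nth (v_H b s (v_sol b)) (n - Suc s))"
    by (simp add: v_next_def right_diff_distrib n_def del: of_nat_Suc)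
  finally show ?thesis by (simp add: n_def)
qed

lemma has_real_derivative_V_sum:
  "((\<lambda>e. V_sum (Suc m) b e) has_real_derivative (\<Sum>k<m. fps_nth (fps_deriv (v_sol b)) k * e ^ k)) (at e)"
proof -
  have "((\<lambda>e. \<Sum>k<m. fps_nth (v_sol b) (Suc k) * e ^ Suc k) has_real_derivative (\<Sum>k<m. fps_nth (fps_deriv (v_sol b)) k * e ^ k)) (at e)"
  proof (intro DERIV_sum)
    fix k
    show "((\<lambda>e. fps_nth (v_sol b) (Suc k) * e ^ Suc k) has_real_derivative fps_nth (fps_deriv (v_sol b)) k * e ^ k) (at e)"
      using DERIV_cmult[OF DERIV_pow[of "Suc k" e UNIV], of "fps_nth (v_sol b) (Suc k)"] by (simp add: mult_ac del: of_nat_Suc power_Suc)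
  qed
  then show ?thesis by (simp add: V_sum_def[abs_def] sum.lessThan_Suc_shift del: sum.lessThan_Suc)
qed

text \<open>\<open>\<rho>\<close> is unbounded in \<open>x\<close>, so it is not expanded directly.
  The \<open>e\<close>-derivative of \<open>\<rho>(X)\<close> is \<open>bh x\<close> times the
  function \<open>Z = W * D\<close>, which depends on \<open>x\<close> only through \<open>b\<close>
  and has a uniform expansion of order \<open>m\<close>; the mean value theorem raises this to order
  \<open>m + 1\<close>.\<close>

lemma rho_X_sum_expansion:
  obtains C e0 where "e0 > 0" "e0 \<le> 1" "C \<ge> 0"
    "\<And>x e. x > 0 \<Longrightarrow> 0 \<le> e \<Longrightarrow> e \<le> e0 \<Longrightarrow>
      \<bar>rho (X_sum (Suc m) x e) - rho x - bh x * (\<Sum>k<m. fps_nth (v_W (1 / (1 + x\<^sup>2)) (v_sol (1 / (1 + x\<^sup>2))) * fps_deriv (v_sol (1 / (1 + x\<^sup>2)))) k / real (Suc k) * e ^ Suc k)\<bar> \<le> C * e ^ Suc m"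
proof -
  define n where "n = Suc m"
  define D where "D b e = (\<Sum>k<m. fps_nth (fps_deriv (v_sol b)) k * e ^ k)" for b e
  define W where "W b e = sqrt (U_sum n b e) / (1 + b * V_sum n b e)" for b e
  define F where "F b = v_W b (v_sol b) * fps_deriv (v_sol b)" for b
  have "fps_poly_coeffs m (\<lambda>b. fps_deriv (v_sol b))"
    using fps_poly_coeffs_v_sol[of "Suc m"] unfolding fps_poly_coeffs_def fps_deriv_nth
    by (intro allI impI poly_fun_mult poly_fun_const) auto
  then have "unif m D (\<lambda>b. fps_deriv (v_sol b))" unfolding D_def[abs_def] by (rule unif_truncation)
  moreover have "unif m W (\<lambda>b. v_W b (v_sol b))"
    unfolding W_def[abs_def] by (rule unif_Suc, unfold n_def, rule unif_W_sum)
  ultimately have u: "unif m (\<lambda>b e. W b e * D b e) F" unfolding F_def[abs_def] by (intro unif_mult)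
  define Z where "Z b e = W b e * D b e" for b e
  have uZ: "unif m Z F" using u by (simp add: Z_def[abs_def])
  obtain C e0 where C: "e0 > 0" "e0 \<le> 1" "C \<ge> 0"
    "\<And>b e. 0 \<le> b \<Longrightarrow> b \<le> 1 \<Longrightarrow> 0 \<le> e \<Longrightarrow> e \<le> e0 \<Longrightarrow> \<bar>Z b e - (\<Sum>k<m. fps_nth (F b) k * e ^ k)\<bar> \<le> C * e ^ m"
    using unifE[OF uZ] by metis
  obtain e1 where e1: "e1 > 0" "\<And>b e. 0 \<le> b \<Longrightarrow> b \<le> 1 \<Longrightarrow> 0 \<le> e \<Longrightarrow> e \<le> e1 \<Longrightarrow> \<bar>V_sum n b e\<bar> \<le> 1 / 8"
    using V_sum_small[of n] by metis
  have "\<bar>rho (X_sum n x e) - rho x - bh x * (\<Sum>k<m. fps_nth (F (1 / (1 + x\<^sup>2))) k / real (Suc k) * e ^ Suc k)\<bar> \<le> C * e ^ n"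
    if x: "x > 0" and e: "0 \<le> e" "e \<le> min e0 e1" for x e
  proof -
    define b where "b = 1 / (1 + x\<^sup>2)"
    have p: "1 + x\<^sup>2 > 0" by (simp add: add_pos_nonneg)
    have b: "0 \<le> b" "b \<le> 1" using p by (simp_all add: b_def field_simps)
    have bb: "b * sqrt (1 + x\<^sup>2) = bh x" using p real_div_sqrt[of "1 + x\<^sup>2"] by (simp add: b_def bh_def field_simps)
    have n1: "n \<ge> 1" by (simp add: n_def)
    define h where "h t = rho (X_sum n x t) - rho x - bh x * (\<Sum>k<m. fps_nth (F b) k / real (Suc k) * t ^ Suc k)" for t
    define h' where "h' t = bh x * Z b t - bh x * (\<Sum>k<m. fps_nth (F b) k * t ^ k)" for t
    have d: "(h has_real_derivative h' t) (at t)" if t: "0 \<le> t" "t \<le> e" for t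
    proof -
      have v: "\<bar>V_sum n b t\<bar> \<le> 1 / 8" using e1(2)[OF b] t e by simp
      note ub = U_sum_bounds[OF b v]
      have Xe: "X_sum n x = (\<lambda>t. x * (1 + b * V_sum n b t))" using X_sum_eq[OF n1 b_def] by (intro ext)
      have X0: "X_sum n x t > 0" using ub x unfolding Xe by simp
      have dX: "(X_sum n x has_real_derivative x * (b * D b t)) (at t)"
        using DERIV_cmult[OF DERIV_add[OF DERIV_const DERIV_cmult[OF has_real_derivative_V_sum]], of x 1 b m b t] unfolding Xe by (simp add: D_def n_def del: fps_deriv_nth)
      have "((\<lambda>t. rho (X_sum n x t)) has_real_derivative sqrt ((X_sum n x t)\<^sup>2 + 1) / X_sum n x t * (x * (b * D b t))) (at t)"
        by (rule DERIV_chain2[OF has_real_derivative_rho[OF X0] dX])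
      also have "sqrt ((X_sum n x t)\<^sup>2 + 1) = sqrt (1 + x\<^sup>2) * sqrt (U_sum n b t)"
        using bh_X_sum(1)[OF n1 b_def, of t] by (simp add: add.commute real_sqrt_mult)
      also have "sqrt (1 + x\<^sup>2) * sqrt (U_sum n b t) / X_sum n x t * (x * (b * D b t)) = (b * sqrt (1 + x\<^sup>2)) * (W b t * D b t)"
      proof -
        have "p * q / (x * d) * (x * (b * D')) = (b * p) * (q / d * D')" if "d \<ge> 1 / 2" for p q d D'
          using x that by simp
        from this[OF ub(2)] show ?thesis unfolding Xe W_def .
      qed
      also have "\<dots> = bh x * Z b t" by (simp only: bb Z_def)
      finally have d1: "((\<lambda>t. rho (X_sum n x t)) has_real_derivative bh x * Z b t) (at t)" .
      have d2: "((\<lambda>t. \<Sum>k<m. fps_nth (F b) k / real (Suc k) * t ^ Suc k) has_real_derivative (\<Sum>k<m. fps_nth (F b) k * t ^ k)) (at t)"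
      proof (intro DERIV_sum)
        fix k
        show "((\<lambda>t. fps_nth (F b) k / real (Suc k) * t ^ Suc k) has_real_derivative fps_nth (F b) k * t ^ k) (at t)"
          using DERIV_cmult[OF DERIV_pow[of "Suc k" t UNIV], of "fps_nth (F b) k / real (Suc k)"] by (simp del: of_nat_Suc power_Suc)
      qed
      show ?thesis unfolding h_def[abs_def] h'_def
        using DERIV_diff[OF DERIV_diff[OF d1 DERIV_const] DERIV_cmult[OF d2, of "bh x"], of "rho x"] by simp
    qed
    have h0: "h 0 = 0" by (simp add: h_def X_sum_eq[OF n1 b_def] V_sum_0)
    have hb: "\<bar>h' t\<bar> \<le> C * e ^ m" if t: "0 \<le> t" "t \<le> e" for t
    proof -
      have "\<bar>h' t\<bar> = bh x * \<bar>Z b t - (\<Sum>k<m. fps_nth (F b) k * t ^ k)\<bar>"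
        unfolding h'_def right_diff_distrib[symmetric] abs_mult using bh_pos[of x] by simp
      also have "\<dots> \<le> 1 * (C * t ^ m)"
        using C(4)[OF b, of t] t e by (intro mult_mono) (auto simp: bh_le_1)
      also have "\<dots> \<le> C * e ^ m" using C(3) t by (simp add: mult_left_mono power_mono)
      finally show ?thesis .
    qed
    have "\<bar>h e\<bar> \<le> C * e ^ n"
    proof (cases "e = 0")
      case True
      then show ?thesis using h0 C(3) by simp
    next
      case False
      then have "0 < e" using e by simp
      from MVT2[OF this d] obtain z where "0 < z" "z < e" "h e - h 0 = (e - 0) * h' z" by auto
      then have "\<bar>h e\<bar> = e * \<bar>h' z\<bar>" using h0 e by (simp add: abs_mult)
      also have "\<dots> \<le> e * (C * e ^ m)" using hb[of z] \<open>0 < z\<close> \<open>z < e\<close> e by (intro mult_left_mono) auto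
      finally show ?thesis by (simp add: n_def mult_ac)
    qed
    then show ?thesis by (simp only: h_def b_def)
  qed
  then show thesis
    by (intro that[of "min e0 e1" C]) (use C e1(1) in \<open>auto simp: n_def F_def simp del: of_nat_Suc power_Suc fps_deriv_nth\<close>)
qed

text \<open>Each summand is \<open>bh x\<close> times a function of \<open>b\<close> and
  \<open>e\<close> built from \<open>U^(-1/2)\<close>; the weight \<open>e^(s+1)\<close> corresponds
  to the power \<open>fps_X^(s+1)\<close>.\<close>

lemma E_hat_X_sum_expansion:
  assumes "n \<ge> 1"
  obtains C e0 where "e0 > 0" "e0 \<le> 1" "C \<ge> 0"
    "\<And>x e. x > 0 \<Longrightarrow> 0 \<le> e \<Longrightarrow> e \<le> e0 \<Longrightarrow>
      \<bar>(\<Sum>s<n. e ^ Suc s * E_hat (2 * s + 1) (bh (X_sum n x e))) - bh x * (\<Sum>k<n. (\<Sum>s<k. fps_nth (v_H (1 / (1 + x\<^sup>2)) s (v_sol (1 / (1 + x\<^sup>2)))) (k - Suc s)) * e ^ k)\<bar> \<le> C * e ^ n"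
proof -
  define I where "I b e = 1 / sqrt (U_sum n b e)" for b e
  have I: "unif n I (\<lambda>b. v_I b (v_sol b))" unfolding I_def[abs_def] by (rule unif_I_sum)
  define Z where "Z b e = (\<Sum>s<n. e ^ Suc s * (I b e * poly (P_poly s) (b * (I b e * I b e))))" for b e
  define F where "F b = (\<Sum>s<n. fps_X ^ Suc s * v_H b s (v_sol b))" for b
  have uZ: "unif n Z F"
    unfolding Z_def[abs_def] F_def[abs_def] v_H_def
    by (intro unif_sum unif_mult unif_power unif_X I unif_pfps unif_poly_const[of _ "[:0, 1:]"]) simp
  obtain C e0 where C: "e0 > 0" "e0 \<le> 1" "C \<ge> 0"
    "\<And>b e. 0 \<le> b \<Longrightarrow> b \<le> 1 \<Longrightarrow> 0 \<le> e \<Longrightarrow> e \<le> e0 \<Longrightarrow> \<bar>Z b e - (\<Sum>k<n. fps_nth (F b) k * e ^ k)\<bar> \<le> C * e ^ n"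
    using unifE[OF uZ] by metis
  obtain e1 where e1: "e1 > 0" "\<And>b e. 0 \<le> b \<Longrightarrow> b \<le> 1 \<Longrightarrow> 0 \<le> e \<Longrightarrow> e \<le> e1 \<Longrightarrow> \<bar>V_sum n b e\<bar> \<le> 1 / 8"
    using V_sum_small[of n] by metis
  have F: "fps_nth (F b) k = (\<Sum>s<k. fps_nth (v_H b s (v_sol b)) (k - Suc s))" if "k < n" for b k
  proof -
    have "fps_nth (F b) k = (\<Sum>s<n. if s < k then fps_nth (v_H b s (v_sol b)) (k - Suc s) else 0)"
      unfolding F_def fps_sum_nth by (intro sum.cong refl) (auto simp: fps_X_power_mult_nth simp del: power_Suc)
    also have "\<dots> = (\<Sum>s<k. if s < k then fps_nth (v_H b s (v_sol b)) (k - Suc s) else 0)"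
      using that by (intro sum.mono_neutral_right) auto
    finally show ?thesis by simp
  qed
  have "\<bar>(\<Sum>s<n. e ^ Suc s * E_hat (2 * s + 1) (bh (X_sum n x e))) - bh x * (\<Sum>k<n. (\<Sum>s<k. fps_nth (v_H b s (v_sol b)) (k - Suc s)) * e ^ k)\<bar> \<le> C * e ^ n"
    if x: "x > 0" and e: "0 \<le> e" "e \<le> min e0 e1" and bd: "b = 1 / (1 + x\<^sup>2)" for x e b
  proof -
    have p: "1 + x\<^sup>2 > 0" by (simp add: add_pos_nonneg)
    have b: "0 \<le> b" "b \<le> 1" using p by (simp_all add: bd field_simps)
    have v: "\<bar>V_sum n b e\<bar> \<le> 1 / 8" using e1(2)[OF b] e by simp
    have U: "U_sum n b e \<ge> 0" using U_sum_bounds(1)[OF b v] by linarith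
    have "(\<Sum>s<n. e ^ Suc s * E_hat (2 * s + 1) (bh (X_sum n x e))) = bh x * Z b e"
      unfolding Z_def sum_distrib_left E_hat_X_sum[OF assms bd U] I_def by (intro sum.cong refl) (simp only: mult_ac)
    moreover have "(\<Sum>k<n. (\<Sum>s<k. fps_nth (v_H b s (v_sol b)) (k - Suc s)) * e ^ k) = (\<Sum>k<n. fps_nth (F b) k * e ^ k)"
      by (intro sum.cong refl) (simp add: F)
    ultimately have "\<bar>(\<Sum>s<n. e ^ Suc s * E_hat (2 * s + 1) (bh (X_sum n x e))) - bh x * (\<Sum>k<n. (\<Sum>s<k. fps_nth (v_H b s (v_sol b)) (k - Suc s)) * e ^ k)\<bar>
       = bh x * \<bar>Z b e - (\<Sum>k<n. fps_nth (F b) k * e ^ k)\<bar>"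
      using bh_pos[of x] by (simp only: right_diff_distrib[symmetric] abs_mult abs_of_pos)
    also have "\<dots> \<le> 1 * (C * e ^ n)"
      using C(4)[OF b] e by (intro mult_mono) (auto simp: bh_le_1)
    finally show ?thesis by simp
  qed
  then show thesis
    by (intro that[of "min e0 e1" C]) (use C e1(1) in auto)
qed

text \<open>The polynomial parts \<open>T\<close> and \<open>R\<close> of the two expansions cancel
  by \<open>v_sol_residual\<close>, which is the formal equation; only the two uniform remainders
  are left.\<close>

lemma X_sum_residual:
  assumes "n \<ge> 1"
  obtains C e0 where "e0 > 0" "e0 \<le> 1" "C \<ge> 0"
    "\<And>x e. x > 0 \<Longrightarrow> 0 \<le> e \<Longrightarrow> e \<le> e0 \<Longrightarrow> X_sum n x e > 0"
    "\<And>x e. x > 0 \<Longrightarrow> 0 \<le> e \<Longrightarrow> e \<le> e0 \<Longrightarrow>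
       \<bar>rho (X_sum n x e) + (\<Sum>s<n. e ^ Suc s * E_hat (2 * s + 1) (bh (X_sum n x e))) - rho x\<bar> \<le> C * e ^ n"
proof -
  obtain m where m: "n = Suc m" using assms by (cases n) auto
  define S where "S x e = (\<Sum>s<n. e ^ Suc s * E_hat (2 * s + 1) (bh (X_sum n x e)))" for x e
  define T where "T x e = bh x * (\<Sum>k<m. fps_nth (v_W (1 / (1 + x\<^sup>2)) (v_sol (1 / (1 + x\<^sup>2))) * fps_deriv (v_sol (1 / (1 + x\<^sup>2)))) k / real (Suc k) * e ^ Suc k)" for x e
  define R where "R x e = bh x * (\<Sum>k<n. (\<Sum>s<k. fps_nth (v_H (1 / (1 + x\<^sup>2)) s (v_sol (1 / (1 + x\<^sup>2)))) (k - Suc s)) * e ^ k)" for x e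
  obtain C e0 where C: "e0 > 0" "e0 \<le> 1" "C \<ge> 0"
    "\<And>x e. x > 0 \<Longrightarrow> 0 \<le> e \<Longrightarrow> e \<le> e0 \<Longrightarrow> \<bar>rho (X_sum n x e) - rho x - T x e\<bar> \<le> C * e ^ n"
    by (rule rho_X_sum_expansion[of m]) (simp only: T_def m)
  obtain D e1 where D: "e1 > 0" "e1 \<le> 1" "D \<ge> 0"
    "\<And>x e. x > 0 \<Longrightarrow> 0 \<le> e \<Longrightarrow> e \<le> e1 \<Longrightarrow> \<bar>S x e - R x e\<bar> \<le> D * e ^ n"
    by (rule E_hat_X_sum_expansion[OF assms]) (simp only: S_def R_def)
  obtain e2 where e2: "e2 > 0" "\<And>b e. 0 \<le> b \<Longrightarrow> b \<le> 1 \<Longrightarrow> 0 \<le> e \<Longrightarrow> e \<le> e2 \<Longrightarrow> \<bar>V_sum n b e\<bar> \<le> 1 / 8"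
    using V_sum_small[of n] by metis
  have TR: "T x e + R x e = 0" for x e
  proof -
    define b where "b = 1 / (1 + x\<^sup>2)"
    have "(\<Sum>k<n. (\<Sum>s<k. fps_nth (v_H b s (v_sol b)) (k - Suc s)) * e ^ k) = (\<Sum>k<m. (\<Sum>s<Suc k. fps_nth (v_H b s (v_sol b)) (k - s)) * e ^ Suc k)"
      unfolding m sum.lessThan_Suc_shift[of _ m] by simp
    moreover have "(\<Sum>k<m. fps_nth (v_W b (v_sol b) * fps_deriv (v_sol b)) k / real (Suc k) * e ^ Suc k) = (\<Sum>k<m. - ((\<Sum>s<Suc k. fps_nth (v_H b s (v_sol b)) (k - s)) * e ^ Suc k))"
      unfolding v_sol_residual by (intro sum.cong refl) (simp del: of_nat_Suc power_Suc sum.lessThan_Suc)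
    ultimately show ?thesis
      unfolding T_def R_def b_def[symmetric] by (simp only: sum_negf mult_minus_right add.left_inverse)
  qed
  show thesis
  proof (rule that[of "min e0 (min e1 e2)" "C + D"])
    fix x e :: real assume xe: "x > 0" "0 \<le> e" "e \<le> min e0 (min e1 e2)"
    have p: "1 + x\<^sup>2 > 0" by (simp add: add_pos_nonneg)
    have b: "0 \<le> 1 / (1 + x\<^sup>2)" "1 / (1 + x\<^sup>2) \<le> 1" using p by (simp_all add: field_simps)
    show "X_sum n x e > 0"
      unfolding X_sum_eq[OF assms refl] using xe by (intro mult_pos_pos less_le_trans[OF _ U_sum_bounds(2)[OF b e2(2)[OF b, of e]]]) auto
    have "\<bar>rho (X_sum n x e) - rho x - T x e\<bar> \<le> C * e ^ n" "\<bar>S x e - R x e\<bar> \<le> D * e ^ n"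
      using C(4) D(4) xe by simp_all
    then show "\<bar>rho (X_sum n x e) + (\<Sum>s<n. e ^ Suc s * E_hat (2 * s + 1) (bh (X_sum n x e))) - rho x\<bar> \<le> (C + D) * e ^ n"
      using TR[of x e] unfolding S_def[symmetric] distrib_right by linarith
  qed (use C D e2(1) in auto)
qed

text \<open>\<open>\<rho>' \<ge> 1\<close>, and the derivatives of the corrections are
  \<open>O(e)\<close> uniformly in \<open>x\<close>, so the derivative of the sum is at least
  \<open>1/2\<close>. This turns an error in the equation into an error in the zero.\<close>

lemma phase_expanding:
  obtains e0 where "e0 > 0" "e0 \<le> 1"
    "\<And>e x y. 0 \<le> e \<Longrightarrow> e \<le> e0 \<Longrightarrow> 0 < x \<Longrightarrow> 0 < y \<Longrightarrow>
      \<bar>x - y\<bar> \<le> 2 * \<bar>(rho x + (\<Sum>s<n. e ^ Suc s * E_hat (2 * s + 1) (bh x))) - (rho y + (\<Sum>s<n. e ^ Suc s * E_hat (2 * s + 1) (bh y)))\<bar>"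
proof -
  define Q where "Q s = [:0, 1:] * pcompose (P_poly s) [:0, 0, 1:]" for s
  have Q: "E_hat (2 * s + 1) y = poly (Q s) y" for s y
    unfolding E_hat_odd by (simp add: Q_def poly_pcompose power2_eq_square)
  have "\<exists>K. \<forall>y\<in>{0..1}. \<bar>poly (pderiv (Q s)) y\<bar> \<le> K" for s
  proof -
    have "bounded (poly (pderiv (Q s)) ` {0..1})"
      by (intro compact_imp_bounded compact_continuous_image continuous_intros) auto
    then show ?thesis unfolding bounded_iff by auto
  qed
  then obtain K where K: "\<And>s y. y \<in> {0..1} \<Longrightarrow> \<bar>poly (pderiv (Q s)) y\<bar> \<le> K s" by metis
  have K0: "K s \<ge> 0" for s using K[of 0 s] by simp
  define B where "B = (\<Sum>s<n. K s)"
  have B: "B \<ge> 0" unfolding B_def using K0 by (intro sum_nonneg) auto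
  \<comment> \<open>Makes the sum of the derivatives of the corrections at most
    \<open>e0 * B \<le> 1/2\<close>.\<close>
  define e0 where "e0 = 1 / (2 * (1 + B))"
  have e0: "e0 > 0" "e0 \<le> 1" "e0 * B \<le> 1 / 2" using B by (simp_all add: e0_def field_simps)
  define G where "G e x = rho x + (\<Sum>s<n. e ^ Suc s * E_hat (2 * s + 1) (bh x))" for e x
  define G' where "G' e x = sqrt (x\<^sup>2 + 1) / x + (\<Sum>s<n. e ^ Suc s * (poly (pderiv (Q s)) (bh x) * - (x * (bh x * bh x * bh x))))" for e x
  have dG: "(G e has_real_derivative G' e x) (at x)" if "x > 0" for e x
    unfolding G_def[abs_def] G'_def Q
    by (intro DERIV_add DERIV_sum DERIV_cmult has_real_derivative_rho that DERIV_chain2[OF poly_DERIV has_real_derivative_bh])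
  have G': "G' e x \<ge> 1 / 2" if x: "x > 0" and e: "0 \<le> e" "e \<le> e0" for e x
  proof -
    have "x \<le> sqrt (x\<^sup>2 + 1)" by (rule real_le_rsqrt) simp
    then have 1: "sqrt (x\<^sup>2 + 1) / x \<ge> 1" using x by simp
    have bh1: "0 < bh x" "bh x \<le> 1" by (simp_all add: bh_le_1)
    have "x \<le> sqrt (1 + x\<^sup>2)" by (rule real_le_rsqrt) simp
    then have xb: "x * bh x \<le> 1" using add_pos_nonneg[of 1 "x\<^sup>2"] by (simp add: bh_def)
    have "\<bar>\<Sum>s<n. e ^ Suc s * (poly (pderiv (Q s)) (bh x) * - (x * (bh x * bh x * bh x)))\<bar>
       \<le> (\<Sum>s<n. \<bar>e ^ Suc s * (poly (pderiv (Q s)) (bh x) * - (x * (bh x * bh x * bh x)))\<bar>)" by (rule sum_abs)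
    also have "\<dots> \<le> (\<Sum>s<n. e * (K s * 1))"
    proof (intro sum_mono)
      fix s
      have "e ^ Suc s \<le> e" using e e0 power_le_one[of e s] by (simp add: mult_left_le)
      moreover have "x * (bh x * bh x * bh x) \<le> 1"
        using mult_le_one[OF xb, of "bh x * bh x"] bh1 mult_le_one[of "bh x" "bh x"] by (simp add: mult_ac)
      moreover have "x * (bh x * bh x * bh x) \<ge> 0" using x less_imp_le[OF bh1(1)] by (intro mult_nonneg_nonneg) auto
      moreover have "\<bar>poly (pderiv (Q s)) (bh x)\<bar> \<le> K s" using K bh1 by simp
      ultimately show "\<bar>e ^ Suc s * (poly (pderiv (Q s)) (bh x) * - (x * (bh x * bh x * bh x)))\<bar> \<le> e * (K s * 1)"
        unfolding abs_mult using e K0 by (intro mult_mono) (auto simp: abs_mult)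
    qed
    also have "\<dots> = e * B" by (simp add: B_def sum_distrib_left)
    also have "\<dots> \<le> e0 * B" using e B by (intro mult_right_mono)
    finally show ?thesis using 1 e0(3) unfolding G'_def by linarith
  qed
  have less: "y - x \<le> 2 * \<bar>G e x - G e y\<bar>" if xy: "0 < x" "x < y" and e: "0 \<le> e" "e \<le> e0" for e x y
  proof -
    have "(G e has_real_derivative G' e z) (at z)" if "x \<le> z" "z \<le> y" for z using dG that xy by simp
    from MVT2[OF xy(2) this] obtain z where z: "x < z" "z < y" "G e y - G e x = (y - x) * G' e z" by auto
    have "(y - x) * (1 / 2) \<le> (y - x) * G' e z" using G'[of z e] z xy e by (intro mult_left_mono) auto
    then have "(y - x) * (1 / 2) \<le> G e y - G e x" using z(3) by simp
    then have "y - x \<le> 2 * (G e y - G e x)" by simp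
    also have "\<dots> \<le> 2 * \<bar>G e x - G e y\<bar>" using abs_ge_minus_self[of "G e x - G e y"] by (intro mult_left_mono) simp_all
    finally show ?thesis .
  qed
  have "\<bar>x - y\<bar> \<le> 2 * \<bar>G e x - G e y\<bar>" if "0 \<le> e" "e \<le> e0" "0 < x" "0 < y" for e x y
    using less[of x y e] less[of y x e] that by (cases x y rule: linorder_cases) (auto simp: abs_minus_commute)
  then show thesis using that[of e0] e0 unfolding G_def by blast
qed

subsection \<open>Monotonicity of the phase\<close>

text \<open>Near \<open>x\<close> the phase equals \<open>\<theta> x + Im (Ln (f t / f x))\<close>:
  by continuity the phase difference is below \<open>\<pi>\<close> in modulus, so the principal
  logarithm returns it exactly. A merely continuous phase thus inherits the differentiability of
  \<open>f\<close>.\<close>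

lemma has_real_derivative_phase:
  fixes f :: "real \<Rightarrow> complex"
  assumes f: "(f has_vector_derivative f') (at x)" and x: "x > 0"
    and nz: "\<And>t. t > 0 \<Longrightarrow> f t \<noteq> 0"
    and cont: "continuous_on {0<..} \<theta>"
    and phase: "\<And>t. t > 0 \<Longrightarrow> f t = of_real (cmod (f t)) * cis (\<theta> t)"
  shows "(\<theta> has_real_derivative Im (cnj (f x) * f') / (cmod (f x))\<^sup>2) (at x)"
proof -
  have "((\<lambda>t. f t / f x) has_vector_derivative f' / f x) (at x)"
    using bounded_linear.has_vector_derivative[OF bounded_linear_divide[of "f x"] f] by simp
  moreover have "(Ln has_field_derivative inverse (f x / f x)) (at (f x / f x))"
    using nz[OF x] by (intro has_field_derivative_Ln) simp
  ultimately have "((Ln \<circ> (\<lambda>t. f t / f x)) has_vector_derivative f' / f x * inverse (f x / f x)) (at x)"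
    by (rule field_vector_diff_chain_at)
  from bounded_linear.has_vector_derivative[OF bounded_linear_Im this]
  have "((\<lambda>t. Im (Ln (f t / f x))) has_real_derivative Im (f' / f x)) (at x)"
    using nz[OF x] by (simp add: o_def has_real_derivative_iff_has_vector_derivative)
  then have d: "((\<lambda>t. \<theta> x + Im (Ln (f t / f x))) has_real_derivative Im (f' / f x)) (at x)"
    using DERIV_add[OF DERIV_const, of "\<lambda>t. Im (Ln (f t / f x))" "Im (f' / f x)" x UNIV "\<theta> x"] by simp
  have "isCont \<theta> x" using cont x by (simp add: continuous_on_eq_continuous_at)
  then have "(\<theta> \<longlongrightarrow> \<theta> x) (nhds x)" by (simp add: isCont_def tendsto_at_iff_tendsto_nhds)
  then have "\<forall>\<^sub>F t in nhds x. dist (\<theta> t) (\<theta> x) < pi" by (rule tendstoD) simp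
  moreover have "\<forall>\<^sub>F t in nhds x. t \<in> {0<..}" using x by (intro eventually_nhds_in_open) auto
  ultimately have "\<forall>\<^sub>F t in nhds x. \<theta> t = \<theta> x + Im (Ln (f t / f x))"
  proof eventually_elim
    case (elim t)
    have "f t / f x = of_real (cmod (f t) / cmod (f x)) * cis (\<theta> t - \<theta> x)"
      using phase[of t] phase[OF x] elim by (metis cis_divide greaterThan_iff of_real_divide times_divide_times_eq)
    also have "\<dots> = exp (Complex (ln (cmod (f t) / cmod (f x))) (\<theta> t - \<theta> x))"
      using nz[of t] nz[OF x] elim by (simp add: exp_eq_polar flip: exp_of_real)
    finally have "Ln (f t / f x) = Complex (ln (cmod (f t) / cmod (f x))) (\<theta> t - \<theta> x)"
      using elim by (simp add: dist_real_def abs_less_iff)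
    then show ?case by simp
  qed
  then have "(\<theta> has_real_derivative Im (f' / f x)) (at x)"
    using d by (simp cong: DERIV_cong_ev)
  moreover have "Im (f' / f x) = Im (cnj (f x) * f') / (cmod (f x))\<^sup>2"
    by (simp add: complex_div_cnj[of f' "f x"] mult.commute)
  ultimately show ?thesis by simp
qed

context
  fixes \<nu> :: real and \<theta> :: "real \<Rightarrow> real"
  assumes nu: "\<nu> > 0" and cont: "continuous_on {0<..} \<theta>"
    and phase: "\<And>x. x > 0 \<Longrightarrow> bes_y \<nu> (\<nu> * x) = of_real (cmod (bes_y \<nu> (\<nu> * x))) * cis (\<theta> x)"
begin

text \<open>The numerator of the phase derivative is the Wronskian, which is the constant
  \<open>w\<close>.\<close>

lemma bes_phase_deriv:
  obtains w where "w > 0"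
    "\<And>x. x > 0 \<Longrightarrow> (\<theta> has_real_derivative w / (x * (cmod (bes_y \<nu> (\<nu> * x)))\<^sup>2)) (at x)"
proof -
  define w where "w = \<nu> * (cmod (rGamma (\<i> * of_real \<nu> + 1)))\<^sup>2"
  have w: "Im (cnj (bes_y \<nu> t) * bes_yd \<nu> t) = w" if "t > 0" for t
    using bes_wronskian[OF that] by (simp add: w_def)
  have "w > 0" using bes_wronskian_pos[of 1 \<nu>] w[of 1] nu by simp
  moreover have "(\<theta> has_real_derivative w / (x * (cmod (bes_y \<nu> (\<nu> * x)))\<^sup>2)) (at x)" if x: "x > 0" for x
  proof -
    have t: "\<nu> * x > 0" using x nu by simp
    have "((\<lambda>x. \<nu> * x) has_vector_derivative \<nu>) (at x)"
      by (auto intro!: derivative_eq_intros simp flip: has_real_derivative_iff_has_vector_derivative)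
    from vector_diff_chain_at[OF this has_vector_derivative_bes_y(1)[OF t]]
    have d: "((\<lambda>x. bes_y \<nu> (\<nu> * x)) has_vector_derivative bes_yd \<nu> (\<nu> * x) / of_real x) (at x)"
      using nu x by (simp add: o_def scaleR_conv_of_real)
    have "(\<theta> has_real_derivative Im (cnj (bes_y \<nu> (\<nu> * x)) * (bes_yd \<nu> (\<nu> * x) / of_real x)) / (cmod (bes_y \<nu> (\<nu> * x)))\<^sup>2) (at x)"
      by (rule has_real_derivative_phase[OF d x _ cont phase]) (use nu bes_y_nonzero in auto)
    also have "cnj (bes_y \<nu> (\<nu> * x)) * (bes_yd \<nu> (\<nu> * x) / of_real x) = (cnj (bes_y \<nu> (\<nu> * x)) * bes_yd \<nu> (\<nu> * x)) / of_real x"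
      by simp
    also have "Im \<dots> = w / x" unfolding Im_divide_of_real w[OF t] by simp
    finally show ?thesis by simp
  qed
  ultimately show thesis by (rule that)
qed

lemma bes_phase_strict_mono: "strict_mono_on {0<..} \<theta>"
proof (rule strict_mono_onI)
  fix a b :: real assume "a \<in> {0<..}" "a < b"
  obtain w where w: "w > 0" "\<And>x. x > 0 \<Longrightarrow> (\<theta> has_real_derivative w / (x * (cmod (bes_y \<nu> (\<nu> * x)))\<^sup>2)) (at x)"
    using bes_phase_deriv by blast
  have "\<exists>y. (\<theta> has_real_derivative y) (at x) \<and> y > 0" if "a \<le> x" for x
  proof -
    have x: "x > 0" using that \<open>a \<in> {0<..}\<close> by simp
    then have "w / (x * (cmod (bes_y \<nu> (\<nu> * x)))\<^sup>2) > 0" using w(1) bes_y_nonzero[of "\<nu> * x" \<nu>] nu by simp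
    then show ?thesis using w(2)[OF x] by blast
  qed
  then show "\<theta> a < \<theta> b" using DERIV_pos_imp_increasing[OF \<open>a < b\<close>, of \<theta>] by blast
qed

text \<open>To the right of \<open>a\<close> the phase derivative exceeds a positive constant,
  because \<open>t |J|^2\<close> is bounded there; to the left it exceeds a constant over
  \<open>x\<close>, because \<open>J\<close> is bounded. So the phase grows at least linearly at
  infinity and falls at least logarithmically at 0.\<close>

lemma bes_phase_surj: "\<exists>x>0. \<theta> x = p"
proof -
  obtain w where w: "w > 0" and d: "\<And>x. x > 0 \<Longrightarrow> (\<theta> has_real_derivative w / (x * (cmod (bes_y \<nu> (\<nu> * x)))\<^sup>2)) (at x)"
    using bes_phase_deriv by blast
  have nz: "cmod (bes_y \<nu> (\<nu> * x)) > 0" if "x > 0" for x using bes_y_nonzero[of "\<nu> * x" \<nu>] nu that by simp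
  \<comment> \<open>The point where \<open>\<nu> x = 1\<close>, at which the two bounds on the
    Bessel function meet.\<close>
  define a where "a = 1 / \<nu>"
  have a: "a > 0" using nu by (simp add: a_def)
  obtain K0 where K0: "\<And>t. 0 < t \<Longrightarrow> t \<le> 1 \<Longrightarrow> cmod (bes_y \<nu> t) \<le> K0" using norm_bes_y_near_0[of \<nu>] by blast
  define K where "K = \<bar>K0\<bar> + 1"
  have K: "K > 0" "\<And>t. 0 < t \<Longrightarrow> t \<le> 1 \<Longrightarrow> cmod (bes_y \<nu> t) \<le> K" using K0 by (fastforce simp: K_def)+
  obtain C0 where C0: "\<And>t. t \<ge> 1 \<Longrightarrow> cmod (bes_u \<nu> t) \<le> C0" using bes_u_bounded[of \<nu>] by blast
  define C where "C = \<bar>C0\<bar> + 1"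
  have C: "C > 0" "\<And>t. t \<ge> 1 \<Longrightarrow> cmod (bes_u \<nu> t) \<le> C" using C0 by (fastforce simp: C_def)+
  define c where "c = w * \<nu> / C\<^sup>2"
  have c: "c > 0" using w nu C by (simp add: c_def)
  define k where "k = w / K\<^sup>2"
  have k: "k > 0" using w K by (simp add: k_def)
  have up: "\<theta> a - c * a \<le> \<theta> x - c * x" if x: "a \<le> x" for x
  proof (rule DERIV_nonneg_imp_nondecreasing[OF x])
    fix y assume y: "a \<le> y" "y \<le> x"
    then have y0: "y > 0" using a by simp
    have "\<nu> * y \<ge> 1" using y nu by (simp add: a_def field_simps)
    from C(2)[OF this] have "sqrt (\<nu> * y) * cmod (bes_y \<nu> (\<nu> * y)) \<le> C"
      using nu y0 by (simp add: bes_u_def norm_mult)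
    then have "(sqrt (\<nu> * y) * cmod (bes_y \<nu> (\<nu> * y)))\<^sup>2 \<le> C\<^sup>2" using nu y0 by (intro power_mono) auto
    then have "\<nu> * (y * (cmod (bes_y \<nu> (\<nu> * y)))\<^sup>2) \<le> C\<^sup>2" using nu y0 by (simp add: power_mult_distrib)
    then have "c \<le> w / (y * (cmod (bes_y \<nu> (\<nu> * y)))\<^sup>2)"
      using w y0 nz[OF y0] C(1) by (simp add: c_def field_simps mult_left_mono)
    moreover have "((\<lambda>x. \<theta> x - c * x) has_real_derivative w / (y * (cmod (bes_y \<nu> (\<nu> * y)))\<^sup>2) - c) (at y)"
      by (rule derivative_eq_intros d[OF y0] refl | simp)+
    ultimately show "\<exists>z. ((\<lambda>x. \<theta> x - c * x) has_real_derivative z) (at y) \<and> 0 \<le> z" by (intro exI conjI) auto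
  qed
  have down: "\<theta> x - k * ln x \<le> \<theta> a - k * ln a" if x: "0 < x" "x \<le> a" for x
  proof (rule DERIV_nonneg_imp_nondecreasing[OF x(2)])
    fix y assume y: "x \<le> y" "y \<le> a"
    then have y0: "y > 0" using x by simp
    have "\<nu> * y \<le> 1" using y nu by (simp add: a_def field_simps)
    then have "cmod (bes_y \<nu> (\<nu> * y)) \<le> K" using K(2) nu y0 by simp
    then have "(cmod (bes_y \<nu> (\<nu> * y)))\<^sup>2 \<le> K\<^sup>2" by (intro power_mono) auto
    then have "k / y \<le> w / (y * (cmod (bes_y \<nu> (\<nu> * y)))\<^sup>2)"
      using w y0 nz[OF y0] K(1) by (simp add: k_def field_simps)
    moreover have "((\<lambda>x. \<theta> x - k * ln x) has_real_derivative w / (y * (cmod (bes_y \<nu> (\<nu> * y)))\<^sup>2) - k / y) (at y)"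
      using y0 by (auto intro!: derivative_eq_intros d)
    ultimately show "\<exists>z. ((\<lambda>x. \<theta> x - k * ln x) has_real_derivative z) (at y) \<and> 0 \<le> z" by (intro exI conjI) auto
  qed
  \<comment> \<open>\<open>x1\<close> and \<open>x2\<close> are chosen so that the estimates
    \<open>down\<close> and \<open>up\<close> just reach the target \<open>p\<close>.\<close>
  define x1 where "x1 = a * exp (- (\<bar>\<theta> a - p\<bar> / k))"
  define x2 where "x2 = a + \<bar>p - \<theta> a\<bar> / c"
  have x1: "0 < x1" "x1 \<le> a" using a k by (simp_all add: x1_def mult_left_le)
  have x2: "a \<le> x2" using c by (simp add: x2_def)
  have "ln x1 = ln a - \<bar>\<theta> a - p\<bar> / k" using a by (simp add: x1_def ln_mult)
  then have "k * ln x1 = k * ln a - \<bar>\<theta> a - p\<bar>" using k by (simp add: right_diff_distrib)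
  then have 1: "\<theta> x1 \<le> p" using down[OF x1] by linarith
  have "c * x2 = c * a + \<bar>p - \<theta> a\<bar>" using c by (simp add: x2_def distrib_left)
  then have 2: "p \<le> \<theta> x2" using up[OF x2] by linarith
  have "continuous_on {x1..x2} \<theta>" using x1 by (intro continuous_on_subset[OF cont]) auto
  then obtain x where "x1 \<le> x" "\<theta> x = p" using IVT'[of \<theta> x1 p x2, OF 1 2] x1 x2 by auto
  then show ?thesis using x1 by (intro exI[of _ x]) auto
qed

end

lemma bessel_phaseD:
  assumes "bessel_phase \<Theta>" "\<nu> > 0"
  shows "continuous_on {0<..} (\<Theta> \<nu>)"
    "\<And>x. x > 0 \<Longrightarrow> bes_y \<nu> (\<nu> * x) = of_real (cmod (bes_y \<nu> (\<nu> * x))) * cis (\<Theta> \<nu> x)"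
  using assms unfolding bessel_phase_def bes_y_def by blast+

text \<open>After rotation by \<open>- r \<pi>\<close> the real part is the modulus times
  \<open>cos (\<Theta> - r \<pi>)\<close>. The zeros of the cosine, numbered as
  \<open>m \<pi> + \<pi>/2\<close>, are shifted by one to match the labelling.\<close>

lemma mem_bessel_zeros_iff:
  assumes "bessel_phase \<Theta>" "\<nu> > 0" "x > 0"
  shows "\<nu> * x \<in> bessel_zeros r \<nu> \<longleftrightarrow> (\<exists>m::int. \<Theta> \<nu> x = (of_int m + r - 1 / 2) * pi)"
proof -
  have "exp (- \<i> * of_real r * of_real pi) = cis (- (r * pi))"
    by (simp add: cis_conv_exp mult.assoc)
  then have "exp (- \<i> * of_real r * of_real pi) * bes_y \<nu> (\<nu> * x) = of_real (cmod (bes_y \<nu> (\<nu> * x))) * (cis (- (r * pi)) * cis (\<Theta> \<nu> x))"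
    using bessel_phaseD(2)[OF assms] by (metis mult.left_commute)
  also have "cis (- (r * pi)) * cis (\<Theta> \<nu> x) = cis (\<Theta> \<nu> x - r * pi)" by (simp add: cis_mult)
  finally have "Re (exp (- \<i> * of_real r * of_real pi) * bes_y \<nu> (\<nu> * x)) = cmod (bes_y \<nu> (\<nu> * x)) * cos (\<Theta> \<nu> x - r * pi)"
    by simp
  moreover have "cmod (bes_y \<nu> (\<nu> * x)) \<noteq> 0" using bes_y_nonzero assms by simp
  moreover have "\<nu> * x \<in> bessel_zeros r \<nu> \<longleftrightarrow> Re (exp (- \<i> * of_real r * of_real pi) * bes_y \<nu> (\<nu> * x)) = 0"
    using assms by (simp add: bessel_zeros_def bes_y_def)
  ultimately have "\<nu> * x \<in> bessel_zeros r \<nu> \<longleftrightarrow> cos (\<Theta> \<nu> x - r * pi) = 0"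
    by simp
  also have "\<dots> \<longleftrightarrow> (\<exists>m::int. \<Theta> \<nu> x - r * pi = m * pi + pi / 2)" by (rule cos_zero_iff_int2)
  also have "\<dots> \<longleftrightarrow> (\<exists>m::int. \<Theta> \<nu> x = (of_int m + r - 1 / 2) * pi)"
  proof
    assume "\<exists>m::int. \<Theta> \<nu> x - r * pi = m * pi + pi / 2"
    then obtain m :: int where "\<Theta> \<nu> x - r * pi = m * pi + pi / 2" by blast
    then show "\<exists>m::int. \<Theta> \<nu> x = (of_int m + r - 1 / 2) * pi" by (intro exI[of _ "m + 1"]) (simp add: algebra_simps)
  next
    assume "\<exists>m::int. \<Theta> \<nu> x = (of_int m + r - 1 / 2) * pi"
    then obtain m :: int where "\<Theta> \<nu> x = (of_int m + r - 1 / 2) * pi" by blast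
    then show "\<exists>m::int. \<Theta> \<nu> x - r * pi = m * pi + pi / 2" by (intro exI[of _ "m - 1"]) (simp add: algebra_simps)
  qed
  finally show ?thesis .
qed

lemma scaled_zero_phase:
  assumes "bessel_phase \<Theta>" "\<nu> > 0"
  shows "scaled_zero \<Theta> r \<nu> m > 0" "\<Theta> \<nu> (scaled_zero \<Theta> r \<nu> m) = (of_int m + r - 1 / 2) * pi"
    "\<And>x. x > 0 \<Longrightarrow> \<Theta> \<nu> x = (of_int m + r - 1 / 2) * pi \<Longrightarrow> scaled_zero \<Theta> r \<nu> m = x"
proof -
  note ph = bessel_phaseD[OF assms]
  have inj: "inj_on (\<Theta> \<nu>) {0<..}"
    using bes_phase_strict_mono[OF assms(2) ph] by (rule strict_mono_on_imp_inj_on)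
  obtain x where x: "x > 0" "\<Theta> \<nu> x = (of_int m + r - 1 / 2) * pi"
    using bes_phase_surj[OF assms(2) ph] by blast
  have z: "scaled_zero \<Theta> r \<nu> m = x" if "x > 0" "\<Theta> \<nu> x = (of_int m + r - 1 / 2) * pi" for x
    unfolding scaled_zero_def
  proof (rule the_equality)
    show "0 < x \<and> \<nu> * x \<in> bessel_zeros r \<nu> \<and> \<Theta> \<nu> x = (of_int m + r - 1 / 2) * pi"
      using that mem_bessel_zeros_iff[OF assms that(1), of r] by blast
    fix y assume "0 < y \<and> \<nu> * y \<in> bessel_zeros r \<nu> \<and> \<Theta> \<nu> y = (of_int m + r - 1 / 2) * pi"
    then show "y = x" using inj that by (auto simp: inj_on_def)
  qed
  show "scaled_zero \<Theta> r \<nu> m > 0" "\<Theta> \<nu> (scaled_zero \<Theta> r \<nu> m) = (of_int m + r - 1 / 2) * pi"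
    using x z[OF x] by simp_all
  show "\<And>x. x > 0 \<Longrightarrow> \<Theta> \<nu> x = (of_int m + r - 1 / 2) * pi \<Longrightarrow> scaled_zero \<Theta> r \<nu> m = x"
    by (rule z)
qed

lemma bij_betw_scaled_zero:
  assumes "bessel_phase \<Theta>" "\<nu> > 0"
  shows "bij_betw (\<lambda>m::int. \<nu> * scaled_zero \<Theta> r \<nu> m) UNIV (bessel_zeros r \<nu>)"
proof (rule bij_betwI')
  fix m m' :: int
  note z = scaled_zero_phase[OF assms]
  show "(\<nu> * scaled_zero \<Theta> r \<nu> m = \<nu> * scaled_zero \<Theta> r \<nu> m') = (m = m')"
  proof
    assume "\<nu> * scaled_zero \<Theta> r \<nu> m = \<nu> * scaled_zero \<Theta> r \<nu> m'"
    then have "scaled_zero \<Theta> r \<nu> m = scaled_zero \<Theta> r \<nu> m'" using assms(2) by simp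
    then have "(of_int m + r - 1 / 2) * pi = (of_int m' + r - 1 / 2) * pi" using z(2) by metis
    then show "m = m'" by simp
  qed simp
  show "\<nu> * scaled_zero \<Theta> r \<nu> m \<in> bessel_zeros r \<nu>"
    using mem_bessel_zeros_iff[OF assms z(1)] z(2) by blast
next
  fix t assume t: "t \<in> bessel_zeros r \<nu>"
  have x: "t / \<nu> > 0" using t assms(2) by (simp add: bessel_zeros_def)
  have "\<nu> * (t / \<nu>) \<in> bessel_zeros r \<nu>" using t assms(2) by simp
  then obtain m :: int where "\<Theta> \<nu> (t / \<nu>) = (of_int m + r - 1 / 2) * pi"
    using mem_bessel_zeros_iff[OF assms x] by blast
  from scaled_zero_phase(3)[OF assms x this] show "\<exists>m\<in>UNIV. t = \<nu> * scaled_zero \<Theta> r \<nu> m"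
    using assms(2) by (intro bexI[of _ m]) auto
qed

subsection \<open>The uniform expansion of the phase\<close>

text \<open>An even polynomial with real coefficients is real at an imaginary argument; the even
  orders therefore change only the modulus of the approximate solution.\<close>

lemma E_hat_even: "even s \<Longrightarrow> E_hat s b = 0"
proof -
  assume s: "even s"
  have "coeff (E_poly s) i * (- \<i> * of_real b) ^ i \<in> \<real>" for i
  proof (cases "even i")
    case True
    then obtain k where i: "i = 2 * k" by blast
    have "(- \<i> * complex_of_real b) ^ i = of_real ((- (b\<^sup>2)) ^ k)"
      unfolding i power_mult by (simp add: power_mult_distrib)
    moreover have "coeff (E_poly s) i \<in> \<real>" using real_graded_E_poly[of s] by (simp add: real_graded_def)
    ultimately show ?thesis by (metis Reals_mult Reals_of_real)
  next
    case False
    then have "coeff (E_poly s) i = 0" using real_graded_E_poly[of s] s by (simp add: real_graded_def)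
    then show ?thesis by simp
  qed
  then have "poly (E_poly s) (- \<i> * of_real b) \<in> \<real>" unfolding poly_altdef by (intro sum_in_Reals)
  then obtain a where "poly (E_poly s) (- \<i> * of_real b) = of_real a" by (auto elim: Reals_cases)
  then show ?thesis by (simp add: E_hat_def)
qed

lemma Im_wkb_S_odd:
  assumes "\<nu> > 0"
  shows "Im (wkb_S (2 * n) \<nu> x) = \<nu> * (rho x + (\<Sum>s<n. (1 / \<nu>\<^sup>2) ^ Suc s * E_hat (2 * s + 1) (bh x)))"
proof -
  have "(\<Sum>s=1..2 * n. (1 / \<nu>) ^ s * E_hat s b) = \<nu> * (\<Sum>s<n. (1 / \<nu>\<^sup>2) ^ Suc s * E_hat (2 * s + 1) b)" for b
  proof (induction n)
    case (Suc n)
    have "(1 / \<nu>) ^ Suc (2 * n) = \<nu> * (1 / \<nu>) ^ (2 * Suc n)" using assms by simp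
    also have "\<dots> = \<nu> * (1 / \<nu>\<^sup>2) ^ Suc n" by (simp only: power_mult power_one_over)
    finally have 1: "(1 / \<nu>) ^ Suc (2 * n) = \<nu> * (1 / \<nu>\<^sup>2) ^ Suc n" .
    have "E_hat (Suc (Suc (2 * n))) b = 0" by (rule E_hat_even) simp
    then have 2: "(\<Sum>s=1..2 * Suc n. (1 / \<nu>) ^ s * E_hat s b)
       = (\<Sum>s=1..2 * n. (1 / \<nu>) ^ s * E_hat s b) + (1 / \<nu>) ^ Suc (2 * n) * E_hat (2 * n + 1) b"
      by simp
    show ?case unfolding 2 Suc 1 sum.lessThan_Suc distrib_left by (simp only: mult.assoc)
  qed simp
  then show ?thesis
    unfolding Im_wkb_S by (simp add: rt_def bh_def distrib_left)
qed

lemma E_hat_bounded: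
  obtains K where "K \<ge> 0" "\<And>b. 0 \<le> b \<Longrightarrow> b \<le> 1 \<Longrightarrow> \<bar>E_hat s b\<bar> \<le> K"
proof -
  have "continuous_on {0..1} (E_hat s)"
    unfolding E_hat_def[abs_def] by (intro continuous_intros)
  then have "bounded (E_hat s ` {0..1})" by (intro compact_imp_bounded compact_continuous_image) auto
  then obtain B where "\<forall>y\<in>E_hat s ` {0..1}. norm y \<le> B" unfolding bounded_iff by blast
  then have B: "\<bar>E_hat s b\<bar> \<le> B" if "0 \<le> b" "b \<le> 1" for b using that by simp
  show thesis by (rule that[OF _ B]) (use B[of 0] in linarith)+
qed

text \<open>For each \<open>x\<close>, \<open>bes_y_uniform\<close> gives the phase only modulo
  \<open>2 \<pi>\<close>. It implies \<open>cos D > 0\<close>, so the continuous difference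
  \<open>D\<close> cannot cross \<open>\<pi>/2\<close> in modulus; the branch condition gives
  \<open>|D| < \<pi>/2\<close> at one point and hence everywhere.\<close>

lemma phase_expansion:
  assumes "bessel_phase \<Theta>"
  obtains n0 C where "n0 \<ge> 1" "C \<ge> 0"
    "\<And>\<nu> x. \<nu> \<ge> n0 \<Longrightarrow> x > 0 \<Longrightarrow>
      \<bar>\<Theta> \<nu> x - (\<nu> * (rho x + (\<Sum>s<n. (1 / \<nu>\<^sup>2) ^ Suc s * E_hat (2 * s + 1) (bh x))) - pi / 4)\<bar> \<le> C / \<nu> ^ (2 * n + 1)"
proof -
  obtain n0 C where n0: "n0 \<ge> 1" "C \<ge> 0" and bes:
    "\<And>\<nu> x. \<nu> \<ge> n0 \<Longrightarrow> x > 0 \<Longrightarrow> \<exists>c>0. \<exists>\<eta>. cmod \<eta> \<le> C / \<nu> ^ (2 * n + 1) \<and>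
       bes_y \<nu> (\<nu> * x) = of_real c * cis (Im (wkb_S (2 * n) \<nu> x) - pi / 4) * (1 + \<eta>)"
    using bes_y_uniform[of "2 * n"] by blast
  obtain C1 \<delta> N1 where b: "\<delta> > 0" "N1 > 0" and branch:
    "\<And>\<nu> x. \<nu> \<ge> N1 \<Longrightarrow> 0 < x \<Longrightarrow> \<nu> * x \<le> \<delta> \<Longrightarrow> \<bar>\<Theta> \<nu> x - (\<nu> * ln (x / 2) + \<nu> - pi / 4)\<bar> \<le> C1 * (\<nu> * x\<^sup>2 + 1 / \<nu>)"
    using assms unfolding bessel_phase_def by blast
  have "\<exists>K\<ge>0. \<forall>b. 0 \<le> b \<and> b \<le> 1 \<longrightarrow> \<bar>E_hat s b\<bar> \<le> K" for s
    using E_hat_bounded[of s] by metis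
  then obtain K where K: "\<And>s. K s \<ge> 0" "\<And>s b. 0 \<le> b \<Longrightarrow> b \<le> 1 \<Longrightarrow> \<bar>E_hat s b\<bar> \<le> K s" by metis
  define B where "B = (\<Sum>s<n. K (2 * s + 1))"
  have B: "B \<ge> 0" unfolding B_def using K by (intro sum_nonneg) auto
  \<comment> \<open>The entry \<open>2 * C\<close> gives \<open>|\<eta>| \<le> 1/2\<close>; the
    entries \<open>4 * |C1|\<close> and \<open>4 * B\<close> give two of the quarters used at
    \<open>x0\<close>.\<close>
  define n1 where "n1 = Max {n0, N1, 2 * C, 4 * \<bar>C1\<bar>, 4 * B}"
  have n1: "n1 \<ge> n0" "n1 \<ge> N1" "n1 \<ge> 2 * C" "n1 \<ge> 4 * \<bar>C1\<bar>" "n1 \<ge> 4 * B"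
    unfolding n1_def by (rule Max_ge; simp)+
  define S where "S \<nu> x = \<nu> * (\<Sum>s<n. (1 / \<nu>\<^sup>2) ^ Suc s * E_hat (2 * s + 1) (bh x))" for \<nu> x
  define D where "D \<nu> x = \<Theta> \<nu> x - (\<nu> * rho x + S \<nu> x - pi / 4)" for \<nu> x
  have S: "\<bar>S \<nu> x\<bar> \<le> B / \<nu>" if "\<nu> \<ge> 1" for \<nu> x
  proof -
    have "\<bar>\<Sum>s<n. (1 / \<nu>\<^sup>2) ^ Suc s * E_hat (2 * s + 1) (bh x)\<bar> \<le> (\<Sum>s<n. \<bar>(1 / \<nu>\<^sup>2) ^ Suc s * E_hat (2 * s + 1) (bh x)\<bar>)"
      by (rule sum_abs)
    also have "\<dots> \<le> (\<Sum>s<n. 1 / \<nu>\<^sup>2 * K (2 * s + 1))"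
    proof (intro sum_mono)
      fix s
      have v: "0 \<le> 1 / \<nu>\<^sup>2" "1 / \<nu>\<^sup>2 \<le> 1" using that by simp_all
      then have "(1 / \<nu>\<^sup>2) ^ Suc s \<le> 1 / \<nu>\<^sup>2" using power_le_one[OF v, of s] unfolding power_Suc by (intro mult_left_le) auto
      then show "\<bar>(1 / \<nu>\<^sup>2) ^ Suc s * E_hat (2 * s + 1) (bh x)\<bar> \<le> 1 / \<nu>\<^sup>2 * K (2 * s + 1)"
        unfolding abs_mult using v K(2)[of "bh x" "2 * s + 1"] bh_le_1[of x] by (intro mult_mono) auto
    qed
    also have "\<dots> = 1 / \<nu>\<^sup>2 * B" by (simp add: B_def sum_distrib_left)
    finally have s: "\<bar>\<Sum>s<n. (1 / \<nu>\<^sup>2) ^ Suc s * E_hat (2 * s + 1) (bh x)\<bar> \<le> 1 / \<nu>\<^sup>2 * B" .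
    have v: "0 \<le> \<nu>" using that by simp
    have "\<bar>S \<nu> x\<bar> \<le> \<nu> * (1 / \<nu>\<^sup>2 * B)"
      unfolding S_def abs_mult abs_of_nonneg[OF v] by (rule mult_left_mono[OF s v])
    also have "\<dots> = B / \<nu>" using that by (simp add: power2_eq_square)
    finally show ?thesis .
  qed
  have main: "\<bar>D \<nu> x\<bar> \<le> 2 * C / \<nu> ^ (2 * n + 1)" if nu: "\<nu> \<ge> n1" and x: "x > 0" for \<nu> x
  proof -
    have nu1: "\<nu> \<ge> 1" "\<nu> \<ge> n0" "\<nu> \<ge> N1" using nu n1 n0 by linarith+
    then have nu0: "\<nu> > 0" by linarith
    note ph = bessel_phaseD[OF assms nu0]
    have small: "C / \<nu> ^ (2 * n + 1) \<le> 1 / 2"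
    proof -
      have "\<nu> ^ 1 \<le> \<nu> ^ (2 * n + 1)" using nu1 by (intro power_increasing) auto
      then have "2 * C \<le> \<nu> ^ (2 * n + 1)" using nu n1(3) by simp
      then show ?thesis using nu0 by (simp add: field_simps)
    qed
    have D: "\<exists>\<eta>. cos (D \<nu> x) > 0 \<and> cmod \<eta> \<le> C / \<nu> ^ (2 * n + 1) \<and> tan (D \<nu> x) = Im \<eta> / (1 + Re \<eta>)" if x: "x > 0" for x
    proof -
      obtain c \<eta> where c: "c > 0" and eta: "cmod \<eta> \<le> C / \<nu> ^ (2 * n + 1)"
        and y: "bes_y \<nu> (\<nu> * x) = of_real c * cis (Im (wkb_S (2 * n) \<nu> x) - pi / 4) * (1 + \<eta>)"
        using bes[OF nu1(2) x] by blast
      define \<alpha> where "\<alpha> = Im (wkb_S (2 * n) \<nu> x) - pi / 4"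
      define R where "R = cmod (bes_y \<nu> (\<nu> * x))"
      have R: "R > 0" using bes_y_nonzero[of "\<nu> * x" \<nu>] nu0 x by (simp add: R_def)
      have \<alpha>: "\<alpha> = \<nu> * rho x + S \<nu> x - pi / 4" unfolding \<alpha>_def Im_wkb_S_odd[OF nu0] S_def by (simp add: distrib_left)
      have "of_real R * cis (\<Theta> \<nu> x) = of_real c * cis \<alpha> * (1 + \<eta>)"
        using ph(2)[OF x] y by (simp add: R_def \<alpha>_def)
      then have "of_real R * cis (\<Theta> \<nu> x) * cis (- \<alpha>) = of_real c * (cis \<alpha> * cis (- \<alpha>)) * (1 + \<eta>)"
        by (simp only: mult_ac)
      then have e: "of_real R * cis (D \<nu> x) = of_real c * (1 + \<eta>)"
        by (simp add: cis_mult mult.assoc D_def \<alpha> algebra_simps)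
      have Re: "R * cos (D \<nu> x) = c * (1 + Re \<eta>)" using arg_cong[OF e, of Re] by simp
      have Im: "R * sin (D \<nu> x) = c * Im \<eta>" using arg_cong[OF e, of Im] by simp
      have "\<bar>Re \<eta>\<bar> \<le> 1 / 2" using abs_Re_le_cmod[of \<eta>] eta small by linarith
      then have p: "1 + Re \<eta> > 0" by linarith
      have "R * cos (D \<nu> x) > 0" unfolding Re using c p by simp
      then have cp: "cos (D \<nu> x) > 0" using R by (simp add: zero_less_mult_iff)
      have "tan (D \<nu> x) = (R * sin (D \<nu> x)) / (R * cos (D \<nu> x))" using R by (simp add: tan_def)
      also have "\<dots> = Im \<eta> / (1 + Re \<eta>)" unfolding Re Im using c by simp
      finally show ?thesis using cp eta by blast
    qed
    have contD: "continuous_on {0<..} (D \<nu>)"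
    proof -
      have "continuous_on {0<..} rho"
        by (intro continuous_at_imp_continuous_on ballI DERIV_isCont[OF has_real_derivative_rho]) auto
      moreover have "continuous_on {0<..} (\<lambda>x. E_hat s (bh x))" for s
      proof (rule continuous_on_compose2[of UNIV "E_hat s" "{0<..}" bh])
        show "continuous_on UNIV (E_hat s)" unfolding E_hat_def[abs_def] by (intro continuous_intros)
        show "continuous_on {0<..} bh"
          by (intro continuous_at_imp_continuous_on ballI DERIV_isCont[OF has_real_derivative_bh])
      qed simp
      ultimately show ?thesis
        unfolding D_def[abs_def] S_def[abs_def]
        by (intro continuous_on_diff continuous_on_add continuous_on_mult_left continuous_on_sum continuous_on_const ph(1))
    qed
    \<comment> \<open>At 0 one has \<open>\<rho>(x) = ln (x/2) + 1 + o(1)\<close>, which matches the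
      leading terms of the branch condition. The point \<open>x0\<close> found from this may depend
      on \<open>\<nu>\<close>.\<close>
    have lim: "((\<lambda>x. \<nu> * (rho x - ln (x / 2) - 1)) \<longlongrightarrow> 0) (at_right 0)"
      unfolding rho_def by real_asymp (simp add: ln_div)
    have lim2: "((\<lambda>x. \<bar>C1\<bar> * (\<nu> * x\<^sup>2)) \<longlongrightarrow> 0) (at_right 0)" "((\<lambda>x. \<nu> * x) \<longlongrightarrow> 0) (at_right 0)"
      by (auto intro!: tendsto_eq_intros)
    have "\<forall>\<^sub>F x in at_right 0. \<bar>\<nu> * (rho x - ln (x / 2) - 1)\<bar> < 1 / 4 \<and> \<bar>C1\<bar> * (\<nu> * x\<^sup>2) < 1 / 4 \<and> \<nu> * x < \<delta> \<and> 0 < x"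
      using tendstoD[OF lim, of "1 / 4"] order_tendstoD(2)[OF lim2(1), of "1 / 4"] order_tendstoD(2)[OF lim2(2) b(1)]
      by (auto intro!: eventually_conj simp: eventually_at_right_less)
    then obtain x0 where x0: "\<bar>\<nu> * (rho x0 - ln (x0 / 2) - 1)\<bar> < 1 / 4" "\<bar>C1\<bar> * (\<nu> * x0\<^sup>2) < 1 / 4" "\<nu> * x0 < \<delta>" "0 < x0"
      using eventually_happens'[OF trivial_limit_at_right_real] by blast
    \<comment> \<open>Four contributions of at most \<open>1/4\<close> each: the expansion of
      \<open>\<rho>\<close>, the two parts of the branch error, and the correction sum
      \<open>S\<close>. Their total is below 1, hence below \<open>\<pi>/2\<close>.\<close>
    have D0: "\<bar>D \<nu> x0\<bar> < pi / 2"
    proof -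
      have "C1 * (\<nu> * x0\<^sup>2 + 1 / \<nu>) \<le> \<bar>C1\<bar> * (\<nu> * x0\<^sup>2 + 1 / \<nu>)" using nu0 by (intro mult_right_mono) auto
      also have "\<dots> = \<bar>C1\<bar> * (\<nu> * x0\<^sup>2) + \<bar>C1\<bar> / \<nu>" by (simp add: distrib_left)
      finally have "\<bar>\<Theta> \<nu> x0 - (\<nu> * ln (x0 / 2) + \<nu> - pi / 4)\<bar> \<le> \<bar>C1\<bar> * (\<nu> * x0\<^sup>2) + \<bar>C1\<bar> / \<nu>"
        using branch[OF nu1(3) x0(4)] x0(3) by linarith
      moreover have "\<bar>C1\<bar> / \<nu> \<le> 1 / 4" "B / \<nu> \<le> 1 / 4" using nu n1(4,5) nu0 by (simp_all add: field_simps)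
      moreover have "\<nu> * (rho x0 - ln (x0 / 2) - 1) = \<nu> * rho x0 - \<nu> * ln (x0 / 2) - \<nu>" by (simp add: algebra_simps)
      moreover have "D \<nu> x0 = \<Theta> \<nu> x0 - \<nu> * rho x0 - S \<nu> x0 + pi / 4" by (simp add: D_def)
      ultimately have "\<bar>D \<nu> x0\<bar> < 1" using x0(1,2) S[OF nu1(1), of x0] by linarith
      then show ?thesis using pi_gt3 by linarith
    qed
    have Dx: "\<bar>D \<nu> x\<bar> < pi / 2"
    proof (rule ccontr)
      assume "\<not> ?thesis"
      then have ge: "pi / 2 \<le> \<bar>D \<nu> x\<bar>" by simp
      have "connected ((\<lambda>t. \<bar>D \<nu> t\<bar>) ` {0<..})"
        by (intro connected_continuous_image continuous_intros contD) auto
      then have "pi / 2 \<in> (\<lambda>t. \<bar>D \<nu> t\<bar>) ` {0<..}"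
        using connected_contains_Icc[of _ "\<bar>D \<nu> x0\<bar>" "\<bar>D \<nu> x\<bar>"] x x0(4) D0 ge by fastforce
      then obtain t where t: "t > 0" "\<bar>D \<nu> t\<bar> = pi / 2" by auto
      then have "cos (D \<nu> t) = 0" by (metis cos_abs_real cos_pi_half)
      then show False using D[OF t(1)] by auto
    qed
    obtain \<eta> where eta: "cmod \<eta> \<le> C / \<nu> ^ (2 * n + 1)" "tan (D \<nu> x) = Im \<eta> / (1 + Re \<eta>)"
      using D[OF x] by blast
    have "\<bar>Re \<eta>\<bar> \<le> 1 / 2" using abs_Re_le_cmod[of \<eta>] eta small by linarith
    then have p: "1 + Re \<eta> \<ge> 1 / 2" by linarith
    have "\<bar>D \<nu> x\<bar> \<le> \<bar>tan (D \<nu> x)\<bar>" by (rule abs_tan_ge[OF Dx])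
    also have "\<dots> = \<bar>Im \<eta>\<bar> / (1 + Re \<eta>)" unfolding eta(2) using p by simp
    also have "\<dots> \<le> C / \<nu> ^ (2 * n + 1) / (1 / 2)"
      using abs_Im_le_cmod[of \<eta>] eta(1) p by (intro frac_le) auto
    finally show ?thesis by (simp add: mult.commute)
  qed
  show thesis
  proof (rule that[of n1 "2 * C"])
    show "1 \<le> n1" using n1 n0 by linarith
    show "0 \<le> 2 * C" using n0 by simp
    show "\<bar>\<Theta> \<nu> x - (\<nu> * (rho x + (\<Sum>s<n. (1 / \<nu>\<^sup>2) ^ Suc s * E_hat (2 * s + 1) (bh x))) - pi / 4)\<bar> \<le> 2 * C / \<nu> ^ (2 * n + 1)"
      if "\<nu> \<ge> n1" "x > 0" for \<nu> x
      using main[OF that] unfolding D_def S_def distrib_left .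
  qed
qed

text \<open>The zero and the partial sum both satisfy \<open>G e y = M\<close> up to
  \<open>O(\<nu>^(-2n))\<close>, the former by the phase expansion and the latter by
  \<open>X_sum_residual\<close>; the expanding property of \<open>G e\<close> then bounds their
  distance. The constants do not depend on \<open>m\<close>, because both estimates hold for all
  positive arguments.\<close>

lemma scaled_zero_expansion:
  assumes "bessel_phase \<Theta>" "n \<ge> 1"
  shows "\<exists>C. \<forall>\<^sub>F \<nu> in at_top. \<forall>m. \<bar>scaled_zero \<Theta> r \<nu> m - (\<Sum>s<n. zero_coeff r \<nu> m s / \<nu> ^ (2 * s))\<bar> \<le> C / \<nu> ^ (2 * n)"
proof -
  define G where "G e x = rho x + (\<Sum>s<n. e ^ Suc s * E_hat (2 * s + 1) (bh x))" for e x
  obtain n0 C where n0: "n0 \<ge> 1" "C \<ge> 0" and ph: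
    "\<And>\<nu> x. \<nu> \<ge> n0 \<Longrightarrow> x > 0 \<Longrightarrow> \<bar>\<Theta> \<nu> x - (\<nu> * G (1 / \<nu>\<^sup>2) x - pi / 4)\<bar> \<le> C / \<nu> ^ (2 * n + 1)"
    using phase_expansion[OF assms(1), of n] unfolding G_def by blast
  obtain D e0 where e0: "e0 > 0" "e0 \<le> 1" "D \<ge> 0" and Xpos: "\<And>x e. x > 0 \<Longrightarrow> 0 \<le> e \<Longrightarrow> e \<le> e0 \<Longrightarrow> X_sum n x e > 0"
    and X: "\<And>x e. x > 0 \<Longrightarrow> 0 \<le> e \<Longrightarrow> e \<le> e0 \<Longrightarrow> \<bar>G e (X_sum n x e) - rho x\<bar> \<le> D * e ^ n"
    by (rule X_sum_residual[OF assms(2)]) (simp only: G_def)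
  obtain e1 where e1: "e1 > 0" "e1 \<le> 1" and exp: "\<And>e x y. 0 \<le> e \<Longrightarrow> e \<le> e1 \<Longrightarrow> 0 < x \<Longrightarrow> 0 < y \<Longrightarrow> \<bar>x - y\<bar> \<le> 2 * \<bar>G e x - G e y\<bar>"
    by (rule phase_expanding[of n]) (simp only: G_def)
  have "((\<lambda>\<nu>::real. 1 / \<nu>\<^sup>2) \<longlongrightarrow> 0) at_top" by real_asymp
  then have "\<forall>\<^sub>F \<nu> in at_top. 1 / \<nu>\<^sup>2 < min e0 e1" by (rule order_tendstoD) (use e0 e1 in auto)
  moreover have "\<forall>\<^sub>F \<nu> in at_top. \<nu> \<ge> n0" by (rule eventually_ge_at_top)
  ultimately have "\<forall>\<^sub>F \<nu> in at_top. \<forall>m. \<bar>scaled_zero \<Theta> r \<nu> m - (\<Sum>s<n. zero_coeff r \<nu> m s / \<nu> ^ (2 * s))\<bar> \<le> 2 * (C + D) / \<nu> ^ (2 * n)"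
  proof eventually_elim
    case (elim \<nu>)
    have nu: "\<nu> \<ge> 1" "\<nu> > 0" using elim n0 by linarith+
    define e where "e = 1 / \<nu>\<^sup>2"
    have e: "0 \<le> e" "e \<le> e0" "e \<le> e1" using elim by (simp_all add: e_def)
    show ?case
    proof
      fix m
      define z where "z = scaled_zero \<Theta> r \<nu> m"
      define M where "M = zero_param r \<nu> m"
      define x where "x = inv_into {0<..} rho M"
      have im: "M \<in> rho ` {0<..}" using bij_betw_rho by (simp add: bij_betw_def)
      have x: "x > 0" "rho x = M"
        using inv_into_into[OF im] f_inv_into_f[OF im] by (auto simp: x_def)
      note z = scaled_zero_phase[OF assms(1) nu(2), of r m, folded z_def]
      \<comment> \<open>The term \<open>- \<pi>/4\<close> of the phase turns
        \<open>m + r - 1/2\<close> into the \<open>m + r - 1/4\<close> of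
        \<open>zero_param\<close>.\<close>
      have "\<Theta> \<nu> z - (\<nu> * G e z - pi / 4) = \<nu> * (M - G e z)"
        unfolding z(2) M_def zero_param_def using nu by (simp add: field_simps)
      then have "\<nu> * \<bar>G e z - M\<bar> \<le> C / \<nu> ^ (2 * n + 1)"
        using ph[OF elim(2) z(1)] nu(2) by (simp add: e_def abs_mult abs_minus_commute)
      also have "\<dots> \<le> C / \<nu> ^ (2 * n)"
        using n0(2) nu by (intro divide_left_mono power_increasing) auto
      finally have "\<nu> * \<bar>G e z - M\<bar> \<le> C / \<nu> ^ (2 * n)" .
      moreover have "1 * \<bar>G e z - M\<bar> \<le> \<nu> * \<bar>G e z - M\<bar>" using nu by (intro mult_right_mono) auto
      ultimately have 1: "\<bar>G e z - M\<bar> \<le> C / \<nu> ^ (2 * n)" by (metis mult_1 order_trans)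
      have "\<bar>G e (X_sum n x e) - M\<bar> \<le> D * e ^ n" using X[OF x(1) e(1,2)] x(2) by simp
      also have "D * e ^ n = D / \<nu> ^ (2 * n)" by (simp add: e_def power_divide power_mult)
      finally have 2: "\<bar>G e (X_sum n x e) - M\<bar> \<le> D / \<nu> ^ (2 * n)" .
      have "(\<Sum>s<n. zero_coeff r \<nu> m s / \<nu> ^ (2 * s)) = X_sum n x e"
        unfolding X_sum_def by (intro sum.cong refl) (simp add: zero_coeff_eq x_def M_def e_def power_divide power_mult)
      then have "\<bar>scaled_zero \<Theta> r \<nu> m - (\<Sum>s<n. zero_coeff r \<nu> m s / \<nu> ^ (2 * s))\<bar> = \<bar>z - X_sum n x e\<bar>"
        by (simp add: z_def)
      also have "\<dots> \<le> 2 * \<bar>G e z - G e (X_sum n x e)\<bar>"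
        by (rule exp[OF e(1,3) z(1) Xpos[OF x(1) e(1,2)]])
      also have "\<bar>G e z - G e (X_sum n x e)\<bar> \<le> \<bar>G e z - M\<bar> + \<bar>G e (X_sum n x e) - M\<bar>"
        using abs_triangle_ineq4[of "G e z - M" "G e (X_sum n x e) - M"] by simp
      also have "\<dots> \<le> C / \<nu> ^ (2 * n) + D / \<nu> ^ (2 * n)" by (rule add_mono[OF 1 2])
      also have "2 * (C / \<nu> ^ (2 * n) + D / \<nu> ^ (2 * n)) = 2 * (C + D) / \<nu> ^ (2 * n)" by (simp add: add_divide_distrib)
      finally show "\<bar>scaled_zero \<Theta> r \<nu> m - (\<Sum>s<n. zero_coeff r \<nu> m s / \<nu> ^ (2 * s))\<bar> \<le> 2 * (C + D) / \<nu> ^ (2 * n)" by simp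
    qed
  qed
  then show ?thesis by blast
qed

theorem mainTheorem4:
  shows "\<exists>q :: nat \<Rightarrow> real \<Rightarrow> real.
    (\<forall>x>0. q 0 x = x) \<and>
    (\<forall>s\<ge>1. \<exists>A B :: real poly. \<forall>x>0. poly B x \<noteq> 0 \<and> q s x = poly A x / poly B x) \<and>
    (\<forall>x>0. q 1 x = x * (3 * x^2 - 2) / (24 * (x^2 + 1)^2)) \<and>
    (\<forall>x>0. q 2 x = - (x * (465 * x^6 - 4119 * x^4 + 1812 * x^2 - 4) / (5760 * (x^2 + 1)^5))) \<and>
    (\<forall>x>0. q 3 x = x / (2903040 * (x^2 + 1)^8) *
       (714231 * x^10 - 19038132 * x^8 + 46671831 * x^6 - 19043730 * x^4 + 910164 * x^2 - 1912)) \<and>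
    (\<forall>x>0. q 4 x = - (x / (1393459200 * (x^2 + 1)^11)) *
       (2542280985 * x^14 - 138922188885 * x^12 + 846638961795 * x^10 - 1239519604671 * x^8
        + 493158930936 * x^6 - 45022408056 * x^4 + 452367216 * x^2 + 742544)) \<and>
    (\<forall>(r::real) (\<Theta> :: real \<Rightarrow> real \<Rightarrow> real). 0 \<le> r \<longrightarrow> r \<le> 1 / 2 \<longrightarrow> bessel_phase \<Theta> \<longrightarrow>
       (\<forall>\<nu>>0. bij_betw (\<lambda>m::int. \<nu> * scaled_zero \<Theta> r \<nu> m) UNIV (bessel_zeros r \<nu>)) \<and>
       (\<forall>\<nu>>0. \<forall>m. zero_coeff r \<nu> m 0 = inv_into {0<..} rho (zero_param r \<nu> m)) \<and>
       (\<forall>\<nu>>0. \<forall>m s. zero_coeff r \<nu> m s = q s (zero_coeff r \<nu> m 0)) \<and>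
       (\<forall>n\<ge>1. \<exists>C. \<forall>\<^sub>F \<nu> in at_top. \<forall>m.
          \<bar>scaled_zero \<Theta> r \<nu> m - (\<Sum>s<n. zero_coeff r \<nu> m s / \<nu> ^ (2 * s))\<bar> \<le> C / \<nu> ^ (2 * n)))"
proof (intro exI[of _ q_coeff] conjI allI impI)
  fix x :: real and s :: nat
  show "q_coeff 0 x = x" by (simp add: q_coeff_def)
  show "\<exists>A B :: real poly. \<forall>x>0. poly B x \<noteq> 0 \<and> q_coeff s x = poly A x / poly B x" by (rule q_coeff_rational)
  assume x: "x > 0"
  show "q_coeff 1 x = x * (3 * x^2 - 2) / (24 * (x^2 + 1)^2)" by (rule q_coeff_explicit(1)[OF x])
  show "q_coeff 2 x = - (x * (465 * x^6 - 4119 * x^4 + 1812 * x^2 - 4) / (5760 * (x^2 + 1)^5))"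
    by (rule q_coeff_explicit(2)[OF x])
  show "q_coeff 3 x = x / (2903040 * (x^2 + 1)^8) *
       (714231 * x^10 - 19038132 * x^8 + 46671831 * x^6 - 19043730 * x^4 + 910164 * x^2 - 1912)"
    by (rule q_coeff_explicit(3)[OF x])
  show "q_coeff 4 x = - (x / (1393459200 * (x^2 + 1)^11)) *
       (2542280985 * x^14 - 138922188885 * x^12 + 846638961795 * x^10 - 1239519604671 * x^8
        + 493158930936 * x^6 - 45022408056 * x^4 + 452367216 * x^2 + 742544)"
    by (rule q_coeff_explicit(4)[OF x])
next
  fix r :: real and \<Theta> :: "real \<Rightarrow> real \<Rightarrow> real"
  assume \<Theta>: "bessel_phase \<Theta>"
  show "bij_betw (\<lambda>m::int. \<nu> * scaled_zero \<Theta> r \<nu> m) UNIV (bessel_zeros r \<nu>)" if "\<nu> > 0" for \<nu>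
    by (rule bij_betw_scaled_zero[OF \<Theta> that])
  have z0: "zero_coeff r \<nu> m 0 = inv_into {0<..} rho (zero_param r \<nu> m)" for \<nu> m
    by (simp add: zero_coeff_eq q_coeff_def)
  then show "zero_coeff r \<nu> m 0 = inv_into {0<..} rho (zero_param r \<nu> m)" for \<nu> m .
  show "zero_coeff r \<nu> m s = q_coeff s (zero_coeff r \<nu> m 0)" for \<nu> m s
    unfolding z0 by (rule zero_coeff_eq)
  show "\<exists>C. \<forall>\<^sub>F \<nu> in at_top. \<forall>m. \<bar>scaled_zero \<Theta> r \<nu> m - (\<Sum>s<n. zero_coeff r \<nu> m s / \<nu> ^ (2 * s))\<bar> \<le> C / \<nu> ^ (2 * n)" if "n \<ge> 1" for n
    by (rule scaled_zero_expansion[OF \<Theta> that])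
qed

end
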